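(* Let $\mathbf u=(u_1,u_2)^\top\in\mathbb Z^2$ be a column vector and let $\gamma=\begin{pmatrix}a&b\\c&d\end{pmatrix}\in\mathrm{SL}_2(\mathbb Z)$ with $\operatorname{tr}(\gamma)>2$ and $c>0$. Let $S=\begin{pmatrix}0&-1\\1&0\end{pmatrix}$, $N=\operatorname{tr}(\gamma)-2$, let $\Psi(\gamma)$ be the Rademacher class invariant, and let $\tau=\frac{a-d+\sqrt{N(N+4)}}{2c}$, a fixed point of $\gamma$. Put $\mathbf r=\frac1N(I-\gamma^{-1})S\mathbf u$. If $\mathbf u\notin(\gamma^\top-I)\mathbb Z^2$, then $$F^{\pm}_\gamma(\mathbf u^\top)=e^{\frac{\pi i}{12}\Psi(\gamma)}\,\mathrm{sh}^{\mathbf r}_\gamma(\tau)^{-1}.$$ If $\mathbf u\in(\gamma^\top-I)\mathbb Z^2$, then $$F^{\pm}_\gamma(\mathbf u^\top)=\begin{cases}\left(e^{-\frac{\pi i}{12}\Psi(\gamma)}\,\mathrm{sh}^{\mathbf r}_\gamma(\tau)\right)^{\pm1}&\text{if }\left((I-\gamma^{-1})S\mathbf u\right)_2>0,\\[4pt]\left(e^{-\frac{\pi i}{12}\Psi(\gamma)}\,\mathrm{sh}^{\mathbf r}_\gamma(\tau)\right)^{\mp1}&\text{if }\left((I-\gamma^{-1})S\mathbf u\right)_2\le0.\end{cases}$$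
   Context: Notation: $\mathrm e(z)=e^{2\pi i z}$; $(x;q)_\infty=\prod_{k\ge0}(1-xq^k)$ for $|q|<1$; $\mathbb H$ is the upper half-plane; for $M=\begin{pmatrix}\alpha&\beta\\ \kappa&\delta\end{pmatrix}\in\mathrm{SL}_2(\mathbb Z)$, $M\cdot\tau=\frac{\alpha\tau+\beta}{\kappa\tau+\delta}$ and $j_M(\tau)=\kappa\tau+\delta$. **Finite quantum dilogarithm $F^\pm_\gamma$ (Radchenko--Wheeler).** With $\gamma,\tau$ as in the claim let $\varepsilon=c\tau+d>1$ (the largest eigenvalue of $\gamma$). Let $\eta$ be the Dedekind eta function and $\mu_\gamma=\frac{\eta(\gamma\cdot z)}{\eta(z)\sqrt{cz+d}}$ (independent of $z\in\mathbb H$, principal branch of the square root). For $m,n\in\mathbb Z$, Faddeev's modular quantum dilogarithm $\Phi_{\gamma,m,n}(z;\tau)$ is the meromorphic continuation to $z\in\mathbb C$, $\tau\in\{\tau\in\mathbb C: c\tau+d\notin(-\infty,0]\}$ of $$\Phi_{\gamma,m,n}(z;\tau)=\frac{\bigl(\mathrm e(m\tau+z);\mathrm e(\tau)\bigr)_\infty}{\bigl(\mathrm e(n\,\gamma\cdot\tau+\frac{z}{c\tau+d});\mathrm e(\gamma\cdot\tau)\bigr)_\infty}\qquad(\tau\in\mathbb H).$$ For a row vector $\mathbf u^\top=(u_1,u_2)\in\mathbb Z^2$: if $\mathbf u\notin(\gamma^\top-I)\mathbb Z^2$, then $$F^{+}_\gamma(\mathbf u^\top)=F^-_\gamma(\mathbf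 u^\top)=\mu_\gamma\,\Phi_{\gamma,u_1,0}\!\left(\frac{u_1\tau+u_2}{\varepsilon^{-1}-1};\tau\right);$$ if $\mathbf u\in(\gamma^\top-I)\mathbb Z^2$, then $F^{\pm}_\gamma(\mathbf u^\top)=\varepsilon^{\pm1/2}$. **Rademacher class invariant.** For $\gamma=\begin{pmatrix}a&b\\c&d\end{pmatrix}\in\mathrm{SL}_2(\mathbb Z)$ with $c>0$ and $a+d>0$, $\Psi(\gamma)=\frac{a+d}{c}-12\,s(d,c)-3\in\mathbb Z$, where $s(d,c)=\sum_{k=1}^{c-1}((k/c))((kd/c))$ is the Dedekind sum, with $((x))=x-\lfloor x\rfloor-\frac12$ for $x\notin\mathbb Z$ and $((x))=0$ for $x\in\mathbb Z$. One has $\mu_\gamma=e^{\frac{\pi i}{12}\Psi(\gamma)}$. **Shintani--Faddeev modular cocycle $\mathrm{sh}$** (the paper uses the Hebrew letter shin). For $\tau\in\mathbb H$ let $\varpi(z,\tau)=\prod_{k\ge0}(1-\mathrm e(z+k\tau))$. For $M\in\mathrm{SL}_2(\mathbb Z)$, $\mathbf v\in\mathbb Z^2$, let $\sigma_{\mathbf v,M}(z,\tau)=\varpi\bigl(\frac{z}{j_M(\tau)}+v_2(M\cdot\tau)-v_1,M\cdot\tau\bigr)/\varpi(z,\tau)$ for $\tau\in\mathbb H$, continued meromorphically to $z\in\mathbb C$, $\tau\in\{j_M(\tau)\notin(-\infty,0]\}$. For $\mathbf r=(r_1,r_2)^\top\in\mathbb Q^2$ with $(M-I)\mathbf r\in\mathbb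 Z^2$, $\mathrm{sh}^{\mathbf r}_M(\tau)=\sigma_{(I-M)\mathbf r,M}(r_2\tau-r_1,\tau)$, the value of the two-variable meromorphic function at that point (removable singularities removed). *)

theory Defs
  imports "HOL-Complex_Analysis.Complex_Analysis"
begin

section \<open>Meromorphic continuation in two complex variables\<close>

text \<open>The sets below are meant to be open; the linear map is the \<^emph>\<open>complex\<close> total derivative.\<close>

definition holomorphic2_on :: "(complex \<times> complex \<Rightarrow> complex) \<Rightarrow> (complex \<times> complex) set \<Rightarrow> bool"
    (infixl "(holomorphic2'_on)" 50) where
  "f holomorphic2_on U \<longleftrightarrow>
     (\<forall>p\<in>U. \<exists>a b. (f has_derivative (\<lambda>(h, k). a * h + b * k)) (at p))"

text \<open>A meromorphic function is locally a quotient of holomorphic functions.  It is represented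
  by a total function whose values on the zero set of the local denominator are arbitrary.\<close>

definition meromorphic2_on :: "(complex \<times> complex \<Rightarrow> complex) \<Rightarrow> (complex \<times> complex) set \<Rightarrow> bool"
    (infixl "(meromorphic2'_on)" 50) where
  "F meromorphic2_on D \<longleftrightarrow>
     (\<forall>p\<in>D. \<exists>W g h. open W \<and> connected W \<and> p \<in> W \<and> W \<subseteq> D \<and>
        g holomorphic2_on W \<and> h holomorphic2_on W \<and> (\<exists>x\<in>W. h x \<noteq> 0) \<and>
        (\<forall>x\<in>W. h x \<noteq> 0 \<longrightarrow> F x = g x / h x))"

text \<open>The value at \<open>p\<close> of the meromorphic continuation to \<open>D\<close> of the quotient \<open>f / g\<close> given on
  \<open>D0\<close>.  Representatives of the continuation that are holomorphic near \<open>p\<close> exist iff \<open>p\<close> is a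
  regular point or a removable singularity, and for connected \<open>D\<close> they all have the same value
  at \<open>p\<close>.  At the remaining points (poles, points of indeterminacy) the value is unspecified.\<close>

definition continuation2 ::
  "(complex \<times> complex \<Rightarrow> complex) \<Rightarrow> (complex \<times> complex \<Rightarrow> complex) \<Rightarrow>
   (complex \<times> complex) set \<Rightarrow> (complex \<times> complex) set \<Rightarrow> complex \<times> complex \<Rightarrow> complex" where
  "continuation2 f g D0 D p =
     (THE v. \<exists>F. F meromorphic2_on D \<and>
        (\<forall>x\<in>D0. g x \<noteq> 0 \<longrightarrow> F x = f x / g x) \<and>
        (\<exists>W. open W \<and> p \<in> W \<and> W \<subseteq> D \<and> F holomorphic2_on W) \<and> v = F p)"


section \<open>Modular notation\<close>

definition upper_half_plane :: "complex set" where
  "upper_half_plane = {\<tau>. Im \<tau> > 0}"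

definition e2pi :: "complex \<Rightarrow> complex" where
  "e2pi z = exp (2 * of_real pi * \<i> * z)"

definition qpoch_inf :: "complex \<Rightarrow> complex \<Rightarrow> complex" where
  "qpoch_inf x q = (\<Prod>k. 1 - x * q ^ k)"

definition aut_factor :: "int^2^2 \<Rightarrow> complex \<Rightarrow> complex" where
  "aut_factor M \<tau> = of_int (M $ 2 $ 1) * \<tau> + of_int (M $ 2 $ 2)"

definition moebius :: "int^2^2 \<Rightarrow> complex \<Rightarrow> complex" where
  "moebius M \<tau> = (of_int (M $ 1 $ 1) * \<tau> + of_int (M $ 1 $ 2)) / aut_factor M \<tau>"

definition slit_domain :: "int^2^2 \<Rightarrow> (complex \<times> complex) set" where
  "slit_domain M = UNIV \<times> {\<tau>. aut_factor M \<tau> \<notin> \<real>\<^sub>\<le>\<^sub>0}"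

definition S_mat :: "int^2^2" where
  "S_mat = vector [vector [0, -1], vector [1, 0]]"

definition dedekind_eta :: "complex \<Rightarrow> complex" where
  "dedekind_eta \<tau> = e2pi (\<tau> / 24) * (\<Prod>k. 1 - e2pi (of_nat (Suc k) * \<tau>))"

text \<open>The defining quotient does not depend on \<open>z\<close>.\<close>

definition eta_multiplier :: "int^2^2 \<Rightarrow> complex" where
  "eta_multiplier \<gamma> = (THE m. \<forall>z\<in>upper_half_plane.
     m = dedekind_eta (moebius \<gamma> z) / (dedekind_eta z * csqrt (aut_factor \<gamma> z)))"

definition sawtooth :: "real \<Rightarrow> real" where
  "sawtooth x = (if x \<in> \<int> then 0 else x - of_int \<lfloor>x\<rfloor> - 1 / 2)"

definition dedekind_sum :: "int \<Rightarrow> int \<Rightarrow> real" where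
  "dedekind_sum d c =
     (\<Sum>k\<in>{1..c - 1}. sawtooth (of_int k / of_int c) * sawtooth (of_int (k * d) / of_int c))"

definition rademacher :: "int^2^2 \<Rightarrow> real" where
  "rademacher \<gamma> = of_int (trace \<gamma>) / of_int (\<gamma> $ 2 $ 1)
     - 12 * dedekind_sum (\<gamma> $ 2 $ 2) (\<gamma> $ 2 $ 1) - 3"


section \<open>The finite quantum dilogarithm\<close>

text \<open>Two-variable functions take the argument \<open>(z, \<tau>)\<close>.\<close>

definition faddeev :: "int^2^2 \<Rightarrow> int \<Rightarrow> int \<Rightarrow> complex \<times> complex \<Rightarrow> complex" where
  "faddeev \<gamma> m n = continuation2
     (\<lambda>(z, \<tau>). qpoch_inf (e2pi (of_int m * \<tau> + z)) (e2pi \<tau>))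
     (\<lambda>(z, \<tau>). qpoch_inf (e2pi (of_int n * moebius \<gamma> \<tau> + z / aut_factor \<gamma> \<tau>))
                         (e2pi (moebius \<gamma> \<tau>)))
     (UNIV \<times> upper_half_plane) (slit_domain \<gamma>)"

definition fixed_pt :: "int^2^2 \<Rightarrow> real" where
  "fixed_pt \<gamma> = (let N = of_int (trace \<gamma> - 2) in
     (of_int (\<gamma> $ 1 $ 1) - of_int (\<gamma> $ 2 $ 2) + sqrt (N * (N + 4))) / (2 * of_int (\<gamma> $ 2 $ 1)))"

definition eigenval :: "int^2^2 \<Rightarrow> real" where
  "eigenval \<gamma> = of_int (\<gamma> $ 2 $ 1) * fixed_pt \<gamma> + of_int (\<gamma> $ 2 $ 2)"

text \<open>\<open>F\<^sup>+\<close> and \<open>F\<^sup>-\<close> are the cases \<open>s = 1\<close> and \<open>s = -1\<close>.\<close>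

definition fin_qdilog :: "int \<Rightarrow> int^2^2 \<Rightarrow> int^2 \<Rightarrow> complex" where
  "fin_qdilog s \<gamma> u =
     (if u \<in> range (\<lambda>x. (transpose \<gamma> - mat 1) *v x) then of_real (eigenval \<gamma> powr (of_int s / 2))
      else let \<tau> = fixed_pt \<gamma>; \<epsilon> = eigenval \<gamma> in
        eta_multiplier \<gamma> * faddeev \<gamma> (u $ 1) 0
          (of_real ((of_int (u $ 1) * \<tau> + of_int (u $ 2)) / (inverse \<epsilon> - 1)), of_real \<tau>))"


section \<open>The Shintani--Faddeev modular cocycle\<close>

definition varpi :: "complex \<Rightarrow> complex \<Rightarrow> complex" where
  "varpi z \<tau> = (\<Prod>k. 1 - e2pi (z + of_nat k * \<tau>))"

definition sf_sigma :: "int^2 \<Rightarrow> int^2^2 \<Rightarrow> complex \<times> complex \<Rightarrow> complex" where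
  "sf_sigma v M = continuation2
     (\<lambda>(z, \<tau>). varpi (z / aut_factor M \<tau> + of_int (v $ 2) * moebius M \<tau> - of_int (v $ 1))
                     (moebius M \<tau>))
     (\<lambda>(z, \<tau>). varpi z \<tau>)
     (UNIV \<times> upper_half_plane) (slit_domain M)"

text \<open>Only meaningful if \<open>(M - I) r\<close> is integral; then taking floors just converts the type
  of \<open>(I - M) r\<close>.\<close>

definition sf_cocycle :: "rat^2 \<Rightarrow> int^2^2 \<Rightarrow> complex \<Rightarrow> complex" where
  "sf_cocycle r M \<tau> = sf_sigma (\<chi> i. \<lfloor>((mat 1 - map_matrix of_int M) *v r) $ i\<rfloor>) M
     (of_rat (r $ 2) * \<tau> - of_rat (r $ 1), \<tau>)"

end

theory Submission
  imports Defs
begin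

text \<open>Write \<open>\<gamma>\<tau>\<close> for the Moebius image and \<open>j = c\<tau> + d\<close>.  Splitting the products over \<open>k\<close> by
  residues modulo \<open>c\<close> reduces the quotient \<open>varpi z \<tau> / varpi (z/j) (\<gamma>\<tau>)\<close> to a product over
  \<open>0 \<le> l < c\<close> of quotients for the matrix \<open>S\<close>, each with modulus \<open>j\<close>.  Those equal the exponential of
  Faddeev's integral in a strip, which continues them across the positive real axis in \<open>j\<close>.  Up to
  finitely many factors \<open>1 - e2pi _\<close> both sides of the theorem are values of this quotient and its
  inverse.  If \<open>u\<close> is not in the range, the point \<open>(z, \<tau>)\<close> lies off the zeros and poles and the two
  continuations are inverse to each other at the fixed point.  If \<open>u\<close> is in the range, then
  \<open>z\<close> lies in the period lattice and the finitely many factors move it to the origin, where the reflection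
  formula evaluates Faddeev's integral: the contributions of the residues modulo \<open>c\<close> add up to the
  Dedekind sum and leave \<open>sqrt \<epsilon>\<close>, while for positive second coordinate a zero and a pole cancel and
  contribute another factor \<open>\<epsilon>\<close>.  The same computation for \<open>\<tau>\<close> in the upper half-plane identifies the eta
  multiplier.\<close>

section \<open>Holomorphic functions of two variables\<close>

text \<open>The fixed point is real, so none of the defining products converges there, and both
  values are descriptions (\<open>THE\<close>) over meromorphic functions on the whole slit domain,
  lower half-plane included. Two things are therefore constructed separately: one global meromorphic
  representative, and a function holomorphic near the single point of interest that agrees with it
  somewhere nearby.

  The matrix \<open>S\<close> suffices because \<open>c \<tau> = j - d\<close> and, by the
  determinant, \<open>c (\<gamma> \<tau>) = a - 1 / j\<close>: after the splitting modulo
  \<open>c\<close> the moduli are \<open>j\<close> and \<open>- 1 / j\<close> up to integers, which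
  \<open>e2pi\<close> ignores.

  The two values are mutually inverse because at the fixed point
  \<open>z / j = z + u1 \<tau> + u2\<close>, so that the elementary factors of one continuation
  become those of the other upside down. On the lattice the sign condition comes from the factor of
  index 0, which is present only for a positive multiple of \<tau>: there \<open>1 - e2pi z\<close>
  over \<open>1 - e2pi (z / j)\<close> tends to \<open>j = \<epsilon>\<close> and turns
  \<open>1 / sqrt \<epsilon>\<close> into \<open>sqrt \<epsilon>\<close>.\<close>

lemma holomorphic2_onD:
  assumes "f holomorphic2_on U" "p \<in> U"
  obtains a b where "(f has_derivative (\<lambda>h. a * fst h + b * snd h)) (at p)"
  using assms unfolding holomorphic2_on_def by (auto simp: case_prod_unfold)

lemma holomorphic2_onI:
  assumes "\<And>p. p \<in> U \<Longrightarrow> \<exists>a b. (f has_derivative (\<lambda>h. a * fst h + b * snd h)) (at p)"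
  shows "f holomorphic2_on U"
  using assms unfolding holomorphic2_on_def by (auto simp: case_prod_unfold)

lemma holomorphic2_on_subset:
  "f holomorphic2_on U \<Longrightarrow> V \<subseteq> U \<Longrightarrow> f holomorphic2_on V"
  unfolding holomorphic2_on_def by blast

lemma holomorphic2_on_imp_isCont:
  assumes "f holomorphic2_on U" "p \<in> U"
  shows "isCont f p"
  using assms by (metis has_derivative_continuous holomorphic2_onD)

lemma holomorphic2_on_imp_continuous_on:
  "f holomorphic2_on U \<Longrightarrow> continuous_on U f"
  by (simp add: continuous_at_imp_continuous_on holomorphic2_on_imp_isCont)

lemma holomorphic2_on_cong:
  assumes "f holomorphic2_on U" "open U" "\<And>x. x \<in> U \<Longrightarrow> g x = f x"
  shows "g holomorphic2_on U"
proof (rule holomorphic2_onI)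
  fix p assume p: "p \<in> U"
  obtain a b where *: "(f has_derivative (\<lambda>h. a * fst h + b * snd h)) (at p)"
    using holomorphic2_onD[OF assms(1) p] .
  have "(g has_derivative (\<lambda>h. a * fst h + b * snd h)) (at p)"
    by (rule has_derivative_transform_within_open[OF * assms(2) p]) (use assms(3) in auto)
  thus "\<exists>a b. (g has_derivative (\<lambda>h. a * fst h + b * snd h)) (at p)" by blast
qed

lemma holomorphic2_on_Union:
  "(\<And>p. p \<in> U \<Longrightarrow> \<exists>V. p \<in> V \<and> f holomorphic2_on V) \<Longrightarrow> f holomorphic2_on U"
  unfolding holomorphic2_on_def by blast

lemma holomorphic2_on_const [intro]: "(\<lambda>_. k) holomorphic2_on U"
  by (rule holomorphic2_onI, rule exI[of _ 0], rule exI[of _ 0]) auto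

lemma holomorphic2_on_fst [intro]: "fst holomorphic2_on U"
  by (rule holomorphic2_onI, rule exI[of _ 1], rule exI[of _ 0])
     (auto intro!: derivative_eq_intros)

lemma holomorphic2_on_snd [intro]: "snd holomorphic2_on U"
  by (rule holomorphic2_onI, rule exI[of _ 0], rule exI[of _ 1])
     (auto intro!: derivative_eq_intros)

text \<open>The chain rule: complex-linear maps compose to complex-linear maps. Sums and products
  are obtained from it as compositions with two polynomial maps, so that each costs a single
  derivative.\<close>

lemma holomorphic2_on_compose:
  assumes "A holomorphic2_on U" "B holomorphic2_on U" "f holomorphic2_on V"
    and "\<And>p. p \<in> U \<Longrightarrow> (A p, B p) \<in> V"
  shows "(\<lambda>p. f (A p, B p)) holomorphic2_on U"
proof (rule holomorphic2_onI)
  fix p assume p: "p \<in> U"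
  obtain a1 a2 where a: "(A has_derivative (\<lambda>h. a1 * fst h + a2 * snd h)) (at p)"
    using holomorphic2_onD[OF assms(1) p] .
  obtain b1 b2 where b: "(B has_derivative (\<lambda>h. b1 * fst h + b2 * snd h)) (at p)"
    using holomorphic2_onD[OF assms(2) p] .
  obtain f1 f2 where f: "(f has_derivative (\<lambda>h. f1 * fst h + f2 * snd h)) (at (A p, B p))"
    using holomorphic2_onD[OF assms(3) assms(4)[OF p]] .
  have "((\<lambda>p. f (A p, B p)) has_derivative
      (\<lambda>h. f1 * fst (a1 * fst h + a2 * snd h, b1 * fst h + b2 * snd h)
         + f2 * snd (a1 * fst h + a2 * snd h, b1 * fst h + b2 * snd h))) (at p)"
    by (rule has_derivative_compose[OF has_derivative_Pair[OF a b] f])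
  also have "(\<lambda>h. f1 * fst (a1 * fst h + a2 * snd h, b1 * fst h + b2 * snd h)
         + f2 * snd (a1 * fst h + a2 * snd h, b1 * fst h + b2 * snd h))
      = (\<lambda>h. (f1 * a1 + f2 * b1) * fst h + (f1 * a2 + f2 * b2) * snd h)"
    by (auto simp: algebra_simps)
  finally show "\<exists>a b. ((\<lambda>p. f (A p, B p)) has_derivative (\<lambda>h. a * fst h + b * snd h)) (at p)"
    by blast
qed

lemma holomorphic2_on_compose1:
  assumes "g holomorphic_on S" "open S" "A holomorphic2_on U" "\<And>p. p \<in> U \<Longrightarrow> A p \<in> S"
  shows "(\<lambda>p. g (A p)) holomorphic2_on U"
proof (rule holomorphic2_onI)
  fix p assume p: "p \<in> U"
  obtain a1 a2 where a: "(A has_derivative (\<lambda>h. a1 * fst h + a2 * snd h)) (at p)"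
    using holomorphic2_onD[OF assms(3) p] .
  have "(g has_field_derivative deriv g (A p)) (at (A p))"
    using assms p holomorphic_derivI by blast
  hence g: "(g has_derivative (*) (deriv g (A p))) (at (A p))"
    by (simp add: has_field_derivative_def)
  have "((\<lambda>p. g (A p)) has_derivative (\<lambda>h. deriv g (A p) * (a1 * fst h + a2 * snd h))) (at p)"
    by (rule has_derivative_compose[OF a g])
  also have "(\<lambda>h. deriv g (A p) * (a1 * fst h + a2 * snd h))
     = (\<lambda>h. (deriv g (A p) * a1) * fst h + (deriv g (A p) * a2) * snd h)"
    by (auto simp: algebra_simps)
  finally show "\<exists>a b. ((\<lambda>p. g (A p)) has_derivative (\<lambda>h. a * fst h + b * snd h)) (at p)"
    by blast
qed

lemma holomorphic2_on_add [intro]: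
  assumes "f holomorphic2_on U" "g holomorphic2_on U"
  shows "(\<lambda>p. f p + g p) holomorphic2_on U"
proof -
  have *: "(\<lambda>p. fst p + snd p) holomorphic2_on UNIV"
    by (rule holomorphic2_onI, rule exI[of _ 1], rule exI[of _ 1])
       (auto intro!: derivative_eq_intros)
  show ?thesis using holomorphic2_on_compose[OF assms *] by simp
qed

lemma holomorphic2_on_mult [intro]:
  assumes "f holomorphic2_on U" "g holomorphic2_on U"
  shows "(\<lambda>p. f p * g p) holomorphic2_on U"
proof -
  have *: "(\<lambda>p. fst p * snd p) holomorphic2_on UNIV"
  proof (rule holomorphic2_onI)
    fix p :: "complex \<times> complex"
    have "((\<lambda>p. fst p * snd p) has_derivative (\<lambda>h. snd p * fst h + fst p * snd h)) (at p)"
      by (auto intro!: derivative_eq_intros)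
    thus "\<exists>a b. ((\<lambda>p. fst p * snd p) has_derivative (\<lambda>h. a * fst h + b * snd h)) (at p)"
      by blast
  qed
  show ?thesis using holomorphic2_on_compose[OF assms *] by simp
qed

lemma holomorphic2_on_uminus [intro]:
  assumes "f holomorphic2_on U"
  shows "(\<lambda>p. - f p) holomorphic2_on U"
  using holomorphic2_on_mult[OF holomorphic2_on_const[of "-1"] assms] by simp

lemma holomorphic2_on_diff [intro]:
  assumes "f holomorphic2_on U" "g holomorphic2_on U"
  shows "(\<lambda>p. f p - g p) holomorphic2_on U"
  using holomorphic2_on_add[OF assms(1) holomorphic2_on_uminus[OF assms(2)]] by simp

lemma holomorphic2_on_divide [intro]:
  assumes "f holomorphic2_on U" "g holomorphic2_on U" "\<And>p. p \<in> U \<Longrightarrow> g p \<noteq> 0"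
  shows "(\<lambda>p. f p / g p) holomorphic2_on U"
proof -
  have "(\<lambda>p. inverse (g p)) holomorphic2_on U"
    by (rule holomorphic2_on_compose1[of inverse "- {0}"])
       (use assms in \<open>auto intro!: holomorphic_intros\<close>)
  thus ?thesis using holomorphic2_on_mult[OF assms(1)] by (simp add: divide_inverse)
qed

lemma holomorphic2_on_prod [intro]:
  "(\<And>i. i \<in> A \<Longrightarrow> f i holomorphic2_on U) \<Longrightarrow> (\<lambda>p. \<Prod>i\<in>A. f i p) holomorphic2_on U"
  by (induction A rule: infinite_finite_induct) auto

lemma holomorphic2_on_exp [intro]:
  "f holomorphic2_on U \<Longrightarrow> (\<lambda>p. exp (f p)) holomorphic2_on U"
  by (rule holomorphic2_on_compose1[of exp UNIV]) (auto intro!: holomorphic_intros)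

text \<open>The inner and the outer conjugation cancel in the derivative, which stays linear over
  the complex numbers. This carries holomorphy from the upper to the lower half-plane of the second
  variable.\<close>

lemma holomorphic2_on_cnj:
  assumes "f holomorphic2_on V" "\<And>p. p \<in> U \<Longrightarrow> (cnj (fst p), cnj (snd p)) \<in> V"
  shows "(\<lambda>p. cnj (f (cnj (fst p), cnj (snd p)))) holomorphic2_on U"
proof (rule holomorphic2_onI)
  fix p assume p: "p \<in> U"
  obtain f1 f2 where f: "(f has_derivative (\<lambda>h. f1 * fst h + f2 * snd h))
      (at (cnj (fst p), cnj (snd p)))"
    using holomorphic2_onD[OF assms(1) assms(2)[OF p]] .
  have c: "((\<lambda>p. (cnj (fst p), cnj (snd p))) has_derivative (\<lambda>h. (cnj (fst h), cnj (snd h)))) (at p)"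
    by (auto intro!: derivative_eq_intros)
  have "((\<lambda>p. cnj (f (cnj (fst p), cnj (snd p)))) has_derivative
     (\<lambda>h. cnj (f1 * fst (cnj (fst h), cnj (snd h)) + f2 * snd (cnj (fst h), cnj (snd h))))) (at p)"
    by (rule has_derivative_cnj[OF has_derivative_compose[OF c f]])
  hence "((\<lambda>p. cnj (f (cnj (fst p), cnj (snd p)))) has_derivative
     (\<lambda>h. cnj f1 * fst h + cnj f2 * snd h)) (at p)" by simp
  thus "\<exists>a b. ((\<lambda>p. cnj (f (cnj (fst p), cnj (snd p)))) has_derivative
     (\<lambda>h. a * fst h + b * snd h)) (at p)" by blast
qed

text \<open>On a complex line a complex-linear derivative is multiplication by a number; questions
  about two variables are thereby reduced to one-variable analysis.\<close>

lemma holomorphic2_on_line: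
  assumes "f holomorphic2_on U"
  shows "(\<lambda>t. f (x + t * d, y + t * e)) holomorphic_on {t. (x + t * d, y + t * e) \<in> U}"
  unfolding holomorphic_on_def
proof
  fix t assume t: "t \<in> {t. (x + t * d, y + t * e) \<in> U}"
  then obtain f1 f2 where f: "(f has_derivative (\<lambda>h. f1 * fst h + f2 * snd h))
      (at (x + t * d, y + t * e))"
    using holomorphic2_onD[OF assms] by blast
  have "((\<lambda>t. (x + t * d, y + t * e)) has_derivative (\<lambda>h. (h * d, h * e))) (at t)"
    by (auto intro!: derivative_eq_intros)
  from has_derivative_compose[OF this f]
  have "((\<lambda>t. f (x + t * d, y + t * e)) has_derivative (*) (f1 * d + f2 * e)) (at t)"
    by (rule back_subst[where P = "\<lambda>D. (_ has_derivative D) _"]) (auto simp: algebra_simps fun_eq_iff)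
  hence "(\<lambda>t. f (x + t * d, y + t * e)) field_differentiable (at t)"
    unfolding field_differentiable_def has_field_derivative_def by blast
  thus "(\<lambda>t. f (x + t * d, y + t * e)) field_differentiable
      (at t within {t. (x + t * d, y + t * e) \<in> U})"
    by (rule field_differentiable_at_within)
qed

text \<open>Cauchy's estimate turns uniform continuity of \<open>f\<close> on a compact set into continuity of
  the derivative.\<close>

lemma continuous_on_deriv_param:
  fixes f :: "'a::metric_space \<Rightarrow> complex \<Rightarrow> complex"
  assumes A: "compact A" and B: "open B" and cont: "continuous_on (A \<times> B) (\<lambda>(x, w). f x w)"
    and hol: "\<And>x. x \<in> A \<Longrightarrow> f x holomorphic_on B"
  shows "continuous_on (A \<times> B) (\<lambda>(x, w). deriv (f x) w)"
  unfolding continuous_on_eq_continuous_within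
proof safe
  fix z t assume z: "z \<in> A" and t: "t \<in> B"
  obtain r0 where r0: "r0 > 0" "cball t r0 \<subseteq> B" using B t open_contains_cball by blast
  define r where "r = r0 / 2"
  have r: "r > 0" "cball t (2*r) \<subseteq> B" using r0 by (auto simp: r_def)
  show "continuous (at (z, t) within A \<times> B) (\<lambda>(x, y). deriv (f x) y)"
    unfolding continuous_within
  proof (rule tendstoI)
    fix e :: real assume e: "e > 0"
    have uc: "uniformly_continuous_on (A \<times> cball t (2*r)) (\<lambda>(x, w). f x w)"
      using r by (intro compact_uniformly_continuous compact_Times A compact_cball
          continuous_on_subset[OF cont]) auto
    \<comment> \<open>Cauchy's estimate on a circle of radius \<open>r\<close> divides by
      \<open>r\<close>, which leaves \<open>e / 4\<close> for the change of function; the change of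
      the point \<open>y\<close> costs another \<open>e / 2\<close>.\<close>
    have "e * r / 4 > 0" using e r by simp
    then obtain \<delta> where \<delta>: "\<delta> > 0"
      "\<And>x y. x \<in> A \<times> cball t (2*r) \<Longrightarrow> y \<in> A \<times> cball t (2*r) \<Longrightarrow>
         dist y x < \<delta> \<Longrightarrow> dist (case y of (x, w) \<Rightarrow> f x w) (case x of (x, w) \<Rightarrow> f x w) < e * r / 4"
      using uc unfolding uniformly_continuous_on_def by meson
    have "deriv (f z) holomorphic_on B" by (rule holomorphic_deriv[OF hol[OF z] B])
    hence "isCont (deriv (f z)) t"
      using B t by (metis continuous_on_eq_continuous_at holomorphic_on_imp_continuous_on)
    hence "\<forall>\<^sub>F y in at t. dist (deriv (f z) y) (deriv (f z) t) < e / 2"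
      using e by (intro tendstoD) (auto simp: isCont_def simp del: dist_0_norm)
    then obtain \<delta>2 where \<delta>2: "\<delta>2 > 0" "\<And>y. y \<noteq> t \<Longrightarrow> dist y t < \<delta>2 \<Longrightarrow> dist (deriv (f z) y) (deriv (f z) t) < e / 2"
      unfolding eventually_at by auto
    define \<delta>3 where "\<delta>3 = min r (min \<delta> \<delta>2)"
    have \<delta>3: "\<delta>3 > 0" "\<delta>3 \<le> \<delta>" "\<delta>3 \<le> \<delta>2" "\<delta>3 \<le> r" using \<delta> \<delta>2 r by (auto simp: \<delta>3_def)
    have "dist (deriv (f x) y) (deriv (f z) t) < e"
      if xy: "x \<in> A" "y \<in> B" "dist (x, y) (z, t) < \<delta>3" for x y
    proof -
      have dx: "dist x z < \<delta>" "dist y t < \<delta>2" "dist y t < r"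
        using xy(3) \<delta>3 dist_fst_le[of "(x,y)" "(z,t)"] dist_snd_le[of "(x,y)" "(z,t)"] by auto
      have inb: "cball y r \<subseteq> cball t (2*r)"
      proof
        fix w assume "w \<in> cball y r"
        thus "w \<in> cball t (2*r)" using dx(3) dist_triangle[of t w y] by (auto simp: dist_commute)
      qed
      have hold: "(\<lambda>w. f x w - f z w) holomorphic_on B"
        by (intro holomorphic_intros hol xy z)
      have "norm ((deriv ^^ 1) (\<lambda>w. f x w - f z w) y) \<le> fact 1 * (e * r / 4) / r ^ 1"
      proof (rule Cauchy_inequality)
        have "(\<lambda>w. f x w - f z w) holomorphic_on cball y r"
          using inb r by (intro holomorphic_on_subset[OF hold]) auto
        thus "continuous_on (cball y r) (\<lambda>w. f x w - f z w)" "(\<lambda>w. f x w - f z w) holomorphic_on ball y r"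
          by (auto intro: holomorphic_on_imp_continuous_on holomorphic_on_subset)
        show "norm (f x w - f z w) \<le> e * r / 4" if "norm (y - w) = r" for w
        proof -
          have "w \<in> cball t (2*r)" using inb that by (auto simp: dist_norm)
          moreover have "dist (x, w) (z, w) < \<delta>" using dx by (simp add: dist_Pair_Pair)
          ultimately show ?thesis using \<delta>(2)[of "(z, w)" "(x, w)"] xy z
            by (auto simp: dist_norm norm_minus_commute)
        qed
      qed (use r in auto)
      also have "(deriv ^^ 1) (\<lambda>w. f x w - f z w) y = deriv (f x) y - deriv (f z) y"
      proof -
        have "((\<lambda>w. f x w - f z w) has_field_derivative deriv (f x) y - deriv (f z) y) (at y)"
          using xy z by (intro DERIV_diff holomorphic_derivI[OF hol B]) auto
        thus ?thesis by (simp add: DERIV_imp_deriv)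
      qed
      finally have "dist (deriv (f x) y) (deriv (f z) y) \<le> e / 4" using r by (simp add: dist_norm)
      moreover have "dist (deriv (f z) y) (deriv (f z) t) < e / 2" using \<delta>2 dx e by (cases "y = t") auto
      ultimately show ?thesis
        using dist_triangle[of "deriv (f x) y" "deriv (f z) t" "deriv (f z) y"] e by linarith
    qed
    thus "\<forall>\<^sub>F x in at (z, t) within A \<times> B.
        dist (case x of (x, y) \<Rightarrow> deriv (f x) y) (case (z, t) of (x, y) \<Rightarrow> deriv (f x) y) < e"
      unfolding eventually_at using \<delta>3(1) by (intro exI[of _ \<delta>3]) auto
  qed
qed

text \<open>Osgood's lemma.\<close>

lemma holomorphic2_on_separately:
  assumes cont: "continuous_on U f" and "open U"
    and fst: "\<And>z t. (z, t) \<in> U \<Longrightarrow> (\<lambda>w. f (w, t)) holomorphic_on {w. (w, t) \<in> U}"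
    and snd: "\<And>z t. (z, t) \<in> U \<Longrightarrow> (\<lambda>w. f (z, w)) holomorphic_on {w. (z, w) \<in> U}"
  shows "f holomorphic2_on U"
proof (rule holomorphic2_onI)
  fix p assume "p \<in> U"
  obtain z t where p: "p = (z, t)" by (cases p)
  obtain A B where AB: "open A" "open B" "p \<in> A \<times> B" "A \<times> B \<subseteq> U"
    using open_prod_elim[OF \<open>open U\<close> \<open>p \<in> U\<close>] by (metis subsetI)
  obtain e1 where e1: "e1 > 0" "cball z e1 \<subseteq> A"
    using AB p open_contains_cball by (metis SigmaE2)
  obtain e2 where e2: "e2 > 0" "cball t e2 \<subseteq> B"
    using AB p open_contains_cball by (metis SigmaE2)
  define r where "r = min e1 e2 / 2"
  have r: "r > 0" "2 * r \<le> e1" "2 * r \<le> e2" using e1 e2 by (auto simp: r_def)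
  have sub: "cball z (2*r) \<times> cball t (2*r) \<subseteq> U"
    using AB e1 e2 r by (force simp: subset_iff)
  have holt: "(\<lambda>w. f (x, w)) holomorphic_on cball t (2*r)" if "x \<in> cball z (2*r)" for x
    by (rule holomorphic_on_subset[OF snd[of x t]]) (use sub that r in auto)
  have holz: "(\<lambda>w. f (w, t)) holomorphic_on cball z (2*r)"
    by (rule holomorphic_on_subset[OF fst[of z t]]) (use sub r in auto)
  define f' where "f' = (\<lambda>x y. deriv (\<lambda>w. f (x, w)) y)"
  have d: "((\<lambda>w. f (x, w)) has_field_derivative f' x y) (at y)"
    if "x \<in> ball z (2*r)" "y \<in> ball t (2*r)" for x y
    unfolding f'_def
    by (rule holomorphic_derivI[of _ "ball t (2*r)"])
       (use that in \<open>auto intro!: holomorphic_on_subset[OF holt]\<close>)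
  have "continuous_on (cball z (2*r) \<times> ball t (2*r)) (\<lambda>(x, y). f' x y)"
    unfolding f'_def
  proof (rule continuous_on_deriv_param)
    show "continuous_on (cball z (2*r) \<times> ball t (2*r)) (\<lambda>(x, w). f (x, w))"
      unfolding case_prod_unfold prod.collapse
      by (rule continuous_on_subset[OF cont], rule subset_trans[OF _ sub]) (intro Sigma_mono order_refl ball_subset_cball)
  qed (use holomorphic_on_subset[OF holt ball_subset_cball] in simp_all)
  hence "continuous (at (z, t) within cball z (2*r) \<times> ball t (2*r)) (\<lambda>(x, y). f' x y)"
    using r(1) by (simp add: continuous_on_eq_continuous_within)
  moreover have "ball z r \<times> ball t r \<subseteq> cball z (2*r) \<times> ball t (2*r)" using r(1) by auto
  ultimately have contf': "continuous (at (z, t) within ball z r \<times> ball t r) (\<lambda>(x, y). f' x y)"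
    by (rule continuous_within_subset)
  have "((\<lambda>w. f (w, t)) has_field_derivative deriv (\<lambda>w. f (w, t)) z) (at z)"
    by (rule holomorphic_derivI[of _ "ball z (2*r)"])
       (use r in \<open>auto intro!: holomorphic_on_subset[OF holz]\<close>)
  hence dz: "((\<lambda>w. f (w, t)) has_derivative (*) (deriv (\<lambda>w. f (w, t)) z)) (at z within ball z r)"
    using has_field_derivative_at_within has_field_derivative_def by blast
  \<comment> \<open>Total differentiability follows from the existence of one partial derivative at
    the point together with existence nearby and continuity of the other; the continuity is what
    \<open>continuous_on_deriv_param\<close> supplies.\<close>
  have "((\<lambda>(x, y). f (x, y)) has_derivative
     (\<lambda>(tx, ty). deriv (\<lambda>w. f (w, t)) z * tx + blinfun_mult_right (f' z t) ty))
     (at (z, t) within ball z r \<times> ball t r)"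
  proof (rule has_derivative_partialsI[where fy = "\<lambda>x y. blinfun_mult_right (f' x y)"])
    show "continuous (at (z, t) within ball z r \<times> ball t r) (\<lambda>(x, y). blinfun_mult_right (f' x y))"
      using bounded_linear.continuous[OF bounded_linear_blinfun_mult_right contf']
      by (simp add: case_prod_unfold)
    show "((\<lambda>y. f (x, y)) has_derivative blinfun_apply (blinfun_mult_right (f' x y))) (at y within ball t r)"
      if "x \<in> ball z r" "y \<in> ball t r" for x y
      using has_derivative_at_withinI[OF d[of x y, unfolded has_field_derivative_def]] that r
      by (auto simp: blinfun_mult_right.rep_eq)
  qed (use dz r in auto)
  hence "(f has_derivative (\<lambda>h. deriv (\<lambda>w. f (w, t)) z * fst h + f' z t * snd h))
     (at (z, t) within ball z r \<times> ball t r)"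
    by (simp add: case_prod_unfold)
  moreover have "at (z, t) within ball z r \<times> ball t r = at (z, t)"
    by (rule at_within_open) (use r in \<open>auto intro: open_Times\<close>)
  ultimately show "\<exists>a b. (f has_derivative (\<lambda>h. a * fst h + b * snd h)) (at p)"
    using p by auto
qed

section \<open>The identity theorem in two variables\<close>

lemma convex_line_preimage:
  fixes x y d e :: complex
  assumes "convex U"
  shows "convex {t. (x + t * d, y + t * e) \<in> U}"
proof (rule convexI)
  fix s t :: complex and u v :: real
  assume s: "s \<in> {t. (x + t * d, y + t * e) \<in> U}" and t: "t \<in> {t. (x + t * d, y + t * e) \<in> U}"
    and uv: "0 \<le> u" "0 \<le> v" "u + v = 1"
  have "u *\<^sub>R (x + s * d, y + s * e) + v *\<^sub>R (x + t * d, y + t * e) \<in> U"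
    using assms s t uv by (intro convexD) auto
  also have "u *\<^sub>R (x + s * d, y + s * e) + v *\<^sub>R (x + t * d, y + t * e)
     = ((u + v) *\<^sub>R x + (u *\<^sub>R s + v *\<^sub>R t) * d, (u + v) *\<^sub>R y + (u *\<^sub>R s + v *\<^sub>R t) * e)"
    by (simp add: algebra_simps scaleR_conv_of_real)
  finally show "u *\<^sub>R s + v *\<^sub>R t \<in> {t. (x + t * d, y + t * e) \<in> U}"
    using uv by simp
qed

text \<open>The complex line through a point of \<open>O'\<close> and \<open>p\<close> meets a
  convex \<open>U\<close> in a convex set of parameters, and meets \<open>O'\<close> in an open set
  of parameters, so the one-variable identity theorem reaches \<open>p\<close>.\<close>

lemma holomorphic2_zero_convex:
  assumes f: "f holomorphic2_on U" and U: "open U" "convex U"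
    and O: "open O'" "O' \<noteq> {}" "O' \<subseteq> U" "\<And>x. x \<in> O' \<Longrightarrow> f x = 0" and "p \<in> U"
  shows "f p = 0"
proof -
  obtain q where q: "q \<in> O'" using O by blast
  define d where "d = p - q"
  define L where "L = (\<lambda>t. (fst q + t * fst d, snd q + t * snd d))"
  define S where "S = {t. L t \<in> U}"
  have L: "continuous_on UNIV L" unfolding L_def by (intro continuous_intros)
  have "open S" unfolding S_def using open_vimage[OF U(1) L] by (simp add: vimage_def)
  moreover have "connected S" unfolding S_def L_def
    by (intro convex_connected convex_line_preimage U)
  moreover have hol: "(\<lambda>t. f (L t)) holomorphic_on S"
    unfolding S_def L_def by (rule holomorphic2_on_line[OF f])
  moreover have oV: "open {t. L t \<in> O'}" using open_vimage[OF O(1) L] by (simp add: vimage_def)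
  moreover have 0: "0 \<in> {t. L t \<in> O'}" using q by (simp add: L_def)
  ultimately have "f (L 1) = 0"
  proof (intro analytic_continuation[of "\<lambda>t. f (L t)" S "{t. L t \<in> O'}" 0 1])
    show "0 islimpt {t. L t \<in> O'}"
      using oV 0 by (simp add: interior_limit_point interior_open)
  qed (use O q \<open>p \<in> U\<close> in \<open>auto simp: S_def L_def d_def\<close>)
  thus ?thesis by (simp add: L_def d_def)
qed

text \<open>The usual open-and-closed argument. Closedness enters through \<open>cl\<close>: every
  point of \<open>D\<close> has a ball in which a single good point already makes the centre
  good.\<close>

lemma connected_propagate:
  fixes D :: "'a :: metric_space set"
  assumes "connected D" "open D" "a \<in> D" "P a" "p \<in> D"
    and op: "\<And>x. x \<in> D \<Longrightarrow> P x \<Longrightarrow> \<exists>r>0. \<forall>y\<in>ball x r. P y"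
    and cl: "\<And>x. x \<in> D \<Longrightarrow> \<exists>r>0. (\<exists>y\<in>ball x r. P y) \<longrightarrow> P x"
  shows "P p"
proof (rule ccontr)
  assume np: "\<not> P p"
  have o1: "open {x \<in> D. P x}"
    unfolding open_contains_ball
  proof
    fix x assume x: "x \<in> {x \<in> D. P x}"
    then obtain r where r: "r > 0" "\<forall>y\<in>ball x r. P y" using op by blast
    obtain r' where r': "r' > 0" "ball x r' \<subseteq> D" using x \<open>open D\<close> open_contains_ball by blast
    show "\<exists>e>0. ball x e \<subseteq> {x \<in> D. P x}"
      by (rule exI[of _ "min r r'"]) (use r r' in auto)
  qed
  have o2: "open {x \<in> D. \<not> P x}"
    unfolding open_contains_ball
  proof
    fix x assume x: "x \<in> {x \<in> D. \<not> P x}"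
    then obtain r where r: "r > 0" "\<not> (\<exists>y\<in>ball x r. P y)" using cl by blast
    obtain r' where r': "r' > 0" "ball x r' \<subseteq> D" using x \<open>open D\<close> open_contains_ball by blast
    show "\<exists>e>0. ball x e \<subseteq> {x \<in> D. \<not> P x}"
      by (rule exI[of _ "min r r'"]) (use r r' in auto)
  qed
  have "\<not> connected D"
    unfolding connected_def using o1 o2 assms np
    by (simp, intro exI[of _ "{x \<in> D. P x}"] conjI exI[of _ "{x \<in> D. \<not> P x}"]) auto
  thus False using \<open>connected D\<close> by blast
qed

text \<open>The propagated property is vanishing on a whole ball. Balls are convex, so
  \<open>holomorphic2_zero_convex\<close> spreads it from any small ball to a larger one that meets
  it, which is the closedness condition.\<close>

lemma holomorphic2_identity:
  assumes f: "f holomorphic2_on U" and U: "open U" "connected U"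
    and O: "open O'" "O' \<noteq> {}" "O' \<subseteq> U" "\<And>x. x \<in> O' \<Longrightarrow> f x = 0" and "p \<in> U"
  shows "f p = 0"
proof -
  obtain a where a: "a \<in> O'" using O by blast
  have "\<exists>r>0. \<forall>x\<in>ball p r. f x = 0"
  proof (rule connected_propagate[where P = "\<lambda>x. \<exists>r>0. \<forall>y\<in>ball x r. f y = 0" and D = U])
    show "\<exists>r>0. \<forall>x\<in>ball a r. f x = 0"
      using O a by (meson open_contains_ball subsetD)
    fix x assume x: "x \<in> U"
    show "\<exists>r>0. \<forall>y\<in>ball x r. \<exists>r>0. \<forall>y\<in>ball y r. f y = 0" if "\<exists>r>0. \<forall>y\<in>ball x r. f y = 0"
      using that by (metis open_ball open_contains_ball subsetD)
    obtain r where r: "r > 0" "ball x r \<subseteq> U" using x U open_contains_ball by blast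
    show "\<exists>r>0. (\<exists>y\<in>ball x r. \<exists>r>0. \<forall>y\<in>ball y r. f y = 0) \<longrightarrow> (\<exists>r>0. \<forall>y\<in>ball x r. f y = 0)"
    proof (intro exI[of _ r] conjI impI r)
      assume "\<exists>y\<in>ball x r. \<exists>r>0. \<forall>y\<in>ball y r. f y = 0"
      then obtain y s where y: "y \<in> ball x r" "s > 0" "\<forall>y\<in>ball y s. f y = 0" by blast
      show "\<forall>y\<in>ball x r. f y = 0"
      proof
        fix z assume z: "z \<in> ball x r"
        show "f z = 0"
        proof (rule holomorphic2_zero_convex[of f "ball x r" "ball y s \<inter> ball x r"])
          show "f holomorphic2_on ball x r" using f r holomorphic2_on_subset by blast
          show "ball y s \<inter> ball x r \<noteq> {}" using y by force
        qed (use y z in auto)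
      qed
    qed
  qed (use assms a in auto)
  thus ?thesis by force
qed

lemma holomorphic2_nonzero_open:
  assumes "h holomorphic2_on U" "open U" "connected U" "\<exists>x\<in>U. h x \<noteq> 0"
    and "open O'" "O' \<noteq> {}" "O' \<subseteq> U"
  shows "\<exists>y\<in>O'. h y \<noteq> 0"
  using holomorphic2_identity[OF assms(1-3,5-7)] assms(4) by blast

lemma holomorphic2_nonzero_nbhd:
  assumes "h holomorphic2_on U" "open U" "x \<in> U" "h x \<noteq> 0"
  shows "\<exists>r>0. ball x r \<subseteq> U \<and> (\<forall>y\<in>ball x r. h y \<noteq> 0)"
proof -
  have "\<forall>\<^sub>F y in at x. h y \<noteq> 0"
    using holomorphic2_on_imp_isCont[OF assms(1,3)] assms(4)
    by (simp add: isCont_def tendsto_imp_eventually_ne)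
  then obtain d where "d > 0" "\<And>y. y \<noteq> x \<Longrightarrow> dist y x < d \<Longrightarrow> h y \<noteq> 0"
    unfolding eventually_at by auto
  moreover obtain r where "r > 0" "ball x r \<subseteq> U" using assms open_contains_ball by blast
  ultimately show ?thesis using assms(4)
    by (intro exI[of _ "min d r"] conjI ballI)
       (auto simp: dist_commute simp del: split_paired_All, metis dist_commute)
qed

text \<open>One factor is nonzero on some small ball, by continuity, and on that ball the other
  cannot vanish identically: there are no zero divisors on a connected open set.\<close>

lemma holomorphic2_mult_nonzero:
  assumes "g holomorphic2_on U" "h holomorphic2_on U" "open U" "connected U"
    and "\<exists>x\<in>U. g x \<noteq> 0" "\<exists>x\<in>U. h x \<noteq> 0"
    and "open O'" "O' \<noteq> {}" "O' \<subseteq> U"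
  shows "\<exists>y\<in>O'. g y * h y \<noteq> 0"
proof -
  obtain y where y: "y \<in> O'" "g y \<noteq> 0"
    using holomorphic2_nonzero_open[OF assms(1,3,4,5,7-9)] by blast
  obtain r where r: "r > 0" "ball y r \<subseteq> O'" "\<forall>z\<in>ball y r. g z \<noteq> 0"
    using holomorphic2_nonzero_nbhd[of g O' y, OF holomorphic2_on_subset[OF assms(1,9)] assms(7)] y
    by blast
  have "\<exists>z\<in>ball y r. h z \<noteq> 0"
    by (rule holomorphic2_nonzero_open[OF assms(2,3,4,6)]) (use r assms(9) in auto)
  then obtain z where "z \<in> ball y r" "h z \<noteq> 0" by blast
  thus ?thesis using r by force
qed

section \<open>Meromorphic functions of two variables\<close>

lemma meromorphic2_localI:
  assumes "r > 0" "ball p r \<subseteq> D" "g holomorphic2_on ball p r"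
    "h holomorphic2_on ball p r" "\<exists>x\<in>ball p r. h x \<noteq> 0"
    "\<And>x. x \<in> ball p r \<Longrightarrow> h x \<noteq> 0 \<Longrightarrow> F x = g x / h x"
  shows "\<exists>r>0. \<exists>g h. ball p r \<subseteq> D \<and> g holomorphic2_on ball p r \<and>
    h holomorphic2_on ball p r \<and> (\<exists>x\<in>ball p r. h x \<noteq> 0) \<and> (\<forall>x\<in>ball p r. h x \<noteq> 0 \<longrightarrow> F x = g x / h x)"
  by (rule exI[of _ r], rule conjI, fact, rule exI[of _ g], rule exI[of _ h]) (use assms in blast)

text \<open>Balls replace arbitrary connected neighbourhoods because two balls with the same centre
  intersect in a ball; the intersection stays connected and the identity theorem applies to
  it.\<close>

lemma meromorphic2_onD:
  assumes "F meromorphic2_on D" "p \<in> D"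
  shows "\<exists>r>0. \<exists>g h. ball p r \<subseteq> D \<and> g holomorphic2_on ball p r \<and>
    h holomorphic2_on ball p r \<and> (\<exists>x\<in>ball p r. h x \<noteq> 0) \<and> (\<forall>x\<in>ball p r. h x \<noteq> 0 \<longrightarrow> F x = g x / h x)"
proof -
  from bspec[OF assms(1)[unfolded meromorphic2_on_def] assms(2)]
  obtain W g h where W: "open W" "connected W" "p \<in> W" "W \<subseteq> D" "g holomorphic2_on W"
    "h holomorphic2_on W" "\<exists>x\<in>W. h x \<noteq> 0" "\<forall>x\<in>W. h x \<noteq> 0 \<longrightarrow> F x = g x / h x"
    by (elim exE conjE) (rule that; assumption)
  obtain r where r: "r > 0" "ball p r \<subseteq> W" using W open_contains_ball by blast
  have "\<exists>x\<in>ball p r. h x \<noteq> 0"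
    using holomorphic2_nonzero_open[OF W(6,1,2,7), of "ball p r"] W r by auto
  thus ?thesis using r W by (intro meromorphic2_localI[of r _ _ g h]) (auto intro: holomorphic2_on_subset)
qed

lemma meromorphic2_onI:
  assumes "\<And>p. p \<in> D \<Longrightarrow> \<exists>r>0. \<exists>g h. ball p r \<subseteq> D \<and> g holomorphic2_on ball p r \<and>
    h holomorphic2_on ball p r \<and> (\<exists>x\<in>ball p r. h x \<noteq> 0) \<and> (\<forall>x\<in>ball p r. h x \<noteq> 0 \<longrightarrow> F x = g x / h x)"
  shows "F meromorphic2_on D"
  unfolding meromorphic2_on_def
proof
  fix p assume "p \<in> D"
  from assms[OF this] obtain r g h where "r > 0" "ball p r \<subseteq> D" "g holomorphic2_on ball p r"
    "h holomorphic2_on ball p r" "\<exists>x\<in>ball p r. h x \<noteq> 0"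
    "\<forall>x\<in>ball p r. h x \<noteq> 0 \<longrightarrow> F x = g x / h x" by (elim exE conjE) (rule that; assumption)
  thus "\<exists>W g h. open W \<and> connected W \<and> p \<in> W \<and> W \<subseteq> D \<and> g holomorphic2_on W \<and>
      h holomorphic2_on W \<and> (\<exists>x\<in>W. h x \<noteq> 0) \<and> (\<forall>x\<in>W. h x \<noteq> 0 \<longrightarrow> F x = g x / h x)"
    by (intro exI[of _ "ball p r"] exI[of _ g] exI[of _ h]) auto
qed

lemma holomorphic2_imp_meromorphic2:
  assumes "f holomorphic2_on D" "open D"
  shows "f meromorphic2_on D"
proof (rule meromorphic2_onI)
  fix p assume "p \<in> D"
  then obtain r where "r > 0" "ball p r \<subseteq> D" using assms open_contains_ball by blast
  moreover from this have "\<exists>x\<in>ball p r. (1::complex) \<noteq> 0"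
    by (metis centre_in_ball zero_neq_one)
  ultimately show "\<exists>r>0. \<exists>g h. ball p r \<subseteq> D \<and> g holomorphic2_on ball p r \<and> h holomorphic2_on ball p r \<and>
     (\<exists>x\<in>ball p r. h x \<noteq> 0) \<and> (\<forall>x\<in>ball p r. h x \<noteq> 0 \<longrightarrow> f x = g x / h x)"
    using holomorphic2_on_subset[OF assms(1)]
    by (intro meromorphic2_localI[of r _ _ f "\<lambda>_. 1"]) auto
qed

lemma meromorphic2_on_subset:
  assumes "F meromorphic2_on D" "D' \<subseteq> D" "open D'"
  shows "F meromorphic2_on D'"
proof (rule meromorphic2_onI)
  fix p assume p: "p \<in> D'"
  obtain r g h where *: "r > 0" "ball p r \<subseteq> D" "g holomorphic2_on ball p r"
    "h holomorphic2_on ball p r" "\<exists>x\<in>ball p r. h x \<noteq> 0"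
    "\<forall>x\<in>ball p r. h x \<noteq> 0 \<longrightarrow> F x = g x / h x"
    using meromorphic2_onD[OF assms(1) subsetD[OF assms(2) p]] by (elim exE conjE) (rule that; assumption)
  obtain s where s: "s > 0" "ball p s \<subseteq> D'" using assms p open_contains_ball by blast
  define q where "q = min r s"
  have q: "q > 0" "ball p q \<subseteq> ball p r" "ball p q \<subseteq> D'" using * s by (auto simp: q_def)
  have "\<exists>x\<in>ball p q. h x \<noteq> 0"
    using holomorphic2_nonzero_open[of h "ball p r" "ball p q"] * q by auto
  thus "\<exists>r>0. \<exists>g h. ball p r \<subseteq> D' \<and> g holomorphic2_on ball p r \<and> h holomorphic2_on ball p r \<and>
     (\<exists>x\<in>ball p r. h x \<noteq> 0) \<and> (\<forall>x\<in>ball p r. h x \<noteq> 0 \<longrightarrow> F x = g x / h x)"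
    using * q by (intro meromorphic2_localI[of q _ _ g h])
       (auto intro: holomorphic2_on_subset)
qed

lemma meromorphic2_on_mult:
  assumes "F meromorphic2_on D" "G meromorphic2_on D"
  shows "(\<lambda>x. F x * G x) meromorphic2_on D"
proof (rule meromorphic2_onI)
  fix p assume p: "p \<in> D"
  obtain r1 g1 h1 where 1: "r1 > 0" "ball p r1 \<subseteq> D" "g1 holomorphic2_on ball p r1"
    "h1 holomorphic2_on ball p r1" "\<exists>x\<in>ball p r1. h1 x \<noteq> 0"
    "\<forall>x\<in>ball p r1. h1 x \<noteq> 0 \<longrightarrow> F x = g1 x / h1 x"
    using meromorphic2_onD[OF assms(1) p] by (elim exE conjE) (rule that; assumption)
  obtain r2 g2 h2 where 2: "r2 > 0" "ball p r2 \<subseteq> D" "g2 holomorphic2_on ball p r2"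
    "h2 holomorphic2_on ball p r2" "\<exists>x\<in>ball p r2. h2 x \<noteq> 0"
    "\<forall>x\<in>ball p r2. h2 x \<noteq> 0 \<longrightarrow> G x = g2 x / h2 x"
    using meromorphic2_onD[OF assms(2) p] by (elim exE conjE) (rule that; assumption)
  define r where "r = min r1 r2"
  have r: "r > 0" "ball p r \<subseteq> ball p r1" "ball p r \<subseteq> ball p r2" "r \<le> r1" "r \<le> r2" using 1 2 by (auto simp: r_def)
  have n: "\<exists>x\<in>ball p r. h1 x \<noteq> 0" "\<exists>x\<in>ball p r. h2 x \<noteq> 0"
    using holomorphic2_nonzero_open[of h1 "ball p r1" "ball p r"]
      holomorphic2_nonzero_open[of h2 "ball p r2" "ball p r"] 1 2 r by auto
  have hol: "g1 holomorphic2_on ball p r" "h1 holomorphic2_on ball p r"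
     "g2 holomorphic2_on ball p r" "h2 holomorphic2_on ball p r"
    using 1 2 r holomorphic2_on_subset by blast+
  have "\<exists>x\<in>ball p r. h1 x * h2 x \<noteq> 0"
    by (rule holomorphic2_mult_nonzero[OF hol(2,4)]) (use n r in auto)
  thus "\<exists>r>0. \<exists>g h. ball p r \<subseteq> D \<and> g holomorphic2_on ball p r \<and> h holomorphic2_on ball p r \<and>
     (\<exists>x\<in>ball p r. h x \<noteq> 0) \<and> (\<forall>x\<in>ball p r. h x \<noteq> 0 \<longrightarrow> F x * G x = g x / h x)"
    using 1(2,6) 2(6) r hol
    by (intro meromorphic2_localI[of r _ _ "\<lambda>x. g1 x * g2 x" "\<lambda>x. h1 x * h2 x"]) auto
qed

text \<open>Values on the zero set of a denominator are arbitrary, so only agreement on a dense set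
  can be hoped for. The propagated property \<open>P\<close> is density of the agreement set in a
  ball; it passes between overlapping balls through the numerators, cleared of denominators.\<close>

lemma meromorphic2_agree:
  assumes F: "F meromorphic2_on D" and G: "G meromorphic2_on D" and D: "open D" "connected D"
    and O: "open O'" "O' \<noteq> {}" "O' \<subseteq> D" "\<And>x. x \<in> O' \<Longrightarrow> F x = G x"
    and V: "open V" "V \<noteq> {}" "V \<subseteq> D"
  shows "\<exists>x\<in>V. F x = G x"
proof -
  obtain a where a: "a \<in> O'" using O by blast
  obtain b where b: "b \<in> V" using V by blast
  define P where "P = (\<lambda>x. \<exists>r>0. \<forall>U. open U \<longrightarrow> U \<noteq> {} \<longrightarrow> U \<subseteq> ball x r \<longrightarrow> (\<exists>y\<in>U. F y = G y))"
  have "P b"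
  proof (rule connected_propagate[where P = P and D = D and a = a])
    obtain r where "r > 0" "ball a r \<subseteq> O'" using O a open_contains_ball by blast
    thus "P a" unfolding P_def using O by (intro exI[of _ r]) blast
    fix x assume x: "x \<in> D"
    show "\<exists>r>0. \<forall>y\<in>ball x r. P y" if Px: "P x"
    proof -
      from Px obtain r where r: "r > 0"
        "\<And>U. open U \<Longrightarrow> U \<noteq> {} \<Longrightarrow> U \<subseteq> ball x r \<Longrightarrow> (\<exists>y\<in>U. F y = G y)" unfolding P_def by blast
      show ?thesis
      proof (intro exI[of _ r] conjI ballI r)
        fix y assume y: "y \<in> ball x r"
        then obtain s where "s > 0" "ball y s \<subseteq> ball x r" by (meson open_ball open_contains_ball)
        thus "P y" unfolding P_def using r by (intro exI[of _ s]) blast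
      qed
    qed
    obtain r1 g1 h1 where 1: "r1 > 0" "ball x r1 \<subseteq> D" "g1 holomorphic2_on ball x r1"
      "h1 holomorphic2_on ball x r1" "\<exists>y\<in>ball x r1. h1 y \<noteq> 0"
      "\<forall>y\<in>ball x r1. h1 y \<noteq> 0 \<longrightarrow> F y = g1 y / h1 y"
      using meromorphic2_onD[OF F x] by (elim exE conjE) (rule that; assumption)
    obtain r2 g2 h2 where 2: "r2 > 0" "ball x r2 \<subseteq> D" "g2 holomorphic2_on ball x r2"
      "h2 holomorphic2_on ball x r2" "\<exists>y\<in>ball x r2. h2 y \<noteq> 0"
      "\<forall>y\<in>ball x r2. h2 y \<noteq> 0 \<longrightarrow> G y = g2 y / h2 y"
      using meromorphic2_onD[OF G x] by (elim exE conjE) (rule that; assumption)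
    define r where "r = min r1 r2"
    have r: "r > 0" "ball x r \<subseteq> ball x r1" "ball x r \<subseteq> ball x r2" "r \<le> r1" "r \<le> r2" using 1 2 by (auto simp: r_def)
    have n: "\<exists>y\<in>ball x r. h1 y \<noteq> 0" "\<exists>y\<in>ball x r. h2 y \<noteq> 0"
      using holomorphic2_nonzero_open[of h1 "ball x r1" "ball x r"]
        holomorphic2_nonzero_open[of h2 "ball x r2" "ball x r"] 1 2 r by auto
    have hol: "g1 holomorphic2_on ball x r" "h1 holomorphic2_on ball x r"
       "g2 holomorphic2_on ball x r" "h2 holomorphic2_on ball x r"
      using 1 2 r holomorphic2_on_subset by blast+
    show "\<exists>r>0. (\<exists>y\<in>ball x r. P y) \<longrightarrow> P x"
    proof (intro exI[of _ r] conjI impI r)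
      assume "\<exists>y\<in>ball x r. P y"
      then obtain y s where ys: "y \<in> ball x r" "s > 0"
        "\<And>U. open U \<Longrightarrow> U \<noteq> {} \<Longrightarrow> U \<subseteq> ball y s \<Longrightarrow> (\<exists>y\<in>U. F y = G y)"
        unfolding P_def by metis
      have hh: "(\<lambda>z. h1 z * h2 z) holomorphic2_on ball x r" using hol by auto
      have nn: "\<exists>z\<in>U. h1 z * h2 z \<noteq> 0" if "open U" "U \<noteq> {}" "U \<subseteq> ball x r" for U
        by (rule holomorphic2_mult_nonzero[OF hol(2,4)]) (use n that in auto)
      \<comment> \<open>A nonzero value would persist on a ball; inside it there is a ball without
        zeros of \<open>h1\<close> and \<open>h2\<close>, and a point of agreement there contradicts
        it.\<close>
      have zero: "g1 z * h2 z - g2 z * h1 z = 0" if z: "z \<in> ball y s \<inter> ball x r" for z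
      proof (rule ccontr)
        assume ne: "g1 z * h2 z - g2 z * h1 z \<noteq> 0"
        have "(\<lambda>z. g1 z * h2 z - g2 z * h1 z) holomorphic2_on (ball y s \<inter> ball x r)"
          using hol by (intro holomorphic2_on_diff holomorphic2_on_mult)
             (auto intro: holomorphic2_on_subset)
        then obtain t where t: "t > 0" "ball z t \<subseteq> ball y s \<inter> ball x r"
          "\<forall>w\<in>ball z t. g1 w * h2 w - g2 w * h1 w \<noteq> 0"
          using holomorphic2_nonzero_nbhd[of _ "ball y s \<inter> ball x r" z] z ne by blast
        obtain w where w: "w \<in> ball z t" "h1 w * h2 w \<noteq> 0"
          using nn[of "ball z t"] t by auto
        obtain t' where t': "t' > 0" "ball w t' \<subseteq> ball z t" "\<forall>v\<in>ball w t'. h1 v * h2 v \<noteq> 0"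
          using holomorphic2_nonzero_nbhd[of _ "ball z t" w, OF holomorphic2_on_subset[OF hh]] w t
          by (metis (no_types, lifting) le_inf_iff open_ball)
        obtain v where v: "v \<in> ball w t'" "F v = G v"
          using ys(3)[of "ball w t'"] t t' by (auto simp: subset_iff)
        have "v \<in> ball x r" using v t' t by blast
        hence "g1 v / h1 v = g2 v / h2 v" using 1(6)[rule_format, of v] 2(6)[rule_format, of v] v t' r
          by (metis mult_zero_left mult_zero_right subsetD)
        moreover have "h1 v \<noteq> 0" "h2 v \<noteq> 0" "v \<in> ball z t" using v t' by auto
        ultimately show False using t by (auto simp: field_simps)
      qed
      \<comment> \<open>The cross difference is holomorphic on all of \<open>ball x r\<close>,
        unlike \<open>F\<close> and \<open>G\<close> themselves, so its vanishing near
        \<open>y\<close> spreads to the whole ball.\<close>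
      have zero': "g1 z * h2 z - g2 z * h1 z = 0" if z: "z \<in> ball x r" for z
      proof (rule holomorphic2_identity[where f = "\<lambda>z. g1 z * h2 z - g2 z * h1 z" and O' = "ball y s \<inter> ball x r"])
        show "(\<lambda>z. g1 z * h2 z - g2 z * h1 z) holomorphic2_on ball x r" using hol by auto
        show "ball y s \<inter> ball x r \<noteq> {}" using ys by force
      qed (use zero z in auto)
      show "P x" unfolding P_def
      proof (intro exI[of _ r] conjI allI impI r)
        fix U assume U: "open U" "U \<noteq> {}" "U \<subseteq> ball x r"
        obtain z where z: "z \<in> U" "h1 z * h2 z \<noteq> 0" using nn[OF U] by blast
        hence "z \<in> ball x r" using U by blast
        hence "F z = g1 z / h1 z" "G z = g2 z / h2 z" "g1 z * h2 z = g2 z * h1 z" "h1 z \<noteq> 0" "h2 z \<noteq> 0"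
          using 1(6)[rule_format, of z] 2(6)[rule_format, of z] z r zero'[of z] by auto
        hence "F z = G z" by (simp add: frac_eq_eq)
        thus "\<exists>z\<in>U. F z = G z" using z by blast
      qed
    qed
  qed (use D O V a b in auto)
  then obtain r where r: "r > 0" "\<And>U. open U \<Longrightarrow> U \<noteq> {} \<Longrightarrow> U \<subseteq> ball b r \<Longrightarrow> (\<exists>y\<in>U. F y = G y)"
    unfolding P_def by blast
  have "b \<in> V \<inter> ball b r" using b r(1) by simp
  hence "\<exists>y\<in>V \<inter> ball b r. F y = G y" using V by (intro r(2)) auto
  thus ?thesis by blast
qed

lemma isCont_eq_on_dense:
  fixes f :: "complex \<times> complex \<Rightarrow> complex" and x and g :: "complex \<times> complex \<Rightarrow> complex"
  assumes "isCont f x" "isCont g x" "open U" "x \<in> U"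
    and "\<And>V. open V \<Longrightarrow> V \<noteq> {} \<Longrightarrow> V \<subseteq> U \<Longrightarrow> \<exists>y\<in>V. f y = g y"
  shows "f x = g x"
proof (rule ccontr)
  assume "f x \<noteq> g x"
  obtain A B where AB: "open A" "open B" "f x \<in> A" "g x \<in> B" "A \<inter> B = {}"
    using \<open>f x \<noteq> g x\<close> by (meson hausdorff)
  obtain V1 where V1: "open V1" "x \<in> V1" "\<forall>y\<in>V1. f y \<in> A"
    using assms(1) AB continuous_at_open by metis
  obtain V2 where V2: "open V2" "x \<in> V2" "\<forall>y\<in>V2. g y \<in> B"
    using assms(2) AB continuous_at_open by metis
  have "\<exists>y\<in>V1 \<inter> V2 \<inter> U. f y = g y"
    by (rule assms(5)) (use V1 V2 assms(3,4) in blast)+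
  thus False using V1 V2 AB by auto
qed

text \<open>The local quotients of \<open>F\<close> still serve: where the denominator is nonzero,
  \<phi> and \<open>g / h\<close> are both continuous and agree on a dense set, hence
  everywhere.\<close>

lemma meromorphic2_on_modify:
  assumes F: "F meromorphic2_on D" and B: "open B" "B \<subseteq> D" and \<phi>: "\<phi> holomorphic2_on B"
    and dense: "\<And>V. open V \<Longrightarrow> V \<noteq> {} \<Longrightarrow> V \<subseteq> B \<Longrightarrow> \<exists>y\<in>V. F y = \<phi> y"
  shows "(\<lambda>x. if x \<in> B then \<phi> x else F x) meromorphic2_on D"
proof (rule meromorphic2_onI)
  fix p assume p: "p \<in> D"
  obtain r g h where *: "r > 0" "ball p r \<subseteq> D" "g holomorphic2_on ball p r"
    "h holomorphic2_on ball p r" "\<exists>x\<in>ball p r. h x \<noteq> 0"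
    "\<forall>x\<in>ball p r. h x \<noteq> 0 \<longrightarrow> F x = g x / h x"
    using meromorphic2_onD[OF F p] by (elim exE conjE) (rule that; assumption)
  have "\<phi> x = g x / h x" if x: "x \<in> B" "x \<in> ball p r" "h x \<noteq> 0" for x
  proof -
    obtain s where s: "s > 0" "ball x s \<subseteq> ball p r" "\<forall>y\<in>ball x s. h y \<noteq> 0"
      using holomorphic2_nonzero_nbhd[OF *(4) _ x(2,3)] by auto
    show ?thesis
    proof (rule isCont_eq_on_dense[where f = \<phi> and x = x and g = "\<lambda>x. g x / h x" and U = "B \<inter> ball x s"])
      show "isCont \<phi> x" using holomorphic2_on_imp_isCont[OF \<phi>] x by blast
      show "isCont (\<lambda>x. g x / h x) x"
        using holomorphic2_on_imp_isCont[OF *(3)] holomorphic2_on_imp_isCont[OF *(4)] x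
        by (intro continuous_intros) auto
      show "\<exists>y\<in>V. \<phi> y = g y / h y" if V: "open V" "V \<noteq> {}" "V \<subseteq> B \<inter> ball x s" for V
        using dense[of V] V s *(6)[rule_format] by (metis le_inf_iff subsetD)
    qed (use B x s in auto)
  qed
  thus "\<exists>r>0. \<exists>g h. ball p r \<subseteq> D \<and> g holomorphic2_on ball p r \<and> h holomorphic2_on ball p r \<and>
     (\<exists>x\<in>ball p r. h x \<noteq> 0) \<and>
     (\<forall>x\<in>ball p r. h x \<noteq> 0 \<longrightarrow> (if x \<in> B then \<phi> x else F x) = g x / h x)"
    using * by (intro meromorphic2_localI[of r _ _ g h]) auto
qed

text \<open>The two auxiliary open sets \<open>O'\<close> and \<open>V\<close> may be arbitrarily small: agreement propagates
  by the identity theorem.\<close>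

lemma continuation2_eqI:
  assumes D: "open D" "connected D" and D0: "open D0" "connected D0" "D0 \<subseteq> D"
    and f: "f holomorphic2_on D0" and g: "g holomorphic2_on D0"
    and F: "F meromorphic2_on D"
    and O: "open O'" "O' \<noteq> {}" "O' \<subseteq> D0" "\<And>x. x \<in> O' \<Longrightarrow> g x \<noteq> 0 \<and> F x = f x / g x"
    and B: "open B" "connected B" "B \<subseteq> D" "p \<in> B" and \<phi>: "\<phi> holomorphic2_on B"
    and V: "open V" "V \<noteq> {}" "V \<subseteq> B" "\<And>x. x \<in> V \<Longrightarrow> \<phi> x = F x"
  shows "continuation2 f g D0 D p = \<phi> p"
proof -
  obtain x0 where x0: "x0 \<in> D0" "g x0 \<noteq> 0" using O by blast
  define Z where "Z = {x \<in> D0. g x \<noteq> 0}"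
  have Z: "open Z" "Z \<subseteq> D0"
    unfolding Z_def using continuous_open_preimage[OF holomorphic2_on_imp_continuous_on[OF g] D0(1), of "-{0}"]
    by (auto simp: vimage_def Int_def)
  have fgZ: "(\<lambda>x. f x / g x) holomorphic2_on Z"
    using f g by (intro holomorphic2_on_divide) (auto simp: Z_def intro: holomorphic2_on_subset)
  have Zdense: "\<exists>x\<in>U. g x \<noteq> 0" if "open U" "U \<noteq> {}" "U \<subseteq> D0" for U
    using holomorphic2_nonzero_open[OF g D0(1,2) _ that] x0 by blast
  have fg: "(\<lambda>x. f x / g x) meromorphic2_on D0"
  proof (rule meromorphic2_onI)
    fix q assume q: "q \<in> D0"
    then obtain r where r: "r > 0" "ball q r \<subseteq> D0" using D0 open_contains_ball by blast
    hence "\<exists>x\<in>ball q r. g x \<noteq> 0" by (intro Zdense) auto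
    thus "\<exists>r>0. \<exists>g' h. ball q r \<subseteq> D0 \<and> g' holomorphic2_on ball q r \<and> h holomorphic2_on ball q r \<and>
     (\<exists>x\<in>ball q r. h x \<noteq> 0) \<and> (\<forall>x\<in>ball q r. h x \<noteq> 0 \<longrightarrow> f x / g x = g' x / h x)"
      using r f g by (intro meromorphic2_localI[of r _ _ f g]) (auto intro: holomorphic2_on_subset)
  qed
  define F1 where "F1 = (\<lambda>x. if x \<in> B then \<phi> x else F x)"
  have \<phi>m: "\<phi> meromorphic2_on B" by (rule holomorphic2_imp_meromorphic2) (use \<phi> B in auto)
  have Fd: "\<exists>y\<in>U. F y = f y / g y" if "open U" "U \<noteq> {}" "U \<subseteq> D0" for U
    by (rule meromorphic2_agree[OF meromorphic2_on_subset[OF F] fg]) (use D0 O that in auto)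
  have F1: "F1 meromorphic2_on D" unfolding F1_def
  proof (rule meromorphic2_on_modify[OF F B(1,3) \<phi>])
    fix U assume "open U" "U \<noteq> {}" "U \<subseteq> B"
    thus "\<exists>y\<in>U. F y = \<phi> y"
      by (intro meromorphic2_agree[OF meromorphic2_on_subset[OF F] \<phi>m, where O' = V]) (use B V in auto)
  qed
  have F1V: "F1 x = F x" if "x \<in> V" for x using V that by (auto simp: F1_def)
  have F1d: "\<exists>y\<in>U. f y / g y = F1 y" if U: "open U" "U \<noteq> {}" "U \<subseteq> D0" for U
  proof -
    obtain y where y: "y \<in> U" "g y \<noteq> 0" using Zdense[OF U] by blast
    have "\<exists>x\<in>U. F1 x = f x / g x"
    proof (rule ccontr)
      assume no: "\<not> ?thesis"
      \<comment> \<open>\<open>V\<close> may be far from \<open>O'\<close>, and \<open>F1\<close>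
        agrees with \<open>F\<close> only densely. Near a point of \<open>O'\<close> where
        \<open>F1\<close> is holomorphic, density and continuity give equality with
        \<open>f / g\<close> on an open set, from which agreement spreads over
        \<open>D0\<close>.\<close>
      have op: "\<exists>O1. open O1 \<and> O1 \<noteq> {} \<and> O1 \<subseteq> D0 \<and> (\<forall>x\<in>O1. F1 x = f x / g x)"
      proof -
        obtain q where q: "q \<in> O'" using O by blast
        obtain r g1 h1 where 1: "r > 0" "ball q r \<subseteq> D" "g1 holomorphic2_on ball q r"
          "h1 holomorphic2_on ball q r" "\<exists>x\<in>ball q r. h1 x \<noteq> 0"
          "\<forall>x\<in>ball q r. h1 x \<noteq> 0 \<longrightarrow> F1 x = g1 x / h1 x"
          using meromorphic2_onD[OF F1 subsetD[OF D0(3) subsetD[OF O(3) q]]] by (elim exE conjE) (rule that; assumption)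
        have "\<exists>z\<in>ball q r \<inter> O'. h1 z \<noteq> 0"
        proof (rule holomorphic2_nonzero_open[OF 1(4) _ _ 1(5)])
          show "ball q r \<inter> O' \<noteq> {}" using 1(1) q by (metis IntI centre_in_ball empty_iff)
        qed (use O(1) in auto)
        then obtain z where z: "z \<in> ball q r \<inter> O'" "h1 z \<noteq> 0" by blast
        obtain s where s: "s > 0" "ball z s \<subseteq> ball q r \<inter> O'" "\<forall>y\<in>ball z s. h1 y \<noteq> 0"
          using holomorphic2_nonzero_nbhd[of h1 "ball q r \<inter> O'" z] 1 O z
          by (metis holomorphic2_on_subset inf_le1 open_Int open_ball)
        have "F1 x = f x / g x" if x: "x \<in> ball z s" for x
        proof (rule isCont_eq_on_dense[where f = F1 and x = x and g = "\<lambda>x. f x / g x" and U = "ball z s"])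
          have "(\<lambda>x. g1 x / h1 x) holomorphic2_on ball z s"
            using 1 s by (intro holomorphic2_on_divide) (auto intro: holomorphic2_on_subset)
          hence "F1 holomorphic2_on ball z s"
            by (rule holomorphic2_on_cong) (use s 1 in auto)
          thus "isCont F1 x" using holomorphic2_on_imp_isCont x by blast
          have "ball z s \<subseteq> Z" using s O by (force simp: Z_def)
          thus "isCont (\<lambda>x. f x / g x) x" using holomorphic2_on_imp_isCont[OF fgZ] x by blast
          fix W assume W: "open W" "W \<noteq> {}" "W \<subseteq> ball z s"
          have "\<exists>x\<in>W. F x = F1 x"
          proof (rule meromorphic2_agree[OF F F1, where O' = V])
            show "W \<subseteq> D" using W(3) s(2) O(3) D0(3) by blast
          qed (use D V F1V B W in auto)
          thus "\<exists>y\<in>W. F1 y = f y / g y" using W s O(4) by (metis IntD2 subsetD)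
        qed (use x in auto)
        thus ?thesis using s O by (intro exI[of _ "ball z s"]) auto
      qed
      then obtain O1 where O1: "open O1" "O1 \<noteq> {}" "O1 \<subseteq> D0" "\<forall>x\<in>O1. F1 x = f x / g x" by blast
      have "\<exists>x\<in>U. F1 x = f x / g x"
        by (rule meromorphic2_agree[OF meromorphic2_on_subset[OF F1] fg D0(1,2) O1(1-3)])
           (use O1 D0 U in auto)
      thus False using no by blast
    qed
    thus ?thesis by metis
  qed
  \<comment> \<open>The second correction: \<open>continuation2\<close> asks for
    \<open>f x / g x\<close> at every point of \<open>D0\<close> with \<open>g x \<noteq> 0\<close>,
    whereas \<open>F1\<close> has this value only densely. Continuity shows that the correction does
    not destroy \<phi> on \<open>B\<close>.\<close>
  define F2 where "F2 = (\<lambda>x. if x \<in> Z then f x / g x else F1 x)"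
  have F2: "F2 meromorphic2_on D" unfolding F2_def
  proof (rule meromorphic2_on_modify[OF F1 Z(1) _ fgZ])
    fix U assume "open U" "U \<noteq> {}" "U \<subseteq> Z"
    thus "\<exists>y\<in>U. F1 y = f y / g y" using F1d[of U] Z by (metis subset_trans)
  qed (use Z D0 in auto)
  have F2\<phi>: "F2 x = \<phi> x" if x: "x \<in> B" for x
  proof (cases "x \<in> Z")
    case True
    have "f x / g x = \<phi> x"
    proof (rule isCont_eq_on_dense[where f = "\<lambda>x. f x / g x" and x = x and g = \<phi> and U = "B \<inter> Z"])
      show "isCont (\<lambda>x. f x / g x) x" using holomorphic2_on_imp_isCont[OF fgZ] True by blast
      show "isCont \<phi> x" using holomorphic2_on_imp_isCont[OF \<phi>] x by blast
      show "\<exists>y\<in>U. f y / g y = \<phi> y" if "open U" "U \<noteq> {}" "U \<subseteq> B \<inter> Z" for U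
        using F1d[of U] Z that by (force simp: F1_def)
    qed (use True x B Z in auto)
    thus ?thesis using True by (simp add: F2_def)
  qed (use x in \<open>auto simp: F2_def F1_def\<close>)
  have F2hol: "F2 holomorphic2_on B" by (rule holomorphic2_on_cong[OF \<phi> B(1)]) (use F2\<phi> in auto)
  show ?thesis unfolding continuation2_def
  proof (rule the_equality)
    show "\<exists>F. F meromorphic2_on D \<and> (\<forall>x\<in>D0. g x \<noteq> 0 \<longrightarrow> F x = f x / g x) \<and>
        (\<exists>W. open W \<and> p \<in> W \<and> W \<subseteq> D \<and> F holomorphic2_on W) \<and> \<phi> p = F p"
      using F2 F2hol B F2\<phi> by (intro exI[of _ F2]) (auto simp: F2_def Z_def)
  next
    fix v assume "\<exists>F. F meromorphic2_on D \<and> (\<forall>x\<in>D0. g x \<noteq> 0 \<longrightarrow> F x = f x / g x) \<and>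
        (\<exists>W. open W \<and> p \<in> W \<and> W \<subseteq> D \<and> F holomorphic2_on W) \<and> v = F p"
    then obtain G W where G: "G meromorphic2_on D" "\<forall>x\<in>D0. g x \<noteq> 0 \<longrightarrow> G x = f x / g x"
      "open W" "p \<in> W" "W \<subseteq> D" "G holomorphic2_on W" "v = G p"
      by (elim exE conjE) (rule that; assumption)
    have "G p = F2 p"
    proof (rule isCont_eq_on_dense[where f = G and x = p and g = F2 and U = "W \<inter> B"])
      show "isCont G p" using G holomorphic2_on_imp_isCont by blast
      show "isCont F2 p" using F2hol B holomorphic2_on_imp_isCont by blast
      show "\<exists>y\<in>U. G y = F2 y" if "open U" "U \<noteq> {}" "U \<subseteq> W \<inter> B" for U
      proof (rule meromorphic2_agree[OF G(1) F2 D Z(1)])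
        show "Z \<noteq> {}" using x0 unfolding Z_def by blast
        show "Z \<subseteq> D" using Z D0 by blast
        show "G x = F2 x" if "x \<in> Z" for x using that G(2) by (simp add: F2_def Z_def)
      qed (use that B in auto)
    qed (use G B in auto)
    thus "v = \<phi> p" using G F2\<phi> B by auto
  qed
qed

text \<open>A quotient that is given only on a dense open set \<open>T\<close> is extended by its limits along \<open>T\<close>.\<close>

lemma meromorphic2_extend:
  assumes T: "open T" "\<And>V. open V \<Longrightarrow> V \<noteq> {} \<Longrightarrow> V \<subseteq> D \<Longrightarrow> V \<inter> T \<noteq> {}"
    and Q: "continuous_on T Q"
    and loc: "\<And>p. p \<in> D \<Longrightarrow> \<exists>r>0. \<exists>g h. ball p r \<subseteq> D \<and> g holomorphic2_on ball p r \<and>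
      h holomorphic2_on ball p r \<and> (\<exists>x\<in>ball p r. h x \<noteq> 0) \<and> (\<forall>x\<in>ball p r \<inter> T. Q x * h x = g x)"
  obtains F where "F meromorphic2_on D" "\<And>x. x \<in> T \<inter> D \<Longrightarrow> F x = Q x"
proof -
  \<comment> \<open>A meromorphic representative must equal \<open>g x / h x\<close> at every point
    with \<open>h x \<noteq> 0\<close>, also off \<open>T\<close>; there this quotient is the limit
    of \<open>Q\<close> along \<open>T\<close>, whichever local pair \<open>g\<close>,
    \<open>h\<close> is used.\<close>
  define F where "F = (\<lambda>x. if x \<in> T then Q x else Lim (at x within T) Q)"
  have "F meromorphic2_on D"
  proof (rule meromorphic2_onI)
    fix p assume p: "p \<in> D"
    obtain r g h where *: "r > 0" "ball p r \<subseteq> D" "g holomorphic2_on ball p r"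
      "h holomorphic2_on ball p r" "\<exists>x\<in>ball p r. h x \<noteq> 0" "\<forall>x\<in>ball p r \<inter> T. Q x * h x = g x"
      using loc[OF p] by (elim exE conjE) (rule that; assumption)
    have "F x = g x / h x" if x: "x \<in> ball p r" "h x \<noteq> 0" for x
    proof (cases "x \<in> T")
      case True
      thus ?thesis using * x by (auto simp: F_def field_simps)
    next
      case False
      obtain s where s: "s > 0" "ball x s \<subseteq> ball p r" "\<forall>y\<in>ball x s. h y \<noteq> 0"
        using holomorphic2_nonzero_nbhd[OF *(4) _ x] by auto
      have "(g \<longlongrightarrow> g x) (at x)" "(h \<longlongrightarrow> h x) (at x)"
        using holomorphic2_on_imp_isCont[OF *(3)] holomorphic2_on_imp_isCont[OF *(4)] x isCont_def by blast+
      hence "((\<lambda>y. g y / h y) \<longlongrightarrow> g x / h x) (at x)"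
        using x by (intro tendsto_divide) auto
      hence l: "((\<lambda>y. g y / h y) \<longlongrightarrow> g x / h x) (at x within T)"
        using at_le by (metis subset_UNIV tendsto_mono)
      have "\<forall>\<^sub>F y in at x within T. g y / h y = Q y"
        unfolding eventually_at using s *(6)
        by (intro exI[of _ s]) (force simp: field_simps dist_commute)
      from tendsto_cong[OF this] l have "(Q \<longlongrightarrow> g x / h x) (at x within T)" by blast
      moreover have "at x within T \<noteq> bot"
      proof -
        have "x islimpt T" unfolding islimpt_approachable
        proof (intro allI impI)
          fix e :: real assume "e > 0"
          hence "ball x (min e s) \<inter> T \<noteq> {}" using s * x by (intro T) auto
          then obtain y where "y \<in> ball x (min e s)" "y \<in> T" by blast
          thus "\<exists>x'\<in>T. x' \<noteq> x \<and> dist x' x < e" using False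
            by (intro bexI[of _ y]) (auto simp: dist_commute)
        qed
        thus ?thesis by (simp add: trivial_limit_within)
      qed
      ultimately show ?thesis using False by (simp add: F_def tendsto_Lim)
    qed
    thus "\<exists>r>0. \<exists>g h. ball p r \<subseteq> D \<and> g holomorphic2_on ball p r \<and> h holomorphic2_on ball p r \<and>
     (\<exists>x\<in>ball p r. h x \<noteq> 0) \<and> (\<forall>x\<in>ball p r. h x \<noteq> 0 \<longrightarrow> F x = g x / h x)"
      using * by blast
  qed
  thus ?thesis using that by (auto simp: F_def)
qed

text \<open>The limit is continuous, and on each coordinate line it is holomorphic by the
  one-variable Weierstrass theorem; Osgood's lemma combines the two facts.\<close>

lemma holomorphic2_on_uniform_limit:
  assumes "open U" and f: "\<And>n::nat. f n holomorphic2_on U"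
    and lim: "\<And>p. p \<in> U \<Longrightarrow> \<exists>r>0. cball p r \<subseteq> U \<and> uniform_limit (cball p r) f g sequentially"
  shows "g holomorphic2_on U"
proof (rule holomorphic2_on_separately[OF _ \<open>open U\<close>])
  show "continuous_on U g"
  proof (rule continuous_at_imp_continuous_on, rule ballI)
    fix p assume "p \<in> U"
    then obtain r where r: "r > 0" "cball p r \<subseteq> U" "uniform_limit (cball p r) f g sequentially"
      using lim by blast
    have "continuous_on (cball p r) g"
      by (rule uniform_limit_theorem[OF _ r(3)])
         (auto intro!: always_eventually continuous_on_subset[OF holomorphic2_on_imp_continuous_on[OF f] r(2)])
    hence "continuous_on (ball p r) g" using continuous_on_subset ball_subset_cball by blast
    thus "isCont g p" using r(1) by (simp add: continuous_on_eq_continuous_at)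
  qed
next
  fix z t assume "(z, t) \<in> U"
  have open1: "open {w. (w, t) \<in> U}" "open {w. (z, w) \<in> U}"
    using open_vimage[OF \<open>open U\<close>, of "\<lambda>w. (w, t)"] open_vimage[OF \<open>open U\<close>, of "\<lambda>w. (z, w)"]
    by (simp_all add: vimage_def continuous_on_Pair)
  show "(\<lambda>w. g (w, t)) holomorphic_on {w. (w, t) \<in> U}"
    unfolding holomorphic_on_open[OF open1(1)]
  proof
    fix w assume "w \<in> {w. (w, t) \<in> U}"
    then obtain r where r: "r > 0" "cball (w, t) r \<subseteq> U" "uniform_limit (cball (w, t) r) f g sequentially"
      using lim by blast
    have sub: "cball w r \<subseteq> {w. (w, t) \<in> U}" using r(2) by (auto simp: subset_iff dist_Pair_Pair)
    have hol: "(\<lambda>w. f n (w, t)) holomorphic_on {w. (w, t) \<in> U}" for n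
      using holomorphic2_on_line[OF f[of n], where x = 0 and d = 1 and y = t and e = 0] by simp
    have "uniform_limit (cball w r) (\<lambda>n w. f n (w, t)) (\<lambda>w. g (w, t)) sequentially"
      using r(3) unfolding uniform_limit_iff
      by (auto elim!: eventually_mono simp: dist_Pair_Pair)
    then have "(\<lambda>w. g (w, t)) holomorphic_on ball w r"
      by (rule holomorphic_uniform_limit[rotated])
         (auto intro!: always_eventually holomorphic_on_imp_continuous_on holomorphic_on_subset[OF hol]
            sub order_trans[OF ball_subset_cball sub])
    thus "\<exists>f'. ((\<lambda>w. g (w, t)) has_field_derivative f') (at w)"
      using r(1) by (simp add: holomorphic_on_open)
  qed
  show "(\<lambda>w. g (z, w)) holomorphic_on {w. (z, w) \<in> U}"
    unfolding holomorphic_on_open[OF open1(2)]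
  proof
    fix w assume "w \<in> {w. (z, w) \<in> U}"
    then obtain r where r: "r > 0" "cball (z, w) r \<subseteq> U" "uniform_limit (cball (z, w) r) f g sequentially"
      using lim by blast
    have sub: "cball w r \<subseteq> {w. (z, w) \<in> U}" using r(2) by (auto simp: subset_iff dist_Pair_Pair)
    have hol: "(\<lambda>w. f n (z, w)) holomorphic_on {w. (z, w) \<in> U}" for n
      using holomorphic2_on_line[OF f[of n], where x = z and d = 0 and y = 0 and e = 1] by simp
    have "uniform_limit (cball w r) (\<lambda>n w. f n (z, w)) (\<lambda>w. g (z, w)) sequentially"
      using r(3) unfolding uniform_limit_iff
      by (auto elim!: eventually_mono simp: dist_Pair_Pair)
    then have "(\<lambda>w. g (z, w)) holomorphic_on ball w r"
      by (rule holomorphic_uniform_limit[rotated])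
         (auto intro!: always_eventually holomorphic_on_imp_continuous_on holomorphic_on_subset[OF hol]
            sub order_trans[OF ball_subset_cball sub])
    thus "\<exists>f'. ((\<lambda>w. g (z, w)) has_field_derivative f') (at w)"
      using r(1) by (simp add: holomorphic_on_open)
  qed
qed

section \<open>The function \<open>varpi\<close>\<close>

lemma e2pi_add: "e2pi (x + y) = e2pi x * e2pi y"
  by (simp add: e2pi_def ring_distribs exp_add)

lemma e2pi_diff: "e2pi (x - y) = e2pi x / e2pi y"
  by (simp add: e2pi_def ring_distribs exp_diff)

lemma e2pi_0 [simp]: "e2pi 0 = 1"
  by (simp add: e2pi_def)

lemma e2pi_nonzero [simp]: "e2pi x \<noteq> 0"
  by (simp add: e2pi_def)

lemma norm_e2pi: "norm (e2pi x) = exp (- 2 * pi * Im x)"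
  by (simp add: e2pi_def)

lemma e2pi_eq_1_iff: "e2pi x = 1 \<longleftrightarrow> x \<in> \<int>"
proof
  assume "e2pi x = 1"
  then obtain n where "Re (2 * of_real pi * \<i> * x) = 0" "Im (2 * of_real pi * \<i> * x) = of_int (2 * n) * pi"
    unfolding e2pi_def exp_eq_1 by blast
  hence "x = of_int n" by (auto simp: complex_eq_iff)
  thus "x \<in> \<int>" by simp
next
  assume "x \<in> \<int>"
  then obtain n where "x = of_int n" by (elim Ints_cases)
  thus "e2pi x = 1" unfolding e2pi_def exp_eq_1 by (auto intro!: exI[of _ n])
qed

lemma e2pi_of_int [simp]: "e2pi (of_int n) = 1" "e2pi (of_nat k) = 1" "e2pi 1 = 1"
  by (simp_all add: e2pi_eq_1_iff)

lemma e2pi_add_of_int [simp]: "e2pi (x + of_int n) = e2pi x"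
  by (simp add: e2pi_add)

lemma e2pi_cnj: "e2pi (- cnj x) = cnj (e2pi x)"
  by (simp add: e2pi_def exp_cnj)

lemma e2pi_power: "e2pi x ^ n = e2pi (of_nat n * x)"
  by (simp add: e2pi_def exp_of_nat_mult [symmetric] mult_ac)

lemma holomorphic_e2pi [holomorphic_intros]:
  "f holomorphic_on A \<Longrightarrow> (\<lambda>z. e2pi (f z)) holomorphic_on A"
  unfolding e2pi_def by (intro holomorphic_intros)

lemma continuous_e2pi [continuous_intros]:
  "continuous_on A f \<Longrightarrow> continuous_on A (\<lambda>z. e2pi (f z))"
  unfolding e2pi_def by (intro continuous_intros)

lemma holomorphic2_e2pi [intro]:
  "f holomorphic2_on A \<Longrightarrow> (\<lambda>z. e2pi (f z)) holomorphic2_on A"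
  unfolding e2pi_def by (intro holomorphic2_on_exp holomorphic2_on_mult holomorphic2_on_const)

lemma qpoch_inf_e2pi: "qpoch_inf (e2pi x) (e2pi \<tau>) = varpi x \<tau>"
  by (simp add: qpoch_inf_def varpi_def e2pi_power e2pi_add)

lemma varpi_summable:
  assumes "Im t > 0"
  shows "summable (\<lambda>k. norm (e2pi (z + of_nat k * t)))"
proof -
  have "norm (e2pi (z + of_nat k * t)) = norm (e2pi z) * norm (e2pi t) ^ k" for k
    by (simp add: e2pi_add e2pi_power norm_mult flip: norm_power)
  moreover have "summable (\<lambda>k. norm (e2pi z) * norm (e2pi t) ^ k)"
    by (intro summable_mult summable_geometric) (use assms in \<open>auto simp: norm_e2pi\<close>)
  ultimately show ?thesis by simp
qed

lemma varpi_convergent_prod: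
  assumes "Im t > 0"
  shows "convergent_prod (\<lambda>k. 1 - e2pi (z + of_nat k * t))"
  by (intro abs_convergent_prod_imp_convergent_prod summable_imp_abs_convergent_prod)
     (use varpi_summable[OF assms] in simp)

lemma varpi_has_prod:
  assumes "Im t > 0"
  shows "(\<lambda>k. 1 - e2pi (z + of_nat k * t)) has_prod varpi z t"
  unfolding varpi_def using varpi_convergent_prod[OF assms] by blast

lemma varpi_LIMSEQ:
  assumes "Im t > 0"
  shows "(\<lambda>n. \<Prod>k<n. 1 - e2pi (z + of_nat k * t)) \<longlonglongrightarrow> varpi z t"
  using has_prod_imp_tendsto'[OF varpi_has_prod[OF assms]] .

lemma varpi_eq_0_iff:
  assumes "Im t > 0"
  shows "varpi z t = 0 \<longleftrightarrow> (\<exists>k::nat. z + of_nat k * t \<in> \<int>)"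
proof -
  have "varpi z t = 0 \<longleftrightarrow> 0 \<in> range (\<lambda>k. 1 - e2pi (z + of_nat k * t))"
    by (rule has_prod_eq_0_iff[OF varpi_has_prod[OF assms]])
  also have "\<dots> \<longleftrightarrow> (\<exists>k. 0 = 1 - e2pi (z + of_nat k * t))"
    by (simp only: image_iff Bex_def UNIV_I simp_thms)
  also have "(\<lambda>k. 0 = 1 - e2pi (z + of_nat k * t)) = (\<lambda>k. z + of_nat k * t \<in> \<int>)"
    unfolding e2pi_eq_1_iff[symmetric] by (intro ext) (metis diff_self eq_iff_diff_eq_0)
  finally show ?thesis .
qed

lemma varpi_split:
  assumes "Im t > 0"
  shows "varpi z t = (\<Prod>k<n. 1 - e2pi (z + of_nat k * t)) * varpi (z + of_nat n * t) t"
proof -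
  have "(\<lambda>k. 1 - e2pi (z + of_nat k * t)) has_prod
      ((\<Prod>k<n. 1 - e2pi (z + of_nat k * t)) * (\<Prod>k. 1 - e2pi (z + of_nat (k + n) * t)))"
    by (rule has_prod_ignore_initial_segment'[OF varpi_convergent_prod[OF assms]])
  hence "varpi z t = (\<Prod>k<n. 1 - e2pi (z + of_nat k * t)) * (\<Prod>k. 1 - e2pi (z + of_nat (k + n) * t))"
    using varpi_has_prod[OF assms] has_prod_unique2 by blast
  also have "(\<Prod>k. 1 - e2pi (z + of_nat (k + n) * t)) = varpi (z + of_nat n * t) t"
    by (simp add: varpi_def algebra_simps)
  finally show ?thesis .
qed

lemma varpi_shift:
  assumes "Im t > 0"
  shows "varpi z t = (1 - e2pi z) * varpi (z + t) t"
  using varpi_split[OF assms, of z 1] by simp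

lemma varpi_of_int [simp]: "varpi (z + of_int n) t = varpi z t"
proof -
  have "e2pi (z + of_int n + x) = e2pi (z + x)" for x
    using e2pi_add_of_int[of "z + x" n] by (simp add: add_ac)
  thus ?thesis by (simp add: varpi_def)
qed

text \<open>Write the index as \<open>k = l + m c\<close>. Along the partial products of length
  \<open>n * c\<close> the factors group by the residue \<open>l\<close> into \<open>c\<close>
  partial products with modulus \<open>c t\<close>.\<close>

lemma varpi_distribution:
  assumes "Im t > 0" "c > 0"
  shows "varpi z t = (\<Prod>l<c. varpi (z + of_nat l * t) (of_nat c * t))"
proof -
  have "(\<lambda>n. \<Prod>k<n*c. 1 - e2pi (z + of_nat k * t)) \<longlonglongrightarrow> varpi z t"
    using LIMSEQ_subseq_LIMSEQ[OF varpi_LIMSEQ[OF assms(1), of z], of "\<lambda>n. n * c"] assms(2)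
    by (auto simp: strict_mono_def o_def)
  moreover have "(\<lambda>n. \<Prod>k<n*c. 1 - e2pi (z + of_nat k * t)) =
     (\<lambda>n. \<Prod>l<c. \<Prod>k<n. 1 - e2pi (z + of_nat l * t + of_nat k * (of_nat c * t)))"
  proof
    fix n
    have "(\<Prod>k<n*c. 1 - e2pi (z + of_nat k * t)) =
        (\<Prod>m<n. \<Prod>k\<in>{m*c..<m*c+c}. 1 - e2pi (z + of_nat k * t))"
      by (rule prod.nat_group[symmetric])
    also have "\<dots> = (\<Prod>m<n. \<Prod>l<c. 1 - e2pi (z + of_nat l * t + of_nat m * (of_nat c * t)))"
    proof (rule prod.cong[OF refl])
      fix m
      have "(\<Prod>k\<in>{m*c..<m*c+c}. 1 - e2pi (z + of_nat k * t))
          = (\<Prod>l\<in>{0..<c}. 1 - e2pi (z + of_nat (l + m*c) * t))"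
        using prod.shift_bounds_nat_ivl[of "\<lambda>k. 1 - e2pi (z + of_nat k * t)" 0 "m*c" c]
        by (simp add: add_ac)
      thus "(\<Prod>k\<in>{m*c..<m*c+c}. 1 - e2pi (z + of_nat k * t)) =
          (\<Prod>l<c. 1 - e2pi (z + of_nat l * t + of_nat m * (of_nat c * t)))"
        by (simp add: algebra_simps lessThan_atLeast0)
    qed
    also have "\<dots> = (\<Prod>l<c. \<Prod>k<n. 1 - e2pi (z + of_nat l * t + of_nat k * (of_nat c * t)))"
      by (rule prod.swap)
    finally show "(\<Prod>k<n*c. 1 - e2pi (z + of_nat k * t)) = \<dots>" .
  qed
  moreover have "(\<lambda>n. \<Prod>l<c. \<Prod>k<n. 1 - e2pi (z + of_nat l * t + of_nat k * (of_nat c * t)))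
     \<longlonglongrightarrow> (\<Prod>l<c. varpi (z + of_nat l * t) (of_nat c * t))"
    by (intro tendsto_prod varpi_LIMSEQ) (use assms in auto)
  ultimately show ?thesis using LIMSEQ_unique by metis
qed

lemma open_upper_half_plane [simp]: "open upper_half_plane"
  unfolding upper_half_plane_def by (simp add: open_halfspace_Im_gt)

lemma holomorphic2_varpi: "(\<lambda>p. varpi (fst p) (snd p)) holomorphic2_on (UNIV \<times> upper_half_plane)"
proof (rule holomorphic2_on_uniform_limit)
  show op: "open (UNIV \<times> upper_half_plane :: (complex \<times> complex) set)"
    by (simp add: open_Times)
  show "(\<lambda>p. \<Prod>k<n. 1 - e2pi (fst p + of_nat k * snd p)) holomorphic2_on (UNIV \<times> upper_half_plane)" for n
    by (intro holomorphic2_on_prod holomorphic2_on_diff holomorphic2_on_const holomorphic2_e2pi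
        holomorphic2_on_add holomorphic2_on_fst holomorphic2_on_mult holomorphic2_on_snd)
  fix p :: "complex \<times> complex" assume p: "p \<in> UNIV \<times> upper_half_plane"
  \<comment> \<open>On \<open>cball p \<delta>\<close> the modulus keeps height at least \<delta>,
    so the terms are dominated by one geometric series with ratio
    \<open>exp (- 2 * pi * \<delta>)\<close>.\<close>
  define \<delta> where "\<delta> = Im (snd p) / 2"
  have \<delta>: "\<delta> > 0" using p by (auto simp: \<delta>_def upper_half_plane_def)
  have K: "Im (fst x) \<ge> Im (fst p) - \<delta>" "Im (snd x) \<ge> \<delta>" if "x \<in> cball p \<delta>" for x
  proof -
    have "dist (fst p) (fst x) \<le> \<delta>" "dist (snd p) (snd x) \<le> \<delta>"
      using that dist_fst_le[of p x] dist_snd_le[of p x] by auto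
    hence "\<bar>Im (fst p - fst x)\<bar> \<le> \<delta>" "\<bar>Im (snd p - snd x)\<bar> \<le> \<delta>"
      by (metis abs_Im_le_cmod dist_norm order_trans)+
    thus "Im (fst x) \<ge> Im (fst p) - \<delta>" "Im (snd x) \<ge> \<delta>"
      unfolding \<delta>_def by (simp_all only: minus_complex.sel)
  qed
  define M where "M = exp (- 2 * pi * (Im (fst p) - \<delta>))"
  have bound: "norm (e2pi (fst x + of_nat k * snd x)) \<le> M * exp (- 2 * pi * \<delta>) ^ k"
    if "x \<in> cball p \<delta>" for x k
  proof -
    have "Im (fst x + of_nat k * snd x) \<ge> (Im (fst p) - \<delta>) + of_nat k * \<delta>"
      using K[OF that] by (simp add: add_mono mult_left_mono)
    hence "norm (e2pi (fst x + of_nat k * snd x)) \<le> exp (- 2 * pi * ((Im (fst p) - \<delta>) + of_nat k * \<delta>))"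
      unfolding norm_e2pi by simp
    also have "\<dots> = M * exp (- 2 * pi * \<delta>) ^ k"
      by (simp add: M_def exp_of_nat_mult[symmetric] exp_add[symmetric] algebra_simps)
    finally show ?thesis .
  qed
  have uc: "uniformly_convergent_on (cball p \<delta>) (\<lambda>n x. \<Prod>k<n. 1 - e2pi (fst x + of_nat k * snd x))"
  proof (rule uniformly_convergent_on_prod')
    show "uniformly_convergent_on (cball p \<delta>)
       (\<lambda>N x. \<Sum>n<N. norm (1 - e2pi (fst x + of_nat n * snd x) - 1))"
    proof (rule Weierstrass_m_test')
      show "summable (\<lambda>k. M * exp (- 2 * pi * \<delta>) ^ k)"
        by (intro summable_mult summable_geometric) (use \<delta> in auto)
    qed (use bound in auto)
  qed (auto intro!: continuous_intros)
  then obtain l where l: "uniform_limit (cball p \<delta>) (\<lambda>n x. \<Prod>k<n. 1 - e2pi (fst x + of_nat k * snd x)) l sequentially"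
    unfolding uniformly_convergent_on_def by blast
  have "l x = varpi (fst x) (snd x)" if x: "x \<in> cball p \<delta>" for x
  proof -
    have "Im (snd x) > 0" using K[OF x] \<delta> by linarith
    from varpi_LIMSEQ[OF this] tendsto_uniform_limitI[OF l x] show ?thesis
      using LIMSEQ_unique by blast
  qed
  hence "uniform_limit (cball p \<delta>) (\<lambda>n x. \<Prod>k<n. 1 - e2pi (fst x + of_nat k * snd x))
      (\<lambda>p. varpi (fst p) (snd p)) sequentially"
    using l by (metis (mono_tags, lifting) uniform_limit_cong')
  moreover have "cball p \<delta> \<subseteq> UNIV \<times> upper_half_plane"
  proof
    fix x assume "x \<in> cball p \<delta>"
    thus "x \<in> UNIV \<times> upper_half_plane"
      using K(2)[of x] \<delta> by (cases x) (auto simp: upper_half_plane_def)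
  qed
  ultimately show "\<exists>r>0. cball p r \<subseteq> UNIV \<times> upper_half_plane \<and>
     uniform_limit (cball p r) (\<lambda>n x. \<Prod>k<n. 1 - e2pi (fst x + of_nat k * snd x))
        (\<lambda>p. varpi (fst p) (snd p)) sequentially"
    using \<delta> by blast
qed

lemma holomorphic2_varpi_compose:
  assumes "A holomorphic2_on U" "B holomorphic2_on U" "\<And>p. p \<in> U \<Longrightarrow> Im (B p) > 0"
  shows "(\<lambda>p. varpi (A p) (B p)) holomorphic2_on U"
  using holomorphic2_on_compose[OF assms(1,2) holomorphic2_varpi] assms(3)
  by (simp add: upper_half_plane_def)

lemma holomorphic_varpi:
  assumes "Im t > 0"
  shows "(\<lambda>z. varpi z t) holomorphic_on A"
proof -
  have "(\<lambda>w. varpi w t) holomorphic_on {w. (0 + w * 1, t + w * 0) \<in> UNIV \<times> upper_half_plane}"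
    using holomorphic2_on_line[OF holomorphic2_varpi, where x = 0 and d = 1 and y = t and e = 0] by simp
  thus ?thesis using assms holomorphic_on_subset
    by (auto simp: upper_half_plane_def)
qed

section \<open>Integrals over horizontal lines\<close>

lemma integrable_exp_neg_abs:
  assumes "\<delta> > (0::real)"
  shows "integrable lborel (\<lambda>x::real. exp (- \<delta> * \<bar>x\<bar>))"
proof -
  have "(\<lambda>x::real. exp (- \<delta> * x)) absolutely_integrable_on {0..}"
    by (rule nonnegative_absolutely_integrable_1)
       (use has_integral_exp_minus_to_infinity[OF assms, of 0] in \<open>auto simp: integrable_on_def\<close>)
  hence 1: "integrable lborel (\<lambda>x::real. indicator {0..} x *\<^sub>R exp (- \<delta> * x))"
    unfolding set_integrable_def by (subst (asm) integrable_completion) auto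
  have 2: "integrable lborel (\<lambda>x::real. indicator {0..} (0 + (-1) * x) *\<^sub>R exp (- \<delta> * (0 + (-1) * x)))"
    by (rule lborel_integrable_real_affine[OF 1]) auto
  show ?thesis
  proof (rule Bochner_Integration.integrable_bound[OF Bochner_Integration.integrable_add[OF 1 2]])
    show "AE x in lborel. norm (exp (- \<delta> * \<bar>x\<bar>)) \<le> norm (indicator {0..} x *\<^sub>R exp (- \<delta> * x) +
       indicator {0..} (0 + (-1) * x) *\<^sub>R exp (- \<delta> * (0 + (-1) * x)))"
      by (intro always_eventually) (auto simp: indicator_def abs_if)
  qed auto
qed

lemma integrable_exp_decay:
  fixes f :: "real \<Rightarrow> complex"
  assumes "\<delta> > 0" "continuous_on UNIV f" "\<And>x. norm (f x) \<le> C * exp (- \<delta> * \<bar>x\<bar>)"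
  shows "integrable lborel f"
proof (rule Bochner_Integration.integrable_bound)
  show "integrable lborel (\<lambda>x::real. C * exp (- \<delta> * \<bar>x\<bar>))"
    using integrable_exp_neg_abs[OF assms(1)] by simp
  show "f \<in> borel_measurable lborel"
    using borel_measurable_continuous_onI[OF assms(2)] by simp
  show "AE x in lborel. norm (f x) \<le> norm (C * exp (- \<delta> * \<bar>x\<bar>))"
    by (intro always_eventually allI) (metis abs_ge_self assms(3) order_trans real_norm_def)
qed

text \<open>Half of the exponential decay makes the part outside \<open>[-n, n]\<close> small,
  uniformly in the parameter, and the other half keeps its integral finite.\<close>

lemma line_integral_uniform_limit:
  fixes F :: "'a \<Rightarrow> real \<Rightarrow> complex"
  assumes \<delta>: "\<delta> > 0" and cont: "\<And>p. p \<in> K \<Longrightarrow> continuous_on UNIV (F p)"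
    and bound: "\<And>p x. p \<in> K \<Longrightarrow> norm (F p x) \<le> C * exp (- \<delta> * \<bar>x\<bar>)"
  shows "uniform_limit K (\<lambda>n p. integral {-real n..real n} (F p)) (\<lambda>p. LINT x|lborel. F p x) sequentially"
proof (rule uniform_limitI)
  fix e :: real assume e: "e > 0"
  define E where "E = (LINT x|lborel. exp (- (\<delta>/2) * \<bar>x\<bar>))"
  have intE: "integrable lborel (\<lambda>x::real. exp (- (\<delta>/2) * \<bar>x\<bar>))"
    using integrable_exp_neg_abs[of "\<delta>/2"] \<delta> by simp
  have main: "dist (integral {-real n..real n} (F p)) (LINT x|lborel. F p x) \<le> \<bar>C\<bar> * exp (- (\<delta>/2) * real n) * E"
    if p: "p \<in> K" for n p
  proof -
    have int: "integrable lborel (F p)"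
      using integrable_exp_decay[OF \<delta> cont[OF p] bound[OF p]] .
    let ?A = "{-real n..real n}"
    have sint: "set_integrable lborel ?A (F p)"
      unfolding set_integrable_def using int by (intro integrable_mult_indicator) auto
    have "(LINT x|lborel. F p x) - integral ?A (F p) = (LINT x|lborel. F p x - indicator ?A x *\<^sub>R F p x)"
      using set_borel_integral_eq_integral(2)[OF sint] int sint
      by (simp add: set_integrable_def set_lebesgue_integral_def)
    also have "norm \<dots> \<le> (LINT x|lborel. \<bar>C\<bar> * exp (- (\<delta>/2) * real n) * exp (- (\<delta>/2) * \<bar>x\<bar>))"
    proof (rule Bochner_Integration.integral_norm_bound_integral)
      show "integrable lborel (\<lambda>x. F p x - indicator ?A x *\<^sub>R F p x)"
        using int sint by (auto simp: set_integrable_def)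
      show "integrable lborel (\<lambda>x. \<bar>C\<bar> * exp (- (\<delta>/2) * real n) * exp (- (\<delta>/2) * \<bar>x\<bar>))"
        using intE by simp
      fix x :: real
      show "norm (F p x - indicator ?A x *\<^sub>R F p x) \<le> \<bar>C\<bar> * exp (- (\<delta>/2) * real n) * exp (- (\<delta>/2) * \<bar>x\<bar>)"
      proof (cases "x \<in> ?A")
        case False
        hence x: "\<bar>x\<bar> \<ge> real n" by auto
        have "norm (F p x) \<le> C * exp (- \<delta> * \<bar>x\<bar>)" by (rule bound[OF p])
        also have "\<dots> \<le> \<bar>C\<bar> * exp (- \<delta> * \<bar>x\<bar>)" by (intro mult_right_mono) auto
        also have "\<dots> \<le> \<bar>C\<bar> * exp (- (\<delta>/2) * real n + - (\<delta>/2) * \<bar>x\<bar>)"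
        proof (intro mult_left_mono, subst exp_le_cancel_iff)
          have "\<delta>/2 * real n \<le> \<delta>/2 * \<bar>x\<bar>" by (rule mult_left_mono[OF x]) (use \<delta> in auto)
          thus "- \<delta> * \<bar>x\<bar> \<le> - (\<delta>/2) * real n + - (\<delta>/2) * \<bar>x\<bar>" by (simp add: field_simps)
        qed auto
        also have "\<dots> = \<bar>C\<bar> * exp (- (\<delta>/2) * real n) * exp (- (\<delta>/2) * \<bar>x\<bar>)"
          by (simp only: exp_add mult.assoc)
        finally show ?thesis using False by simp
      qed auto
    qed
    also have "\<dots> = \<bar>C\<bar> * exp (- (\<delta>/2) * real n) * E" by (simp add: E_def)
    finally show ?thesis by (simp add: dist_norm norm_minus_commute)
  qed
  have "(\<lambda>n. \<bar>C\<bar> * exp (- (\<delta>/2) * real n) * E) \<longlonglongrightarrow> \<bar>C\<bar> * 0 * E"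
  proof (intro tendsto_intros)
    have "filterlim (\<lambda>n. - (\<delta>/2) * real n) at_bot sequentially"
      using \<delta> by (intro filterlim_tendsto_neg_mult_at_bot[OF tendsto_const] filterlim_real_sequentially) auto
    thus "(\<lambda>n. exp (- (\<delta>/2) * real n)) \<longlonglongrightarrow> 0" using exp_at_bot filterlim_compose by blast
  qed
  hence "\<forall>\<^sub>F n in sequentially. \<bar>C\<bar> * exp (- (\<delta>/2) * real n) * E < e"
    using order_tendstoD(2)[of _ 0 _ e] e by simp
  thus "\<forall>\<^sub>F n in sequentially. \<forall>x\<in>K. dist (integral {-real n..real n} (F x)) (LINT xa|lborel. F x xa) < e"
    by eventually_elim (auto intro: le_less_trans[OF main])
qed

lemma line_integral_LIMSEQ:
  fixes f :: "real \<Rightarrow> complex"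
  assumes "\<delta> > 0" "continuous_on UNIV f" "\<And>x. norm (f x) \<le> C * exp (- \<delta> * \<bar>x\<bar>)"
  shows "(\<lambda>n. integral {-real n..real n} f) \<longlonglongrightarrow> (LINT x|lborel. f x)"
  using tendsto_uniform_limitI[OF line_integral_uniform_limit[of \<delta> "{()}" "\<lambda>_. f" C], of "()"] assms by simp

lemma continuous_on_param_compose:
  assumes "continuous_on (A \<times> B) (\<lambda>(p, x). F p x)" "continuous_on S g" "continuous_on S h"
    and "\<And>s. s \<in> S \<Longrightarrow> g s \<in> A" "\<And>s. s \<in> S \<Longrightarrow> h s \<in> B"
  shows "continuous_on S (\<lambda>s. F (g s) (h s))"
proof -
  have "continuous_on S (\<lambda>s. case (g s, h s) of (p, x) \<Rightarrow> F p x)"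
    by (rule continuous_on_compose2[OF assms(1) continuous_on_Pair[OF assms(2,3)]]) (use assms in auto)
  thus ?thesis by simp
qed

text \<open>Decay has to be checked only for large \<open>x\<close>: over the compact remainder the
  function times \<open>exp (\<delta> * \<bar>x\<bar>)\<close> is bounded by continuity.\<close>

lemma exp_decay_compact_extend:
  fixes F :: "'a::metric_space \<Rightarrow> real \<Rightarrow> complex"
  assumes "compact K" "continuous_on (K \<times> UNIV) (\<lambda>(p, x). F p x)"
    and bound: "\<And>p x. p \<in> K \<Longrightarrow> \<bar>x\<bar> \<ge> X \<Longrightarrow> norm (F p x) \<le> C * exp (- \<delta> * \<bar>x\<bar>)"
  shows "\<exists>C'. \<forall>p\<in>K. \<forall>x. norm (F p x) \<le> C' * exp (- \<delta> * \<bar>x\<bar>)"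
proof -
  have "compact ((\<lambda>(p, x). F p x * exp (of_real (\<delta> * \<bar>x\<bar>))) ` (K \<times> {-X..X}))"
    by (intro compact_continuous_image compact_Times assms compact_Icc)
       (auto intro!: continuous_intros continuous_on_subset[OF assms(2)] simp: case_prod_unfold
          intro: continuous_on_subset[OF assms(2)[unfolded case_prod_unfold]])
  then obtain B where B: "\<And>p x. p \<in> K \<Longrightarrow> x \<in> {-X..X} \<Longrightarrow> norm (F p x * exp (of_real (\<delta> * \<bar>x\<bar>))) \<le> B"
    unfolding compact_eq_bounded_closed bounded_iff by (metis (no_types, lifting) SigmaI case_prod_conv imageI)
  have "norm (F p x) \<le> max B C * exp (- \<delta> * \<bar>x\<bar>)" if p: "p \<in> K" for p x
  proof (cases "\<bar>x\<bar> \<ge> X")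
    case True
    have "norm (F p x) \<le> C * exp (- \<delta> * \<bar>x\<bar>)" by (rule bound[OF p True])
    also have "\<dots> \<le> max B C * exp (- \<delta> * \<bar>x\<bar>)" by (intro mult_right_mono) auto
    finally show ?thesis .
  next
    case False
    hence "norm (F p x * exp (of_real (\<delta> * \<bar>x\<bar>))) \<le> B" by (intro B[OF p]) auto
    hence "norm (F p x) * exp (\<delta> * \<bar>x\<bar>) \<le> max B C" by (simp add: norm_mult)
    thus ?thesis by (simp add: exp_minus field_simps)
  qed
  thus ?thesis by blast
qed

lemma has_field_derivative_integral_param:
  fixes F :: "complex \<Rightarrow> real \<Rightarrow> complex"
  assumes "open U" and cont: "continuous_on (U \<times> {a..b}) (\<lambda>(w, x). F w x)"
    and hol: "\<And>x. (\<lambda>w. F w x) holomorphic_on U" and "w0 \<in> U"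
  shows "((\<lambda>w. integral {a..b} (F w)) has_field_derivative
    integral {a..b} (\<lambda>x. deriv (\<lambda>w. F w x) w0)) (at w0)"
proof -
  obtain r where r: "r > 0" "ball w0 r \<subseteq> U" using assms open_contains_ball by blast
  have "((\<lambda>w. integral (cbox a b) (F w)) has_field_derivative
    integral (cbox a b) (\<lambda>x. deriv (\<lambda>w. F w x) w0)) (at w0 within ball w0 r)"
  proof (rule leibniz_rule_field_derivative)
    fix w x assume w: "w \<in> ball w0 r" and "x \<in> cbox a b"
    show "((\<lambda>w. F w x) has_field_derivative deriv (\<lambda>w. F w x) w) (at w within ball w0 r)"
      using w r by (intro has_field_derivative_at_within[OF holomorphic_derivI[OF hol \<open>open U\<close>]]) auto
  next
    fix w assume w: "w \<in> ball w0 r"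
    have "continuous_on {a..b} (\<lambda>x. F w x)"
      by (rule continuous_on_param_compose[OF cont, where g = "\<lambda>_. w" and h = "\<lambda>x. x"])
         (use w r in auto)
    thus "F w integrable_on cbox a b" by (simp add: integrable_continuous_interval)
  next
    have sw: "continuous_on ({a..b} \<times> U) (\<lambda>(x, w). F w x)"
      unfolding case_prod_unfold
      by (rule continuous_on_param_compose[OF cont]) (auto intro!: continuous_intros)
    have dc: "continuous_on ({a..b} \<times> U) (\<lambda>(x, w). deriv (\<lambda>w. F w x) w)"
      by (rule continuous_on_deriv_param[OF _ \<open>open U\<close> sw]) (use hol in auto)
    have "continuous_on (U \<times> {a..b}) (\<lambda>s. deriv (\<lambda>w. F w (snd s)) (fst s))"
      by (rule continuous_on_param_compose[OF dc, where g = snd and h = fst])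
         (auto intro!: continuous_intros)
    hence "continuous_on (U \<times> {a..b}) (\<lambda>(w, x). deriv (\<lambda>w. F w x) w)"
      by (simp add: case_prod_unfold)
    thus "continuous_on (ball w0 r \<times> cbox a b) (\<lambda>(w, x). deriv (\<lambda>w. F w x) w)"
      by (rule continuous_on_subset) (use r in auto)
  qed (use r in auto)
  thus ?thesis using r at_within_open[of w0 "ball w0 r"] by simp
qed

text \<open>Integrals over \<open>[-n, n]\<close> are holomorphic by the Leibniz rule in each
  variable and Osgood's lemma; the locally uniform decay passes this on to the whole line.\<close>

lemma holomorphic2_line_integral:
  fixes F :: "complex \<times> complex \<Rightarrow> real \<Rightarrow> complex"
  assumes U: "open U" and cont: "continuous_on (U \<times> UNIV) (\<lambda>(p, x). F p x)"
    and hol: "\<And>x. (\<lambda>p. F p x) holomorphic2_on U"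
    and bound: "\<And>p. p \<in> U \<Longrightarrow> \<exists>r>0. \<exists>\<delta>>0. \<exists>C. cball p r \<subseteq> U \<and>
      (\<forall>q\<in>cball p r. \<forall>x. norm (F q x) \<le> C * exp (- \<delta> * \<bar>x\<bar>))"
  shows "(\<lambda>p. LINT x|lborel. F p x) holomorphic2_on U"
proof (rule holomorphic2_on_uniform_limit[OF U])
  fix n :: nat
  let ?I = "\<lambda>p. integral {-real n..real n} (F p)"
  show "?I holomorphic2_on U"
  proof (rule holomorphic2_on_separately[OF _ U])
    show "continuous_on U ?I"
      using integral_continuous_on_param[of U "-real n" "real n" F] continuous_on_subset[OF cont]
      by (auto simp: Sigma_mono)
    fix z t assume "(z, t) \<in> U"
    have open1: "open {w. (w, t) \<in> U}" "open {w. (z, w) \<in> U}"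
      using open_vimage[OF U, of "\<lambda>w. (w, t)"] open_vimage[OF U, of "\<lambda>w. (z, w)"]
      by (simp_all add: vimage_def continuous_on_Pair)
    show "(\<lambda>w. ?I (w, t)) holomorphic_on {w. (w, t) \<in> U}"
      unfolding holomorphic_on_open[OF open1(1)]
    proof
      fix w assume w: "w \<in> {w. (w, t) \<in> U}"
      have "((\<lambda>w. ?I (w, t)) has_field_derivative
         integral {-real n..real n} (\<lambda>x. deriv (\<lambda>w. F (w, t) x) w)) (at w)"
      proof (rule has_field_derivative_integral_param[OF open1(1)])
        show "continuous_on ({w. (w, t) \<in> U} \<times> {-real n..real n}) (\<lambda>(w, x). F (w, t) x)"
          unfolding case_prod_unfold
          by (rule continuous_on_param_compose[OF cont]) (auto intro!: continuous_intros)
        show "(\<lambda>w. F (w, t) x) holomorphic_on {w. (w, t) \<in> U}" for x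
          using holomorphic2_on_line[OF hol[of x], where x = 0 and d = 1 and y = t and e = 0] by simp
      qed (use w in auto)
      thus "\<exists>f'. ((\<lambda>w. ?I (w, t)) has_field_derivative f') (at w)" by blast
    qed
    show "(\<lambda>w. ?I (z, w)) holomorphic_on {w. (z, w) \<in> U}"
      unfolding holomorphic_on_open[OF open1(2)]
    proof
      fix w assume w: "w \<in> {w. (z, w) \<in> U}"
      have "((\<lambda>w. ?I (z, w)) has_field_derivative
         integral {-real n..real n} (\<lambda>x. deriv (\<lambda>w. F (z, w) x) w)) (at w)"
      proof (rule has_field_derivative_integral_param[OF open1(2)])
        show "continuous_on ({w. (z, w) \<in> U} \<times> {-real n..real n}) (\<lambda>(w, x). F (z, w) x)"
          unfolding case_prod_unfold
          by (rule continuous_on_param_compose[OF cont]) (auto intro!: continuous_intros)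
        show "(\<lambda>w. F (z, w) x) holomorphic_on {w. (z, w) \<in> U}" for x
          using holomorphic2_on_line[OF hol[of x], where x = z and d = 0 and y = 0 and e = 1] by simp
      qed (use w in auto)
      thus "\<exists>f'. ((\<lambda>w. ?I (z, w)) has_field_derivative f') (at w)" by blast
    qed
  qed
next
  fix p assume "p \<in> U"
  then obtain r \<delta> C where *: "r > 0" "\<delta> > 0" "cball p r \<subseteq> U"
    "\<forall>q\<in>cball p r. \<forall>x. norm (F q x) \<le> C * exp (- \<delta> * \<bar>x\<bar>)"
    using bound by metis
  have "continuous_on UNIV (F q)" if "q \<in> U" for q
    by (rule continuous_on_param_compose[OF cont, where g = "\<lambda>_. q" and h = "\<lambda>x. x"])
       (use that in auto)
  hence "uniform_limit (cball p r) (\<lambda>n p. integral {-real n..real n} (F p)) (\<lambda>p. LINT x|lborel. F p x) sequentially"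
    using * by (intro line_integral_uniform_limit[of \<delta> _ _ C]) auto
  thus "\<exists>r>0. cball p r \<subseteq> U \<and> uniform_limit (cball p r) (\<lambda>n p. integral {-real n..real n} (F p))
      (\<lambda>p. LINT x|lborel. F p x) sequentially" using * by blast
qed

text \<open>Here the value of the derivative matters, not only its existence: for
  \<open>log_int\<close> it is an integral that can be evaluated in closed form.\<close>

lemma has_field_derivative_line_integral:
  fixes F F' :: "complex \<Rightarrow> real \<Rightarrow> complex"
  assumes U: "open U" and cont: "continuous_on (U \<times> UNIV) (\<lambda>(p, x). F p x)"
    and der: "\<And>w x. w \<in> U \<Longrightarrow> ((\<lambda>w. F w x) has_field_derivative F' w x) (at w)"
    and w: "w \<in> U" and r: "r > 0" "cball w r \<subseteq> U" and \<delta>: "\<delta> > 0"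
    and bound: "\<And>q x. q \<in> cball w r \<Longrightarrow> norm (F q x) \<le> C * exp (- \<delta> * \<bar>x\<bar>)"
    and cont': "continuous_on UNIV (F' w)"
    and bound': "\<And>x. norm (F' w x) \<le> C * exp (- \<delta> * \<bar>x\<bar>)"
  shows "((\<lambda>w. LINT x|lborel. F w x) has_field_derivative (LINT x|lborel. F' w x)) (at w)"
proof -
  let ?I = "\<lambda>n w. integral {-real n..real n} (F w)"
  have hol: "(\<lambda>w. F w x) holomorphic_on U" for x
    using der U by (auto simp: holomorphic_on_open)
  have dI: "(?I n has_field_derivative integral {-real n..real n} (F' q)) (at q)" if "q \<in> U" for n q
  proof -
    have "(?I n has_field_derivative integral {-real n..real n} (\<lambda>x. deriv (\<lambda>w. F w x) q)) (at q)"
      by (rule has_field_derivative_integral_param[OF U continuous_on_subset[OF cont] hol that]) auto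
    moreover have "deriv (\<lambda>w. F w x) q = F' q x" for x
      using der[OF that] by (rule DERIV_imp_deriv)
    ultimately show ?thesis by simp
  qed
  have contF: "continuous_on UNIV (F q)" if "q \<in> U" for q
    by (rule continuous_on_param_compose[OF cont, where g = "\<lambda>_. q" and h = "\<lambda>x. x"])
       (use that in auto)
  have ul: "uniform_limit (cball w r) ?I (\<lambda>p. LINT x|lborel. F p x) sequentially"
    using bound r contF by (intro line_integral_uniform_limit[OF \<delta>]) auto
  have "\<exists>g'. \<forall>x\<in>ball w r. ((\<lambda>p. LINT x|lborel. F p x) has_field_derivative g' x) (at x) \<and>
      ((\<lambda>n. integral {-real n..real n} (F' x)) \<longlongrightarrow> g' x) sequentially"
  proof (rule has_complex_derivative_uniform_sequence)
    fix x assume x: "x \<in> ball w r"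
    then obtain d where "d > 0" "cball x d \<subseteq> ball w r" using open_contains_cball[of "ball w r"] by blast
    thus "\<exists>d. 0 < d \<and> cball x d \<subseteq> ball w r \<and> uniform_limit (cball x d) ?I (\<lambda>p. LINT x|lborel. F p x) sequentially"
      using uniform_limit_on_subset[OF ul] ball_subset_cball by (meson order_trans)
  next
    fix n x assume "x \<in> ball w r"
    thus "(?I n has_field_derivative integral {-real n..real n} (F' x)) (at x)"
      using r ball_subset_cball by (intro dI) blast
  qed auto
  then obtain g' where g': "((\<lambda>p. LINT x|lborel. F p x) has_field_derivative g') (at w)"
    "(\<lambda>n. integral {-real n..real n} (F' w)) \<longlonglongrightarrow> g'" using r(1) by (metis centre_in_ball)
  moreover have "(\<lambda>n. integral {-real n..real n} (F' w)) \<longlonglongrightarrow> (LINT x|lborel. F' w x)"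
    by (rule line_integral_LIMSEQ[OF \<delta> cont' bound'])
  ultimately show ?thesis using LIMSEQ_unique by blast
qed

lemma contour_integral_horizontal:
  assumes "a < b"
  shows "contour_integral (linepath (Complex a y) (Complex b y)) f = integral {a..b} (\<lambda>x. f (Complex x y))"
proof -
  let ?g = "\<lambda>w. f (w + \<i> * of_real y)"
  have "contour_integral (linepath (Complex a y) (Complex b y)) f
     = integral {0..1} (\<lambda>x. f (linepath (Complex a y) (Complex b y) x) * (Complex b y - Complex a y))"
    by (simp add: contour_integral_integral)
  also have "(\<lambda>x. f (linepath (Complex a y) (Complex b y) x) * (Complex b y - Complex a y))
     = (\<lambda>x. ?g (linepath (of_real a) (of_real b) x) * (of_real b - of_real a))"
  proof
    fix x
    have "linepath (Complex a y) (Complex b y) x = linepath (of_real a) (of_real b) x + \<i> * of_real y"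
      by (simp add: linepath_def complex_eq_iff algebra_simps)
    moreover have "Complex b y - Complex a y = of_real b - of_real a" by (simp add: complex_eq_iff)
    ultimately show "f (linepath (Complex a y) (Complex b y) x) * (Complex b y - Complex a y)
      = ?g (linepath (of_real a) (of_real b) x) * (of_real b - of_real a)" by simp
  qed
  also have "integral {0..1} \<dots> = contour_integral (linepath (of_real a) (of_real b)) ?g"
    by (simp add: contour_integral_integral)
  also have "\<dots> = integral {a..b} (\<lambda>x. ?g (of_real x))"
    by (subst contour_integral_linepath_Reals_eq) (use assms in auto)
  also have "(\<lambda>x. ?g (of_real x)) = (\<lambda>x. f (Complex x y))"
    by (simp add: Complex_eq)
  finally show ?thesis .
qed

text \<open>The residue theorem on rectangles with vertical sides at abscissae \<open>-n\<close> and
  \<open>n\<close>. By the decay the sides contribute at most \<open>2 * B n\<close>, which tends to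
  0. The lower line counts positively because the rectangle is traversed counterclockwise.\<close>

lemma line_integral_shift_residue:
  assumes S: "open S" "convex S" and strip: "\<And>z. y1 \<le> Im z \<Longrightarrow> Im z \<le> y2 \<Longrightarrow> z \<in> S"
    and p: "y1 < Im p" "Im p < y2" and hol: "f holomorphic_on (S - {p})"
    and \<delta>: "\<delta> > 0" and bound: "\<And>x y. y1 \<le> y \<Longrightarrow> y \<le> y2 \<Longrightarrow> \<bar>x\<bar> \<ge> X \<Longrightarrow>
        norm (f (Complex x y)) \<le> C * exp (- \<delta> * \<bar>x\<bar>)"
  shows "(LINT x|lborel. f (Complex x y1)) - (LINT x|lborel. f (Complex x y2)) = 2 * pi * \<i> * residue f p"
proof -
  have lim: "(\<lambda>n. integral {-real n..real n} (\<lambda>x. f (Complex x y))) \<longlonglongrightarrow> (LINT x|lborel. f (Complex x y))"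
    if y: "y \<in> {y1, y2}" for y
  proof -
    have yy: "y1 \<le> y" "y \<le> y2" "y \<noteq> Im p" using y p by auto
    have c: "continuous_on UNIV (\<lambda>x. f (Complex x y))"
    proof (rule continuous_on_compose2[OF holomorphic_on_imp_continuous_on[OF hol]])
      show "range (\<lambda>x. Complex x y) \<subseteq> S - {p}" using strip yy by auto
      show "continuous_on UNIV (\<lambda>x. Complex x y)"
        unfolding Complex_eq by (intro continuous_intros)
    qed
    have "\<exists>C'. \<forall>q\<in>{0::real}. \<forall>x. norm (f (Complex x y)) \<le> C' * exp (- \<delta> * \<bar>x\<bar>)"
    proof (rule exp_decay_compact_extend[of "{0::real}" "\<lambda>_ x. f (Complex x y)" X C \<delta>])
      show "continuous_on ({0::real} \<times> UNIV) (\<lambda>(p, x). f (Complex x y))"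
        using continuous_on_compose2[OF c, of "{0::real} \<times> UNIV" snd]
        by (simp add: case_prod_unfold continuous_on_snd)
    qed (use bound yy in auto)
    then obtain C' where "\<And>x. norm (f (Complex x y)) \<le> C' * exp (- \<delta> * \<bar>x\<bar>)" by auto
    thus ?thesis by (intro line_integral_LIMSEQ[OF \<delta> c])
  qed
  define B where "B = (\<lambda>n::nat. \<bar>C\<bar> * exp (- \<delta> * real n) * (y2 - y1))"
  have y12: "y1 < y2" using p by linarith
  have side: "norm (contour_integral (linepath (Complex x a) (Complex x b)) f) \<le> B n"
    if x: "\<bar>x\<bar> = real n" "real n \<ge> X" "real n > \<bar>Re p\<bar>" "{a, b} = {y1, y2}" for x a b n
  proof -
    have seg: "closed_segment (Complex x a) (Complex x b) \<subseteq> {z. Re z = x \<and> y1 \<le> Im z \<and> Im z \<le> y2}"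
    proof -
      have "convex {z. Re z = x \<and> y1 \<le> Im z \<and> Im z \<le> y2}"
      proof -
        have "{z. Re z = x \<and> y1 \<le> Im z \<and> Im z \<le> y2} =
            ({z. Re z \<ge> x} \<inter> {z. Re z \<le> x}) \<inter> ({z. Im z \<ge> y1} \<inter> {z. Im z \<le> y2})" by auto
        thus ?thesis by (simp add: convex_Int convex_halfspace_Im_ge convex_halfspace_Im_le
            convex_halfspace_Re_ge convex_halfspace_Re_le)
      qed
      moreover have "a \<in> {y1, y2}" "b \<in> {y1, y2}" using x(4) by auto
      hence "Complex x a \<in> {z. Re z = x \<and> y1 \<le> Im z \<and> Im z \<le> y2}"
        "Complex x b \<in> {z. Re z = x \<and> y1 \<le> Im z \<and> Im z \<le> y2}" using y12 by auto
      ultimately show ?thesis by (simp add: closed_segment_subset)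
    qed
    have "norm (contour_integral (linepath (Complex x a) (Complex x b)) f)
        \<le> (\<bar>C\<bar> * exp (- \<delta> * real n)) * norm (Complex x b - Complex x a)"
    proof (rule contour_integral_bound_linepath)
      show "f contour_integrable_on linepath (Complex x a) (Complex x b)"
      proof (rule contour_integrable_continuous_linepath, rule continuous_on_subset[OF holomorphic_on_imp_continuous_on[OF hol]])
        show "closed_segment (Complex x a) (Complex x b) \<subseteq> S - {p}"
          using seg strip x by fastforce
      qed
      fix z assume z: "z \<in> closed_segment (Complex x a) (Complex x b)"
      hence z': "Re z = x" "y1 \<le> Im z" "Im z \<le> y2" using seg by auto
      have "norm (f (Complex (Re z) (Im z))) \<le> C * exp (- \<delta> * \<bar>Re z\<bar>)"
        by (rule bound) (use z' x in auto)
      also have "\<dots> \<le> \<bar>C\<bar> * exp (- \<delta> * real n)" using z' x by simp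
      finally show "norm (f z) \<le> \<bar>C\<bar> * exp (- \<delta> * real n)" by simp
    qed auto
    also have "norm (Complex x b - Complex x a) = y2 - y1"
    proof -
      have "Complex x b - Complex x a = \<i> * of_real (b - a)" by (simp add: complex_eq_iff)
      hence "norm (Complex x b - Complex x a) = \<bar>b - a\<bar>" by (simp only: norm_mult norm_ii norm_of_real mult_1)
      thus ?thesis using x(4) y12 by (auto simp: doubleton_eq_iff)
    qed
    finally show ?thesis by (simp add: B_def)
  qed
  have rect: "norm (integral {-real n..real n} (\<lambda>x. f (Complex x y1)) - integral {-real n..real n} (\<lambda>x. f (Complex x y2))
       - 2 * pi * \<i> * residue f p) \<le> 2 * B n"
    if n: "real n \<ge> X" "real n > \<bar>Re p\<bar>" for n
  proof -
    define a1 a2 a3 a4 where "a1 = Complex (-real n) y1" and "a2 = Complex (real n) y1"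
      and "a3 = Complex (real n) y2" and "a4 = Complex (-real n) y2"
    have n0: "real n > 0" using n by linarith
    have pin: "p \<in> box a1 a3" using n p by (auto simp: a1_def a3_def in_box_complex_iff)
    have pathS: "path_image (rectpath a1 a3) \<subseteq> S - {p}"
    proof -
      have "path_image (rectpath a1 a3) = cbox a1 a3 - box a1 a3"
        by (rule path_image_rectpath_cbox_minus_box) (use n0 y12 in \<open>auto simp: a1_def a3_def\<close>)
      thus ?thesis using pin strip by (auto simp: in_cbox_complex_iff a1_def a3_def)
    qed
    have "contour_integral (rectpath a1 a3) f = 2 * pi * \<i> * (\<Sum>q\<in>{p}. winding_number (rectpath a1 a3) q * residue f q)"
    proof (rule Residue_theorem[OF S(1) convex_connected[OF S(2)] _ hol])
      show "\<forall>z. z \<notin> S \<longrightarrow> winding_number (rectpath a1 a3) z = 0"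
      proof (intro allI impI)
        fix z assume "z \<notin> S"
        hence "z \<notin> cbox a1 a3" using strip by (auto simp: in_cbox_complex_iff a1_def a3_def)
        thus "winding_number (rectpath a1 a3) z = 0"
          by (intro winding_number_rectpath_outside) (use n0 y12 in \<open>auto simp: a1_def a3_def\<close>)
      qed
    qed (use pathS in auto)
    hence 1: "contour_integral (rectpath a1 a3) f = 2 * pi * \<i> * residue f p"
      using winding_number_rectpath[OF pin] by simp
    have rp: "rectpath a1 a3 = linepath a1 a2 +++ linepath a2 a3 +++ linepath a3 a4 +++ linepath a4 a1"
      by (simp add: rectpath_def Let_def a1_def a2_def a3_def a4_def)
    have ints: "f contour_integrable_on linepath a1 a2" "f contour_integrable_on linepath a2 a3"
      "f contour_integrable_on linepath a3 a4" "f contour_integrable_on linepath a4 a1"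
    proof -
      have "path_image (rectpath a1 a3) = closed_segment a1 a2 \<union> closed_segment a2 a3 \<union> closed_segment a3 a4 \<union> closed_segment a4 a1"
        unfolding rp by (simp add: path_image_join Un_assoc)
      hence "closed_segment a1 a2 \<subseteq> S - {p}" "closed_segment a2 a3 \<subseteq> S - {p}"
         "closed_segment a3 a4 \<subseteq> S - {p}" "closed_segment a4 a1 \<subseteq> S - {p}" using pathS by blast+
      thus "f contour_integrable_on linepath a1 a2" "f contour_integrable_on linepath a2 a3"
        "f contour_integrable_on linepath a3 a4" "f contour_integrable_on linepath a4 a1"
        by (auto intro!: contour_integrable_continuous_linepath
            continuous_on_subset[OF holomorphic_on_imp_continuous_on[OF hol]])
    qed
    have "contour_integral (rectpath a1 a3) f = contour_integral (linepath a1 a2) f + contour_integral (linepath a2 a3) f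
      + contour_integral (linepath a3 a4) f + contour_integral (linepath a4 a1) f"
      unfolding rp using ints by (simp add: contour_integrable_join valid_path_join)
    moreover have "contour_integral (linepath a1 a2) f = integral {-real n..real n} (\<lambda>x. f (Complex x y1))"
      unfolding a1_def a2_def by (rule contour_integral_horizontal) (use n0 in auto)
    moreover have "contour_integral (linepath a3 a4) f = - contour_integral (linepath a4 a3) f"
      using contour_integral_reversepath[of "linepath a4 a3" f] by simp
    moreover have "contour_integral (linepath a4 a3) f = integral {-real n..real n} (\<lambda>x. f (Complex x y2))"
      unfolding a3_def a4_def by (rule contour_integral_horizontal) (use n0 in auto)
    moreover have "norm (contour_integral (linepath a2 a3) f) \<le> B n"
      unfolding a2_def a3_def by (rule side) (use n in auto)
    moreover have "norm (contour_integral (linepath a4 a1) f) \<le> B n"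
      unfolding a4_def a1_def by (rule side) (use n in auto)
    ultimately show ?thesis
      using 1 norm_triangle_ineq[of "contour_integral (linepath a2 a3) f" "contour_integral (linepath a4 a1) f"]
      by (smt (verit) norm_minus_cancel add.commute add_diff_cancel_left' diff_add_eq diff_minus_eq_add minus_diff_eq uminus_add_conv_diff add_diff_eq)
  qed
  have "(\<lambda>n. exp (- \<delta> * real n)) \<longlonglongrightarrow> 0"
  proof -
    have "filterlim (\<lambda>n. - \<delta> * real n) at_bot sequentially"
      using \<delta> by (intro filterlim_tendsto_neg_mult_at_bot[OF tendsto_const] filterlim_real_sequentially) auto
    thus ?thesis using exp_at_bot filterlim_compose by blast
  qed
  hence "(\<lambda>n. 2 * B n) \<longlonglongrightarrow> 2 * (\<bar>C\<bar> * 0 * (y2 - y1))" unfolding B_def by (intro tendsto_intros)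
  hence B0: "(\<lambda>n. 2 * B n) \<longlonglongrightarrow> 0" by simp
  have ev: "\<forall>\<^sub>F n in sequentially. real n \<ge> X \<and> real n > \<bar>Re p\<bar>"
    by (intro eventually_conj filterlim_at_top[THEN iffD1, rule_format]
        filterlim_at_top_dense[THEN iffD1, rule_format] filterlim_real_sequentially)
  have "(\<lambda>n. integral {-real n..real n} (\<lambda>x. f (Complex x y1)) - integral {-real n..real n} (\<lambda>x. f (Complex x y2))
       - 2 * pi * \<i> * residue f p) \<longlonglongrightarrow> 0"
    by (rule Lim_null_comparison[OF _ B0]) (use ev rect in \<open>auto elim!: eventually_mono\<close>)
  moreover have "(\<lambda>n. integral {-real n..real n} (\<lambda>x. f (Complex x y1)) - integral {-real n..real n} (\<lambda>x. f (Complex x y2))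
       - 2 * pi * \<i> * residue f p) \<longlonglongrightarrow> (LINT x|lborel. f (Complex x y1)) - (LINT x|lborel. f (Complex x y2)) - 2 * pi * \<i> * residue f p"
    by (intro tendsto_intros lim) auto
  ultimately show ?thesis using LIMSEQ_unique by fastforce
qed

section \<open>The elementary kernel\<close>

lemma Re_inverse_complex: "Re (1 / \<omega>) = Re \<omega> / (cmod \<omega>)\<^sup>2"
  by (simp add: Re_divide cmod_power2)

lemma Re_inverse_pos_iff: "Re (1 / \<omega>) > 0 \<longleftrightarrow> Re \<omega> > 0"
  unfolding Re_inverse_complex by (auto simp: zero_less_divide_iff)

lemma Im_2pi_i_mult: "Im (of_int k * (2 * of_real pi * \<i> * w)) = of_int k * (2 * pi * Re w)"
  by simp

lemma exp_mult_eq_1: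
  assumes "exp (\<omega> * t) = 1" "\<omega> \<noteq> 0"
  obtains k :: int where "t = of_int k * (2 * of_real pi * \<i> / \<omega>)" "Im t = of_int k * (2 * pi * Re (1 / \<omega>))"
proof -
  have "e2pi (\<omega> * t / (2 * of_real pi * \<i>)) = 1" using assms by (simp add: e2pi_def)
  then obtain k :: int where "\<omega> * t / (2 * of_real pi * \<i>) = of_int k"
    unfolding e2pi_eq_1_iff by (elim Ints_cases)
  hence t: "t = of_int k * (2 * of_real pi * \<i> / \<omega>)" using assms(2) by (simp add: field_simps)
  hence "t = of_int k * (2 * of_real pi * \<i> * (1 / \<omega>))" by simp
  hence "Im t = of_int k * (2 * pi * Re (1 / \<omega>))" by (simp only: Im_2pi_i_mult)
  thus ?thesis using t that by blast
qed

text \<open>The solutions of \<open>exp (\<omega> * t) = 1\<close> are the integer multiples of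
  \<open>2 * pi * \<i> / \<omega>\<close>, at heights that are multiples of
  \<open>2 * pi * Re (1 / \<omega>)\<close>; strictly between the heights 0 and 1 of these there are
  none.\<close>

lemma exp_mult_neq_1:
  assumes "0 < Im t" "Im t < 2 * pi * Re (1 / \<omega>)"
  shows "exp (\<omega> * t) \<noteq> 1"
proof
  assume e: "exp (\<omega> * t) = 1"
  have "\<omega> \<noteq> 0" using assms by auto
  then obtain k :: int where k: "Im t = of_int k * (2 * pi * Re (1 / \<omega>))" using exp_mult_eq_1[OF e] by blast
  define P where "P = 2 * pi * Re (1 / \<omega>)"
  have "P > 0" using assms unfolding P_def by linarith
  moreover have "0 < of_int k * P" "of_int k * P < 1 * P" using assms k by (simp_all add: P_def)
  ultimately have "0 < (of_int k :: real)" "(of_int k :: real) < 1"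
    using zero_less_mult_pos2 mult_less_cancel_right_pos by blast+
  thus False by simp
qed

text \<open>The constant bound serves the end of the line where the exponential dies out, the
  exponential bound the end where it grows.\<close>

lemma norm_inverse_one_minus_exp:
  assumes "\<bar>Re u\<bar> \<ge> 1"
  shows "norm (1 / (1 - exp u)) \<le> 2" "norm (1 / (1 - exp u)) \<le> 2 * exp (- Re u)"
proof -
  have e2: "exp (1::real) \<ge> 2" using exp_ge_add_one_self[of "1::real"] by simp
  have "norm (1 / (1 - exp u)) \<le> 2 \<and> norm (1 / (1 - exp u)) \<le> 2 * exp (- Re u)"
  proof (cases "Re u \<ge> 1")
    case True
    hence e: "exp (Re u) \<ge> 2" using e2 by (meson exp_le_cancel_iff order_trans)
    have "norm (1 - exp u) \<ge> exp (Re u) - 1"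
      using norm_triangle_ineq2[of "exp u" 1] by (simp add: norm_minus_commute)
    hence n: "norm (1 - exp u) \<ge> exp (Re u) / 2" using e by linarith
    hence "norm (1 / (1 - exp u)) \<le> 1 / (exp (Re u) / 2)"
      unfolding norm_divide norm_one
      by (intro divide_left_mono n mult_pos_pos) (auto intro: less_le_trans[OF _ n])
    hence "norm (1 / (1 - exp u)) \<le> 2 * exp (- Re u)" by (simp add: exp_minus field_simps)
    moreover have "exp (- Re u) \<le> 1" using True by simp
    ultimately show ?thesis by linarith
  next
    case False
    hence r: "Re u \<le> -1" using assms by linarith
    hence "exp (Re u) \<le> exp (-1)" by simp
    also have "\<dots> \<le> 1/2" using e2 by (simp add: exp_minus field_simps)
    finally have e: "exp (Re u) \<le> 1/2" .
    have "norm (1 - exp u) \<ge> 1 - exp (Re u)"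
      using norm_triangle_ineq2[of 1 "exp u"] by simp
    hence n: "norm (1 - exp u) \<ge> 1 / 2" using e by linarith
    hence "norm (1 / (1 - exp u)) \<le> 1 / (1 / 2)"
      unfolding norm_divide norm_one
      by (intro divide_left_mono n mult_pos_pos) (auto intro: less_le_trans[OF _ n])
    hence "norm (1 / (1 - exp u)) \<le> 2" by simp
    moreover have "exp (- Re u) \<ge> 1" using r by simp
    ultimately show ?thesis by linarith
  qed
  thus "norm (1 / (1 - exp u)) \<le> 2" "norm (1 / (1 - exp u)) \<le> 2 * exp (- Re u)" by auto
qed

text \<open>Faddeev's kernel is a product of two such factors, with \<omega> equal to 1 and to
  \<tau>, divided by \<open>t\<close>. Each factor decays in both directions exactly when
  \<open>0 < Re s\<close> and \<open>Re s < Re \<omega>\<close>.\<close>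

definition exp_kernel :: "complex \<Rightarrow> complex \<Rightarrow> complex \<Rightarrow> complex" where
  "exp_kernel s \<omega> t = exp (s * t) / (1 - exp (\<omega> * t))"

text \<open>To the right the denominator grows and leaves the rate
  \<open>Re \<omega> - Re s\<close>, to the left it is bounded away from 0 and leaves the rate
  \<open>Re s\<close>. The threshold on \<open>x\<close> makes the real part of
  \<open>\<omega> * t\<close> at least 1 in absolute value; imaginary parts cost only the constant
  \<open>exp (2 * M * Y)\<close>.\<close>

lemma exp_kernel_tail:
  assumes "\<delta> \<le> Re s" "\<delta> \<le> Re \<omega> - Re s" "\<delta> > 0" "\<alpha> \<le> Re \<omega>" "\<alpha> > 0"
    and "\<bar>Im s\<bar> \<le> M" "\<bar>Im \<omega>\<bar> \<le> M" "\<bar>y\<bar> \<le> Y" "\<bar>x\<bar> \<ge> (1 + M * Y) / \<alpha>"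
  shows "norm (exp_kernel s \<omega> (Complex x y)) \<le> 2 * exp (2 * M * Y) * exp (- \<delta> * \<bar>x\<bar>)"
proof -
  have M: "M \<ge> 0" "Y \<ge> 0" using assms by auto
  have sy: "\<bar>Im s * y\<bar> \<le> M * Y" "\<bar>Im \<omega> * y\<bar> \<le> M * Y"
    unfolding abs_mult using assms M by (auto intro!: mult_mono)
  have "\<bar>Re \<omega> * x\<bar> \<ge> \<alpha> * \<bar>x\<bar>" unfolding abs_mult using assms by (intro mult_mono) auto
  moreover have "\<alpha> * \<bar>x\<bar> \<ge> 1 + M * Y" using assms by (simp add: field_simps)
  moreover have R: "Re (\<omega> * Complex x y) = Re \<omega> * x - Im \<omega> * y" by simp
  ultimately have "\<bar>Re (\<omega> * Complex x y)\<bar> \<ge> 1" using sy by linarith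
  note b = norm_inverse_one_minus_exp[OF this]
  have n: "norm (exp_kernel s \<omega> (Complex x y)) = exp (Re s * x - Im s * y) * norm (1 / (1 - exp (\<omega> * Complex x y)))"
    by (simp add: exp_kernel_def norm_divide)
  show ?thesis
  proof (cases "x \<ge> 0")
    case True
    have "norm (exp_kernel s \<omega> (Complex x y)) \<le> exp (Re s * x - Im s * y) * (2 * exp (- (Re \<omega> * x - Im \<omega> * y)))"
      unfolding n R[symmetric] by (intro mult_left_mono b) auto
    also have "\<dots> = 2 * exp (- ((Re \<omega> - Re s) * x) + (Im \<omega> * y - Im s * y))"
      by (simp add: exp_add[symmetric] algebra_simps)
    also have "\<dots> \<le> 2 * exp (- (\<delta> * x) + 2 * M * Y)"
    proof -
      have "\<delta> * x \<le> (Re \<omega> - Re s) * x" using assms True by (intro mult_right_mono) auto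
      thus ?thesis using sy by simp
    qed
    finally show ?thesis using True by (simp add: exp_add exp_diff exp_minus field_simps)
  next
    case False
    have "norm (exp_kernel s \<omega> (Complex x y)) \<le> exp (Re s * x - Im s * y) * 2"
      unfolding n by (intro mult_left_mono b) auto
    also have "\<dots> \<le> 2 * exp (\<delta> * x + 2 * M * Y)"
    proof -
      have "Re s * x \<le> \<delta> * x" using assms False by (intro mult_right_mono_neg) auto
      moreover have "M * Y \<ge> 0" using M by simp
      ultimately show ?thesis using sy by simp
    qed
    finally show ?thesis using False by (simp add: exp_add exp_diff exp_minus field_simps)
  qed
qed

lemma compact_pos_lower_bound:
  fixes g :: "'a::topological_space \<Rightarrow> real"
  assumes "compact K" "continuous_on K g" "\<And>x. x \<in> K \<Longrightarrow> 0 < g x"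
  shows "\<exists>\<delta>>0. \<forall>x\<in>K. \<delta> \<le> g x"
proof (cases "K = {}")
  case True
  thus ?thesis by (intro exI[of _ 1]) auto
next
  case False
  then obtain x where "x \<in> K" "\<forall>y\<in>K. g x \<le> g y" using continuous_attains_inf[OF assms(1) _ assms(2)] by blast
  thus ?thesis using assms(3) by blast
qed

lemma compact_abs_upper_bound:
  fixes g :: "'a::topological_space \<Rightarrow> real"
  assumes "compact K" "continuous_on K g"
  shows "\<exists>M\<ge>0. \<forall>x\<in>K. \<bar>g x\<bar> \<le> M"
proof (cases "K = {}")
  case False
  have "continuous_on K (\<lambda>x. \<bar>g x\<bar>)" using assms by (intro continuous_intros)
  then obtain x where "x \<in> K" "\<forall>y\<in>K. \<bar>g y\<bar> \<le> \<bar>g x\<bar>" using continuous_attains_sup[OF assms(1) False] by blast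
  thus ?thesis by (intro exI[of _ "\<bar>g x\<bar>"]) auto
qed auto

definition kernel_domain :: "real \<Rightarrow> (complex \<times> complex) set" where
  "kernel_domain y = {(s, \<omega>). 0 < Re s \<and> Re s < Re \<omega> \<and> y < 2 * pi * Re (1 / \<omega>)}"

lemma exp_kernel_bound:
  assumes K: "compact K" "K \<subseteq> kernel_domain y" and y: "y > 0"
  shows "\<exists>\<delta>>0. \<exists>C\<ge>0. \<forall>p\<in>K. \<forall>x. norm (exp_kernel (fst p) (snd p) (Complex x y)) \<le> C * exp (- \<delta> * \<bar>x\<bar>)"
proof -
  have Kd: "0 < Re (fst p)" "Re (fst p) < Re (snd p)" "y < 2 * pi * Re (1 / snd p)" if "p \<in> K" for p
    using K(2) that by (auto simp: kernel_domain_def)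
  have "\<exists>\<delta>>0. \<forall>p\<in>K. \<delta> \<le> Re (fst p)"
    by (rule compact_pos_lower_bound[OF K(1)]) (use Kd in \<open>auto intro!: continuous_intros\<close>)
  then obtain d1 where d1: "d1 > 0" "\<And>p. p \<in> K \<Longrightarrow> d1 \<le> Re (fst p)" by blast
  have "\<exists>\<delta>>0. \<forall>p\<in>K. \<delta> \<le> Re (snd p) - Re (fst p)"
    by (rule compact_pos_lower_bound[OF K(1)]) (use Kd in \<open>auto intro!: continuous_intros\<close>)
  then obtain d2 where d2: "d2 > 0" "\<And>p. p \<in> K \<Longrightarrow> d2 \<le> Re (snd p) - Re (fst p)" by blast
  have "\<exists>M\<ge>0. \<forall>p\<in>K. \<bar>Im (fst p)\<bar> \<le> M"
    by (rule compact_abs_upper_bound[OF K(1)]) (auto intro!: continuous_intros)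
  then obtain M1 where M1: "M1 \<ge> 0" "\<And>p. p \<in> K \<Longrightarrow> \<bar>Im (fst p)\<bar> \<le> M1" by blast
  have "\<exists>M\<ge>0. \<forall>p\<in>K. \<bar>Im (snd p)\<bar> \<le> M"
    by (rule compact_abs_upper_bound[OF K(1)]) (auto intro!: continuous_intros)
  then obtain M2 where M2: "M2 \<ge> 0" "\<And>p. p \<in> K \<Longrightarrow> \<bar>Im (snd p)\<bar> \<le> M2" by blast
  define \<delta> where "\<delta> = min d1 d2"
  define M where "M = max M1 M2"
  have tail: "norm (exp_kernel (fst p) (snd p) (Complex x y)) \<le> 2 * exp (2 * M * y) * exp (- \<delta> * \<bar>x\<bar>)"
    if p: "p \<in> K" "\<bar>x\<bar> \<ge> (1 + M * y) / d1" for p x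
    by (rule exp_kernel_tail[of _ _ _ d1])
       (use d1(1) d1(2)[OF p(1)] d2(1) d2(2)[OF p(1)] M1(2)[OF p(1)] M2(2)[OF p(1)] p y in \<open>auto simp: \<delta>_def M_def\<close>)
  have "\<exists>C'. \<forall>p\<in>K. \<forall>x. norm (exp_kernel (fst p) (snd p) (Complex x y)) \<le> C' * exp (- \<delta> * \<bar>x\<bar>)"
  proof (rule exp_decay_compact_extend[OF K(1) _ tail])
    show "continuous_on (K \<times> UNIV) (\<lambda>(p, x). exp_kernel (fst p) (snd p) (Complex x y))"
      unfolding exp_kernel_def case_prod_unfold Complex_eq
    proof (intro continuous_intros ballI)
      fix q :: "(complex \<times> complex) \<times> real" assume "q \<in> K \<times> UNIV"
      hence "exp (snd (fst q) * (Complex (snd q) y)) \<noteq> 1"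
        using Kd[of "fst q"] y by (intro exp_mult_neq_1) auto
      thus "1 - exp (snd (fst q) * (of_real (snd q) + \<i> * of_real y)) \<noteq> 0" by (simp add: Complex_eq)
    qed
  qed
  then obtain C where C: "\<forall>p\<in>K. \<forall>x. norm (exp_kernel (fst p) (snd p) (Complex x y)) \<le> C * exp (- \<delta> * \<bar>x\<bar>)" by blast
  have "norm (exp_kernel (fst p) (snd p) (Complex x y)) \<le> \<bar>C\<bar> * exp (- \<delta> * \<bar>x\<bar>)" if "p \<in> K" for p x
  proof -
    have "C * exp (- \<delta> * \<bar>x\<bar>) \<le> \<bar>C\<bar> * exp (- \<delta> * \<bar>x\<bar>)" by (intro mult_right_mono) auto
    thus ?thesis using C that order_trans by blast
  qed
  moreover have "\<delta> > 0" using d1 d2 by (simp add: \<delta>_def)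
  ultimately show ?thesis by (intro exI[of _ \<delta>] conjI exI[of _ "\<bar>C\<bar>"]) auto
qed

text \<open>The denominator has period \<open>p = 2 * pi * \<i> / \<omega>\<close>, and adding
  \<open>p\<close> to \<open>t\<close> multiplies the kernel by \<open>e2pi (s / \<omega>)\<close>.
  The integral minus this multiple of itself is therefore given by the one residue, at
  \<open>p\<close>, between the two lines.\<close>

lemma exp_kernel_integral:
  assumes s: "0 < Re s" "Re s < Re \<omega>" and y: "0 < y" "y < 2 * pi * Re (1 / \<omega>)"
  shows "(LINT x|lborel. exp_kernel s \<omega> (Complex x y)) =
           - (2 * of_real pi * \<i> / \<omega>) * e2pi (s / \<omega>) / (1 - e2pi (s / \<omega>))"
    and "1 - e2pi (s / \<omega>) \<noteq> 0"
proof -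
  define \<rho> where "\<rho> = 2 * pi * Re (1 / \<omega>)"
  have \<rho>: "\<rho> > 0" "y < \<rho>" using y by (auto simp: \<rho>_def)
  have \<omega>0: "\<omega> \<noteq> 0" using s by auto
  define p where "p = 2 * of_real pi * \<i> / \<omega>"
  have Imp: "Im p = \<rho>"
  proof -
    have "p = of_int 1 * (2 * of_real pi * \<i> * (1 / \<omega>))" by (simp add: p_def)
    hence "Im p = of_int 1 * (2 * pi * Re (1 / \<omega>))" by (simp only: Im_2pi_i_mult)
    thus ?thesis by (simp add: \<rho>_def)
  qed
  define S where "S = {z. 0 < Im z \<and> Im z < 2 * \<rho>}"
  have SS: "S = {z. Im z > 0} \<inter> {z. Im z < 2 * \<rho>}" by (auto simp: S_def)
  have S: "open S" "convex S"
    unfolding SS by (auto intro!: open_Int convex_Int open_halfspace_Im_gt open_halfspace_Im_lt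
        convex_halfspace_Im_gt convex_halfspace_Im_lt)
  have nz: "exp (\<omega> * t) \<noteq> 1" if t: "t \<in> S - {p}" for t
  proof
    assume "exp (\<omega> * t) = 1"
    then obtain k :: int where k: "t = of_int k * p" "Im t = of_int k * \<rho>"
      using exp_mult_eq_1[of \<omega> t] \<omega>0 unfolding p_def \<rho>_def by metis
    have "0 < Im t" "Im t < 2 * \<rho>" using t by (auto simp: S_def)
    hence "0 < of_int k * \<rho>" "of_int k * \<rho> < 2 * \<rho>" using k(2) by simp_all
    hence "0 < real_of_int k" "real_of_int k < 2" using \<rho>(1)
      using zero_less_mult_pos2 mult_less_cancel_right_pos by blast+
    hence "k = 1" by linarith
    thus False using k t by simp
  qed
  define X where "X = (1 + (\<bar>Im s\<bar> + \<bar>Im \<omega>\<bar>) * (2 * \<rho>)) / Re \<omega>"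
  define \<delta> where "\<delta> = min (Re s) (Re \<omega> - Re s)"
  have main: "(LINT x|lborel. exp_kernel s \<omega> (Complex x y)) - (LINT x|lborel. exp_kernel s \<omega> (Complex x (y + \<rho>)))
     = 2 * pi * \<i> * residue (exp_kernel s \<omega>) p"
  proof (rule line_integral_shift_residue[OF S])
    show "exp_kernel s \<omega> holomorphic_on (S - {p})"
      unfolding exp_kernel_def by (intro holomorphic_intros) (use nz in auto)
    show "\<delta> > 0" using s by (simp add: \<delta>_def)
    show "norm (exp_kernel s \<omega> (Complex x y')) \<le> (2 * exp (2 * (\<bar>Im s\<bar> + \<bar>Im \<omega>\<bar>) * (2 * \<rho>))) * exp (- \<delta> * \<bar>x\<bar>)"
      if "y \<le> y'" "y' \<le> y + \<rho>" "\<bar>x\<bar> \<ge> X" for x y'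
      by (rule exp_kernel_tail[of _ _ _ "Re \<omega>"]) (use that s y \<rho> in \<open>auto simp: \<delta>_def X_def\<close>)
  qed (use y \<rho> in \<open>auto simp: S_def Imp\<close>)
  have res: "residue (exp_kernel s \<omega>) p = exp (s * p) / (- \<omega>)"
    unfolding exp_kernel_def
  proof (rule residue_simple_pole_deriv[of _ UNIV])
    show "((\<lambda>t. 1 - exp (\<omega> * t)) has_field_derivative - \<omega>) (at p)"
      using \<omega>0 by (auto intro!: derivative_eq_intros simp: p_def exp_two_pi_i)
    show "1 - exp (\<omega> * p) = 0" using \<omega>0 by (simp add: p_def exp_two_pi_i)
  qed (use \<omega>0 in \<open>auto intro!: holomorphic_intros\<close>)
  have sp: "exp (s * p) = e2pi (s / \<omega>)" by (simp add: p_def e2pi_def mult_ac)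
  \<comment> \<open>Translating the real variable by \<open>Re p\<close> leaves the integral
    unchanged and completes the vertical shift by \<rho> to a shift by the full period
    \<open>p\<close>.\<close>
  have "(LINT x|lborel. exp_kernel s \<omega> (Complex x (y + \<rho>))) = (LINT x|lborel. exp_kernel s \<omega> (Complex (Re p + 1 * x) (y + \<rho>)))"
    using lborel_integral_real_affine[of 1 "\<lambda>x. exp_kernel s \<omega> (Complex x (y + \<rho>))" "Re p"] by simp
  also have "(\<lambda>x. exp_kernel s \<omega> (Complex (Re p + 1 * x) (y + \<rho>))) = (\<lambda>x. e2pi (s / \<omega>) * exp_kernel s \<omega> (Complex x y))"
  proof
    fix x
    have "Complex (Re p + 1 * x) (y + \<rho>) = Complex x y + p" by (simp add: complex_eq_iff Imp)
    moreover have "exp (\<omega> * p) = 1" using \<omega>0 by (simp add: p_def exp_two_pi_i)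
    ultimately show "exp_kernel s \<omega> (Complex (Re p + 1 * x) (y + \<rho>)) = e2pi (s / \<omega>) * exp_kernel s \<omega> (Complex x y)"
      by (simp add: exp_kernel_def ring_distribs exp_add sp)
  qed
  finally have sh: "(LINT x|lborel. exp_kernel s \<omega> (Complex x (y + \<rho>))) = e2pi (s / \<omega>) * (LINT x|lborel. exp_kernel s \<omega> (Complex x y))"
    by simp
  show nz: "1 - e2pi (s / \<omega>) \<noteq> 0"
  proof
    assume "1 - e2pi (s / \<omega>) = 0"
    hence "s / \<omega> \<in> \<int>" using e2pi_eq_1_iff[of "s / \<omega>"] by (metis eq_iff_diff_eq_0)
    then obtain k :: int where "s / \<omega> = of_int k" by (elim Ints_cases)
    hence "s = of_int k * \<omega>" using \<omega>0 by (simp add: field_simps)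
    hence "Re s = of_int k * Re \<omega>" by simp
    hence "0 < of_int k * Re \<omega>" "of_int k * Re \<omega> < 1 * Re \<omega>" "Re \<omega> > 0" using s by auto
    hence "0 < (of_int k :: real)" "(of_int k :: real) < 1"
      using zero_less_mult_pos2 mult_less_cancel_right_pos by blast+
    thus False by simp
  qed
  have "(LINT x|lborel. exp_kernel s \<omega> (Complex x y)) * (1 - e2pi (s / \<omega>)) = - (2 * of_real pi * \<i> / \<omega>) * e2pi (s / \<omega>)"
    using main unfolding sh res sp by (simp add: algebra_simps)
  thus "(LINT x|lborel. exp_kernel s \<omega> (Complex x y)) = - (2 * of_real pi * \<i> / \<omega>) * e2pi (s / \<omega>) / (1 - e2pi (s / \<omega>))"
    by (simp only: nonzero_eq_divide_eq[OF nz])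
qed

text \<open>The division by \<open>t\<close> makes this an antiderivative in \<open>s\<close> of the
  integral of \<open>exp_kernel\<close>; \<open>exp_log_int\<close> recognises it as a logarithm of
  \<open>1 - e2pi (s / \<omega>)\<close>.\<close>

definition log_int :: "real \<Rightarrow> complex \<Rightarrow> complex \<Rightarrow> complex" where
  "log_int y \<omega> s = (LINT x|lborel. exp_kernel s \<omega> (Complex x y) / Complex x y)"

lemma norm_Complex_ge: "y > 0 \<Longrightarrow> norm (Complex x y) \<ge> y"
  using abs_Im_le_cmod[of "Complex x y"] by simp

lemma continuous_exp_kernel:
  assumes "0 < y" "y < 2 * pi * Re (1 / \<omega>)"
  shows "continuous_on UNIV (\<lambda>x. exp_kernel s \<omega> (Complex x y))"
  unfolding exp_kernel_def Complex_eq
proof (intro continuous_intros ballI)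
  fix x :: real
  show "1 - exp (\<omega> * (of_real x + \<i> * of_real y)) \<noteq> 0"
    using exp_mult_neq_1[of "Complex x y" \<omega>] assms by (simp add: Complex_eq)
qed

text \<open>Differentiation in \<open>s\<close> brings down a factor \<open>t\<close> that cancels
  the denominator. The constant \<open>C'\<close> bounds the integrands with and without the
  division, using that \<open>t\<close> has norm at least \<open>y\<close>.\<close>

lemma log_int_deriv:
  assumes s: "0 < Re s" "Re s < Re \<omega>" and y: "0 < y" "y < 2 * pi * Re (1 / \<omega>)"
  shows "(log_int y \<omega> has_field_derivative (LINT x|lborel. exp_kernel s \<omega> (Complex x y))) (at s)"
proof -
  define U where "U = {s. 0 < Re s \<and> Re s < Re \<omega>}"
  have "U = {s. Re s > 0} \<inter> {s. Re s < Re \<omega>}" by (auto simp: U_def)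
  hence U: "open U" by (auto intro!: open_Int open_halfspace_Re_gt open_halfspace_Re_lt)
  have sU: "s \<in> U" using s by (simp add: U_def)
  obtain r where r: "r > 0" "cball s r \<subseteq> U" using U sU open_contains_cball by blast
  have "compact (cball s r \<times> {\<omega>})" "cball s r \<times> {\<omega>} \<subseteq> kernel_domain y"
    using r y by (auto intro!: compact_Times simp: kernel_domain_def U_def subset_iff)
  from exp_kernel_bound[OF this y(1)] obtain \<delta> C where C: "\<delta> > 0" "C \<ge> 0"
    "\<And>q x. q \<in> cball s r \<Longrightarrow> norm (exp_kernel q \<omega> (Complex x y)) \<le> C * exp (- \<delta> * \<bar>x\<bar>)" by auto
  define C' where "C' = max C (C / y)"
  have nz: "1 - exp (\<omega> * Complex x y) \<noteq> 0" for x
    using exp_mult_neq_1[of "Complex x y" \<omega>] y by simp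
  have t0: "Complex x y \<noteq> 0" for x using y by (simp add: complex_eq_iff)
  show ?thesis
    unfolding log_int_def
  proof (rule has_field_derivative_line_integral[OF U _ _ sU r C(1), where C = C'])
    show "continuous_on (U \<times> UNIV) (\<lambda>(p, x). exp_kernel p \<omega> (Complex x y) / Complex x y)"
      using nz t0 unfolding exp_kernel_def case_prod_unfold Complex_eq
      by (intro continuous_intros) auto
    show "((\<lambda>w. exp_kernel w \<omega> (Complex x y) / Complex x y) has_field_derivative
        exp_kernel w \<omega> (Complex x y)) (at w)" for w x
    proof -
      let ?t = "Complex x y" and ?k = "1 / (1 - exp (\<omega> * Complex x y))"
      have "((\<lambda>w. exp (w * ?t) * (?k / ?t)) has_field_derivative (exp (w * ?t) * ?t) * (?k / ?t)) (at w)"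
        by (intro DERIV_cmult_right) (auto intro!: derivative_eq_intros)
      moreover have "(exp (w * ?t) * ?t) * (?k / ?t) = exp_kernel w \<omega> ?t"
      proof -
        have "(a * t) * (k / t) = a * k" if "t \<noteq> 0" for a k t :: complex using that by simp
        from this[OF t0[of x]] show ?thesis unfolding exp_kernel_def by simp
      qed
      ultimately have "((\<lambda>w. exp (w * ?t) * (?k / ?t)) has_field_derivative exp_kernel w \<omega> ?t) (at w)"
        by (simp only:)
      thus ?thesis by (simp add: exp_kernel_def)
    qed
    show "norm (exp_kernel q \<omega> (Complex x y) / Complex x y) \<le> C' * exp (- \<delta> * \<bar>x\<bar>)" if "q \<in> cball s r" for q x
    proof -
      have "norm (exp_kernel q \<omega> (Complex x y) / Complex x y) \<le> (C * exp (- \<delta> * \<bar>x\<bar>)) / y"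
        unfolding norm_divide using C that y norm_Complex_ge[of y x] by (intro frac_le) auto
      also have "\<dots> = (C / y) * exp (- \<delta> * \<bar>x\<bar>)" by simp
      also have "\<dots> \<le> C' * exp (- \<delta> * \<bar>x\<bar>)" unfolding C'_def by (intro mult_right_mono) auto
      finally show ?thesis .
    qed
    show "continuous_on UNIV (\<lambda>x. exp_kernel s \<omega> (Complex x y))" by (rule continuous_exp_kernel[OF y])
    show "norm (exp_kernel s \<omega> (Complex x y)) \<le> C' * exp (- \<delta> * \<bar>x\<bar>)" for x
    proof -
      have "norm (exp_kernel s \<omega> (Complex x y)) \<le> C * exp (- \<delta> * \<bar>x\<bar>)" using C(3)[of s x] r by simp
      also have "\<dots> \<le> C' * exp (- \<delta> * \<bar>x\<bar>)" unfolding C'_def by (intro mult_right_mono) auto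
      finally show ?thesis .
    qed
  qed
qed

text \<open>Both sides of the following identity have the same logarithmic derivative in \<open>s\<close> and
  tend to 1 as \<open>Im s\<close> grows.\<close>

lemma exp_log_int:
  assumes s: "0 < Re s" "Re s < Re \<omega>" and y: "0 < y" "y < 2 * pi * Re (1 / \<omega>)"
  shows "exp (log_int y \<omega> s) = 1 - e2pi (s / \<omega>)"
proof -
  define U where "U = {s. 0 < Re s \<and> Re s < Re \<omega>}"
  have Ueq: "U = {s. Re s > 0} \<inter> {s. Re s < Re \<omega>}" by (auto simp: U_def)
  have U: "convex U" unfolding Ueq by (auto intro!: convex_Int convex_halfspace_Re_gt convex_halfspace_Re_lt)
  have sU: "s \<in> U" using s by (simp add: U_def)
  have \<omega>0: "\<omega> \<noteq> 0" "Re \<omega> > 0" using s by auto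
  define h where "h = (\<lambda>s. exp (- log_int y \<omega> s) * (1 - e2pi (s / \<omega>)))"
  have "(h has_field_derivative 0) (at q within U)" if q: "q \<in> U" for q
  proof -
    have q': "0 < Re q" "Re q < Re \<omega>" using q by (auto simp: U_def)
    note K = exp_kernel_integral[OF q' y]
    have "(h has_field_derivative
       exp (- log_int y \<omega> q) * (- (LINT x|lborel. exp_kernel q \<omega> (Complex x y))) * (1 - e2pi (q / \<omega>))
       + (- (e2pi (q / \<omega>) * (2 * of_real pi * \<i> * (1 / \<omega>)))) * exp (- log_int y \<omega> q)) (at q)"
      unfolding h_def e2pi_def using \<omega>0
      by (auto intro!: derivative_eq_intros log_int_deriv[OF q' y] simp: field_simps)
    also have "exp (- log_int y \<omega> q) * (- (LINT x|lborel. exp_kernel q \<omega> (Complex x y))) * (1 - e2pi (q / \<omega>))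
       + (- (e2pi (q / \<omega>) * (2 * of_real pi * \<i> * (1 / \<omega>)))) * exp (- log_int y \<omega> q) = 0"
      unfolding K(1) using K(2) \<omega>0 by (simp add: field_simps)
    finally show ?thesis by (rule has_field_derivative_at_within)
  qed
  from has_field_derivative_zero_constant[OF U this] obtain c where c: "\<And>q. q \<in> U \<Longrightarrow> h q = c" by blast
  \<comment> \<open>Raising \<open>s\<close> by \<open>\<i>\<close> multiplies the kernel by
    \<open>exp (\<i> * t)\<close>, whose norm is \<open>exp (- y)\<close> on the whole line, and
    keeps the point in the strip. Along this sequence the constant can be read off.\<close>
  define q where "q = (\<lambda>n::nat. s + \<i> * of_nat n)"
  have qU: "q n \<in> U" for n using s by (simp add: q_def U_def)
  define L where "L = (LINT x|lborel. norm (exp_kernel s \<omega> (Complex x y) / Complex x y))"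
  have "norm (log_int y \<omega> (q n)) \<le> exp (- y) ^ n * L" for n
  proof -
    have eq: "norm (exp_kernel (q n) \<omega> (Complex x y) / Complex x y)
        = exp (- y) ^ n * norm (exp_kernel s \<omega> (Complex x y) / Complex x y)" for x
      by (simp add: q_def exp_kernel_def norm_divide norm_mult ring_distribs exp_add[symmetric] exp_of_nat_mult[symmetric] exp_diff exp_minus field_simps)
    have "norm (log_int y \<omega> (q n)) \<le> (LINT x|lborel. norm (exp_kernel (q n) \<omega> (Complex x y) / Complex x y))"
      unfolding log_int_def by (rule integral_norm_bound)
    also have "\<dots> = exp (- y) ^ n * L" unfolding eq L_def by simp
    finally show ?thesis .
  qed
  moreover have "(\<lambda>n. exp (- y) ^ n * L) \<longlonglongrightarrow> 0 * L"
    by (intro tendsto_mult LIMSEQ_realpow_zero tendsto_const) (use y in auto)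
  ultimately have lim1: "(\<lambda>n. log_int y \<omega> (q n)) \<longlonglongrightarrow> 0"
    by (intro Lim_null_comparison[of "\<lambda>n. log_int y \<omega> (q n)" "\<lambda>n. exp (- y) ^ n * L"]) auto
  have "e2pi (q n / \<omega>) = e2pi (s / \<omega>) * e2pi (\<i> / \<omega>) ^ n" for n
    by (simp add: q_def add_divide_distrib e2pi_add e2pi_power mult_ac)
  moreover have "norm (e2pi (\<i> / \<omega>)) < 1"
  proof -
    have "Im (\<i> / \<omega>) = Re (1 / \<omega>)" by (metis Im_i_times times_divide_eq_right mult.right_neutral)
    thus ?thesis using \<omega>0 Re_inverse_pos_iff[of \<omega>] by (simp add: norm_e2pi)
  qed
  hence "(\<lambda>n. e2pi (s / \<omega>) * e2pi (\<i> / \<omega>) ^ n) \<longlonglongrightarrow> e2pi (s / \<omega>) * 0"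
    by (intro tendsto_mult tendsto_const LIMSEQ_power_zero)
  ultimately have lim2: "(\<lambda>n. e2pi (q n / \<omega>)) \<longlonglongrightarrow> 0" by simp
  have "(\<lambda>n. h (q n)) \<longlonglongrightarrow> exp (- 0) * (1 - 0)"
    unfolding h_def by (intro tendsto_intros lim1 lim2)
  moreover have "(\<lambda>n. h (q n)) = (\<lambda>n. c)" using c qU by auto
  ultimately have "c = 1" using LIMSEQ_unique tendsto_const by fastforce
  hence "h s = 1" using c sU by simp
  thus ?thesis by (simp add: h_def exp_minus field_simps)
qed

section \<open>Faddeev's integral\<close>

text \<open>The integrand of Faddeev's noncompact quantum dilogarithm, equivalently of the logarithm
  of the double sine function with periods 1 and \<tau>. The line of integration at height
  \<open>y\<close> passes above the triple pole at 0 and below all other poles of the upper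
  half-plane.\<close>

definition fad_kernel :: "complex \<Rightarrow> complex \<Rightarrow> complex \<Rightarrow> complex" where
  "fad_kernel z \<tau> t = exp ((z + 1) * t) / ((1 - exp t) * (1 - exp (\<tau> * t)) * t)"

definition fad_int :: "real \<Rightarrow> complex \<times> complex \<Rightarrow> complex" where
  "fad_int y p = (LINT x|lborel. fad_kernel (fst p) (snd p) (Complex x y))"

definition fad_domain :: "real \<Rightarrow> (complex \<times> complex) set" where
  "fad_domain y = {(z, \<tau>). -1 < Re z \<and> Re z < Re \<tau> \<and> y < 2 * pi * Re (1 / \<tau>)}"

text \<open>Inversion maps a right half-plane to a disc through the origin. The disc makes
  \<open>fad_domain\<close> visibly open and convex.\<close>

lemma Re_inverse_gt_iff_ball:
  assumes "y > 0"
  shows "y < 2 * pi * Re (1 / \<tau>) \<longleftrightarrow> \<tau> \<in> ball (of_real (pi / y)) (pi / y)"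
proof -
  have "\<tau> \<in> ball (of_real (pi / y)) (pi / y) \<longleftrightarrow> norm (\<tau> - of_real (pi / y)) < pi / y"
    by (simp add: dist_norm norm_minus_commute)
  also have "\<dots> \<longleftrightarrow> (norm (\<tau> - of_real (pi / y)))\<^sup>2 < (pi / y)\<^sup>2"
  proof -
    have "(pi / y)\<^sup>2 \<le> (norm (\<tau> - of_real (pi / y)))\<^sup>2 \<longleftrightarrow> pi / y \<le> norm (\<tau> - of_real (pi / y))"
      by (rule power_mono_iff) (use assms in auto)
    thus ?thesis by linarith
  qed
  also have "(norm (\<tau> - of_real (pi / y)))\<^sup>2 = (norm \<tau>)\<^sup>2 - 2 * (pi / y) * Re \<tau> + (pi / y)\<^sup>2"
  proof -
    have "(norm (\<tau> - of_real a))\<^sup>2 = (norm \<tau>)\<^sup>2 - 2 * a * Re \<tau> + a\<^sup>2" for a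
      by (simp add: cmod_power2) (simp add: power2_eq_square algebra_simps)
    thus ?thesis .
  qed
  also have "\<dots> < (pi / y)\<^sup>2 \<longleftrightarrow> y * (norm \<tau>)\<^sup>2 < 2 * pi * Re \<tau>"
    using assms by (simp add: field_simps)
  also have "\<dots> \<longleftrightarrow> y < 2 * pi * Re (1 / \<tau>)"
  proof (cases "\<tau> = 0")
    case False
    thus ?thesis unfolding Re_inverse_complex by (simp add: field_simps)
  qed (use assms in auto)
  finally show ?thesis by blast
qed

lemma fad_domain_eq:
  assumes "y > 0"
  shows "fad_domain y = {p. Re (fst p) > -1} \<inter> {p. Re (fst p) < Re (snd p)} \<inter>
    (UNIV \<times> ball (of_real (pi / y)) (pi / y))"
proof (rule set_eqI)
  fix p
  show "p \<in> fad_domain y \<longleftrightarrow> p \<in> {p. Re (fst p) > -1} \<inter> {p. Re (fst p) < Re (snd p)} \<inter>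
    (UNIV \<times> ball (of_real (pi / y)) (pi / y))"
    unfolding fad_domain_def Re_inverse_gt_iff_ball[OF assms]
    by (cases p) (simp del: mem_ball)
qed

lemma open_fad_domain: "y > 0 \<Longrightarrow> open (fad_domain y)"
  unfolding fad_domain_eq
  by (intro open_Int open_Times open_Collect_less continuous_intros) auto

lemma fad_domain_Re_pos:
  assumes "(z, \<tau>) \<in> fad_domain y" "y > 0"
  shows "Re \<tau> > 0"
proof -
  have "0 < (2 * pi) * Re (1 / \<tau>)" using assms by (simp add: fad_domain_def del: one_divide_eq_0_iff)
  hence "Re (1 / \<tau>) > 0" by (rule zero_less_mult_pos) simp
  thus ?thesis by (simp only: Re_inverse_pos_iff)
qed

lemma fad_kernel_split:
  "s1 + s2 = z + 1 \<Longrightarrow> fad_kernel z \<tau> t = exp_kernel s1 1 t * exp_kernel s2 \<tau> t / t"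
  by (simp add: fad_kernel_def exp_kernel_def exp_add[symmetric] ring_distribs[symmetric])

context
  fixes y :: real
  assumes y: "0 < y" "y < 2 * pi"
begin

lemma exp_Complex_neq_1: "exp (Complex x y) \<noteq> 1"
  using exp_mult_neq_1[of "Complex x y" 1] y by simp

lemma exp_tau_Complex_neq_1: "(z, \<tau>) \<in> fad_domain y \<Longrightarrow> exp (\<tau> * Complex x y) \<noteq> 1"
  using exp_mult_neq_1[of "Complex x y" \<tau>] y by (simp add: fad_domain_def)

lemma fad_kernel_bound:
  assumes K: "compact K" "K \<subseteq> fad_domain y"
  shows "\<exists>\<delta>>0. \<exists>C. \<forall>p\<in>K. \<forall>x. norm (fad_kernel (fst p) (snd p) (Complex x y)) \<le> C * exp (- \<delta> * \<bar>x\<bar>)"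
proof -
  have Kd: "-1 < Re (fst p)" "Re (fst p) < Re (snd p)" "y < 2 * pi * Re (1 / snd p)" "Re (snd p) > 0"
    if "p \<in> K" for p
    using subsetD[OF K(2) that] fad_domain_Re_pos[of "fst p" "snd p" y] y by (auto simp: fad_domain_def)
  \<comment> \<open>The real part of \<open>z + 1\<close> lies between 0 and
    \<open>1 + Re \<tau>\<close>. Splitting \<open>z + 1\<close> in the proportion 1 to
    \<open>Re \<tau>\<close> puts the two parts into the strips of width 1 and
    \<open>Re \<tau>\<close> that the elementary kernels require.\<close>
  define g1 :: "complex \<times> complex \<Rightarrow> complex \<times> complex" where "g1 = (\<lambda>p. (of_real (1 / (1 + Re (snd p))) * (fst p + 1), 1 :: complex))"
  define g2 :: "complex \<times> complex \<Rightarrow> complex \<times> complex" where "g2 = (\<lambda>p. (of_real (Re (snd p) / (1 + Re (snd p))) * (fst p + 1), snd p))"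
  have nz: "1 + Re (snd p) \<noteq> 0" if "p \<in> K" for p using Kd[OF that] by linarith
  have nz': "1 + complex_of_real (Re (snd p)) \<noteq> 0" if "p \<in> K" for p
    using nz[OF that] by (metis of_real_1 of_real_add of_real_eq_0_iff)
  have "compact (g1 ` K)" "compact (g2 ` K)"
    unfolding g1_def g2_def using nz nz' by (auto intro!: compact_continuous_image K continuous_intros simp del: split_paired_All)
  moreover have "g1 ` K \<subseteq> kernel_domain y"
  proof -
    have "(Re (fst p) + 1) / (1 + Re (snd p)) < 1" "0 < (Re (fst p) + 1) / (1 + Re (snd p))" if p: "p \<in> K" for p
      using Kd[OF p] by (auto simp: divide_less_eq intro!: divide_pos_pos)
    thus ?thesis using y by (auto simp: g1_def kernel_domain_def)
  qed
  moreover have "g2 ` K \<subseteq> kernel_domain y"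
  proof -
    have "Re (snd p) * (Re (fst p) + 1) / (1 + Re (snd p)) < Re (snd p)"
      "0 < Re (snd p) * (Re (fst p) + 1) / (1 + Re (snd p))" if p: "p \<in> K" for p
      using Kd[OF p] by (auto simp: divide_less_eq intro!: mult_pos_pos divide_pos_pos mult_strict_left_mono)
    thus ?thesis using Kd y by (auto simp: g2_def kernel_domain_def)
  qed
  ultimately obtain d1 C1 d2 C2 where
    1: "d1 > 0" "C1 \<ge> 0" "\<And>p x. p \<in> K \<Longrightarrow> norm (exp_kernel (fst (g1 p)) (snd (g1 p)) (Complex x y)) \<le> C1 * exp (- d1 * \<bar>x\<bar>)" and
    2: "d2 > 0" "C2 \<ge> 0" "\<And>p x. p \<in> K \<Longrightarrow> norm (exp_kernel (fst (g2 p)) (snd (g2 p)) (Complex x y)) \<le> C2 * exp (- d2 * \<bar>x\<bar>)"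
    using exp_kernel_bound[of "g1 ` K" y] exp_kernel_bound[of "g2 ` K" y] y by (metis imageI)
  have "norm (fad_kernel (fst p) (snd p) (Complex x y)) \<le> (C1 * C2 / y) * exp (- (d1 + d2) * \<bar>x\<bar>)"
    if p: "p \<in> K" for p x
  proof -
    have "fst (g1 p) + fst (g2 p) = of_real (1 / (1 + Re (snd p)) + Re (snd p) / (1 + Re (snd p))) * (fst p + 1)"
      by (simp add: g1_def g2_def ring_distribs)
    also have "1 / (1 + Re (snd p)) + Re (snd p) / (1 + Re (snd p)) = 1"
      using nz[OF p] by (simp add: add_divide_distrib[symmetric])
    finally have s: "fst (g1 p) + fst (g2 p) = fst p + 1" by simp
    have "norm (fad_kernel (fst p) (snd p) (Complex x y)) =
        norm (exp_kernel (fst (g1 p)) (snd (g1 p)) (Complex x y)) * norm (exp_kernel (fst (g2 p)) (snd (g2 p)) (Complex x y)) / norm (Complex x y)"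
      by (subst fad_kernel_split[OF s]) (simp add: norm_divide norm_mult g1_def g2_def)
    also have "\<dots> \<le> (C1 * exp (- d1 * \<bar>x\<bar>)) * (C2 * exp (- d2 * \<bar>x\<bar>)) / y"
      using 1 2 p y norm_Complex_ge[of y x] by (intro frac_le mult_mono) auto
    also have "\<dots> = (C1 * C2 / y) * exp (- (d1 + d2) * \<bar>x\<bar>)"
      by (simp add: ring_distribs exp_add exp_diff exp_minus field_simps)
    finally show ?thesis .
  qed
  thus ?thesis using 1 2 by (intro exI[of _ "d1 + d2"] conjI exI[of _ "C1 * C2 / y"]) auto
qed

lemma continuous_fad_kernel:
  "continuous_on (fad_domain y \<times> UNIV) (\<lambda>(p, x). fad_kernel (fst p) (snd p) (Complex x y))"
  unfolding fad_kernel_def case_prod_unfold Complex_eq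
proof (intro continuous_intros ballI)
  fix q :: "(complex \<times> complex) \<times> real" assume q: "q \<in> fad_domain y \<times> UNIV"
  hence "exp (snd (fst q) * Complex (snd q) y) \<noteq> 1"
    using exp_tau_Complex_neq_1[of "fst (fst q)" "snd (fst q)"] by (cases q) auto
  moreover have "Complex (snd q) y \<noteq> 0" using y by (simp add: complex_eq_iff)
  ultimately show "(1 - exp (complex_of_real (snd q) + \<i> * complex_of_real y)) *
      (1 - exp (snd (fst q) * (complex_of_real (snd q) + \<i> * complex_of_real y))) *
         (complex_of_real (snd q) + \<i> * complex_of_real y) \<noteq> 0"
    using exp_Complex_neq_1[of "snd q"] by (simp add: Complex_eq)
qed

lemma fad_integrable:
  assumes "(z, \<tau>) \<in> fad_domain y"
  shows "integrable lborel (\<lambda>x. fad_kernel z \<tau> (Complex x y))"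
proof -
  obtain \<delta> C where *: "\<delta> > 0" "\<And>x. norm (fad_kernel z \<tau> (Complex x y)) \<le> C * exp (- \<delta> * \<bar>x\<bar>)"
    using fad_kernel_bound[of "{(z, \<tau>)}"] assms by auto
  have "continuous_on UNIV (\<lambda>x. fad_kernel (fst (z, \<tau>)) (snd (z, \<tau>)) (Complex x y))"
    by (rule continuous_on_param_compose[OF continuous_fad_kernel, where g = "\<lambda>_. (z, \<tau>)" and h = "\<lambda>x. x"])
       (use assms in auto)
  thus ?thesis using integrable_exp_decay[OF *(1) _ *(2)] by simp
qed

lemma holomorphic2_fad_int: "fad_int y holomorphic2_on fad_domain y"
proof -
  have "(\<lambda>p. LINT x|lborel. fad_kernel (fst p) (snd p) (Complex x y)) holomorphic2_on fad_domain y"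
  proof (rule holomorphic2_line_integral[OF open_fad_domain[OF y(1)] continuous_fad_kernel])
    show "(\<lambda>p. fad_kernel (fst p) (snd p) (Complex x y)) holomorphic2_on fad_domain y" for x
      unfolding fad_kernel_def
    proof (intro holomorphic2_on_divide holomorphic2_on_exp holomorphic2_on_mult holomorphic2_on_add holomorphic2_on_diff
        holomorphic2_on_fst holomorphic2_on_snd holomorphic2_on_const)
      fix p assume "p \<in> fad_domain y"
      hence "exp (snd p * Complex x y) \<noteq> 1"
        using exp_tau_Complex_neq_1[of "fst p" "snd p"] by simp
      moreover have "Complex x y \<noteq> 0" using y by (simp add: complex_eq_iff)
      ultimately show "(1 - exp (Complex x y)) * (1 - exp (snd p * Complex x y)) * Complex x y \<noteq> 0"
        using exp_Complex_neq_1[of x] by simp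
    qed
    fix p assume "p \<in> fad_domain y"
    then obtain r where r: "r > 0" "cball p r \<subseteq> fad_domain y"
      using open_fad_domain[OF y(1)] open_contains_cball by blast
    from fad_kernel_bound[OF compact_cball r(2)] r
    show "\<exists>r>0. \<exists>\<delta>>0. \<exists>C. cball p r \<subseteq> fad_domain y \<and>
       (\<forall>q\<in>cball p r. \<forall>x. norm (fad_kernel (fst q) (snd q) (Complex x y)) \<le> C * exp (- \<delta> * \<bar>x\<bar>))"
      by blast
  qed
  thus ?thesis by (simp add: fad_int_def[abs_def])
qed

text \<open>In the difference of the two kernels the factor \<open>1 - exp (\<tau> * t)\<close>
  cancels, and what remains is the integrand of \<open>log_int\<close> for \<omega> equal to
  1.\<close>

lemma fad_int_shift_tau:
  assumes "(z, \<tau>) \<in> fad_domain y" "Re z < 0"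
  shows "exp (fad_int y (z, \<tau>)) = exp (fad_int y (z + \<tau>, \<tau>)) * (1 - e2pi z)"
proof -
  have Ret: "Re \<tau> > 0" using fad_domain_Re_pos assms y by blast
  have d2: "(z + \<tau>, \<tau>) \<in> fad_domain y" using assms Ret by (auto simp: fad_domain_def)
  have "fad_int y (z, \<tau>) - fad_int y (z + \<tau>, \<tau>) =
      (LINT x|lborel. fad_kernel z \<tau> (Complex x y) - fad_kernel (z + \<tau>) \<tau> (Complex x y))"
    by (simp add: fad_int_def fad_integrable[OF assms(1)] fad_integrable[OF d2])
  also have "\<dots> = log_int y 1 (z + 1)"
    unfolding log_int_def
  proof (rule Bochner_Integration.integral_cong[OF refl])
    fix x
    let ?t = "Complex x y"
    have "fad_kernel z \<tau> ?t - fad_kernel (z + \<tau>) \<tau> ?t =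
       (exp ((z + 1) * ?t) - exp ((z + 1) * ?t) * exp (\<tau> * ?t)) / ((1 - exp ?t) * (1 - exp (\<tau> * ?t)) * ?t)"
      by (simp add: fad_kernel_def diff_divide_distrib exp_add[symmetric] algebra_simps)
    also have "exp ((z + 1) * ?t) - exp ((z + 1) * ?t) * exp (\<tau> * ?t) = exp ((z + 1) * ?t) * (1 - exp (\<tau> * ?t))"
      by (simp add: algebra_simps)
    finally show "fad_kernel z \<tau> ?t - fad_kernel (z + \<tau>) \<tau> ?t = exp_kernel (z + 1) 1 ?t / ?t"
      using exp_tau_Complex_neq_1[OF assms(1), of x] by (simp add: exp_kernel_def)
  qed
  finally have "fad_int y (z, \<tau>) = fad_int y (z + \<tau>, \<tau>) + log_int y 1 (z + 1)" by (simp add: algebra_simps)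
  moreover have "exp (log_int y 1 (z + 1)) = 1 - e2pi ((z + 1) / 1)"
    by (rule exp_log_int) (use assms y in \<open>auto simp: fad_domain_def\<close>)
  ultimately show ?thesis by (simp add: exp_add e2pi_add)
qed

text \<open>The same cancellation with the two periods exchanged: now \<open>1 - exp t\<close> drops
  out and \<open>log_int\<close> for \<omega> equal to \<tau> remains.\<close>

lemma fad_int_shift_1:
  assumes "(z + 1, \<tau>) \<in> fad_domain y" "Re z > -1"
  shows "exp (fad_int y (z, \<tau>)) = exp (fad_int y (z + 1, \<tau>)) * (1 - e2pi ((z + 1) / \<tau>))"
proof -
  have d2: "(z, \<tau>) \<in> fad_domain y" using assms by (auto simp: fad_domain_def)
  have "fad_int y (z, \<tau>) - fad_int y (z + 1, \<tau>) =
      (LINT x|lborel. fad_kernel z \<tau> (Complex x y) - fad_kernel (z + 1) \<tau> (Complex x y))"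
    by (simp add: fad_int_def fad_integrable[OF assms(1)] fad_integrable[OF d2])
  also have "\<dots> = log_int y \<tau> (z + 1)"
    unfolding log_int_def
  proof (rule Bochner_Integration.integral_cong[OF refl])
    fix x
    let ?t = "Complex x y"
    have "fad_kernel z \<tau> ?t - fad_kernel (z + 1) \<tau> ?t =
       (exp ((z + 1) * ?t) - exp ((z + 1) * ?t) * exp ?t) / ((1 - exp ?t) * (1 - exp (\<tau> * ?t)) * ?t)"
      by (simp add: fad_kernel_def diff_divide_distrib exp_add[symmetric] algebra_simps)
    also have "exp ((z + 1) * ?t) - exp ((z + 1) * ?t) * exp ?t = exp ((z + 1) * ?t) * (1 - exp ?t)"
      by (simp add: algebra_simps)
    finally show "fad_kernel z \<tau> ?t - fad_kernel (z + 1) \<tau> ?t = exp_kernel (z + 1) \<tau> ?t / ?t"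
      using exp_Complex_neq_1[of x] by (simp add: exp_kernel_def)
  qed
  finally have "fad_int y (z, \<tau>) = fad_int y (z + 1, \<tau>) + log_int y \<tau> (z + 1)" by (simp add: algebra_simps)
  moreover have "exp (log_int y \<tau> (z + 1)) = 1 - e2pi ((z + 1) / \<tau>)"
    by (rule exp_log_int) (use assms y in \<open>auto simp: fad_domain_def\<close>)
  ultimately show ?thesis by (simp add: exp_add)
qed

text \<open>Conjugation followed by \<open>x \<mapsto> - x\<close> replaces \<open>t\<close> by
  \<open>- t\<close> on the line, and under \<open>t \<mapsto> - t\<close> the kernel changes sign
  with \<open>z\<close> replaced by \<open>\<tau> - 1 - z\<close>.\<close>

lemma cnj_fad_int:
  "cnj (fad_int y (cnj z, cnj \<tau>)) = - fad_int y (\<tau> - 1 - z, \<tau>)"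
proof -
  have pt: "cnj (fad_kernel (cnj z) (cnj \<tau>) (Complex (0 + (- 1) * x) y)) = - fad_kernel (\<tau> - 1 - z) \<tau> (Complex x y)" for x
  proof -
    define t where "t = Complex x y"
    have t: "cnj (Complex (- x) y) = - t" by (simp add: t_def complex_eq_iff)
    have "cnj (fad_kernel (cnj z) (cnj \<tau>) (Complex (- x) y)) =
       exp ((z + 1) * (- t)) / ((1 - exp (- t)) * (1 - exp (\<tau> * (- t))) * (- t))"
      by (simp add: fad_kernel_def exp_cnj t)
    also have "(1 - exp (- t)) * (1 - exp (\<tau> * (- t))) = (1 - exp t) * (1 - exp (\<tau> * t)) / (exp t * exp (\<tau> * t))"
      by (simp add: exp_minus field_simps)
    also have "exp ((z + 1) * (- t)) / ((1 - exp t) * (1 - exp (\<tau> * t)) / (exp t * exp (\<tau> * t)) * (- t)) =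
       - (exp ((z + 1) * (- t)) * (exp t * exp (\<tau> * t))) / ((1 - exp t) * (1 - exp (\<tau> * t)) * t)"
      by simp
    also have "exp ((z + 1) * (- t)) * (exp t * exp (\<tau> * t)) = exp ((\<tau> - 1 - z + 1) * t)"
      by (simp add: exp_add[symmetric] algebra_simps)
    finally show ?thesis by (simp add: fad_kernel_def t_def)
  qed
  have "cnj (fad_int y (cnj z, cnj \<tau>)) = (LINT x|lborel. cnj (fad_kernel (cnj z) (cnj \<tau>) (Complex x y)))"
    by (simp add: fad_int_def)
  also have "\<dots> = (LINT x|lborel. cnj (fad_kernel (cnj z) (cnj \<tau>) (Complex (0 + (-1) * x) y)))"
    using lborel_integral_real_affine[of "-1" "\<lambda>x. cnj (fad_kernel (cnj z) (cnj \<tau>) (Complex x y))" 0] by simp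
  also have "\<dots> = - fad_int y (\<tau> - 1 - z, \<tau>)"
    unfolding pt by (simp add: fad_int_def)
  finally show ?thesis .
qed

end

section \<open>The product formula\<close>

text \<open>The iteration of the shift equations works only on vertical lines. Such a line
  accumulates at each of its points in an open set, which is enough for analytic
  continuation.\<close>

lemma zero_on_vertical_line:
  assumes "f holomorphic_on S" "open S" "connected S" "\<xi> \<in> S"
    and "\<And>w. w \<in> S \<Longrightarrow> Re w = Re \<xi> \<Longrightarrow> f w = 0" and "w \<in> S"
  shows "f w = 0"
proof (rule analytic_continuation[of f S "{w \<in> S. Re w = Re \<xi>}" \<xi>])
  show "\<xi> islimpt {w \<in> S. Re w = Re \<xi>}"
    unfolding islimpt_approachable
  proof (intro allI impI)
    fix e :: real assume e: "e > 0"
    obtain r where r: "r > 0" "ball \<xi> r \<subseteq> S" using assms open_contains_ball by blast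
    define h where "h = min e r / 2"
    have h: "h > 0" "h < e" "h < r" using e r by (auto simp: h_def)
    have d: "dist \<xi> (\<xi> + \<i> * of_real h) = h" using h by (simp add: dist_norm norm_mult)
    hence "\<xi> + \<i> * of_real h \<in> S" using r h by auto
    thus "\<exists>x'\<in>{w \<in> S. Re w = Re \<xi>}. x' \<noteq> \<xi> \<and> dist x' \<xi> < e"
      using h d by (intro bexI[of _ "\<xi> + \<i> * of_real h"]) (auto simp: dist_commute)
  qed
qed (use assms in auto)

lemma Im_minus_inverse_pos: "Im \<tau> > 0 \<Longrightarrow> Im (- 1 / \<tau>) > 0"
  by (simp add: Im_divide sum_power2_gt_zero_iff)

lemma convex_fad_domain:
  assumes "y > 0"
  shows "convex (fad_domain y)"
proof -
  have l: "linear (\<lambda>p :: complex \<times> complex. Re (fst p))" "linear (\<lambda>p :: complex \<times> complex. Re (snd p) - Re (fst p))"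
    by (auto intro!: linearI simp: algebra_simps)
  have "{p :: complex \<times> complex. Re (fst p) > -1} = (\<lambda>p. Re (fst p)) -` {-1<..}"
    "{p :: complex \<times> complex. Re (fst p) < Re (snd p)} = (\<lambda>p. Re (snd p) - Re (fst p)) -` {0<..}" by auto
  hence "convex {p :: complex \<times> complex. Re (fst p) > -1}" "convex {p :: complex \<times> complex. Re (fst p) < Re (snd p)}"
    using convex_linear_vimage[OF l(1), of "{-1<..}"] convex_linear_vimage[OF l(2), of "{0<..}"] by simp_all
  thus ?thesis unfolding fad_domain_eq[OF assms]
    by (intro convex_Int convex_Times convex_UNIV convex_ball)
qed

lemma Re_pos_of_inverse:
  assumes "0 < y" "y < 2 * pi * Re (1 / \<tau>)"
  shows "Re \<tau> > 0"
proof -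
  have "0 < (2 * pi) * Re (1 / \<tau>)" using assms by linarith
  hence "Re (1 / \<tau>) > 0" by (rule zero_less_mult_pos) simp
  thus ?thesis by (simp only: Re_inverse_pos_iff)
qed

text \<open>In the lower half-plane \<open>varpi\<close> has no meaning; there the quotient is given by the symmetry
  \<open>(z, \<tau>) \<mapsto> (cnj (\<tau> - 1 - z), cnj \<tau>)\<close> of Faddeev's integral.\<close>

definition fad_num :: "complex \<Rightarrow> complex \<Rightarrow> complex" where
  "fad_num z \<tau> = (if Im \<tau> > 0 then varpi z \<tau>
     else cnj (varpi (cnj (\<tau> - 1 - z) / cnj \<tau>) (- 1 / cnj \<tau>)))"

definition fad_den :: "complex \<Rightarrow> complex \<Rightarrow> complex" where
  "fad_den z \<tau> = (if Im \<tau> > 0 then varpi (z / \<tau>) (- 1 / \<tau>)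
     else cnj (varpi (cnj (\<tau> - 1 - z)) (cnj \<tau>)))"

text \<open>This is \<open>- pi * \<i>\<close> times the double Bernoulli polynomial of degree 2 at
  \<open>z + 1\<close> with periods 1 and \<tau>; it arises as a residue at the triple pole.\<close>

definition fad_refl :: "complex \<Rightarrow> complex \<Rightarrow> complex" where
  "fad_refl z \<tau> = - 2 * of_real pi * \<i> / \<tau> *
     ((z + 1)\<^sup>2 / 2 - (z + 1) * (1 + \<tau>) / 2 + \<tau> / 4 + (1 + \<tau>\<^sup>2) / 12)"

context
  fixes y :: real
  assumes y: "0 < y" "y < 2 * pi"
begin

text \<open>Raising \<open>z\<close> by \<open>\<i> * b\<close> multiplies the norm of the kernel by
  \<open>exp (- y * b)\<close> at every point of the line, since all of them have height
  \<open>y\<close>.\<close>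

lemma fad_int_decay:
  assumes "b > 0"
  shows "(\<lambda>n. fad_int y (z + of_nat n * (\<i> * of_real b), \<tau>)) \<longlonglongrightarrow> 0"
proof -
  define L where "L = (LINT x|lborel. norm (fad_kernel z \<tau> (Complex x y)))"
  have le: "norm (fad_int y (z + of_nat n * (\<i> * of_real b), \<tau>)) \<le> exp (- y * b) ^ n * L" for n
  proof -
    have eq: "norm (fad_kernel (z + of_nat n * (\<i> * of_real b)) \<tau> (Complex x y))
        = exp (- y * b) ^ n * norm (fad_kernel z \<tau> (Complex x y))" for x
    proof -
      have "norm (exp ((z + of_nat n * (\<i> * of_real b) + 1) * Complex x y)) =
        exp (- y * b) ^ n * norm (exp ((z + 1) * Complex x y))"
      proof -
        have "Re ((z + of_nat n * (\<i> * of_real b) + 1) * Complex x y) = of_nat n * (- y * b) + Re ((z + 1) * Complex x y)"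
          by (simp add: ring_distribs)
        thus ?thesis by (simp only: norm_exp_eq_Re exp_add exp_of_nat_mult)
      qed
      thus ?thesis by (simp only: fad_kernel_def norm_divide times_divide_eq_right)
    qed
    have "norm (fad_int y (z + of_nat n * (\<i> * of_real b), \<tau>)) \<le>
        (LINT x|lborel. norm (fad_kernel (z + of_nat n * (\<i> * of_real b)) \<tau> (Complex x y)))"
      unfolding fad_int_def fst_conv snd_conv by (rule integral_norm_bound)
    also have "\<dots> = exp (- y * b) ^ n * L" unfolding eq L_def by simp
    finally show ?thesis .
  qed
  have "(\<lambda>n. exp (- y * b) ^ n * L) \<longlonglongrightarrow> 0 * L"
    by (intro tendsto_mult LIMSEQ_realpow_zero tendsto_const) (use y assms in auto)
  hence "(\<lambda>n. exp (- y * b) ^ n * L) \<longlonglongrightarrow> 0" by (simp only: mult_zero_left)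
  thus ?thesis by (rule Lim_null_comparison[OF always_eventually, rotated]) (intro allI le)
qed

text \<open>For \<open>Re \<tau> = 1\<close> adding \<tau> and subtracting 1 moves \<open>z\<close>
  straight up by \<open>Im \<tau>\<close>, within the strip. Each such step yields one factor of
  either product, and in the limit the integral disappears.\<close>

lemma fad_int_product_vertical:
  assumes \<tau>: "Re \<tau> = 1" "Im \<tau> > 0" "y < 2 * pi * Re (1 / \<tau>)" and z: "Re z = -1/2"
  shows "exp (fad_int y (z, \<tau>)) * varpi (z / \<tau>) (- 1 / \<tau>) = varpi z \<tau>"
proof -
  define b where "b = Im \<tau>"
  have b: "b > 0" "\<tau> = 1 + \<i> * of_real b" using \<tau> by (auto simp: b_def complex_eq_iff)
  have t0: "\<tau> \<noteq> 0" using \<tau> by auto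
  have step: "exp (fad_int y (w, \<tau>)) * (1 - e2pi (w / \<tau>)) = exp (fad_int y (w + \<i> * of_real b, \<tau>)) * (1 - e2pi w)"
    if w: "Re w = -1/2" for w
  proof -
    have "exp (fad_int y (w, \<tau>)) = exp (fad_int y (w + \<tau>, \<tau>)) * (1 - e2pi w)"
      by (rule fad_int_shift_tau[OF y]) (use w \<tau> in \<open>auto simp: fad_domain_def\<close>)
    moreover have "exp (fad_int y (w + \<i> * of_real b, \<tau>)) =
       exp (fad_int y (w + \<i> * of_real b + 1, \<tau>)) * (1 - e2pi ((w + \<i> * of_real b + 1) / \<tau>))"
      by (rule fad_int_shift_1[OF y]) (use w \<tau> in \<open>auto simp: fad_domain_def\<close>)
    moreover have "w + \<i> * of_real b + 1 = w + \<tau>" using b by simp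
    moreover have "e2pi ((w + \<tau>) / \<tau>) = e2pi (w / \<tau>)" using t0 by (simp add: add_divide_distrib e2pi_add)
    ultimately show ?thesis by simp
  qed
  have iter: "exp (fad_int y (z, \<tau>)) * (\<Prod>k<n. 1 - e2pi (z / \<tau> + of_nat k * (- 1 / \<tau>))) =
      exp (fad_int y (z + of_nat n * (\<i> * of_real b), \<tau>)) * (\<Prod>k<n. 1 - e2pi (z + of_nat k * \<tau>))" for n
  proof (induction n)
    case (Suc n)
    let ?w = "z + of_nat n * (\<i> * of_real b)"
    \<comment> \<open>The integer \<open>n\<close> is invisible to \<open>e2pi\<close> at
      \<open>w\<close>; after division by \<tau> it is the multiple \<open>n * \<tau>\<close> that
      becomes an integer, which produces the modulus \<open>- 1 / \<tau>\<close>.\<close>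
    have w\<tau>: "?w = z + of_nat n * \<tau> - of_nat n" using b by (simp add: algebra_simps)
    have e1: "e2pi (?w / \<tau>) = e2pi (z / \<tau> + of_nat n * (- 1 / \<tau>))"
    proof -
      have "?w / \<tau> = z / \<tau> + of_nat n * (- 1 / \<tau>) + of_nat n"
        unfolding w\<tau> using t0 by (simp add: field_simps)
      thus ?thesis by (simp add: e2pi_add)
    qed
    have e2: "e2pi ?w = e2pi (z + of_nat n * \<tau>)" unfolding w\<tau> by (simp add: e2pi_diff)
    have st: "exp (fad_int y (?w, \<tau>)) * (1 - e2pi (?w / \<tau>)) =
        exp (fad_int y (?w + \<i> * of_real b, \<tau>)) * (1 - e2pi ?w)" by (rule step) (use z in auto)
    have "exp (fad_int y (z, \<tau>)) * (\<Prod>k<Suc n. 1 - e2pi (z / \<tau> + of_nat k * (- 1 / \<tau>))) =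
       (exp (fad_int y (z, \<tau>)) * (\<Prod>k<n. 1 - e2pi (z / \<tau> + of_nat k * (- 1 / \<tau>)))) * (1 - e2pi (?w / \<tau>))"
      unfolding e1 by simp
    also have "\<dots> = (exp (fad_int y (?w, \<tau>)) * (1 - e2pi (?w / \<tau>))) * (\<Prod>k<n. 1 - e2pi (z + of_nat k * \<tau>))"
      unfolding Suc.IH by (simp add: mult_ac)
    also have "\<dots> = exp (fad_int y (?w + \<i> * of_real b, \<tau>)) * (\<Prod>k<Suc n. 1 - e2pi (z + of_nat k * \<tau>))"
      unfolding st e2 by simp
    also have "?w + \<i> * of_real b = z + of_nat (Suc n) * (\<i> * of_real b)" by (simp add: algebra_simps)
    finally show ?case .
  qed simp
  have l1: "(\<lambda>n. exp (fad_int y (z, \<tau>)) * (\<Prod>k<n. 1 - e2pi (z / \<tau> + of_nat k * (- 1 / \<tau>))))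
     \<longlonglongrightarrow> exp (fad_int y (z, \<tau>)) * varpi (z / \<tau>) (- 1 / \<tau>)"
    by (intro tendsto_intros varpi_LIMSEQ Im_minus_inverse_pos \<tau>)
  have l2: "(\<lambda>n. exp (fad_int y (z + of_nat n * (\<i> * of_real b), \<tau>)) * (\<Prod>k<n. 1 - e2pi (z + of_nat k * \<tau>)))
     \<longlonglongrightarrow> exp 0 * varpi z \<tau>"
    by (intro tendsto_intros varpi_LIMSEQ fad_int_decay b \<tau>)
  show ?thesis using LIMSEQ_unique[OF l1[unfolded iter] l2] by simp
qed

text \<open>Two analytic continuations of the vertical case: with \<open>Re z = -1/2\<close> fixed
  from the line \<open>Re \<tau> = 1\<close> to all \<tau>, then for each \<tau> from the line
  \<open>Re z = -1/2\<close> to all \<open>z\<close>.\<close>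

lemma fad_int_product_upper:
  assumes "(z, \<tau>) \<in> fad_domain y" "Im \<tau> > 0"
  shows "exp (fad_int y (z, \<tau>)) * varpi (z / \<tau>) (- 1 / \<tau>) = varpi z \<tau>"
proof -
  define U where "U = fad_domain y \<inter> (UNIV \<times> upper_half_plane)"
  have U: "open U" "convex U"
    unfolding U_def upper_half_plane_def
    by (intro open_Int convex_Int open_fad_domain convex_fad_domain y open_Times convex_Times convex_UNIV open_UNIV
        open_halfspace_Im_gt convex_halfspace_Im_gt)+
  define G where "G = (\<lambda>p. exp (fad_int y p) * varpi (fst p / snd p) (- 1 / snd p) - varpi (fst p) (snd p))"
  have UD: "Im (snd p) > 0" "snd p \<noteq> 0" if "p \<in> U" for p
    using that by (auto simp: U_def upper_half_plane_def)
  have hI: "fad_int y holomorphic2_on U"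
    using holomorphic2_fad_int[OF y] by (rule holomorphic2_on_subset) (auto simp: U_def)
  have G: "G holomorphic2_on U"
    unfolding G_def using UD
    by (intro holomorphic2_on_diff holomorphic2_on_mult holomorphic2_on_exp hI holomorphic2_varpi_compose
        holomorphic2_on_divide holomorphic2_on_fst holomorphic2_on_snd holomorphic2_on_const Im_minus_inverse_pos) auto
  have 1: "G (z, \<tau>) = 0" if z: "Re z = -1/2" and t: "(z, \<tau>) \<in> U" for z \<tau>
  proof -
    define T where "T = {t. (z + t * 0, 0 + t * 1) \<in> U}"
    have hol: "(\<lambda>t. G (z + t * 0, 0 + t * 1)) holomorphic_on T"
      unfolding T_def by (rule holomorphic2_on_line[OF G])
    have oT: "open T" unfolding T_def using open_vimage[OF U(1), of "\<lambda>t. (z + t * 0, 0 + t * 1)"]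
      by (simp add: vimage_def continuous_on_Pair)
    have cT: "connected T" unfolding T_def by (intro convex_connected convex_line_preimage U)
    \<comment> \<open>The modulus 1 is on the boundary of the upper half-plane but inside the open
      \<open>fad_domain\<close>; slightly above it lies a point \<xi> of the line
      \<open>Re \<tau> = 1\<close> from which to continue.\<close>
    have z1: "(z, 1) \<in> fad_domain y" using z y by (simp add: fad_domain_def)
    have "open {t. (z, t) \<in> fad_domain y}"
      using open_vimage[OF open_fad_domain[OF y(1)], of "\<lambda>t. (z, t)"] by (simp add: vimage_def continuous_on_Pair)
    then obtain e where e: "e > 0" "ball 1 e \<subseteq> {t. (z, t) \<in> fad_domain y}"
      using z1 open_contains_ball by (metis mem_Collect_eq)
    define \<xi> where "\<xi> = 1 + \<i> * of_real (e / 2)"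
    have "\<xi> \<in> ball 1 e" using e by (simp add: \<xi>_def dist_norm norm_mult)
    hence \<xi>T: "\<xi> \<in> T" using e by (auto simp: T_def U_def upper_half_plane_def \<xi>_def)
    have "G (z + \<tau> * 0, 0 + \<tau> * 1) = 0"
    proof (rule zero_on_vertical_line[OF hol oT cT \<xi>T])
      fix w assume w: "w \<in> T" "Re w = Re \<xi>"
      have "exp (fad_int y (z, w)) * varpi (z / w) (- 1 / w) = varpi z w"
        by (rule fad_int_product_vertical)
           (use w z in \<open>auto simp: T_def U_def upper_half_plane_def fad_domain_def \<xi>_def\<close>)
      thus "G (z + w * 0, 0 + w * 1) = 0" by (simp add: G_def)
    qed (use t in \<open>simp add: T_def\<close>)
    thus ?thesis by simp
  qed
  define S where "S = {t. (0 + t * 1, \<tau> + t * 0) \<in> U}"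
  have hol: "(\<lambda>t. G (0 + t * 1, \<tau> + t * 0)) holomorphic_on S"
    unfolding S_def by (rule holomorphic2_on_line[OF G])
  have oS: "open S" unfolding S_def using open_vimage[OF U(1), of "\<lambda>t. (0 + t * 1, \<tau> + t * 0)"]
    by (simp add: vimage_def continuous_on_Pair)
  have cS: "connected S" unfolding S_def by (intro convex_connected convex_line_preimage U)
  have \<xi>S: "-1/2 \<in> S" using assms fad_domain_Re_pos[OF assms(1) y(1)]
    by (simp add: S_def U_def upper_half_plane_def fad_domain_def)
  have "G (0 + z * 1, \<tau> + z * 0) = 0"
  proof (rule zero_on_vertical_line[OF hol oS cS \<xi>S])
    show "G (0 + w * 1, \<tau> + w * 0) = 0" if "w \<in> S" "Re w = Re (-1/2)" for w
      using 1[of w \<tau>] that by (simp add: S_def)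
  qed (use assms in \<open>simp add: S_def U_def upper_half_plane_def\<close>)
  thus ?thesis by (simp add: G_def)
qed

text \<open>The lower half-plane is the conjugate of the upper case at the reflected point:
  \<open>cnj_fad_int\<close> inverts the exponential, which is why numerator and denominator
  exchange roles in \<open>fad_num\<close> and \<open>fad_den\<close>.\<close>

lemma fad_int_product:
  assumes "(z, \<tau>) \<in> fad_domain y" "Im \<tau> \<noteq> 0"
  shows "exp (fad_int y (z, \<tau>)) * fad_den z \<tau> = fad_num z \<tau>"
proof (cases "Im \<tau> > 0")
  case True
  thus ?thesis using fad_int_product_upper[OF assms(1)] by (simp add: fad_num_def fad_den_def)
next
  case False
  define w where "w = cnj (\<tau> - 1 - z)"
  have "Re (1 / cnj \<tau>) = Re (1 / \<tau>)" unfolding Re_inverse_complex by simp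
  hence d: "(w, cnj \<tau>) \<in> fad_domain y" using assms(1) by (simp add: fad_domain_def w_def)
  have "exp (fad_int y (w, cnj \<tau>)) * varpi (w / cnj \<tau>) (- 1 / cnj \<tau>) = varpi w (cnj \<tau>)"
    by (rule fad_int_product_upper[OF d]) (use assms False in auto)
  hence "cnj (exp (fad_int y (w, cnj \<tau>))) * cnj (varpi (w / cnj \<tau>) (- 1 / cnj \<tau>)) = cnj (varpi w (cnj \<tau>))"
    by (metis complex_cnj_mult)
  moreover have "cnj (exp (fad_int y (w, cnj \<tau>))) = exp (- fad_int y (z, \<tau>))"
    using cnj_fad_int[OF y, of "\<tau> - 1 - z" \<tau>] by (simp add: w_def exp_cnj)
  ultimately have "exp (fad_int y (z, \<tau>)) * fad_den z \<tau> =
     exp (fad_int y (z, \<tau>)) * exp (- fad_int y (z, \<tau>)) * cnj (varpi (w / cnj \<tau>) (- 1 / cnj \<tau>))"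
    using False by (simp add: fad_den_def w_def)
  thus ?thesis using False by (simp add: fad_num_def w_def exp_minus)
qed

end

section \<open>The reflection formula\<close>

lemma fps_nth_one_minus_exp: "fps_nth (fps_shift 1 (1 - fps_exp (a::complex))) n = - (a ^ Suc n / fact (Suc n))"
  by (simp add: ring_distribs)

lemma fps_mult_nth_le_2:
  fixes P Q :: "'a::comm_ring_1 fps"
  shows "fps_nth (P * Q) 2 = fps_nth P 0 * fps_nth Q 2 + fps_nth P 1 * fps_nth Q 1 + fps_nth P 2 * fps_nth Q 0"
    "fps_nth (P * Q) 1 = fps_nth P 0 * fps_nth Q 1 + fps_nth P 1 * fps_nth Q 0"
    "fps_nth (P * Q) 0 = fps_nth P 0 * fps_nth Q 0"
  by (simp_all add: fps_mult_nth eval_nat_numeral)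

text \<open>\<open>B\<close> is the expansion of \<open>t / (1 - exp (a * t))\<close>, that is, the
  generating function of the Bernoulli numbers up to sign and scaling. Coefficients up to index 2
  are what a triple pole asks for.\<close>

lemma fps_inverse_one_minus_exp:
  fixes a :: complex
  assumes "a \<noteq> 0"
  defines "B \<equiv> inverse (fps_shift 1 (1 - fps_exp a))"
  shows "fps_nth B 0 = - 1 / a" "fps_nth B 1 = 1 / 2" "fps_nth B 2 = - a / 12"
proof -
  define A where "A = fps_shift 1 (1 - fps_exp a)"
  have A: "fps_nth A 0 = - a" "fps_nth A 1 = - (a\<^sup>2 / 2)" "fps_nth A 2 = - (a ^ 3 / 6)"
    unfolding A_def fps_nth_one_minus_exp by (simp_all add: eval_nat_numeral fact_numeral)
  have AB: "A * B = 1" unfolding B_def A_def[symmetric] using A assms by (intro inverse_mult_eq_1') auto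
  have "fps_nth (A * B) 0 = 1" "fps_nth (A * B) 1 = 0" "fps_nth (A * B) 2 = 0" unfolding AB by auto
  hence 0: "- a * fps_nth B 0 = 1"
    and 1: "- a * fps_nth B 1 + - (a\<^sup>2 / 2) * fps_nth B 0 = 0"
    and 2: "- a * fps_nth B 2 + - (a\<^sup>2 / 2) * fps_nth B 1 + - (a ^ 3 / 6) * fps_nth B 0 = 0"
    unfolding fps_mult_nth_le_2 A by simp_all
  show b0: "fps_nth B 0 = - 1 / a" using 0 assms by (simp add: field_simps)
  have "a * fps_nth B 1 = a / 2" using 1 assms unfolding b0 by (simp add: power2_eq_square field_simps)
  thus b1: "fps_nth B 1 = 1 / 2" using assms by simp
  have "a * fps_nth B 2 = a * (- a / 12)"
    using 2 assms unfolding b0 b1 by (simp add: power2_eq_square power3_eq_cube field_simps)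
  thus "fps_nth B 2 = - a / 12" using assms by (metis mult_left_cancel)
qed

text \<open>Three simple zeros meet in the denominator. Taking out \<open>t ^ 3\<close> leaves a
  product of one exponential and two Bernoulli series, and the residue is its coefficient of index
  2.\<close>

lemma residue_fad_kernel:
  assumes "\<tau> \<noteq> 0"
  shows "- 2 * of_real pi * \<i> * residue (fad_kernel z \<tau>) 0 = fad_refl z \<tau>"
proof -
  define a where "a = (\<lambda>b t :: complex. if t = 0 then - b else (1 - exp (b * t)) / t ^ 1)"
  have a: "a b has_fps_expansion fps_shift 1 (1 - fps_exp b)" if "b \<noteq> 0" for b
  proof -
    have "(\<lambda>t. 1 - exp (b * t)) has_fps_expansion 1 - fps_exp b"
      by (intro fps_expansion_intros)
    moreover have "1 \<le> subdegree (1 - fps_exp b)"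
      using that by (intro subdegree_geI) (auto simp: fps_eq_iff intro!: exI[of _ 1])
    ultimately show ?thesis unfolding a_def by (intro has_fps_expansion_shift) auto
  qed
  define G where "G = fps_exp (z + 1) * inverse (fps_shift 1 (1 - fps_exp 1)) * inverse (fps_shift 1 (1 - fps_exp \<tau>))"
  define g where "g = (\<lambda>t. exp ((z + 1) * t) * inverse (a 1 t) * inverse (a \<tau> t))"
  have "g has_fps_expansion G"
    unfolding g_def G_def using assms
    by (intro has_fps_expansion_mult has_fps_expansion_inverse a has_fps_expansion_exp) auto
  hence res: "residue (\<lambda>t. g t / t ^ Suc 2) 0 = fps_nth G 2"
    by (rule residue_fps_expansion_over_power_at_0)
  have "residue (fad_kernel z \<tau>) 0 = residue (\<lambda>t. g t / t ^ Suc 2) 0"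
  proof (rule residue_cong)
    have "fad_kernel z \<tau> t = g t / t ^ Suc 2" if "t \<noteq> 0" for t
    proof -
      have "e / (A * B * t) = e * inverse (A / t ^ 1) * inverse (B / t ^ 1) / t ^ Suc 2" for e A B :: complex
        using that by (cases "A = 0"; cases "B = 0") (simp_all add: field_simps eval_nat_numeral)
      thus ?thesis using that by (simp add: fad_kernel_def g_def a_def)
    qed
    thus "\<forall>\<^sub>F t in at 0. fad_kernel z \<tau> t = g t / t ^ Suc 2"
      by (auto simp: eventually_at intro!: exI[of _ 1])
  qed auto
  also have "\<dots> = fps_nth G 2" by (rule res)
  also have "\<dots> = ((z + 1)\<^sup>2 / 2 - (z + 1) * (1 + \<tau>) / 2 + \<tau> / 4 + (1 + \<tau>\<^sup>2) / 12) / \<tau>"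
  proof -
    define B where "B = inverse (fps_shift 1 (1 - fps_exp (1::complex)))"
    define C where "C = inverse (fps_shift 1 (1 - fps_exp \<tau>))"
    have B: "fps_nth B 0 = - 1" "fps_nth B 1 = 1 / 2" "fps_nth B 2 = - 1 / 12"
      using fps_inverse_one_minus_exp[of 1] by (simp_all add: B_def)
    have C: "fps_nth C 0 = - 1 / \<tau>" "fps_nth C 1 = 1 / 2" "fps_nth C 2 = - \<tau> / 12"
      using fps_inverse_one_minus_exp[OF assms] by (simp_all add: C_def)
    have E: "fps_nth (fps_exp (z + 1)) 0 = 1" "fps_nth (fps_exp (z + 1)) 1 = z + 1"
      "fps_nth (fps_exp (z + 1)) 2 = (z + 1)\<^sup>2 / 2" by (simp_all add: power2_eq_square)
    show ?thesis
      unfolding G_def B_def[symmetric] C_def[symmetric] fps_mult_nth_le_2 B C E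
      using assms by (simp add: field_simps power2_eq_square)
  qed
  finally show ?thesis by (simp add: fad_refl_def)
qed

lemma fad_kernel_minus: "fad_kernel z \<tau> (- t) = - fad_kernel (\<tau> - 1 - z) \<tau> t"
proof -
  have "fad_kernel z \<tau> (- t) = exp ((z + 1) * (- t)) / ((1 - exp (- t)) * (1 - exp (\<tau> * (- t))) * (- t))"
    by (simp add: fad_kernel_def)
  also have "(1 - exp (- t)) * (1 - exp (\<tau> * (- t))) = (1 - exp t) * (1 - exp (\<tau> * t)) / (exp t * exp (\<tau> * t))"
    by (simp add: exp_minus field_simps)
  also have "exp ((z + 1) * (- t)) / ((1 - exp t) * (1 - exp (\<tau> * t)) / (exp t * exp (\<tau> * t)) * (- t)) =
     - (exp ((z + 1) * (- t)) * (exp t * exp (\<tau> * t))) / ((1 - exp t) * (1 - exp (\<tau> * t)) * t)"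
    by simp
  also have "exp ((z + 1) * (- t)) * (exp t * exp (\<tau> * t)) = exp ((\<tau> - 1 - z + 1) * t)"
    by (simp add: exp_add[symmetric] algebra_simps)
  finally show ?thesis by (simp add: fad_kernel_def)
qed

context
  fixes y :: real
  assumes y: "0 < y" "y < 2 * pi"
begin

text \<open>By \<open>fad_kernel_minus\<close> the second integral is minus the integral of the
  first kernel over the line at height \<open>- y\<close>. Between the two lines the only pole is 0,
  so its residue gives the sum.\<close>

lemma fad_int_reflection:
  assumes d: "(z, \<tau>) \<in> fad_domain y"
  shows "fad_int y (z, \<tau>) + fad_int y (\<tau> - 1 - z, \<tau>) = fad_refl z \<tau>"
proof -
  have Ret: "Re \<tau> > 0" using fad_domain_Re_pos d y by blast
  have t0: "\<tau> \<noteq> 0" using Ret by auto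
  have d': "-1 < Re z" "Re z < Re \<tau>" "y < 2 * pi * Re (1 / \<tau>)" using d by (auto simp: fad_domain_def)
  define Y where "Y = min (2 * pi) (2 * pi * Re (1 / \<tau>))"
  have Y: "Y > y" using y d' by (auto simp: Y_def)
  define S where "S = {t. - Y < Im t \<and> Im t < Y}"
  have "S = {t. Im t > - Y} \<inter> {t. Im t < Y}" by (auto simp: S_def)
  hence S: "open S" "convex S"
    by (auto intro!: open_Int convex_Int open_halfspace_Im_gt open_halfspace_Im_lt
        convex_halfspace_Im_gt convex_halfspace_Im_lt)
  have nz: "exp (\<omega> * t) \<noteq> 1" if t: "t \<in> S" "t \<noteq> 0" and \<omega>: "\<omega> \<noteq> 0" "Y \<le> 2 * pi * Re (1 / \<omega>)" for t \<omega>
  proof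
    assume "exp (\<omega> * t) = 1"
    then obtain k :: int where k: "t = of_int k * (2 * of_real pi * \<i> / \<omega>)" "Im t = of_int k * (2 * pi * Re (1 / \<omega>))"
      using exp_mult_eq_1 \<omega>(1) by blast
    define P where "P = 2 * pi * Re (1 / \<omega>)"
    have P: "P > 0" "Y \<le> P" using \<omega>(2) Y y by (auto simp: P_def)
    have "\<bar>Im t\<bar> < P" using t P by (auto simp: S_def)
    hence "\<bar>real_of_int k\<bar> * P < 1 * P" using k(2) P by (simp add: P_def[symmetric] abs_mult)
    hence "\<bar>real_of_int k\<bar> < 1" using P mult_less_cancel_right_pos by blast
    hence "k = 0" by linarith
    thus False using k t by simp
  qed
  define s1 s2 where "s1 = of_real (1 / (1 + Re \<tau>)) * (z + 1)" and "s2 = of_real (Re \<tau> / (1 + Re \<tau>)) * (z + 1)"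
  have s12: "s1 + s2 = z + 1"
  proof -
    have "s1 + s2 = of_real (1 / (1 + Re \<tau>) + Re \<tau> / (1 + Re \<tau>)) * (z + 1)"
      by (simp add: s1_def s2_def ring_distribs)
    also have "1 / (1 + Re \<tau>) + Re \<tau> / (1 + Re \<tau>) = 1" using Ret by (simp add: add_divide_distrib[symmetric])
    finally show ?thesis by simp
  qed
  have s1: "0 < Re s1" "Re s1 < 1" using Ret d' by (auto simp: s1_def divide_less_eq intro!: divide_pos_pos)
  have s2: "0 < Re s2" "Re s2 < Re \<tau>"
  proof -
    have "Re s2 = Re \<tau> * (Re z + 1) / (1 + Re \<tau>)" by (simp add: s2_def)
    thus "0 < Re s2" "Re s2 < Re \<tau>" using Ret d'
      by (auto simp: divide_less_eq intro!: mult_pos_pos divide_pos_pos mult_strict_left_mono)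
  qed
  define \<delta>1 where "\<delta>1 = min (Re s1) (1 - Re s1)"
  define \<delta>2 where "\<delta>2 = min (Re s2) (Re \<tau> - Re s2)"
  define M where "M = \<bar>Im s1\<bar> + \<bar>Im s2\<bar> + \<bar>Im \<tau>\<bar>"
  define X where "X = max 1 (max ((1 + M * y) / 1) ((1 + M * y) / Re \<tau>))"
  define C where "C = 2 * exp (2 * M * y)"
  have M: "M \<ge> 0" by (simp add: M_def)
  have main: "(LINT x|lborel. fad_kernel z \<tau> (Complex x (- y))) - (LINT x|lborel. fad_kernel z \<tau> (Complex x y))
     = 2 * pi * \<i> * residue (fad_kernel z \<tau>) 0"
  proof (rule line_integral_shift_residue[OF S])
    show "fad_kernel z \<tau> holomorphic_on (S - {0})"
      unfolding fad_kernel_def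
    proof (intro holomorphic_intros)
      fix t assume t: "t \<in> S - {0}"
      thus "(1 - exp t) * (1 - exp (\<tau> * t)) * t \<noteq> 0"
        using nz[of t 1] nz[of t \<tau>] t0 by (simp add: Y_def)
    qed
    show "\<delta>1 + \<delta>2 > 0" using s1 s2 by (simp add: \<delta>1_def \<delta>2_def)
    show "norm (fad_kernel z \<tau> (Complex x y')) \<le> (C * C) * exp (- (\<delta>1 + \<delta>2) * \<bar>x\<bar>)"
      if y': "- y \<le> y'" "y' \<le> y" and x: "\<bar>x\<bar> \<ge> X" for x y'
    proof -
      have Xs: "X \<ge> 1" "X \<ge> (1 + M * y) / 1" "X \<ge> (1 + M * y) / Re \<tau>"
        unfolding X_def by (rule max.cobounded1, rule max.coboundedI2, rule max.cobounded1,
            rule max.coboundedI2, rule max.cobounded2)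
      have Ms: "\<bar>Im s1\<bar> \<le> M" "\<bar>Im s2\<bar> \<le> M" "\<bar>Im \<tau>\<bar> \<le> M" "\<bar>Im 1\<bar> \<le> M" by (simp_all add: M_def)
      have ds: "\<delta>1 \<le> Re s1" "\<delta>1 \<le> Re 1 - Re s1" "\<delta>1 > 0" "\<delta>2 \<le> Re s2" "\<delta>2 \<le> Re \<tau> - Re s2" "\<delta>2 > 0"
        using s1 s2 by (simp_all add: \<delta>1_def \<delta>2_def)
      have ay: "\<bar>y'\<bar> \<le> y" using y' by simp
      have k1: "norm (exp_kernel s1 1 (Complex x y')) \<le> C * exp (- \<delta>1 * \<bar>x\<bar>)"
        unfolding C_def by (rule exp_kernel_tail[OF ds(1,2,3) _ _ Ms(1,4) ay order_trans[OF Xs(2) x]]) auto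
      have k2: "norm (exp_kernel s2 \<tau> (Complex x y')) \<le> C * exp (- \<delta>2 * \<bar>x\<bar>)"
        unfolding C_def by (rule exp_kernel_tail[OF ds(4,5,6) order_refl Ret Ms(2,3) ay order_trans[OF Xs(3) x]])
      have k3: "1 \<le> norm (Complex x y')"
        using abs_Re_le_cmod[of "Complex x y'"] x Xs(1) by simp
      have hC: "C \<ge> 0" by (simp add: C_def)
      have "norm (exp_kernel s1 1 (Complex x y')) * norm (exp_kernel s2 \<tau> (Complex x y')) / norm (Complex x y')
         \<le> (C * exp (- \<delta>1 * \<bar>x\<bar>)) * (C * exp (- \<delta>2 * \<bar>x\<bar>)) / 1"
        by (rule frac_le[OF _ mult_mono[OF k1 k2] _ k3]) (use hC in auto)
      also have "\<dots> = (C * C) * exp (- (\<delta>1 + \<delta>2) * \<bar>x\<bar>)"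
        by (simp add: ring_distribs exp_add exp_diff exp_minus field_simps)
      finally show ?thesis by (simp add: fad_kernel_split[OF s12] norm_mult norm_divide)
    qed
  qed (use y Y in \<open>auto simp: S_def\<close>)
  have "(LINT x|lborel. fad_kernel z \<tau> (Complex x (- y))) = (LINT x|lborel. fad_kernel z \<tau> (Complex (0 + (-1) * x) (- y)))"
    using lborel_integral_real_affine[of "-1" "\<lambda>x. fad_kernel z \<tau> (Complex x (- y))" 0] by simp
  also have "(\<lambda>x. fad_kernel z \<tau> (Complex (0 + (-1) * x) (- y))) = (\<lambda>x. - fad_kernel (\<tau> - 1 - z) \<tau> (Complex x y))"
  proof
    fix x
    have "Complex (0 + (-1) * x) (- y) = - Complex x y" by (simp add: complex_eq_iff)
    thus "fad_kernel z \<tau> (Complex (0 + (-1) * x) (- y)) = - fad_kernel (\<tau> - 1 - z) \<tau> (Complex x y)"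
      using fad_kernel_minus by metis
  qed
  finally have "(LINT x|lborel. fad_kernel z \<tau> (Complex x (- y))) = - fad_int y (\<tau> - 1 - z, \<tau>)"
    by (simp add: fad_int_def)
  moreover have "(LINT x|lborel. fad_kernel z \<tau> (Complex x y)) = fad_int y (z, \<tau>)" by (simp add: fad_int_def)
  ultimately have "- fad_int y (\<tau> - 1 - z, \<tau>) - fad_int y (z, \<tau>) = 2 * of_real pi * \<i> * residue (fad_kernel z \<tau>) 0"
    using main by (simp only: of_real_mult of_real_numeral)
  moreover have "a + b = - 2 * of_real pi * \<i> * r" if "- b - a = 2 * of_real pi * \<i> * r" for a b r :: complex
    using that by (metis (no_types, opaque_lifting) add.commute minus_add_distrib minus_minus mult_minus_left uminus_add_conv_diff)
  ultimately have "fad_int y (z, \<tau>) + fad_int y (\<tau> - 1 - z, \<tau>) = - 2 * of_real pi * \<i> * residue (fad_kernel z \<tau>) 0"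
    by blast
  thus ?thesis using residue_fad_kernel[OF t0] by simp
qed

text \<open>Eliminating \<open>fad_int y (q + \<tau>, \<tau>)\<close> from the two shift equations
  compares the values at \<open>q\<close> and \<open>q + \<tau> - 1\<close>. As \<open>q\<close>
  tends to 0 both elementary factors vanish to first order, and the quotient of their derivatives is
  \<tau>.\<close>

lemma exp_fad_int_0_quotient:
  assumes t: "y < 2 * pi * Re (1 / \<tau>)"
  shows "exp (fad_int y (0, \<tau>)) = \<tau> * exp (fad_int y (\<tau> - 1, \<tau>))"
proof -
  have Ret: "Re \<tau> > 0" by (rule Re_pos_of_inverse[OF y(1) t])
  have t0: "\<tau> \<noteq> 0" using Ret by auto
  \<comment> \<open>The approach is through negative reals above \<open>- m\<close>: negative, so
    that \<open>q + \<tau>\<close> is still in the strip, and above \<open>- m\<close>, so that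
    \<open>q\<close> and \<open>q + \<tau> - 1\<close> are.\<close>
  define m where "m = min 1 (Re \<tau>)"
  have m: "m > 0" "m \<le> 1" "m \<le> Re \<tau>" using Ret by (auto simp: m_def)
  define q where "q = (\<lambda>n. complex_of_real (- (m / 2 * inverse (real (Suc n)))))"
  have qre: "Re (q n) < 0" "Re (q n) > - m" for n
  proof -
    have "(m / 2) * inverse (real (Suc n)) > 0" using m by simp
    moreover have "(m / 2) * inverse (real (Suc n)) \<le> (m / 2) * 1"
      using m by (intro mult_left_mono) (auto simp: field_simps)
    moreover have "Re (q n) = - (m / 2 * inverse (real (Suc n)))" unfolding q_def by (rule Re_complex_of_real)
    ultimately show "Re (q n) < 0" "Re (q n) > - m" using m by linarith+
  qed
  have q0: "q \<longlonglongrightarrow> 0"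
  proof -
    have "(\<lambda>n. complex_of_real (- (m / 2 * inverse (real (Suc n))))) \<longlonglongrightarrow> of_real (- (m / 2 * 0))"
      by (intro tendsto_of_real tendsto_minus tendsto_mult tendsto_const LIMSEQ_inverse_real_of_nat)
    thus ?thesis by (simp add: q_def)
  qed
  have qat: "filterlim q (at 0) sequentially"
    unfolding filterlim_at using q0 qre by (auto intro!: always_eventually) (metis less_irrefl zero_complex.sel(1))
  have rel: "exp (fad_int y (q n + \<tau> - 1, \<tau>)) * ((1 - e2pi (q n)) / q n) = exp (fad_int y (q n, \<tau>)) * ((1 - e2pi (q n / \<tau>)) / q n)" for n
  proof -
    have "exp (fad_int y (q n, \<tau>)) = exp (fad_int y (q n + \<tau>, \<tau>)) * (1 - e2pi (q n))"
      by (rule fad_int_shift_tau[OF y]) (use qre[of n] m t in \<open>auto simp: fad_domain_def\<close>)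
    moreover have "exp (fad_int y (q n + \<tau> - 1, \<tau>)) = exp (fad_int y (q n + \<tau> - 1 + 1, \<tau>)) * (1 - e2pi ((q n + \<tau> - 1 + 1) / \<tau>))"
      by (rule fad_int_shift_1[OF y]) (use qre[of n] m t in \<open>auto simp: fad_domain_def\<close>)
    moreover have "e2pi ((q n + \<tau>) / \<tau>) = e2pi (q n / \<tau>)" using t0 by (simp add: add_divide_distrib e2pi_add)
    ultimately show ?thesis by simp
  qed
  have contI: "isCont (\<lambda>z. fad_int y (z, \<tau>)) w" if "(w, \<tau>) \<in> fad_domain y" for w
  proof -
    have "isCont (\<lambda>z. (z, \<tau>)) w" by (intro continuous_intros)
    moreover have "isCont (fad_int y) (w, \<tau>)"
      by (rule holomorphic2_on_imp_isCont[OF holomorphic2_fad_int[OF y] that])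
    ultimately show ?thesis using isCont_o2 by blast
  qed
  have d0: "(0, \<tau>) \<in> fad_domain y" "(\<tau> - 1, \<tau>) \<in> fad_domain y" using Ret t by (auto simp: fad_domain_def)
  have der: "((\<lambda>w. (1 - e2pi (w * c)) / w) \<longlongrightarrow> - (2 * of_real pi * \<i> * c)) (at 0)" for c
  proof -
    have "((\<lambda>w. 1 - e2pi (w * c)) has_field_derivative - (2 * of_real pi * \<i> * c)) (at 0)"
      unfolding e2pi_def by (auto intro!: derivative_eq_intros)
    thus ?thesis by (simp add: has_field_derivative_iff)
  qed
  have "(\<lambda>n. exp (fad_int y (q n + \<tau> - 1, \<tau>)) * ((1 - e2pi (q n)) / q n)) \<longlonglongrightarrow>
      exp (fad_int y (0 + \<tau> - 1, \<tau>)) * (- (2 * of_real pi * \<i> * 1))"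
  proof (intro tendsto_intros)
    have "(\<lambda>n. q n + \<tau> - 1) \<longlonglongrightarrow> 0 + \<tau> - 1" by (intro tendsto_intros q0)
    from isCont_tendsto_compose[OF _ this, of "\<lambda>z. fad_int y (z, \<tau>)"]
    show "(\<lambda>n. fad_int y (q n + \<tau> - 1, \<tau>)) \<longlonglongrightarrow> fad_int y (0 + \<tau> - 1, \<tau>)" using contI d0 by simp
    from filterlim_compose[OF der[of 1] qat]
    show "(\<lambda>n. (1 - e2pi (q n)) / q n) \<longlonglongrightarrow> - (2 * of_real pi * \<i> * 1)" by simp
  qed
  moreover have "(\<lambda>n. exp (fad_int y (q n, \<tau>)) * ((1 - e2pi (q n / \<tau>)) / q n)) \<longlonglongrightarrow>
      exp (fad_int y (0, \<tau>)) * (- (2 * of_real pi * \<i> * (1 / \<tau>)))"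
  proof (intro tendsto_intros)
    from isCont_tendsto_compose[OF _ q0, of "\<lambda>z. fad_int y (z, \<tau>)"]
    show "(\<lambda>n. fad_int y (q n, \<tau>)) \<longlonglongrightarrow> fad_int y (0, \<tau>)" using contI d0 by simp
    from filterlim_compose[OF der[of "1 / \<tau>"] qat]
    show "(\<lambda>n. (1 - e2pi (q n / \<tau>)) / q n) \<longlonglongrightarrow> - (2 * of_real pi * \<i> * (1 / \<tau>))" by simp
  qed
  ultimately have "exp (fad_int y (\<tau> - 1, \<tau>)) * (- (2 * of_real pi * \<i> * 1)) =
     exp (fad_int y (0, \<tau>)) * (- (2 * of_real pi * \<i> * (1 / \<tau>)))"
    unfolding rel using LIMSEQ_unique by fastforce
  thus ?thesis using t0 by (simp add: field_simps)
qed

text \<open>The integer multiple of \<open>2 * pi * \<i>\<close> left open by the previous lemma is constant in \<open>\<tau>\<close>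
  and vanishes at \<open>\<tau> = 1\<close>.\<close>

lemma fad_int_0:
  assumes t: "y < 2 * pi * Re (1 / \<tau>)"
  shows "fad_int y (0, \<tau>) = (Ln \<tau> + fad_refl 0 \<tau>) / 2"
proof -
  define T where "T = ball (complex_of_real (pi / y)) (pi / y)"
  have T: "t \<in> T \<longleftrightarrow> y < 2 * pi * Re (1 / t)" for t unfolding T_def Re_inverse_gt_iff_ball[OF y(1)] ..
  have Rep: "Re t > 0" if "t \<in> T" for t
    using Re_pos_of_inverse[OF y(1)] that unfolding T by blast
  define D where "D = (\<lambda>t. fad_int y (0, t) - fad_int y (t - 1, t) - Ln t)"
  have eD: "exp (D t) = 1" if "t \<in> T" for t
  proof -
    have "t \<noteq> 0" using Rep[OF that] by auto
    thus ?thesis using exp_fad_int_0_quotient[of t] that unfolding T by (simp add: D_def exp_diff)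
  qed
  have "D constant_on T"
  proof (rule continuous_discrete_range_constant)
    show "connected T" by (simp add: T_def)
    show "continuous_on T D"
    proof (rule continuous_at_imp_continuous_on, rule ballI)
      fix t assume t: "t \<in> T"
      have "(0, t) \<in> fad_domain y" "(t - 1, t) \<in> fad_domain y" using t Rep[OF t] unfolding T by (auto simp: fad_domain_def)
      hence "isCont (fad_int y) (0, t)" "isCont (fad_int y) (t - 1, t)"
        by (auto intro!: holomorphic2_on_imp_isCont[OF holomorphic2_fad_int[OF y]])
      moreover have "isCont (\<lambda>t. (0, t)) t" "isCont (\<lambda>t. (t - 1, t)) t" by (intro continuous_intros)+
      ultimately have "isCont (\<lambda>t. fad_int y (0, t)) t" "isCont (\<lambda>t. fad_int y (t - 1, t)) t"
        using isCont_o2[of t "\<lambda>t. (0, t)" "fad_int y"] isCont_o2[of t "\<lambda>t. (t - 1, t)" "fad_int y"] by auto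
      moreover have "t \<notin> \<real>\<^sub>\<le>\<^sub>0" using Rep[OF t] by (auto simp: complex_nonpos_Reals_iff)
      ultimately show "isCont D t" unfolding D_def by (intro continuous_intros)
    qed
    fix t assume t: "t \<in> T"
    show "\<exists>e>0. \<forall>u. u \<in> T \<and> D u \<noteq> D t \<longrightarrow> e \<le> norm (D u - D t)"
    proof (intro exI[of _ "2 * pi"] conjI allI impI)
      fix u assume u: "u \<in> T \<and> D u \<noteq> D t"
      have "exp (D u) = exp (D t)" using eD t u by simp
      then obtain n :: int where n: "D u = D t + of_int (2 * n) * of_real pi * \<i>" by (auto simp: exp_eq)
      hence "n \<noteq> 0" using u by auto
      have "D u - D t = of_int (2 * n) * of_real pi * \<i>" using n by simp
      hence "norm (D u - D t) = norm (of_int (2 * n) * of_real pi * \<i>)" by metis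
      also have "\<dots> = \<bar>real_of_int n\<bar> * (2 * pi)" by (simp add: norm_mult)
      finally have "norm (D u - D t) = \<bar>real_of_int n\<bar> * (2 * pi)" .
      moreover have "1 * (2 * pi) \<le> \<bar>real_of_int n\<bar> * (2 * pi)"
        using \<open>n \<noteq> 0\<close> by (intro mult_right_mono) auto
      ultimately show "2 * pi \<le> norm (D u - D t)" by linarith
    qed auto
  qed
  then obtain k where k: "\<And>t. t \<in> T \<Longrightarrow> D t = k" by (auto simp: constant_on_def)
  \<comment> \<open>At modulus 1 the two arguments 0 and \<open>t - 1\<close> coincide and the
    logarithm is 0.\<close>
  have "1 \<in> T" unfolding T using y by simp
  hence "k = 0" using k[of 1] by (simp add: D_def)
  have tT: "\<tau> \<in> T" using t T by simp
  hence "D \<tau> = 0" using k \<open>k = 0\<close> by simp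
  moreover have "(0, \<tau>) \<in> fad_domain y" using t Rep[OF tT] by (simp add: fad_domain_def)
  from fad_int_reflection[OF this] have "fad_int y (0, \<tau>) + fad_int y (\<tau> - 1, \<tau>) = fad_refl 0 \<tau>" by simp
  ultimately show ?thesis by (simp add: D_def algebra_simps)
qed

end

section \<open>Faddeev's modular quantum dilogarithm\<close>

definition period_lattice :: "complex \<Rightarrow> complex set" where
  "period_lattice \<tau> = {of_int m * \<tau> + of_int n | m n. True}"

lemma period_latticeI: "z = of_int m * \<tau> + of_int n \<Longrightarrow> z \<in> period_lattice \<tau>"
  unfolding period_lattice_def by blast

lemma countable_period_lattice: "countable (period_lattice \<tau>)"
proof -
  have "period_lattice \<tau> = (\<lambda>(m, n). of_int m * \<tau> + of_int n) ` (UNIV :: (int \<times> int) set)"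
    by (auto simp: period_lattice_def image_iff)
  thus ?thesis by (simp add: countable_image)
qed

lemma not_period_lattice_dense:
  assumes "open V" "(z, \<tau>) \<in> V"
  shows "\<exists>w. (w, \<tau>) \<in> V \<and> w \<notin> period_lattice \<tau>"
proof -
  have "open {w. (w, \<tau>) \<in> V}"
    using open_vimage[OF assms(1), of "\<lambda>w. (w, \<tau>)"] by (simp add: vimage_def continuous_on_Pair)
  then obtain r where r: "r > 0" "ball z r \<subseteq> {w. (w, \<tau>) \<in> V}"
    using assms(2) open_contains_ball by (metis mem_Collect_eq)
  have "uncountable (ball z r)" using r by (simp add: uncountable_ball)
  hence "\<not> ball z r \<subseteq> period_lattice \<tau>" using countable_period_lattice countable_subset by blast
  thus ?thesis using r by blast
qed

text \<open>Here all products converge and none of them vanishes. The set is open and comes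
  arbitrarily near every point with real \<tau>, so identities on it determine the
  continuations.\<close>

definition generic_points :: "(complex \<times> complex) set" where
  "generic_points = {(z, \<tau>). Im \<tau> > 0 \<and> z \<notin> period_lattice \<tau>}"

lemma period_lattice_iff:
  assumes "Im \<tau> > 0"
  shows "z \<in> period_lattice \<tau> \<longleftrightarrow> Im z / Im \<tau> \<in> \<int> \<and> Re z - Im z / Im \<tau> * Re \<tau> \<in> \<int>"
proof
  assume "z \<in> period_lattice \<tau>"
  then obtain m n where "z = of_int m * \<tau> + of_int n" unfolding period_lattice_def by blast
  hence "Im z / Im \<tau> = of_int m" "Re z - Im z / Im \<tau> * Re \<tau> = of_int n" using assms by auto
  thus "Im z / Im \<tau> \<in> \<int> \<and> Re z - Im z / Im \<tau> * Re \<tau> \<in> \<int>" by simp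
next
  assume *: "Im z / Im \<tau> \<in> \<int> \<and> Re z - Im z / Im \<tau> * Re \<tau> \<in> \<int>"
  obtain m where m: "Im z / Im \<tau> = of_int m" using * Ints_cases by blast
  obtain n where n: "Re z - Im z / Im \<tau> * Re \<tau> = of_int n" using * Ints_cases by blast
  note mn = m n
  have "Im z = of_int m * Im \<tau>" using mn(1) assms by (simp add: field_simps)
  moreover have "Re z = of_int m * Re \<tau> + of_int n" using mn(2) unfolding mn(1) by simp
  ultimately show "z \<in> period_lattice \<tau>" by (intro period_latticeI[of _ m _ n]) (simp add: complex_eq_iff)
qed

text \<open>In the real coordinates of \<open>z\<close> with respect to \<tau> and 1, membership in
  the lattice is integrality of two continuous functions, a closed condition jointly in both
  variables.\<close>

lemma open_generic_points: "open generic_points"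
proof -
  define H where "H = (UNIV \<times> {\<tau>. Im \<tau> > 0} :: (complex \<times> complex) set)"
  have H: "open H" unfolding H_def by (intro open_Times open_UNIV open_halfspace_Im_gt)
  define X where "X = (\<lambda>p :: complex \<times> complex. Im (fst p) / Im (snd p))"
  define Y where "Y = (\<lambda>p :: complex \<times> complex. Re (fst p) - Im (fst p) / Im (snd p) * Re (snd p))"
  have cX: "continuous_on H X" "continuous_on H Y"
    unfolding X_def Y_def H_def by (auto intro!: continuous_intros)
  have "open (H \<inter> X -` (- \<int>))" "open (H \<inter> Y -` (- \<int>))"
    by (intro continuous_open_preimage cX H, simp add: open_Compl closed_Ints)+
  moreover have "generic_points = (H \<inter> X -` (- \<int>)) \<union> (H \<inter> Y -` (- \<int>))"
    by (auto simp: generic_points_def H_def X_def Y_def period_lattice_iff)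
  ultimately show ?thesis using open_Un by metis
qed

lemma generic_points_meet:
  assumes "open V" "(z, \<tau>) \<in> V" "Im \<tau> > 0"
  shows "V \<inter> generic_points \<noteq> {}"
  using not_period_lattice_dense[OF assms(1,2)] assms(3) by (auto simp: generic_points_def)

lemma generic_points_meet_real:
  assumes "open V" "(z, \<tau>) \<in> V" "Im \<tau> = 0"
  shows "V \<inter> generic_points \<noteq> {}"
proof -
  have "open {w. (z, w) \<in> V}"
    using open_vimage[OF assms(1), of "\<lambda>w. (z, w)"] by (simp add: vimage_def continuous_on_Pair)
  then obtain r where r: "r > 0" "ball \<tau> r \<subseteq> {w. (z, w) \<in> V}"
    using assms(2) open_contains_ball by (metis mem_Collect_eq)
  have "dist \<tau> (\<tau> + \<i> * of_real (r / 2)) < r" using r by (simp add: dist_norm norm_mult)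
  hence "(z, \<tau> + \<i> * of_real (r / 2)) \<in> V" using r by auto
  thus ?thesis by (rule generic_points_meet[OF assms(1)]) (use assms r in auto)
qed

lemma varpi_tau_of_int: "varpi z (t + of_int n) = varpi z t"
proof -
  have "e2pi (z + of_nat k * (t + of_int n)) = e2pi (z + of_nat k * t)" for k
    using e2pi_add_of_int[of "z + of_nat k * t" "int k * n"] by (simp add: algebra_simps)
  thus ?thesis by (simp add: varpi_def)
qed

lemma fad_num_den_zero:
  assumes "Im \<tau> \<noteq> 0" "fad_num z \<tau> = 0 \<or> fad_den z \<tau> = 0"
  shows "z \<in> period_lattice \<tau>"
proof -
  have t0: "\<tau> \<noteq> 0" using assms by auto
  show ?thesis
  proof (cases "Im \<tau> > 0")
    case True
    from assms(2) consider "varpi z \<tau> = 0" | "varpi (z / \<tau>) (- 1 / \<tau>) = 0"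
      using True by (auto simp: fad_num_def fad_den_def)
    thus ?thesis
    proof cases
      case 1
      then obtain k :: nat where "z + of_nat k * \<tau> \<in> \<int>" using varpi_eq_0_iff[OF True] by blast
      then obtain n where "z + of_nat k * \<tau> = of_int n" by (elim Ints_cases)
      thus ?thesis by (intro period_latticeI[of _ "- int k" _ n]) (simp add: algebra_simps)
    next
      case 2
      then obtain k :: nat where "z / \<tau> + of_nat k * (- 1 / \<tau>) \<in> \<int>"
        using varpi_eq_0_iff[OF Im_minus_inverse_pos[OF True]] by blast
      then obtain n where "z / \<tau> + of_nat k * (- 1 / \<tau>) = of_int n" by (elim Ints_cases)
      thus ?thesis using t0 by (intro period_latticeI[of _ n _ "int k"]) (simp add: field_simps)
    qed
  next
    case False
    hence t: "Im (cnj \<tau>) > 0" using assms by simp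
    from assms(2) consider "varpi (cnj (\<tau> - 1 - z) / cnj \<tau>) (- 1 / cnj \<tau>) = 0" | "varpi (cnj (\<tau> - 1 - z)) (cnj \<tau>) = 0"
      using False by (auto simp: fad_num_def fad_den_def)
    thus ?thesis
    proof cases
      case 2
      then obtain k :: nat where "cnj (\<tau> - 1 - z) + of_nat k * cnj \<tau> \<in> \<int>" using varpi_eq_0_iff[OF t] by blast
      then obtain n where "cnj (\<tau> - 1 - z) + of_nat k * cnj \<tau> = of_int n" by (elim Ints_cases)
      hence "cnj (cnj (\<tau> - 1 - z) + of_nat k * cnj \<tau>) = cnj (of_int n)" by simp
      hence "\<tau> - 1 - z + of_nat k * \<tau> = of_int n" by simp
      thus ?thesis by (intro period_latticeI[of _ "1 + int k" _ "- 1 - n"]) (simp add: algebra_simps)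
    next
      case 1
      then obtain k :: nat where "cnj (\<tau> - 1 - z) / cnj \<tau> + of_nat k * (- 1 / cnj \<tau>) \<in> \<int>"
        using varpi_eq_0_iff[OF Im_minus_inverse_pos[OF t]] by blast
      then obtain n where "cnj (\<tau> - 1 - z) / cnj \<tau> + of_nat k * (- 1 / cnj \<tau>) = of_int n" by (elim Ints_cases)
      hence "cnj (cnj (\<tau> - 1 - z) / cnj \<tau> + of_nat k * (- 1 / cnj \<tau>)) = cnj (of_int n)" by simp
      hence "(\<tau> - 1 - z - of_nat k) / \<tau> = of_int n" using t0 by (simp add: diff_divide_distrib)
      hence "\<tau> - 1 - z - of_nat k = of_int n * \<tau>" by (simp only: nonzero_divide_eq_eq[OF t0])
      thus ?thesis by (intro period_latticeI[of _ "1 - n" _ "- 1 - int k"]) (simp add: algebra_simps)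
    qed
  qed
qed

definition fad_shift_fac :: "nat \<Rightarrow> complex \<Rightarrow> complex \<Rightarrow> complex" where
  "fad_shift_fac n z \<tau> = (\<Prod>k<n. 1 - e2pi ((z - of_nat k) / \<tau>))"

lemma fad_shift_fac_zero:
  assumes "fad_shift_fac n z \<tau> = 0" "\<tau> \<noteq> 0"
  shows "z \<in> period_lattice \<tau>"
proof -
  obtain k where "1 - e2pi ((z - of_nat k) / \<tau>) = 0" using assms(1) by (auto simp: fad_shift_fac_def)
  hence "e2pi ((z - of_nat k) / \<tau>) = 1" by (metis eq_iff_diff_eq_0)
  then obtain m where "(z - of_nat k) / \<tau> = of_int m" unfolding e2pi_eq_1_iff by (elim Ints_cases)
  thus ?thesis using assms(2) by (intro period_latticeI[of _ m _ "int k"]) (simp add: field_simps)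
qed

text \<open>An integer shift of \<open>z\<close> is invisible to the product with modulus \<tau> and
  removes the first \<open>n\<close> factors from the one with modulus
  \<open>- 1 / \<tau>\<close>.\<close>

lemma fad_shift_upper:
  assumes "Im \<tau> > 0"
  shows "fad_num (z - of_nat n) \<tau> = fad_num z \<tau>"
    and "fad_den z \<tau> = fad_shift_fac n z \<tau> * fad_den (z - of_nat n) \<tau>"
proof -
  show "fad_num (z - of_nat n) \<tau> = fad_num z \<tau>"
    using assms varpi_of_int[of z "- int n" \<tau>] by (simp add: fad_num_def)
  have "varpi (z / \<tau>) (- 1 / \<tau>) = fad_shift_fac n z \<tau> * varpi ((z - of_nat n) / \<tau>) (- 1 / \<tau>)"
    using varpi_split[OF Im_minus_inverse_pos[OF assms], of "z / \<tau>" n]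
    by (simp add: fad_shift_fac_def diff_divide_distrib)
  thus "fad_den z \<tau> = fad_shift_fac n z \<tau> * fad_den (z - of_nat n) \<tau>" using assms by (simp add: fad_den_def)
qed

text \<open>Now the numerator carries the modulus that notices the shift. The quotient changes by
  the same factor as in the upper half-plane, which allows one formula on both sides of the real
  axis.\<close>

lemma fad_shift_lower:
  assumes "Im \<tau> < 0"
  shows "fad_den (z - of_nat n) \<tau> = fad_den z \<tau>"
    and "fad_num (z - of_nat n) \<tau> = fad_shift_fac n z \<tau> * fad_num z \<tau>"
proof -
  have t: "Im (cnj \<tau>) > 0" "\<tau> \<noteq> 0" using assms by auto
  show "fad_den (z - of_nat n) \<tau> = fad_den z \<tau>"
    using assms varpi_of_int[of "cnj (\<tau> - 1 - z)" "int n" "cnj \<tau>"] by (simp add: fad_den_def algebra_simps)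
  have nI: "(Im \<tau> > 0) = False" using assms by simp
  define w where "w = cnj (\<tau> - 1 - z)"
  have "varpi ((w + of_nat n) / cnj \<tau>) (- 1 / cnj \<tau>) =
     (\<Prod>k<n. 1 - e2pi ((w + of_nat n - of_nat k) / cnj \<tau>)) * varpi (w / cnj \<tau>) (- 1 / cnj \<tau>)"
    using varpi_split[OF Im_minus_inverse_pos[OF t(1)], of "(w + of_nat n) / cnj \<tau>" n]
    by (simp add: diff_divide_distrib add_divide_distrib)
  \<comment> \<open>Reversing the order makes the factors match one by one with the conjugates of
    those in \<open>fad_shift_fac\<close>; the leftover summand 1 in the argument is lost in
    \<open>e2pi\<close>.\<close>
  also have "(\<Prod>k<n. 1 - e2pi ((w + of_nat n - of_nat k) / cnj \<tau>)) = (\<Prod>k<n. 1 - e2pi ((w + of_nat n - of_nat (n - Suc k)) / cnj \<tau>))"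
    by (rule prod.nat_diff_reindex[symmetric])
  also have "\<dots> = (\<Prod>k<n. cnj (1 - e2pi ((z - of_nat k) / \<tau>)))"
  proof (rule prod.cong[OF refl])
    fix k assume "k \<in> {..<n}"
    hence "w + of_nat n - of_nat (n - Suc k) = w + 1 + of_nat k" by (simp add: of_nat_diff)
    also have "\<dots> = cnj (\<tau> - (z - of_nat k))" by (simp add: w_def)
    finally have "(w + of_nat n - of_nat (n - Suc k)) / cnj \<tau> = - cnj ((z - of_nat k) / \<tau>) + 1"
      using t(2) by (simp add: field_simps)
    thus "1 - e2pi ((w + of_nat n - of_nat (n - Suc k)) / cnj \<tau>) = cnj (1 - e2pi ((z - of_nat k) / \<tau>))"
      by (simp only: e2pi_add e2pi_cnj e2pi_of_int mult_1_right complex_cnj_diff complex_cnj_one)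
  qed
  finally have "cnj (varpi ((w + of_nat n) / cnj \<tau>) (- 1 / cnj \<tau>)) = fad_shift_fac n z \<tau> * cnj (varpi (w / cnj \<tau>) (- 1 / cnj \<tau>))"
    by (simp add: fad_shift_fac_def)
  moreover have "cnj (\<tau> - 1 - (z - of_nat n)) = w + of_nat n" by (simp add: w_def)
  ultimately show "fad_num (z - of_nat n) \<tau> = fad_shift_fac n z \<tau> * fad_num z \<tau>"
    using nI by (simp only: fad_num_def if_False w_def[symmetric])
qed

lemma holomorphic2_fad_num_den:
  "(\<lambda>p. fad_num (fst p) (snd p)) holomorphic2_on {p. Im (snd p) \<noteq> 0}"
  "(\<lambda>p. fad_den (fst p) (snd p)) holomorphic2_on {p. Im (snd p) \<noteq> 0}"
proof -
  define U L where "U = {p :: complex \<times> complex. Im (snd p) > 0}" and "L = {p :: complex \<times> complex. Im (snd p) < 0}"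
  have o: "open U" "open L" unfolding U_def L_def by (intro open_Collect_less continuous_intros)+
  note hi = holomorphic2_on_fst holomorphic2_on_snd holomorphic2_on_const holomorphic2_on_diff
  have t: "Im (- 1 / snd p) > 0" if "p \<in> U" for p
    using that Im_minus_inverse_pos[of "snd p"] by (simp only: U_def mem_Collect_eq)
  have U1: "(\<lambda>p. varpi (fst p) (snd p)) holomorphic2_on U"
    by (rule holomorphic2_varpi_compose) (auto simp: U_def intro: hi)
  have U2: "(\<lambda>p. varpi (fst p / snd p) (- 1 / snd p)) holomorphic2_on U"
    by (rule holomorphic2_varpi_compose[OF _ _ t]) (auto simp: U_def intro!: holomorphic2_on_divide hi)
  have V1: "(\<lambda>p. varpi ((snd p - 1 - fst p) / snd p) (- 1 / snd p)) holomorphic2_on U"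
    by (rule holomorphic2_varpi_compose[OF _ _ t]) (auto simp: U_def intro!: holomorphic2_on_divide hi)
  have V2: "(\<lambda>p. varpi (snd p - 1 - fst p) (snd p)) holomorphic2_on U"
    by (rule holomorphic2_varpi_compose) (auto simp: U_def intro!: hi)
  have L1: "(\<lambda>p. cnj (varpi ((snd (cnj (fst p), cnj (snd p)) - 1 - fst (cnj (fst p), cnj (snd p))) / snd (cnj (fst p), cnj (snd p))) (- 1 / snd (cnj (fst p), cnj (snd p))))) holomorphic2_on L"
    by (rule holomorphic2_on_cnj[OF V1]) (auto simp: U_def L_def)
  have L2: "(\<lambda>p. cnj (varpi (snd (cnj (fst p), cnj (snd p)) - 1 - fst (cnj (fst p), cnj (snd p))) (snd (cnj (fst p), cnj (snd p))))) holomorphic2_on L"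
    by (rule holomorphic2_on_cnj[OF V2]) (auto simp: U_def L_def)
  have hU: "(\<lambda>p. fad_num (fst p) (snd p)) holomorphic2_on U" "(\<lambda>p. fad_den (fst p) (snd p)) holomorphic2_on U"
    by (rule holomorphic2_on_cong[OF U1 o(1)], simp add: U_def fad_num_def,
        rule holomorphic2_on_cong[OF U2 o(1)], simp add: U_def fad_den_def)
  have hL: "(\<lambda>p. fad_num (fst p) (snd p)) holomorphic2_on L" "(\<lambda>p. fad_den (fst p) (snd p)) holomorphic2_on L"
    by (rule holomorphic2_on_cong[OF L1 o(2)], simp add: L_def fad_num_def,
        rule holomorphic2_on_cong[OF L2 o(2)], simp add: L_def fad_den_def)
  have c: "p \<in> U \<or> p \<in> L" if "p \<in> {p. Im (snd p) \<noteq> 0}" for p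
    using that by (auto simp: U_def L_def)
  show "(\<lambda>p. fad_num (fst p) (snd p)) holomorphic2_on {p. Im (snd p) \<noteq> 0}"
    by (rule holomorphic2_on_Union) (use c hU(1) hL(1) in blast)
  show "(\<lambda>p. fad_den (fst p) (snd p)) holomorphic2_on {p. Im (snd p) \<noteq> 0}"
    by (rule holomorphic2_on_Union) (use c hU(2) hL(2) in blast)
qed

text \<open>Near a positive real modulus, an integer shift of \<open>z\<close> leads into the strip where the quotient
  is given by Faddeev's integral.\<close>

lemma fad_local:
  assumes J: "J > 0"
  shows "\<exists>N g h. open N \<and> (w0, complex_of_real J) \<in> N \<and> g holomorphic2_on N \<and> h holomorphic2_on N \<and>
    (\<forall>p\<in>N. fst p \<notin> period_lattice (snd p) \<longrightarrow> g p \<noteq> 0 \<and> h p \<noteq> 0) \<and>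
    (\<forall>p\<in>N. Im (snd p) \<noteq> 0 \<longrightarrow> fad_num (fst p) (snd p) * h p = g p * fad_den (fst p) (snd p))"
proof -
  \<comment> \<open>Half of the smaller of the first pole heights \<open>2 * pi\<close> and
    \<open>2 * pi / J\<close>, so that the line stays below both with room to vary the
    modulus.\<close>
  define y where "y = min (pi / J) pi"
  have y: "0 < y" "y < 2 * pi" using J by (auto simp: y_def min_less_iff_disj)
  have Re1J: "Re (1 / complex_of_real J) = 1 / J" using J by (simp add: Re_inverse_complex power2_eq_square)
  have "y < 2 * pi * (1 / J)"
  proof -
    have "y \<le> pi / J" by (simp add: y_def)
    also have "\<dots> < 2 * pi * (1 / J)" using J by (simp add: field_simps)
    finally show ?thesis .
  qed
  hence yJ: "y < 2 * pi * Re (1 / complex_of_real J)" unfolding Re1J .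
  \<comment> \<open>After subtraction of \<open>n\<close> the real part lies in
    \<open>(-1, 0]\<close>, inside the strip for every positive \<open>J\<close>.\<close>
  define n where "n = \<lceil>Re w0\<rceil>"
  have n: "Re w0 - of_int n \<le> 0" "Re w0 - of_int n > -1" unfolding n_def by linarith+
  define N where "N = {p. (fst p - of_int n, snd p) \<in> fad_domain y}"
  have "continuous_on UNIV (\<lambda>p :: complex \<times> complex. (fst p - of_int n, snd p))" by (intro continuous_intros)
  hence oN: "open N" unfolding N_def using open_vimage[OF open_fad_domain[OF y(1)]] by (simp add: vimage_def)
  have inN: "(w0, complex_of_real J) \<in> N" using n yJ J by (simp add: N_def fad_domain_def)
  have nz: "snd p \<noteq> 0" if "p \<in> N" for p
    using fad_domain_Re_pos[of "fst p - of_int n" "snd p" y] that y by (auto simp: N_def)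
  have hI: "(\<lambda>p. exp (fad_int y (fst p - of_int n, snd p))) holomorphic2_on N"
    by (intro holomorphic2_on_exp holomorphic2_on_compose[OF _ _ holomorphic2_fad_int[OF y]])
       (auto simp: N_def intro!: holomorphic2_on_diff)
  have hP: "(\<lambda>p. fad_shift_fac k (fst p + of_int q) (snd p)) holomorphic2_on N" for k q
    unfolding fad_shift_fac_def using nz
    by (intro holomorphic2_on_prod holomorphic2_on_diff holomorphic2_on_const holomorphic2_e2pi holomorphic2_on_divide
        holomorphic2_on_add holomorphic2_on_fst holomorphic2_on_snd)
  have prod: "exp (fad_int y (fst p - of_int n, snd p)) * fad_den (fst p - of_int n) (snd p) = fad_num (fst p - of_int n) (snd p)"
    if "p \<in> N" "Im (snd p) \<noteq> 0" for p
    by (rule fad_int_product[OF y]) (use that in \<open>auto simp: N_def\<close>)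
  show ?thesis
  proof (cases "n \<ge> 0")
    case True
    define k where "k = nat n"
    have k: "complex_of_int n = of_nat k" using True by (simp add: k_def)
    show ?thesis
    proof (intro exI conjI ballI impI)
      show "(\<lambda>p. exp (fad_int y (fst p - of_int n, snd p))) holomorphic2_on N" by (rule hI)
      show "(\<lambda>p. fad_shift_fac k (fst p + of_int 0) (snd p)) holomorphic2_on N" by (rule hP)
      fix p assume p: "p \<in> N"
      show "fad_shift_fac k (fst p + of_int 0) (snd p) \<noteq> 0" if "fst p \<notin> period_lattice (snd p)"
        using fad_shift_fac_zero[of k "fst p" "snd p"] nz[OF p] that by auto
      assume im: "Im (snd p) \<noteq> 0"
      show "fad_num (fst p) (snd p) * fad_shift_fac k (fst p + of_int 0) (snd p) =
         exp (fad_int y (fst p - of_int n, snd p)) * fad_den (fst p) (snd p)"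
      proof (cases "Im (snd p) > 0")
        case True
        from fad_shift_upper[OF True, of "fst p" k] prod[OF p im] show ?thesis unfolding k by (simp add: mult_ac)
      next
        case False
        hence "Im (snd p) < 0" using im by simp
        from fad_shift_lower[OF this, of "fst p" k] prod[OF p im] show ?thesis unfolding k by (simp add: mult_ac)
      qed
    qed (use oN inN in auto)
  next
    case False
    \<comment> \<open>For negative \<open>n\<close> the shift formula is applied at the point
      \<open>z + k\<close>; the factor then multiplies the exponential, and \<open>h\<close> is
      1.\<close>
    define k where "k = nat (- n)"
    have k: "complex_of_int n = - of_nat k" using False by (simp add: k_def)
    show ?thesis
    proof (intro exI conjI ballI impI)
      show "(\<lambda>p. fad_shift_fac k (fst p + of_int (int k)) (snd p) * exp (fad_int y (fst p - of_int n, snd p))) holomorphic2_on N"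
        by (intro holomorphic2_on_mult hI hP)
      show "(\<lambda>_. 1) holomorphic2_on N" by (rule holomorphic2_on_const)
      fix p assume p: "p \<in> N"
      show "fad_shift_fac k (fst p + of_int (int k)) (snd p) * exp (fad_int y (fst p - of_int n, snd p)) \<noteq> 0"
        if nl: "fst p \<notin> period_lattice (snd p)"
      proof -
        have "fst p + of_int (int k) \<notin> period_lattice (snd p)"
        proof
          assume "fst p + of_int (int k) \<in> period_lattice (snd p)"
          then obtain m q where "fst p + of_int (int k) = of_int m * snd p + of_int q" unfolding period_lattice_def by blast
          hence "fst p = of_int m * snd p + of_int (q - int k)" by (simp add: algebra_simps)
          thus False using nl period_latticeI by blast
        qed
        thus ?thesis using fad_shift_fac_zero[of k "fst p + of_int (int k)" "snd p"] nz[OF p] by auto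
      qed
      assume im: "Im (snd p) \<noteq> 0"
      have eq: "fst p - of_int n = fst p + of_int (int k)" unfolding k by simp
      show "fad_num (fst p) (snd p) * 1 =
         fad_shift_fac k (fst p + of_int (int k)) (snd p) * exp (fad_int y (fst p - of_int n, snd p)) * fad_den (fst p) (snd p)"
      proof (cases "Im (snd p) > 0")
        case True
        from fad_shift_upper[OF True, of "fst p + of_int (int k)" k] prod[OF p im] show ?thesis unfolding eq by (simp add: mult_ac)
      next
        case False
        hence "Im (snd p) < 0" using im by simp
        from fad_shift_lower[OF this, of "fst p + of_int (int k)" k] prod[OF p im] show ?thesis
          unfolding eq by (simp add: mult_ac)
      qed
    qed (use oN inN in auto)
  qed
qed

section \<open>Reduction to the matrix \<open>S\<close>\<close>

lemma prod_int_nat: "(\<Prod>l<nat c. f (int l)) = (\<Prod>l\<in>{0..<c}. f l)"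
  by (rule prod.reindex_bij_witness[of _ nat int]) auto

lemma varpi_distribution_int:
  assumes "Im t > 0" "c > 0"
  shows "varpi z t = (\<Prod>l\<in>{0..<c}. varpi (z + of_int l * t) (of_int c * t))"
proof -
  have "varpi z t = (\<Prod>l<nat c. varpi (z + of_int (int l) * t) (of_int c * t))"
    using varpi_distribution[OF assms(1), of "nat c" z] assms(2) by simp
  also have "\<dots> = (\<Prod>l\<in>{0..<c}. varpi (z + of_int l * t) (of_int c * t))"
    by (rule prod_int_nat)
  finally show ?thesis .
qed

lemma bij_betw_mult_mod:
  fixes c d :: int
  assumes "c > 0" "coprime c d"
  shows "bij_betw (\<lambda>l. l * d mod c) {0..<c} {0..<c}"
proof -
  have "inj_on (\<lambda>l. l * d mod c) {0..<c}"
  proof (rule inj_onI)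
    fix l m assume lm: "l \<in> {0..<c}" "m \<in> {0..<c}" "l * d mod c = m * d mod c"
    hence "c dvd (l - m) * d" by (metis left_diff_distrib mod_eq_dvd_iff)
    hence "c dvd l - m" using assms(2) by (simp add: coprime_dvd_mult_left_iff)
    hence "l mod c = m mod c" by (simp add: mod_eq_dvd_iff)
    thus "l = m" using lm by simp
  qed
  moreover have "(\<lambda>l. l * d mod c) ` {0..<c} \<subseteq> {0..<c}" using assms(1) by auto
  ultimately show ?thesis by (simp add: bij_betw_def endo_inj_surj)
qed

definition lin :: "int \<Rightarrow> int \<Rightarrow> complex \<Rightarrow> complex" where
  "lin c d \<tau> = of_int c * \<tau> + of_int d"

lemma Im_lin [simp]: "Im (lin c d \<tau>) = of_int c * Im \<tau>"
  by (simp add: lin_def)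

text \<open>The integer shift makes \<open>fad_arg c d l (0, \<tau>)\<close> lie in the strip of Faddeev's integral.\<close>

definition fad_arg :: "int \<Rightarrow> int \<Rightarrow> int \<Rightarrow> complex \<times> complex \<Rightarrow> complex" where
  "fad_arg c d l p = fst p + of_int l * snd p + of_int (l * d div c)"

definition gam_num :: "int \<Rightarrow> int \<Rightarrow> complex \<times> complex \<Rightarrow> complex" where
  "gam_num c d p = (\<Prod>l\<in>{0..<c}. fad_num (fad_arg c d l p) (lin c d (snd p)))"

definition gam_den :: "int \<Rightarrow> int \<Rightarrow> complex \<times> complex \<Rightarrow> complex" where
  "gam_den c d p = (\<Prod>l\<in>{0..<c}. fad_den (fad_arg c d l p) (lin c d (snd p)))"

definition gam_domain :: "int \<Rightarrow> int \<Rightarrow> (complex \<times> complex) set" where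
  "gam_domain c d = {p. lin c d (snd p) \<notin> \<real>\<^sub>\<le>\<^sub>0}"

lemma fad_arg_period_lattice:
  assumes "fad_arg c d l p \<in> period_lattice (lin c d (snd p))"
  shows "fst p \<in> period_lattice (snd p)"
proof -
  obtain m n where "fad_arg c d l p = of_int m * lin c d (snd p) + of_int n"
    using assms unfolding period_lattice_def by blast
  hence "fst p = of_int (m * c - l) * snd p + of_int (m * d + n - l * d div c)"
    by (simp add: fad_arg_def lin_def algebra_simps)
  thus ?thesis by (rule period_latticeI)
qed

lemma holomorphic2_lin: "(\<lambda>p. lin c d (snd p)) holomorphic2_on U"
  unfolding lin_def by (intro holomorphic2_on_add holomorphic2_on_mult holomorphic2_on_const holomorphic2_on_snd)

lemma holomorphic2_fad_arg: "(\<lambda>p. fad_arg c d l p) holomorphic2_on U"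
  unfolding fad_arg_def
  by (intro holomorphic2_on_add holomorphic2_on_mult holomorphic2_on_const holomorphic2_on_snd holomorphic2_on_fst)

lemma continuous_fad_arg_lin: "continuous_on UNIV (\<lambda>p. (fad_arg c d l p, lin c d (snd p)))"
  by (intro continuous_on_Pair holomorphic2_on_imp_continuous_on holomorphic2_lin holomorphic2_fad_arg)

lemma open_gam_domain: "open (gam_domain c d)"
proof -
  have "continuous_on UNIV (\<lambda>p :: complex \<times> complex. lin c d (snd p))"
    by (intro holomorphic2_on_imp_continuous_on holomorphic2_lin)
  from open_vimage[OF _ this, of "- \<real>\<^sub>\<le>\<^sub>0"] show ?thesis
    by (simp add: gam_domain_def vimage_def open_Compl)
qed

lemma nonperiod_point_dense:
  assumes "open V" "V \<noteq> {}"
  shows "\<exists>x\<in>V. Im (snd x) \<noteq> 0 \<and> fst x \<notin> period_lattice (snd x)"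
proof -
  obtain z \<tau> where p: "(z, \<tau>) \<in> V" using assms by auto
  show ?thesis
  proof (cases "Im \<tau> = 0")
    case True
    thus ?thesis using generic_points_meet_real[OF assms(1) p] by (fastforce simp: generic_points_def)
  next
    case False
    obtain w where "(w, \<tau>) \<in> V" "w \<notin> period_lattice \<tau>"
      using not_period_lattice_dense[OF assms(1) p] by blast
    thus ?thesis using False by (intro bexI[of _ "(w, \<tau>)"]) auto
  qed
qed

context
  fixes a b c d :: int
  assumes det: "a * d - b * c = 1" and c: "c > 0"
begin

lemma coprime_c_d: "coprime c d"
proof (rule coprimeI)
  fix k assume "k dvd c" "k dvd d"
  hence "k dvd a * d - b * c" by simp
  thus "is_unit k" using det by simp
qed

text \<open>The determinant gives \<open>c (a \<tau> + b) = a j - 1\<close>. Hence \<open>c\<close>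
  times the Moebius image is \<open>- 1 / j\<close> up to an integer, the modulus that belongs to
  the matrix \<open>S\<close>.\<close>

lemma lin_upper:
  assumes "Im \<tau> > 0"
  shows "Im (lin c d \<tau>) > 0" "lin c d \<tau> \<noteq> 0"
    "of_int c * (lin a b \<tau> / lin c d \<tau>) = - 1 / lin c d \<tau> + of_int a"
    "Im (lin a b \<tau> / lin c d \<tau>) > 0"
proof -
  show j: "Im (lin c d \<tau>) > 0" using assms c by simp
  thus j0: "lin c d \<tau> \<noteq> 0" by (metis less_irrefl zero_complex.sel(2))
  have "of_int c * lin a b \<tau> = - 1 + of_int a * lin c d \<tau>"
  proof -
    have "of_int c * lin a b \<tau> - of_int a * lin c d \<tau> = - of_int (a * d - b * c)"
      by (simp add: lin_def algebra_simps)
    thus ?thesis unfolding det by (simp add: algebra_simps)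
  qed
  thus eq: "of_int c * (lin a b \<tau> / lin c d \<tau>) = - 1 / lin c d \<tau> + of_int a"
    using j0 by (simp add: field_simps)
  have "of_int c * Im x = Im (of_int c * x)" for x :: complex by simp
  hence "of_int c * Im (lin a b \<tau> / lin c d \<tau>) = Im (of_int c * (lin a b \<tau> / lin c d \<tau>))" .
  also have "\<dots> = Im (- 1 / lin c d \<tau>)" unfolding eq by simp
  also have "\<dots> > 0" by (rule Im_minus_inverse_pos[OF j])
  finally show "Im (lin a b \<tau> / lin c d \<tau>) > 0" using c by (simp add: zero_less_mult_iff)
qed

text \<open>The distribution relation is applied to both products. Their moduli become
  \<open>c \<tau> = j - d\<close> and \<open>a - 1 / j\<close>, and the integers may be dropped;
  only the arguments have to be matched residue by residue.\<close>

lemma gam_upper: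
  assumes "Im \<tau> > 0"
  shows "gam_num c d (z, \<tau>) = varpi z \<tau>"
    and "gam_den c d (z, \<tau>) = varpi (z / lin c d \<tau>) (lin a b \<tau> / lin c d \<tau>)"
proof -
  note j = lin_upper[OF assms]
  have "varpi z \<tau> = (\<Prod>l\<in>{0..<c}. varpi (z + of_int l * \<tau>) (of_int c * \<tau>))"
    by (rule varpi_distribution_int[OF assms c])
  also have "\<dots> = (\<Prod>l\<in>{0..<c}. fad_num (fad_arg c d l (z, \<tau>)) (lin c d \<tau>))"
    using j(1) by (intro prod.cong refl) (simp add: fad_num_def fad_arg_def lin_def varpi_tau_of_int del: of_int_add)
  finally show "gam_num c d (z, \<tau>) = varpi z \<tau>" by (simp add: gam_num_def)
  define \<gamma> where "\<gamma> = lin a b \<tau> / lin c d \<tau>"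
  define J where "J = lin c d \<tau>"
  have "varpi (z / J) \<gamma> = (\<Prod>l\<in>{0..<c}. varpi (z / J + of_int l * \<gamma>) (of_int c * \<gamma>))"
    by (rule varpi_distribution_int[OF _ c]) (use j in \<open>simp add: \<gamma>_def\<close>)
  also have "\<dots> = (\<Prod>l\<in>{0..<c}. varpi (z / J + of_int l * \<gamma>) (- 1 / J))"
  proof -
    have "of_int c * \<gamma> = - 1 / J + of_int a" using j(3) by (simp only: \<gamma>_def J_def)
    thus ?thesis by (simp only: varpi_tau_of_int)
  qed
  \<comment> \<open>The residue \<open>l\<close> of the numerator belongs to the residue
    \<open>l * d\<close> of the denominator, and multiplication by \<open>d\<close> permutes
    residues because \<open>d\<close> is prime to \<open>c\<close>.\<close>
  also have "\<dots> = (\<Prod>l\<in>{0..<c}. varpi (z / J + of_int (l * d mod c) * \<gamma>) (- 1 / J))"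
    by (rule prod.reindex_bij_betw[OF bij_betw_mult_mod[OF c coprime_c_d], symmetric])
  also have "\<dots> = (\<Prod>l\<in>{0..<c}. fad_den (fad_arg c d l (z, \<tau>)) J)"
  proof (rule prod.cong[OF refl])
    fix l
    define m where "m = l * d div c"
    have lm: "l * d mod c = l * d - c * m" unfolding m_def by (simp add: minus_mult_div_eq_mod)
    \<comment> \<open>The inverse matrix gives the coordinates of \<open>l \<tau> + m\<close> in the
      basis \<open>a \<tau> + b\<close>, \<open>c \<tau> + d\<close>. The second coordinate becomes
      an integer after division by \<open>J\<close> and disappears.\<close>
    have 1: "(l * d - c * m) * a + (a * m - l * b) * c = l"
    proof -
      have "(l * d - c * m) * a + (a * m - l * b) * c = l * (a * d - b * c)" by (simp add: algebra_simps)
      thus ?thesis unfolding det by simp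
    qed
    have 2: "(l * d - c * m) * b + (a * m - l * b) * d = m"
    proof -
      have "(l * d - c * m) * b + (a * m - l * b) * d = m * (a * d - b * c)" by (simp add: algebra_simps)
      thus ?thesis unfolding det by simp
    qed
    have "of_int l * \<tau> + of_int m = of_int ((l * d - c * m) * a + (a * m - l * b) * c) * \<tau>
        + of_int ((l * d - c * m) * b + (a * m - l * b) * d)"
      unfolding 1 2 ..
    also have "\<dots> = of_int (l * d mod c) * lin a b \<tau> + of_int (a * m - l * b) * J"
      unfolding lm J_def lin_def by (simp add: algebra_simps)
    finally have "fad_arg c d l (z, \<tau>) = z + of_int (l * d mod c) * lin a b \<tau> + of_int (a * m - l * b) * J"
      by (simp add: fad_arg_def m_def[symmetric] add_ac del: of_int_diff)
    hence "fad_arg c d l (z, \<tau>) / J = z / J + of_int (l * d mod c) * \<gamma> + of_int (a * m - l * b)"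
      using j(2) by (simp add: \<gamma>_def J_def add_divide_distrib del: of_int_diff)
    hence "varpi (fad_arg c d l (z, \<tau>) / J) (- 1 / J) = varpi (z / J + of_int (l * d mod c) * \<gamma>) (- 1 / J)"
      by (simp only: varpi_of_int)
    thus "varpi (z / J + of_int (l * d mod c) * \<gamma>) (- 1 / J) = fad_den (fad_arg c d l (z, \<tau>)) J"
      using j(1) by (simp add: fad_den_def J_def)
  qed
  finally show "gam_den c d (z, \<tau>) = varpi (z / lin c d \<tau>) (lin a b \<tau> / lin c d \<tau>)"
    by (simp add: gam_den_def J_def \<gamma>_def)
qed

lemma gam_nonzero:
  assumes "Im (snd p) \<noteq> 0" "fst p \<notin> period_lattice (snd p)"
  shows "gam_num c d p \<noteq> 0" "gam_den c d p \<noteq> 0"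
proof -
  have "Im (lin c d (snd p)) \<noteq> 0" using assms c by simp
  hence "fad_num (fad_arg c d l p) (lin c d (snd p)) \<noteq> 0 \<and> fad_den (fad_arg c d l p) (lin c d (snd p)) \<noteq> 0" for l
    using fad_num_den_zero fad_arg_period_lattice assms(2) by blast
  thus "gam_num c d p \<noteq> 0" "gam_den c d p \<noteq> 0" by (simp_all add: gam_num_def gam_den_def)
qed

lemma holomorphic2_gam_num_den:
  "gam_num c d holomorphic2_on {p. Im (snd p) \<noteq> 0}" "gam_den c d holomorphic2_on {p. Im (snd p) \<noteq> 0}"
proof -
  have "(\<lambda>p. \<Prod>l\<in>{0..<c}. (\<lambda>q. fad_num (fst q) (snd q)) (fad_arg c d l p, lin c d (snd p))) holomorphic2_on {p. Im (snd p) \<noteq> 0}"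
    using c by (intro holomorphic2_on_prod holomorphic2_on_compose[OF holomorphic2_fad_arg holomorphic2_lin holomorphic2_fad_num_den(1)]) auto
  thus "gam_num c d holomorphic2_on {p. Im (snd p) \<noteq> 0}" by (simp add: gam_num_def[abs_def])
  have "(\<lambda>p. \<Prod>l\<in>{0..<c}. (\<lambda>q. fad_den (fst q) (snd q)) (fad_arg c d l p, lin c d (snd p))) holomorphic2_on {p. Im (snd p) \<noteq> 0}"
    using c by (intro holomorphic2_on_prod holomorphic2_on_compose[OF holomorphic2_fad_arg holomorphic2_lin holomorphic2_fad_num_den(2)]) auto
  thus "gam_den c d holomorphic2_on {p. Im (snd p) \<noteq> 0}" by (simp add: gam_den_def[abs_def])
qed

text \<open>Off the real axis the two products themselves serve as \<open>g\<close> and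
  \<open>h\<close>. At real \<tau> the number \<open>j\<close> is positive, and the local quotients
  from \<open>fad_local\<close> for the single residues are multiplied.\<close>

lemma gam_local:
  assumes p: "p \<in> gam_domain c d"
  shows "\<exists>r>0. \<exists>g h. ball p r \<subseteq> gam_domain c d \<and> g holomorphic2_on ball p r \<and> h holomorphic2_on ball p r \<and>
    (\<forall>x\<in>ball p r. fst x \<notin> period_lattice (snd x) \<longrightarrow> g x \<noteq> 0 \<and> h x \<noteq> 0) \<and>
    (\<forall>x\<in>ball p r. Im (snd x) \<noteq> 0 \<longrightarrow> gam_num c d x * h x = g x * gam_den c d x)"
proof (cases "Im (snd p) = 0")
  case False
  have "open {p :: complex \<times> complex. Im (snd p) \<noteq> 0}"
    by (intro open_Collect_neq continuous_intros)
  hence "open (gam_domain c d \<inter> {p. Im (snd p) \<noteq> 0})" using open_gam_domain by blast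
  then obtain r where r: "r > 0" "ball p r \<subseteq> gam_domain c d \<inter> {p. Im (snd p) \<noteq> 0}"
    using p False open_contains_ball by (metis (mono_tags, lifting) IntI mem_Collect_eq)
  show ?thesis
    by (rule exI[of _ r], intro conjI r(1), rule exI[of _ "gam_num c d"], rule exI[of _ "gam_den c d"])
       (use r gam_nonzero in \<open>auto intro!: holomorphic2_on_subset[OF holomorphic2_gam_num_den(1)]
          holomorphic2_on_subset[OF holomorphic2_gam_num_den(2)]\<close>)
next
  case True
  define J where "J = Re (lin c d (snd p))"
  have Jc: "lin c d (snd p) = of_real J" using True by (simp add: J_def complex_eq_iff)
  hence J: "J > 0" using p True by (simp add: gam_domain_def complex_nonpos_Reals_iff not_le)
  define A where "A = (\<lambda>l p. (fad_arg c d l p, lin c d (snd p)))"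
  have "\<forall>l. \<exists>N g h. open N \<and> (fad_arg c d l p, complex_of_real J) \<in> N \<and> g holomorphic2_on N \<and> h holomorphic2_on N \<and>
    (\<forall>p\<in>N. fst p \<notin> period_lattice (snd p) \<longrightarrow> g p \<noteq> 0 \<and> h p \<noteq> 0) \<and>
    (\<forall>p\<in>N. Im (snd p) \<noteq> 0 \<longrightarrow> fad_num (fst p) (snd p) * h p = g p * fad_den (fst p) (snd p))"
    by (intro allI fad_local J)
  from choice[OF this] obtain N where "\<forall>l. \<exists>g h. open (N l) \<and> (fad_arg c d l p, complex_of_real J) \<in> N l \<and> g holomorphic2_on N l \<and> h holomorphic2_on N l \<and>
    (\<forall>p\<in>N l. fst p \<notin> period_lattice (snd p) \<longrightarrow> g p \<noteq> 0 \<and> h p \<noteq> 0) \<and>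
    (\<forall>p\<in>N l. Im (snd p) \<noteq> 0 \<longrightarrow> fad_num (fst p) (snd p) * h p = g p * fad_den (fst p) (snd p))" by blast
  from choice[OF this] obtain g where "\<forall>l. \<exists>h. open (N l) \<and> (fad_arg c d l p, complex_of_real J) \<in> N l \<and> g l holomorphic2_on N l \<and> h holomorphic2_on N l \<and>
    (\<forall>p\<in>N l. fst p \<notin> period_lattice (snd p) \<longrightarrow> g l p \<noteq> 0 \<and> h p \<noteq> 0) \<and>
    (\<forall>p\<in>N l. Im (snd p) \<noteq> 0 \<longrightarrow> fad_num (fst p) (snd p) * h p = g l p * fad_den (fst p) (snd p))" by blast
  from choice[OF this] obtain h where "\<forall>l. open (N l) \<and> (fad_arg c d l p, complex_of_real J) \<in> N l \<and> g l holomorphic2_on N l \<and> h l holomorphic2_on N l \<and>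
    (\<forall>p\<in>N l. fst p \<notin> period_lattice (snd p) \<longrightarrow> g l p \<noteq> 0 \<and> h l p \<noteq> 0) \<and>
    (\<forall>p\<in>N l. Im (snd p) \<noteq> 0 \<longrightarrow> fad_num (fst p) (snd p) * h l p = g l p * fad_den (fst p) (snd p))" by blast
  hence N: "open (N l)" "(fad_arg c d l p, complex_of_real J) \<in> N l" "g l holomorphic2_on N l" "h l holomorphic2_on N l"
    and Nnz: "\<And>q. q \<in> N l \<Longrightarrow> fst q \<notin> period_lattice (snd q) \<Longrightarrow> g l q \<noteq> 0 \<and> h l q \<noteq> 0"
    and Neq: "\<And>q. q \<in> N l \<Longrightarrow> Im (snd q) \<noteq> 0 \<Longrightarrow> fad_num (fst q) (snd q) * h l q = g l q * fad_den (fst q) (snd q)" for l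
    by blast+
  \<comment> \<open>There are finitely many residues, so the neighbourhoods on which the single
    factors are controlled have a common ball around \<open>p\<close>.\<close>
  define U where "U = gam_domain c d \<inter> (\<Inter>l\<in>{0..<c}. A l -` N l)"
  have "open (A l -` N l)" for l unfolding A_def by (rule open_vimage[OF N(1) continuous_fad_arg_lin])
  hence "open U" unfolding U_def by (intro open_Int open_gam_domain open_INT) auto
  moreover have "p \<in> U" using p N(2) by (simp add: U_def A_def Jc)
  ultimately obtain r where r: "r > 0" "ball p r \<subseteq> U" using open_contains_ball by blast
  have A: "A l x \<in> N l" if "x \<in> ball p r" "l \<in> {0..<c}" for x l using r that by (auto simp: U_def)
  have hol: "(\<lambda>x. \<Prod>l\<in>{0..<c}. f l (A l x)) holomorphic2_on ball p r" if "\<And>l. f l holomorphic2_on N l" for f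
    unfolding A_def
    by (intro holomorphic2_on_prod holomorphic2_on_compose[OF holomorphic2_fad_arg holomorphic2_lin that])
       (use A in \<open>auto simp: A_def\<close>)
  show ?thesis
  proof (rule exI[of _ r], rule conjI[OF r(1)], rule exI[of _ "\<lambda>x. \<Prod>l\<in>{0..<c}. g l (A l x)"],
      rule exI[of _ "\<lambda>x. \<Prod>l\<in>{0..<c}. h l (A l x)"], intro conjI)
    show "ball p r \<subseteq> gam_domain c d" using r by (auto simp: U_def)
    show "(\<lambda>x. \<Prod>l\<in>{0..<c}. g l (A l x)) holomorphic2_on ball p r" by (rule hol) (rule N)
    show "(\<lambda>x. \<Prod>l\<in>{0..<c}. h l (A l x)) holomorphic2_on ball p r" by (rule hol) (rule N)
    show "\<forall>x\<in>ball p r. fst x \<notin> period_lattice (snd x) \<longrightarrow> (\<Prod>l\<in>{0..<c}. g l (A l x)) \<noteq> 0 \<and> (\<Prod>l\<in>{0..<c}. h l (A l x)) \<noteq> 0"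
    proof (intro ballI impI)
      fix x assume x: "x \<in> ball p r" "fst x \<notin> period_lattice (snd x)"
      have "g l (A l x) \<noteq> 0 \<and> h l (A l x) \<noteq> 0" if "l \<in> {0..<c}" for l
        using Nnz[OF A[OF x(1) that]] fad_arg_period_lattice[of c d l x] x(2) by (auto simp: A_def)
      thus "(\<Prod>l\<in>{0..<c}. g l (A l x)) \<noteq> 0 \<and> (\<Prod>l\<in>{0..<c}. h l (A l x)) \<noteq> 0" by simp
    qed
    show "\<forall>x\<in>ball p r. Im (snd x) \<noteq> 0 \<longrightarrow> gam_num c d x * (\<Prod>l\<in>{0..<c}. h l (A l x)) = (\<Prod>l\<in>{0..<c}. g l (A l x)) * gam_den c d x"
    proof (intro ballI impI)
      fix x assume x: "x \<in> ball p r" "Im (snd x) \<noteq> 0"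
      have "fad_num (fad_arg c d l x) (lin c d (snd x)) * h l (A l x) = g l (A l x) * fad_den (fad_arg c d l x) (lin c d (snd x))"
        if "l \<in> {0..<c}" for l
        using Neq[OF A[OF x(1) that]] x(2) c by (simp add: A_def)
      thus "gam_num c d x * (\<Prod>l\<in>{0..<c}. h l (A l x)) = (\<Prod>l\<in>{0..<c}. g l (A l x)) * gam_den c d x"
        unfolding gam_num_def gam_den_def prod.distrib[symmetric] by (intro prod.cong refl)
    qed
  qed
qed

text \<open>The quotient is defined on a dense open set that avoids the real axis;
  \<open>gam_local\<close> supplies the local fractions across it. Faddeev's function is built on
  the quotient and the cocycle on its reciprocal, so both are recorded.\<close>

lemma gam_meromorphic:
  "\<exists>F. F meromorphic2_on gam_domain c d \<and> (\<forall>x\<in>generic_points. F x = gam_num c d x / gam_den c d x)"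
  "\<exists>F. F meromorphic2_on gam_domain c d \<and> (\<forall>x\<in>generic_points. F x = gam_den c d x / gam_num c d x)"
proof -
  define I where "I = {p :: complex \<times> complex. Im (snd p) \<noteq> 0}"
  have I: "open I" unfolding I_def by (intro open_Collect_neq continuous_intros)
  define T where "T = {p \<in> I. gam_num c d p * gam_den c d p \<noteq> 0}"
  have cont: "continuous_on I (gam_num c d)" "continuous_on I (gam_den c d)"
    unfolding I_def by (intro holomorphic2_on_imp_continuous_on holomorphic2_gam_num_den)+
  hence "continuous_on I (\<lambda>p. gam_num c d p * gam_den c d p)" by (intro continuous_intros)
  from continuous_open_preimage[OF this I, of "- {0}"]
  have oT: "open T" by (simp add: T_def vimage_def Int_def open_Compl)
  have dT: "V \<inter> T \<noteq> {}" if V: "open V" "V \<noteq> {}" for V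
    using nonperiod_point_dense[OF V] gam_nonzero by (fastforce simp: T_def I_def)
  have gT: "x \<in> T \<inter> gam_domain c d" if x: "x \<in> generic_points" for x
  proof -
    have x': "Im (snd x) > 0" "fst x \<notin> period_lattice (snd x)" using x by (auto simp: generic_points_def)
    hence "lin c d (snd x) \<notin> \<real>\<^sub>\<le>\<^sub>0" using c by (auto simp: complex_nonpos_Reals_iff)
    thus ?thesis using x' gam_nonzero[of x] by (auto simp: T_def I_def gam_domain_def)
  qed
  have contT: "continuous_on T (gam_num c d)" "continuous_on T (gam_den c d)"
    using cont by (auto simp: T_def intro: continuous_on_subset)
  have ne: "\<exists>x\<in>ball p r. h x \<noteq> 0" if "r > 0" "\<forall>x\<in>ball p r. fst x \<notin> period_lattice (snd x) \<longrightarrow> h x \<noteq> 0"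
    for p r and h :: "complex \<times> complex \<Rightarrow> complex"
    using nonperiod_point_dense[of "ball p r"] that by auto
  obtain F where "F meromorphic2_on gam_domain c d" "\<And>x. x \<in> T \<inter> gam_domain c d \<Longrightarrow> F x = gam_num c d x / gam_den c d x"
  proof (rule meromorphic2_extend[OF oT dT])
    show "continuous_on T (\<lambda>x. gam_num c d x / gam_den c d x)"
      using contT by (intro continuous_intros) (auto simp: T_def)
    fix p assume "p \<in> gam_domain c d"
    from gam_local[OF this] obtain r g h where *: "r > 0" "ball p r \<subseteq> gam_domain c d" "g holomorphic2_on ball p r" "h holomorphic2_on ball p r"
      "\<forall>x\<in>ball p r. fst x \<notin> period_lattice (snd x) \<longrightarrow> g x \<noteq> 0 \<and> h x \<noteq> 0"
      "\<forall>x\<in>ball p r. Im (snd x) \<noteq> 0 \<longrightarrow> gam_num c d x * h x = g x * gam_den c d x"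
      by (elim exE conjE) (rule that; assumption)
    show "\<exists>r>0. \<exists>g h. ball p r \<subseteq> gam_domain c d \<and> g holomorphic2_on ball p r \<and> h holomorphic2_on ball p r \<and>
       (\<exists>x\<in>ball p r. h x \<noteq> 0) \<and> (\<forall>x\<in>ball p r \<inter> T. gam_num c d x / gam_den c d x * h x = g x)"
      by (rule exI[of _ r], intro conjI *(1), rule exI[of _ g], rule exI[of _ h])
         (use * ne[OF *(1), of p h] in \<open>auto simp: T_def I_def field_simps\<close>)
  qed auto
  thus "\<exists>F. F meromorphic2_on gam_domain c d \<and> (\<forall>x\<in>generic_points. F x = gam_num c d x / gam_den c d x)"
    using gT by blast
  obtain F where "F meromorphic2_on gam_domain c d" "\<And>x. x \<in> T \<inter> gam_domain c d \<Longrightarrow> F x = gam_den c d x / gam_num c d x"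
  proof (rule meromorphic2_extend[OF oT dT])
    show "continuous_on T (\<lambda>x. gam_den c d x / gam_num c d x)"
      using contT by (intro continuous_intros) (auto simp: T_def)
    fix p assume "p \<in> gam_domain c d"
    from gam_local[OF this] obtain r g h where *: "r > 0" "ball p r \<subseteq> gam_domain c d" "g holomorphic2_on ball p r" "h holomorphic2_on ball p r"
      "\<forall>x\<in>ball p r. fst x \<notin> period_lattice (snd x) \<longrightarrow> g x \<noteq> 0 \<and> h x \<noteq> 0"
      "\<forall>x\<in>ball p r. Im (snd x) \<noteq> 0 \<longrightarrow> gam_num c d x * h x = g x * gam_den c d x"
      by (elim exE conjE) (rule that; assumption)
    show "\<exists>r>0. \<exists>g h. ball p r \<subseteq> gam_domain c d \<and> g holomorphic2_on ball p r \<and> h holomorphic2_on ball p r \<and>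
       (\<exists>x\<in>ball p r. h x \<noteq> 0) \<and> (\<forall>x\<in>ball p r \<inter> T. gam_den c d x / gam_num c d x * h x = g x)"
      by (rule exI[of _ r], intro conjI *(1), rule exI[of _ h], rule exI[of _ g])
         (use * ne[OF *(1), of p g] in \<open>auto simp: T_def I_def field_simps\<close>)
  qed auto
  thus "\<exists>F. F meromorphic2_on gam_domain c d \<and> (\<forall>x\<in>generic_points. F x = gam_den c d x / gam_num c d x)"
    using gT by blast
qed

section \<open>Dedekind sums and the eta multiplier\<close>

lemma fad_arg_0:
  "fad_arg c d l (0, \<tau>) = of_int l / of_int c * lin c d \<tau> - of_int (l * d mod c) / of_int c"
proof -
  have "of_int (l * d mod c) = of_int (l * d) - of_int c * (of_int (l * d div c) :: complex)"
    by (metis minus_mult_div_eq_mod of_int_diff of_int_mult)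
  hence eq: "of_int (l * d mod c) / of_int c = of_int (l * d) / of_int c - (of_int (l * d div c) :: complex)"
    using c by (simp add: diff_divide_distrib)
  show ?thesis unfolding fad_arg_def lin_def eq using c by (simp add: distrib_left)
qed

text \<open>By \<open>fad_arg_0\<close> the argument is \<open>\<alpha> j - x\<close> with \<alpha>
  and \<open>x\<close> both in \<open>[0, 1)\<close>. This is the purpose of the integer shift in
  \<open>fad_arg\<close>.\<close>

lemma fad_arg_0_domain:
  assumes "y > 0" "y < 2 * pi * Re (1 / lin c d \<tau>)" "l \<in> {0..<c}"
  shows "(fad_arg c d l (0, \<tau>), lin c d \<tau>) \<in> fad_domain y"
proof -
  have R: "Re (lin c d \<tau>) > 0" by (rule Re_pos_of_inverse[OF assms(1,2)])
  define \<alpha> x where "\<alpha> = real_of_int l / real_of_int c" and "x = real_of_int (l * d mod c) / real_of_int c"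
  have \<alpha>: "0 \<le> \<alpha>" "\<alpha> < 1" using assms(3) c by (auto simp: \<alpha>_def)
  have x: "0 \<le> x" "x < 1" using c by (auto simp: x_def)
  have "fad_arg c d l (0, \<tau>) = of_real \<alpha> * lin c d \<tau> - of_real x"
    unfolding fad_arg_0 by (simp add: \<alpha>_def x_def)
  hence "Re (fad_arg c d l (0, \<tau>)) = \<alpha> * Re (lin c d \<tau>) - x" by simp
  moreover have "\<alpha> * Re (lin c d \<tau>) < 1 * Re (lin c d \<tau>)" using \<alpha> R by (intro mult_strict_right_mono) auto
  moreover have "0 \<le> \<alpha> * Re (lin c d \<tau>)" using \<alpha> R by simp
  ultimately show ?thesis using x assms(2) by (auto simp: fad_domain_def)
qed

lemma mult_mod_neq_0:
  assumes "l \<in> {1..<c}"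
  shows "l * d mod c \<noteq> 0"
proof
  assume "l * d mod c = 0"
  hence "c dvd l * d" by (rule mod_0_imp_dvd)
  hence "c dvd l" using coprime_c_d by (simp add: coprime_dvd_mult_left_iff)
  thus False using assms zdvd_imp_le[of c l] by auto
qed

text \<open>For nonzero residues \<open>l * d mod c\<close> is nonzero, so \<open>c - l\<close>
  replaces \<alpha> by \<open>1 - \<alpha>\<close> and \<open>x\<close> by \<open>1 - x\<close>,
  which is the reflection of Faddeev's integral.\<close>

lemma fad_arg_0_reflect:
  assumes l: "l \<in> {1..<c}"
  shows "fad_arg c d (c - l) (0, \<tau>) = lin c d \<tau> - 1 - fad_arg c d l (0, \<tau>)"
proof -
  have "(c - l) * d mod c = (- (l * d)) mod c"
    by (metis (no_types, lifting) left_diff_distrib mod_mult_self1 mult.commute uminus_add_conv_diff add.commute mult_minus_left diff_conv_add_uminus)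
  also have "\<dots> = c - l * d mod c" using mult_mod_neq_0[OF l] by (simp add: zmod_zminus1_eq_if)
  finally have eq: "complex_of_int ((c - l) * d mod c) = of_int c - of_int (l * d mod c)" by simp
  show ?thesis unfolding fad_arg_0 eq using c by (simp add: diff_divide_distrib left_diff_distrib)
qed

text \<open>The residues \<open>l\<close> and \<open>c - l\<close> are paired by the reflection
  formula, each pair being counted twice. Only residue 0 has no partner; its value, from
  \<open>fad_int_0\<close>, contributes half a logarithm.\<close>

lemma sum_fad_int_0:
  assumes y: "0 < y" "y < 2 * pi" and t: "y < 2 * pi * Re (1 / lin c d \<tau>)"
  shows "(\<Sum>l\<in>{0..<c}. fad_int y (fad_arg c d l (0, \<tau>), lin c d \<tau>)) =
     (Ln (lin c d \<tau>) + (\<Sum>l\<in>{0..<c}. fad_refl (fad_arg c d l (0, \<tau>)) (lin c d \<tau>))) / 2"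
proof -
  define I where "I = (\<lambda>l. fad_int y (fad_arg c d l (0, \<tau>), lin c d \<tau>))"
  define R where "R = (\<lambda>l. fad_refl (fad_arg c d l (0, \<tau>)) (lin c d \<tau>))"
  have split: "{0..<c} = insert 0 {1..<c}" using c by auto
  have I0: "I 0 = (Ln (lin c d \<tau>) + R 0) / 2"
    using fad_int_0[OF y t] by (simp add: I_def R_def fad_arg_def)
  have "I l + I (c - l) = R l" if l: "l \<in> {1..<c}" for l
    using fad_int_reflection[OF y fad_arg_0_domain[OF y(1) t, of l]] l
    by (simp add: I_def R_def fad_arg_0_reflect[OF l])
  hence "(\<Sum>l\<in>{1..<c}. R l) = (\<Sum>l\<in>{1..<c}. I l + I (c - l))" by (intro sum.cong) auto
  also have "\<dots> = (\<Sum>l\<in>{1..<c}. I l) + (\<Sum>l\<in>{1..<c}. I (c - l))" by (rule sum.distrib)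
  also have "(\<Sum>l\<in>{1..<c}. I (c - l)) = (\<Sum>l\<in>{1..<c}. I l)"
    by (rule sum.reindex_bij_witness[of _ "\<lambda>l. c - l" "\<lambda>l. c - l"]) auto
  finally have "(\<Sum>l\<in>{1..<c}. R l) = 2 * (\<Sum>l\<in>{1..<c}. I l)" by simp
  hence "(\<Sum>l\<in>{0..<c}. I l) = (Ln (lin c d \<tau>) + (\<Sum>l\<in>{0..<c}. R l)) / 2"
    unfolding split using I0 by (simp add: field_simps)
  thus ?thesis by (simp add: I_def R_def)
qed

lemma sum_int_powers:
  "(\<Sum>l\<in>{0..<int n}. real_of_int l) = real n * (real n - 1) / 2"
  "(\<Sum>l\<in>{0..<int n}. (real_of_int l)\<^sup>2) = (real n - 1) * real n * (2 * real n - 1) / 6"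
proof -
  have s: "{0..<int (Suc m)} = insert (int m) {0..<int m}" for m by auto
  show "(\<Sum>l\<in>{0..<int n}. real_of_int l) = real n * (real n - 1) / 2"
    by (induction n) (simp_all add: s field_simps del: of_nat_Suc, simp_all add: field_simps)
  show "(\<Sum>l\<in>{0..<int n}. (real_of_int l)\<^sup>2) = (real n - 1) * real n * (2 * real n - 1) / 6"
    by (induction n) (simp_all add: s field_simps power2_eq_square del: of_nat_Suc, simp_all add: field_simps)
qed

text \<open>The summand is half the second Bernoulli polynomial, and the identity is its
  distribution relation at 0.\<close>

lemma sum_bernoulli_2:
  "(\<Sum>l\<in>{0..<c}. (real_of_int l / real_of_int c)\<^sup>2 / 2 - real_of_int l / real_of_int c / 2 + 1 / 12) = 1 / (12 * real_of_int c)"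
proof -
  obtain n where n: "c = int n" "n > 0" using c by (metis zero_less_imp_eq_int)
  have "(\<Sum>l\<in>{0..<c}. (real_of_int l / real_of_int c)\<^sup>2 / 2 - real_of_int l / real_of_int c / 2 + 1 / 12)
    = (\<Sum>l\<in>{0..<c}. (real_of_int l)\<^sup>2) / (real n)\<^sup>2 / 2 - (\<Sum>l\<in>{0..<c}. real_of_int l) / real n / 2 + real n / 12"
    using n by (simp add: sum.distrib sum_subtractf power_divide flip: sum_divide_distrib)
  also have "\<dots> = 1 / (12 * real n)"
    unfolding n sum_int_powers using n by (simp add: field_simps power2_eq_square)
  finally show ?thesis using n by simp
qed

text \<open>The \<open>- 1 / 4\<close> is the term of residue 0, where the linear expressions give
  \<open>- 1 / 2\<close> and \<open>1 / 2\<close> whereas the sawtooth would be 0.\<close>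

lemma sum_dedekind:
  "(\<Sum>l\<in>{0..<c}. (real_of_int l / real_of_int c - 1 / 2) * (1 / 2 - real_of_int (l * d mod c) / real_of_int c))
     = - dedekind_sum d c - 1 / 4"
proof -
  have split: "{0..<c} = insert 0 {1..c - 1}" using c by auto
  have "(\<Sum>l\<in>{1..c - 1}. (real_of_int l / real_of_int c - 1 / 2) * (1 / 2 - real_of_int (l * d mod c) / real_of_int c))
     = (\<Sum>l\<in>{1..c - 1}. - (sawtooth (of_int l / of_int c) * sawtooth (of_int (l * d) / of_int c)))"
  proof (rule sum.cong[OF refl])
    fix l assume "l \<in> {1..c - 1}"
    hence l: "l \<in> {1..<c}" by auto
    have saw: "sawtooth (of_int k / of_int c) = of_int (k mod c) / of_int c - 1 / 2" if k: "k mod c \<noteq> 0" for k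
    proof -
      have "real_of_int k / real_of_int c \<notin> \<int>"
      proof
        assume "real_of_int k / real_of_int c \<in> \<int>"
        then obtain m where "real_of_int k / real_of_int c = of_int m" by (elim Ints_cases)
        hence "real_of_int k = of_int (m * c)" using c by (simp add: field_simps)
        hence "k = m * c" by (simp only: of_int_eq_iff)
        thus False using k by simp
      qed
      moreover have "real_of_int k / of_int c - of_int (k div c) = of_int (k mod c) / of_int c"
      proof -
        have "of_int (k mod c) = of_int k - of_int c * (of_int (k div c) :: real)"
          by (metis minus_mult_div_eq_mod of_int_diff of_int_mult)
        thus ?thesis using c by (simp add: field_simps)
      qed
      ultimately show ?thesis by (simp add: sawtooth_def floor_divide_of_int_eq)
    qed
    have "sawtooth (of_int l / of_int c) = of_int l / of_int c - 1 / 2" using saw[of l] l by simp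
    moreover have "sawtooth (of_int (l * d) / of_int c) = of_int (l * d mod c) / of_int c - 1 / 2"
      by (rule saw[OF mult_mod_neq_0[OF l]])
    ultimately show "(real_of_int l / real_of_int c - 1 / 2) * (1 / 2 - real_of_int (l * d mod c) / real_of_int c)
      = - (sawtooth (of_int l / of_int c) * sawtooth (of_int (l * d) / of_int c))"
      by (simp only:) (simp add: algebra_simps)
  qed
  also have "\<dots> = - dedekind_sum d c" by (simp add: dedekind_sum_def sum_negf)
  finally show ?thesis unfolding split by simp
qed

text \<open>At \<open>\<alpha> j - x\<close> the quadratic polynomial in \<open>fad_refl\<close>
  separates by powers of \<open>j\<close>: Bernoulli polynomials in \<alpha> and in \<open>x\<close>
  at the two ends, and the product of two sawtooth values in the middle.\<close>

lemma sum_fad_refl_0: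
  assumes j0: "lin c d \<tau> \<noteq> 0"
  shows "(\<Sum>l\<in>{0..<c}. fad_refl (fad_arg c d l (0, \<tau>)) (lin c d \<tau>)) =
    - 2 * of_real pi * \<i> * ((lin c d \<tau> + 1 / lin c d \<tau>) / (12 * of_int c) - of_real (dedekind_sum d c) - 1 / 4)"
proof -
  define j where "j = lin c d \<tau>"
  define \<alpha> x where "\<alpha> = (\<lambda>l. real_of_int l / real_of_int c)" and "x = (\<lambda>l. real_of_int (l * d mod c) / real_of_int c)"
  define B where "B = (\<lambda>u::real. u\<^sup>2 / 2 - u / 2 + 1 / 12)"
  have trm: "fad_refl (fad_arg c d l (0, \<tau>)) j =
    - 2 * of_real pi * \<i> / j * (j\<^sup>2 * of_real (B (\<alpha> l)) + j * of_real ((\<alpha> l - 1 / 2) * (1 / 2 - x l)) + of_real (B (x l)))" for l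
  proof -
    have "fad_arg c d l (0, \<tau>) = of_real (\<alpha> l) * j - of_real (x l)"
      unfolding fad_arg_0 by (simp add: \<alpha>_def x_def j_def)
    moreover have "(A * j - X + 1)\<^sup>2 / 2 - (A * j - X + 1) * (1 + j) / 2 + j / 4 + (1 + j\<^sup>2) / 12
      = j\<^sup>2 * (A\<^sup>2 / 2 - A / 2 + 1 / 12) + j * ((A - 1 / 2) * (1 / 2 - X)) + (X\<^sup>2 / 2 - X / 2 + 1 / 12)" for A X :: complex
      by (simp add: field_simps power2_eq_square)
    ultimately show ?thesis unfolding fad_refl_def B_def by simp
  qed
  have SB: "(\<Sum>l\<in>{0..<c}. B (\<alpha> l)) = 1 / (12 * real_of_int c)" using sum_bernoulli_2 by (simp add: B_def \<alpha>_def)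
  \<comment> \<open>The fractions \<open>x l\<close> are those of \<open>\<alpha> l\<close> permuted
    by \<open>d\<close>, so both Bernoulli sums are equal.\<close>
  have "(\<Sum>l\<in>{0..<c}. B (x l)) = (\<Sum>l\<in>{0..<c}. B (\<alpha> (l * d mod c)))" by (simp add: \<alpha>_def x_def)
  also have "\<dots> = (\<Sum>l\<in>{0..<c}. B (\<alpha> l))"
    by (rule sum.reindex_bij_betw[OF bij_betw_mult_mod[OF c coprime_c_d]])
  finally have SX: "(\<Sum>l\<in>{0..<c}. B (x l)) = 1 / (12 * real_of_int c)" using SB by simp
  have SD: "(\<Sum>l\<in>{0..<c}. (\<alpha> l - 1 / 2) * (1 / 2 - x l)) = - dedekind_sum d c - 1 / 4"
    using sum_dedekind by (simp add: \<alpha>_def x_def)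
  have "(\<Sum>l\<in>{0..<c}. fad_refl (fad_arg c d l (0, \<tau>)) j) =
     - 2 * of_real pi * \<i> / j * (j\<^sup>2 * of_real (\<Sum>l\<in>{0..<c}. B (\<alpha> l)) + j * of_real (\<Sum>l\<in>{0..<c}. (\<alpha> l - 1 / 2) * (1 / 2 - x l)) + of_real (\<Sum>l\<in>{0..<c}. B (x l)))"
    unfolding trm sum_distrib_left[symmetric] sum.distrib by (simp only: of_real_sum)
  also have "\<dots> = - 2 * of_real pi * \<i> * ((j + 1 / j) / (12 * of_int c) - of_real (dedekind_sum d c) - 1 / 4)"
    unfolding SB SX SD using j0 c by (simp add: j_def[symmetric] field_simps power2_eq_square)
  finally show ?thesis by (simp add: j_def)
qed

text \<open>Half of the logarithm of \<open>j\<close> exponentiates to the principal root, and half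
  of the reflection terms to the factor with the Dedekind sum.\<close>

lemma prod_exp_fad_int_0:
  assumes y: "0 < y" "y < 2 * pi" and t: "y < 2 * pi * Re (1 / lin c d \<tau>)"
  shows "(\<Prod>l\<in>{0..<c}. exp (fad_int y (fad_arg c d l (0, \<tau>), lin c d \<tau>))) = csqrt (lin c d \<tau>) *
    exp (- of_real pi * \<i> * ((lin c d \<tau> + 1 / lin c d \<tau>) / (12 * of_int c) - of_real (dedekind_sum d c) - 1 / 4))"
proof -
  have j0: "lin c d \<tau> \<noteq> 0" using Re_pos_of_inverse[OF y(1) t] by auto
  have "(\<Prod>l\<in>{0..<c}. exp (fad_int y (fad_arg c d l (0, \<tau>), lin c d \<tau>))) =
     exp (\<Sum>l\<in>{0..<c}. fad_int y (fad_arg c d l (0, \<tau>), lin c d \<tau>))" by (simp add: exp_sum)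
  also have "\<dots> = exp (Ln (lin c d \<tau>) / 2) *
    exp (- of_real pi * \<i> * ((lin c d \<tau> + 1 / lin c d \<tau>) / (12 * of_int c) - of_real (dedekind_sum d c) - 1 / 4))"
    unfolding sum_fad_int_0[OF y t] sum_fad_refl_0[OF j0] add_divide_distrib exp_add
    by (simp add: mult.assoc)
  finally show ?thesis using j0 by (simp add: csqrt_exp_Ln)
qed

end

section \<open>The value at the origin and the transformation of the eta function\<close>

definition gam_exp :: "int \<Rightarrow> int \<Rightarrow> real \<Rightarrow> complex \<times> complex \<Rightarrow> complex" where
  "gam_exp c d y p = (\<Prod>l\<in>{0..<c}. exp (fad_int y (fad_arg c d l p, lin c d (snd p))))"

definition gam_strip :: "int \<Rightarrow> int \<Rightarrow> real \<Rightarrow> (complex \<times> complex) set" where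
  "gam_strip c d y = {p. \<forall>l\<in>{0..<c}. (fad_arg c d l p, lin c d (snd p)) \<in> fad_domain y}"

definition eta_const :: "int \<Rightarrow> int \<Rightarrow> int \<Rightarrow> complex" where
  "eta_const a c d = exp (of_real pi * \<i> / 12 *
     of_real (of_int (a + d) / of_int c - 12 * dedekind_sum d c - 3))"

lemma gam_exp_nonzero: "gam_exp c d y p \<noteq> 0"
  by (simp add: gam_exp_def)

lemma open_gam_strip:
  assumes "0 < y"
  shows "open (gam_strip c d y)"
proof -
  have "gam_strip c d y = (\<Inter>l\<in>{0..<c}. (\<lambda>p. (fad_arg c d l p, lin c d (snd p))) -` fad_domain y)"
    by (auto simp: gam_strip_def)
  moreover have "open ((\<lambda>p. (fad_arg c d l p, lin c d (snd p))) -` fad_domain y)" for l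
    by (rule open_vimage[OF open_fad_domain[OF assms] continuous_fad_arg_lin])
  ultimately show ?thesis by (simp add: open_INT)
qed

lemma holomorphic2_gam_exp:
  assumes "0 < y" "y < 2 * pi"
  shows "gam_exp c d y holomorphic2_on gam_strip c d y"
  unfolding gam_exp_def[abs_def]
  by (intro holomorphic2_on_prod holomorphic2_on_exp
      holomorphic2_on_compose[OF holomorphic2_fad_arg holomorphic2_lin holomorphic2_fad_int[OF assms]])
     (auto simp: gam_strip_def)

lemma varpi_isCont:
  assumes "Im t > 0"
  shows "isCont (\<lambda>z. varpi z t) z"
  using holomorphic_on_imp_continuous_on[OF holomorphic_varpi[OF assms, of UNIV]]
  by (simp add: continuous_on_eq_continuous_at)

lemma e2pi_quotient_limit:
  "((\<lambda>w. (1 - e2pi (w * k)) / w) \<longlongrightarrow> - (2 * of_real pi * \<i> * k)) (at 0)"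
proof -
  have "((\<lambda>w. 1 - e2pi (w * k)) has_field_derivative - (2 * of_real pi * \<i> * k)) (at 0)"
    unfolding e2pi_def by (auto intro!: derivative_eq_intros)
  thus ?thesis by (simp add: has_field_derivative_iff)
qed

lemma dedekind_eta_varpi: "dedekind_eta \<tau> = e2pi (\<tau> / 24) * varpi \<tau> \<tau>"
  by (simp add: dedekind_eta_def varpi_def algebra_simps)

lemma holomorphic_dedekind_eta: "dedekind_eta holomorphic_on {\<tau>. Im \<tau> > 0}"
proof -
  have "(\<lambda>t. varpi (fst (0 + t * 1, 0 + t * 1)) (snd (0 + t * 1, 0 + t * 1))) holomorphic_on
      {t. (0 + t * 1, 0 + t * 1) \<in> UNIV \<times> upper_half_plane}"
    by (rule holomorphic2_on_line[OF holomorphic2_varpi])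
  hence "(\<lambda>t. varpi t t) holomorphic_on {\<tau>. Im \<tau> > 0}" by (simp add: upper_half_plane_def)
  thus ?thesis unfolding dedekind_eta_varpi[abs_def] by (intro holomorphic_intros) auto
qed

lemma dedekind_eta_nonzero:
  assumes "Im \<tau> > 0"
  shows "dedekind_eta \<tau> \<noteq> 0"
proof
  assume "dedekind_eta \<tau> = 0"
  hence "varpi \<tau> \<tau> = 0" by (simp add: dedekind_eta_varpi)
  then obtain k :: nat where "\<tau> + of_nat k * \<tau> \<in> \<int>" using varpi_eq_0_iff[OF assms] by blast
  then obtain n where "\<tau> + of_nat k * \<tau> = of_int n" by (elim Ints_cases)
  hence "Im (\<tau> + of_nat k * \<tau>) = 0" by simp
  hence "(1 + real k) * Im \<tau> = 0" by (simp add: algebra_simps)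
  thus False using assms by simp
qed

context
  fixes a b c d :: int
  assumes det: "a * d - b * c = 1" and c: "c > 0"
begin

lemma gam_exp_quotient:
  assumes y: "0 < y" "y < 2 * pi" and p: "p \<in> gam_strip c d y" "Im (snd p) \<noteq> 0"
  shows "gam_exp c d y p * gam_den c d p = gam_num c d p"
  unfolding gam_exp_def gam_den_def gam_num_def prod.distrib[symmetric]
proof (rule prod.cong[OF refl])
  fix l assume "l \<in> {0..<c}"
  thus "exp (fad_int y (fad_arg c d l p, lin c d (snd p))) * fad_den (fad_arg c d l p) (lin c d (snd p)) =
    fad_num (fad_arg c d l p) (lin c d (snd p))"
    using p c by (intro fad_int_product[OF y]) (auto simp: gam_strip_def)
qed

lemma gam_strip_0:
  assumes "0 < y" "y < 2 * pi * Re (1 / lin c d \<tau>)"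
  shows "(0, \<tau>) \<in> gam_strip c d y"
  using fad_arg_0_domain[OF det c assms] by (simp add: gam_strip_def)

text \<open>At \<open>z = 0\<close> the first factor of each product vanishes. Dividing both by
  \<open>z\<close> before letting \<open>z\<close> tend to 0 removes these factors and leaves the
  quotient \<open>1 / j\<close> of their derivatives.\<close>

lemma varpi_tau_tau:
  assumes y: "0 < y" "y < 2 * pi" and t: "y < 2 * pi * Re (1 / lin c d \<tau>)" and up: "Im \<tau> > 0"
  defines "\<gamma> \<equiv> lin a b \<tau> / lin c d \<tau>"
  shows "varpi \<tau> \<tau> = gam_exp c d y (0, \<tau>) * (1 / lin c d \<tau>) * varpi \<gamma> \<gamma>"
proof -
  note j = lin_upper[OF det c up]
  define J where "J = lin c d \<tau>"
  have \<gamma>up: "Im \<gamma> > 0" using j by (simp add: \<gamma>_def)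
  have S0: "(0, \<tau>) \<in> gam_strip c d y" by (rule gam_strip_0[OF y(1) t])
  define q where "q = (\<lambda>n. complex_of_real (inverse (real (Suc n))))"
  have q0: "q \<longlonglongrightarrow> 0" unfolding q_def using tendsto_of_real[OF LIMSEQ_inverse_real_of_nat] by (simp only: of_real_0)
  have qn: "q n \<noteq> 0" for n by (simp add: q_def del: of_nat_Suc)
  have qat: "filterlim q (at 0) sequentially" unfolding filterlim_at using q0 qn by auto
  have "isCont (\<lambda>z. (z, \<tau>)) 0" by (intro continuous_intros)
  hence cont: "isCont (\<lambda>z. gam_exp c d y (z, \<tau>)) 0"
    using holomorphic2_on_imp_isCont[OF holomorphic2_gam_exp[OF y] S0] isCont_o2[of 0 "\<lambda>z. (z, \<tau>)" "gam_exp c d y"] by simp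
  have lp: "(\<lambda>n. (q n, \<tau>)) \<longlonglongrightarrow> (0, \<tau>)" by (intro tendsto_Pair q0 tendsto_const)
  have ev: "\<forall>\<^sub>F n in sequentially. (q n, \<tau>) \<in> gam_strip c d y"
    using topological_tendstoD[OF lp open_gam_strip[OF y(1)] S0] .
  have eq: "(1 - e2pi (q n)) / q n * varpi (q n + \<tau>) \<tau> =
      gam_exp c d y (q n, \<tau>) * ((1 - e2pi (q n / J)) / q n) * varpi (q n / J + \<gamma>) \<gamma>"
    if "(q n, \<tau>) \<in> gam_strip c d y" for n
  proof -
    have "gam_exp c d y (q n, \<tau>) * varpi (q n / J) \<gamma> = varpi (q n) \<tau>"
      using gam_exp_quotient[OF y that] up gam_upper[OF det c up, of "q n"] by (simp add: J_def \<gamma>_def)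
    moreover have "varpi (q n / J) \<gamma> = (1 - e2pi (q n / J)) * varpi (q n / J + \<gamma>) \<gamma>"
      by (rule varpi_shift[OF \<gamma>up])
    moreover have "varpi (q n) \<tau> = (1 - e2pi (q n)) * varpi (q n + \<tau>) \<tau>" by (rule varpi_shift[OF up])
    ultimately have "(1 - e2pi (q n)) * varpi (q n + \<tau>) \<tau> = gam_exp c d y (q n, \<tau>) * (1 - e2pi (q n / J)) * varpi (q n / J + \<gamma>) \<gamma>"
      by (simp add: mult.assoc)
    thus ?thesis by simp
  qed
  have 1: "(\<lambda>n. (1 - e2pi (q n)) / q n * varpi (q n + \<tau>) \<tau>) \<longlonglongrightarrow> - (2 * of_real pi * \<i> * 1) * varpi (0 + \<tau>) \<tau>"
  proof (intro tendsto_mult)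
    from filterlim_compose[OF e2pi_quotient_limit[of 1] qat]
    show "(\<lambda>n. (1 - e2pi (q n)) / q n) \<longlonglongrightarrow> - (2 * of_real pi * \<i> * 1)" by simp
    show "(\<lambda>n. varpi (q n + \<tau>) \<tau>) \<longlonglongrightarrow> varpi (0 + \<tau>) \<tau>"
      by (rule isCont_tendsto_compose[OF varpi_isCont[OF up]]) (intro tendsto_intros q0)
  qed
  have 2: "(\<lambda>n. gam_exp c d y (q n, \<tau>) * ((1 - e2pi (q n / J)) / q n) * varpi (q n / J + \<gamma>) \<gamma>) \<longlonglongrightarrow>
     gam_exp c d y (0, \<tau>) * - (2 * of_real pi * \<i> * (1 / J)) * varpi (0 / J + \<gamma>) \<gamma>"
  proof (intro tendsto_mult)
    show "(\<lambda>n. gam_exp c d y (q n, \<tau>)) \<longlonglongrightarrow> gam_exp c d y (0, \<tau>)"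
      using isCont_tendsto_compose[OF cont q0] by simp
    from filterlim_compose[OF e2pi_quotient_limit[of "1 / J"] qat]
    show "(\<lambda>n. (1 - e2pi (q n / J)) / q n) \<longlonglongrightarrow> - (2 * of_real pi * \<i> * (1 / J))" by simp
    show "(\<lambda>n. varpi (q n / J + \<gamma>) \<gamma>) \<longlonglongrightarrow> varpi (0 / J + \<gamma>) \<gamma>"
      by (rule isCont_tendsto_compose[OF varpi_isCont[OF \<gamma>up]]) (intro tendsto_intros q0, use j in \<open>simp add: J_def\<close>)
  qed
  have 3: "\<forall>\<^sub>F n in sequentially. (1 - e2pi (q n)) / q n * varpi (q n + \<tau>) \<tau> =
      gam_exp c d y (q n, \<tau>) * ((1 - e2pi (q n / J)) / q n) * varpi (q n / J + \<gamma>) \<gamma>"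
    using ev by eventually_elim (rule eq)
  have 4: "- (2 * of_real pi * \<i> * 1) * varpi (0 + \<tau>) \<tau> =
     gam_exp c d y (0, \<tau>) * - (2 * of_real pi * \<i> * (1 / J)) * varpi (0 / J + \<gamma>) \<gamma>"
    by (rule LIMSEQ_unique[OF iffD1[OF tendsto_cong[OF 3] 1] 2])
  have "A = G * K * B" if "- (P * 1) * A = G * - (P * K) * B" "P \<noteq> 0" for A B G K P :: complex
  proof -
    have "P * (A - G * K * B) = 0" using that(1) by (simp add: algebra_simps)
    thus ?thesis using that(2) by simp
  qed
  from this[OF 4] have "varpi (0 + \<tau>) \<tau> = gam_exp c d y (0, \<tau>) * (1 / J) * varpi (0 / J + \<gamma>) \<gamma>" by simp
  thus ?thesis by (simp only: J_def add_0_left div_0)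
qed

text \<open>Since \<open>csqrt j / j\<close> is \<open>1 / csqrt j\<close>, the previous lemma
  already has the right shape; it remains to compare the exponential with the prefactors
  \<open>e2pi (\<tau> / 24)\<close> of the eta function.\<close>

lemma eta_transformation_local:
  assumes y: "0 < y" "y < 2 * pi" and t: "y < 2 * pi * Re (1 / lin c d \<tau>)" and up: "Im \<tau> > 0"
  shows "dedekind_eta (lin a b \<tau> / lin c d \<tau>) = eta_const a c d * dedekind_eta \<tau> * csqrt (lin c d \<tau>)"
proof -
  define j where "j = lin c d \<tau>"
  define \<gamma> where "\<gamma> = lin a b \<tau> / j"
  note jj = lin_upper[OF det c up]
  have j0: "j \<noteq> 0" using jj by (simp add: j_def)
  define s where "s = complex_of_real (dedekind_sum d c)"
  define X where "X = of_real pi * \<i> * ((j + 1 / j) / (12 * of_int c) - s - 1 / 4)"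
  have E: "gam_exp c d y (0, \<tau>) = csqrt j * exp (- X)"
    unfolding gam_exp_def snd_conv prod_exp_fad_int_0[OF det c y t] by (simp add: X_def j_def s_def)
  have "varpi \<tau> \<tau> = csqrt j * exp (- X) * (1 / j) * varpi \<gamma> \<gamma>"
    using varpi_tau_tau[OF y t up] unfolding E by (simp add: j_def \<gamma>_def)
  moreover have "k * k = j \<Longrightarrow> V = k * exp (- X) * (1 / j) * W \<Longrightarrow> W = V * k * exp X" for k V W :: complex
    using j0 by (auto simp: exp_minus divide_simps)
  ultimately have v: "varpi \<gamma> \<gamma> = varpi \<tau> \<tau> * csqrt j * exp X"
    using power2_csqrt[of j] by (simp add: power2_eq_square)
  have c0: "complex_of_int c \<noteq> 0" using c by simp
  have "of_int c * \<gamma> = - 1 / j + of_int a" using jj(3) by (simp add: \<gamma>_def j_def)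
  hence g: "\<gamma> = (of_int a - 1 / j) / of_int c" using c0 by (simp add: field_simps)
  have tt: "\<tau> = (j - of_int d) / of_int c" using c0 by (simp add: j_def lin_def field_simps)
  \<comment> \<open>With \<open>\<tau> = (j - d) / c\<close> and image
    \<open>(a - 1 / j) / c\<close> all terms in \<open>j\<close> and \<open>1 / j\<close> cancel;
    the constants leave \<open>(a + d) / c\<close> and the Dedekind sum.\<close>
  have expo: "2 * of_real pi * \<i> * (\<gamma> / 24) + X = of_real pi * \<i> / 12 *
     of_real (of_int (a + d) / of_int c - 12 * dedekind_sum d c - 3) + 2 * of_real pi * \<i> * (\<tau> / 24)"
  proof -
    have "2 * P * (\<gamma> / 24) + P * ((j + 1 / j) / (12 * of_int c) - s - 1 / 4) =
      P / 12 * ((of_int a + of_int d) / of_int c - 12 * s - 3) + 2 * P * (\<tau> / 24)" for P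
      unfolding g tt using c0 j0 by (simp add: field_simps)
    from this[of "of_real pi * \<i>"] show ?thesis by (simp add: X_def s_def mult.assoc)
  qed
  have "dedekind_eta \<gamma> = varpi \<tau> \<tau> * csqrt j * exp (2 * of_real pi * \<i> * (\<gamma> / 24) + X)"
    by (simp add: dedekind_eta_varpi v e2pi_def exp_add)
  also have "\<dots> = eta_const a c d * dedekind_eta \<tau> * csqrt j"
    unfolding expo exp_add by (simp add: dedekind_eta_varpi eta_const_def e2pi_def)
  finally show ?thesis by (simp add: \<gamma>_def j_def)
qed

text \<open>The integral evaluates the product only where the real part of \<open>1 / j\<close> is
  large enough. Both sides are holomorphic on the half-plane, \<open>j\<close> never meeting the cut
  of \<open>csqrt\<close>, so the identity extends.\<close>

lemma eta_transformation:
  assumes up: "Im \<tau> > 0"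
  shows "dedekind_eta (lin a b \<tau> / lin c d \<tau>) = eta_const a c d * dedekind_eta \<tau> * csqrt (lin c d \<tau>)"
proof -
  define H where "H = {\<tau>. Im \<tau> > 0}"
  define f where "f = (\<lambda>\<tau>. dedekind_eta (lin a b \<tau> / lin c d \<tau>) - eta_const a c d * dedekind_eta \<tau> * csqrt (lin c d \<tau>))"
  define S where "S = {\<tau> \<in> H. pi < 2 * pi * Re (1 / lin c d \<tau>)}"
  have linh: "lin m n holomorphic_on A" for m n A unfolding lin_def[abs_def] by (intro holomorphic_intros)
  have j: "lin c d \<tau> \<noteq> 0" "Im (lin a b \<tau> / lin c d \<tau>) > 0" "lin c d \<tau> \<notin> \<real>\<^sub>\<le>\<^sub>0" if "\<tau> \<in> H" for \<tau>
    using lin_upper[OF det c, of \<tau>] that by (auto simp: H_def complex_nonpos_Reals_iff)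
  have "(dedekind_eta \<circ> (\<lambda>\<tau>. lin a b \<tau> / lin c d \<tau>)) holomorphic_on H"
    by (rule holomorphic_on_compose_gen[OF _ holomorphic_dedekind_eta])
       (use j in \<open>auto intro!: holomorphic_on_divide linh\<close>)
  hence hf: "f holomorphic_on H"
    unfolding f_def using j holomorphic_dedekind_eta
    by (intro holomorphic_intros holomorphic_on_csqrt' linh) (auto simp: o_def H_def)
  have oH: "open H" "connected H" unfolding H_def
    by (auto intro!: open_halfspace_Im_gt convex_connected convex_halfspace_Im_gt)
  have "lin c d -` ball (of_real (pi / pi)) (pi / pi) \<inter> H = S"
    unfolding S_def vimage_def Re_inverse_gt_iff_ball[OF pi_gt_zero] by blast
  moreover have "open (lin c d -` ball (of_real (pi / pi)) (pi / pi))"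
    by (intro open_vimage holomorphic_on_imp_continuous_on linh open_ball)
  ultimately have oS: "open S" using oH by (metis open_Int)
  \<comment> \<open>Chosen so that \<open>j = 1 + \<i> / 2\<close>, whose inverse has real part
    \<open>4 / 5\<close>; this exceeds the value \<open>1 / 2\<close> required for the height
    \<open>pi\<close>.\<close>
  define \<xi> where "\<xi> = (1 + \<i> / 2 - of_int d) / of_int c"
  have lx: "lin c d \<xi> = 1 + \<i> / 2" using c by (simp add: \<xi>_def lin_def)
  have "Im \<xi> = 1 / 2 / real_of_int c" by (simp add: \<xi>_def)
  hence "\<xi> \<in> H" using c by (simp add: H_def)
  moreover have "Re (1 / (1 + \<i> / 2)) = 4 / 5"
    by (simp add: Re_divide power2_eq_square)
  ultimately have \<xi>: "\<xi> \<in> S" by (simp add: S_def lx)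
  have "f \<tau> = 0"
  proof (rule analytic_continuation[OF hf oH])
    show "S \<subseteq> H" "\<xi> \<in> H" using \<xi> by (auto simp: S_def)
    show "\<xi> islimpt S" using oS \<xi> by (simp add: interior_limit_point interior_open)
    show "f z = 0" if "z \<in> S" for z
      using eta_transformation_local[of pi z] that by (simp add: f_def S_def H_def)
    show "\<tau> \<in> H" using up by (simp add: H_def)
  qed
  thus ?thesis by (simp add: f_def)
qed

section \<open>Values of the continuations\<close>

lemma connected_gam_domain: "connected (gam_domain c d)"
proof -
  have "- (complex_of_real ` {..0}) = - \<real>\<^sub>\<le>\<^sub>0"
    by (auto simp: complex_nonpos_Reals_iff image_iff complex_eq_iff)
  hence "connected (- \<real>\<^sub>\<le>\<^sub>0 :: complex set)"
    using starlike_imp_connected[OF starlike_slotted_complex_plane_left[of 0]] by simp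
  hence "connected (UNIV \<times> (- \<real>\<^sub>\<le>\<^sub>0) :: (complex \<times> complex) set)" by (intro connected_Times) auto
  moreover have "continuous_on (UNIV \<times> (- \<real>\<^sub>\<le>\<^sub>0)) (\<lambda>p :: complex \<times> complex. (fst p, (snd p - of_int d) / of_int c))"
    using c by (intro continuous_intros) auto
  ultimately have "connected ((\<lambda>p :: complex \<times> complex. (fst p, (snd p - of_int d) / of_int c)) ` (UNIV \<times> (- \<real>\<^sub>\<le>\<^sub>0)))"
    by (intro connected_continuous_image)
  also have "(\<lambda>p :: complex \<times> complex. (fst p, (snd p - of_int d) / of_int c)) ` (UNIV \<times> (- \<real>\<^sub>\<le>\<^sub>0)) = gam_domain c d"
  proof (intro equalityI subsetI)
    fix x assume "x \<in> (\<lambda>p :: complex \<times> complex. (fst p, (snd p - of_int d) / of_int c)) ` (UNIV \<times> (- \<real>\<^sub>\<le>\<^sub>0))"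
    thus "x \<in> gam_domain c d" using c by (auto simp: gam_domain_def lin_def)
  next
    fix x assume x: "x \<in> gam_domain c d"
    thus "x \<in> (\<lambda>p :: complex \<times> complex. (fst p, (snd p - of_int d) / of_int c)) ` (UNIV \<times> (- \<real>\<^sub>\<le>\<^sub>0))"
      using c by (intro image_eqI[of _ _ "(fst x, lin c d (snd x))"]) (auto simp: gam_domain_def lin_def)
  qed
  finally show ?thesis .
qed

lemma upper_subset_gam_domain: "UNIV \<times> upper_half_plane \<subseteq> gam_domain c d"
  using c by (auto simp: upper_half_plane_def gam_domain_def complex_nonpos_Reals_iff)

lemma generic_subset: "generic_points \<subseteq> UNIV \<times> upper_half_plane"
  by (auto simp: generic_points_def upper_half_plane_def)

text \<open>The common frame for Faddeev's function and the cocycle: each is one of the quotients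
  from \<open>gam_meromorphic\<close> times elementary factors \<open>EA / EB\<close> that are
  holomorphic on the whole slit domain.\<close>

lemma continuation2_gam:
  assumes Q: "\<exists>F. F meromorphic2_on gam_domain c d \<and> (\<forall>x\<in>generic_points. F x = Q x)"
    and EA: "EA holomorphic2_on gam_domain c d" and EB: "EB holomorphic2_on gam_domain c d"
    and f: "f holomorphic2_on (UNIV \<times> upper_half_plane)" and g: "g holomorphic2_on (UNIV \<times> upper_half_plane)"
    and nz: "\<And>x. x \<in> generic_points \<Longrightarrow> EB x \<noteq> 0 \<and> g x \<noteq> 0 \<and> f x / g x = Q x * (EA x / EB x)"
    and B: "open B" "connected B" "B \<subseteq> gam_domain c d" "p \<in> B" and \<phi>: "\<phi> holomorphic2_on B"
    and V: "B \<inter> generic_points \<noteq> {}" "\<And>x. x \<in> B \<inter> generic_points \<Longrightarrow> \<phi> x = f x / g x"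
  shows "continuation2 f g (UNIV \<times> upper_half_plane) (gam_domain c d) p = \<phi> p"
proof -
  obtain F where F: "F meromorphic2_on gam_domain c d" "\<And>x. x \<in> generic_points \<Longrightarrow> F x = Q x" using Q by blast
  obtain x0 where x0: "x0 \<in> generic_points" using V(1) by blast
  have "(\<lambda>x. EA x / EB x) meromorphic2_on gam_domain c d"
  proof (rule meromorphic2_onI)
    fix q assume "q \<in> gam_domain c d"
    then obtain r where r: "r > 0" "ball q r \<subseteq> gam_domain c d" using open_gam_domain open_contains_ball by blast
    have "\<exists>x\<in>ball q r. EB x \<noteq> 0"
    proof (rule holomorphic2_nonzero_open[OF EB open_gam_domain connected_gam_domain])
      show "\<exists>x\<in>gam_domain c d. EB x \<noteq> 0" using x0 nz generic_subset upper_subset_gam_domain by blast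
    qed (use r in auto)
    thus "\<exists>r>0. \<exists>g h. ball q r \<subseteq> gam_domain c d \<and> g holomorphic2_on ball q r \<and> h holomorphic2_on ball q r \<and>
     (\<exists>x\<in>ball q r. h x \<noteq> 0) \<and> (\<forall>x\<in>ball q r. h x \<noteq> 0 \<longrightarrow> EA x / EB x = g x / h x)"
      using r by (intro meromorphic2_localI[of r _ _ EA EB] holomorphic2_on_subset[OF EA] holomorphic2_on_subset[OF EB]) auto
  qed
  hence mero: "(\<lambda>x. F x * (EA x / EB x)) meromorphic2_on gam_domain c d" by (rule meromorphic2_on_mult[OF F(1)])
  have agree: "g x \<noteq> 0 \<and> F x * (EA x / EB x) = f x / g x" if "x \<in> generic_points" for x
    using nz[OF that] F(2)[OF that] by simp
  show ?thesis
  proof (rule continuation2_eqI[OF open_gam_domain connected_gam_domain _ _ upper_subset_gam_domain f g mero open_generic_points _ generic_subset agree B \<phi>])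
    show "connected (UNIV \<times> upper_half_plane :: (complex \<times> complex) set)"
      unfolding upper_half_plane_def
      by (intro connected_Times) (auto intro!: convex_connected convex_halfspace_Im_gt)
    show "generic_points \<noteq> {}" using x0 by blast
    show "open (B \<inter> generic_points)" using B(1) open_generic_points by blast
    show "\<phi> x = F x * (EA x / EB x)" if "x \<in> B \<inter> generic_points" for x
      using V(2)[OF that] agree[of x] that by auto
  qed (use V in \<open>auto intro: open_Times\<close>)
qed

end

section \<open>Shifts by integer multiples of the modulus\<close>

definition shift_top :: "int \<Rightarrow> complex \<Rightarrow> complex \<Rightarrow> complex" where
  "shift_top m x t = (\<Prod>k<nat (- m). 1 - e2pi (x + of_int m * t + of_nat k * t))"

definition shift_bot :: "int \<Rightarrow> complex \<Rightarrow> complex \<Rightarrow> complex" where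
  "shift_bot m x t = (\<Prod>k<nat m. 1 - e2pi (x + of_nat k * t))"

text \<open>For either sign of \<open>m\<close> at most one of \<open>shift_top\<close> and
  \<open>shift_bot\<close> is nontrivial, since \<open>nat\<close> empties the other range. This
  avoids a case distinction, and a division, in the applications.\<close>

lemma varpi_shift_int:
  assumes "Im t > 0"
  shows "varpi (x + of_int m * t) t * shift_bot m x t = shift_top m x t * varpi x t"
proof (cases "m \<ge> 0")
  case True
  hence m: "of_int m = (of_nat (nat m) :: complex)" by simp
  show ?thesis unfolding m using True varpi_split[OF assms, of x "nat m"]
    by (simp add: shift_top_def shift_bot_def mult.commute)
next
  case False
  have "of_nat (nat (- m)) = (of_int (- m) :: complex)" using False by (intro of_nat_nat) simp
  hence "x + of_int m * t + of_nat (nat (- m)) * t = x" by simp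
  thus ?thesis using False varpi_split[OF assms, of "x + of_int m * t" "nat (- m)"]
    by (simp add: shift_top_def shift_bot_def)
qed

lemma e2pi_lattice_neq_1:
  assumes "x \<notin> period_lattice t"
  shows "e2pi (x + of_int m * t) \<noteq> 1"
proof
  assume "e2pi (x + of_int m * t) = 1"
  then obtain n where "x + of_int m * t = of_int n" by (auto simp: e2pi_eq_1_iff elim: Ints_cases)
  hence "x = of_int (- m) * t + of_int n" by (simp add: algebra_simps)
  thus False using assms period_latticeI by blast
qed

lemma shift_nonzero:
  assumes "x \<notin> period_lattice t"
  shows "shift_top m x t \<noteq> 0" "shift_bot m x t \<noteq> 0"
proof -
  have "e2pi (x + of_int m * t + of_nat k * t) \<noteq> 1" for k
    using e2pi_lattice_neq_1[OF assms, of "m + int k"] by (simp add: algebra_simps)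
  thus "shift_top m x t \<noteq> 0" by (fastforce simp: shift_top_def)
  have "e2pi (x + of_nat k * t) \<noteq> 1" for k
    using e2pi_lattice_neq_1[OF assms, of "int k"] by simp
  thus "shift_bot m x t \<noteq> 0" by (fastforce simp: shift_bot_def)
qed

lemma holomorphic2_shift:
  assumes "X holomorphic2_on U" "T holomorphic2_on U"
  shows "(\<lambda>p. shift_top m (X p) (T p)) holomorphic2_on U" "(\<lambda>p. shift_bot m (X p) (T p)) holomorphic2_on U"
  unfolding shift_top_def shift_bot_def using assms
  by (auto intro!: holomorphic2_on_prod holomorphic2_on_diff holomorphic2_on_const holomorphic2_e2pi
      holomorphic2_on_add holomorphic2_on_mult)

text \<open>At the fixed point the rescaled argument is \<open>x + m t + n\<close> with unchanged
  modulus. Undoing the shift there uses the same factors with top and bottom exchanged.\<close>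

lemma shift_inversion:
  "shift_top (- m) (x + of_int m * t + of_int n) t = shift_bot m x t"
  "shift_bot (- m) (x + of_int m * t + of_int n) t = shift_top m x t"
proof -
  have "e2pi (x + of_int m * t + of_int n + of_int (- m) * t + of_nat k * t) = e2pi (x + of_nat k * t)" for k
    using e2pi_add_of_int[of "x + of_nat k * t" n] by (simp add: add_ac)
  thus "shift_top (- m) (x + of_int m * t + of_int n) t = shift_bot m x t"
    by (simp add: shift_top_def shift_bot_def)
  have "e2pi (x + of_int m * t + of_int n + of_nat k * t) = e2pi (x + of_int m * t + of_nat k * t)" for k
    using e2pi_add_of_int[of "x + of_int m * t + of_nat k * t" n] by (simp add: add_ac)
  thus "shift_bot (- m) (x + of_int m * t + of_int n) t = shift_top m x t"
    by (simp add: shift_top_def shift_bot_def)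
qed

definition mob :: "int \<Rightarrow> int \<Rightarrow> int \<Rightarrow> int \<Rightarrow> complex \<times> complex \<Rightarrow> complex" where
  "mob a b c d p = lin a b (snd p) / lin c d (snd p)"

definition rescale :: "int \<Rightarrow> int \<Rightarrow> complex \<times> complex \<Rightarrow> complex" where
  "rescale c d p = fst p / lin c d (snd p)"

definition sigma_num :: "int \<Rightarrow> int \<Rightarrow> int \<Rightarrow> int \<Rightarrow> int \<Rightarrow> int \<Rightarrow> complex \<times> complex \<Rightarrow> complex" where
  "sigma_num a b c d m n p = varpi (rescale c d p + of_int m * mob a b c d p - of_int n) (mob a b c d p)"

lemma gam_domain_lin_nonzero: "p \<in> gam_domain c d \<Longrightarrow> lin c d (snd p) \<noteq> 0"
  by (auto simp: gam_domain_def)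

lemma holomorphic2_mob: "mob a b c d holomorphic2_on gam_domain c d"
  unfolding mob_def[abs_def] by (intro holomorphic2_on_divide holomorphic2_lin gam_domain_lin_nonzero)

lemma holomorphic2_rescale: "rescale c d holomorphic2_on gam_domain c d"
  unfolding rescale_def[abs_def]
  by (intro holomorphic2_on_divide holomorphic2_lin holomorphic2_on_fst gam_domain_lin_nonzero)

lemma rescale_period_lattice:
  assumes "lin c d (snd p) \<noteq> 0" "rescale c d p \<in> period_lattice (mob a b c d p)"
  shows "fst p \<in> period_lattice (snd p)"
proof -
  obtain m n where "fst p / lin c d (snd p) = of_int m * (lin a b (snd p) / lin c d (snd p)) + of_int n"
    using assms(2) unfolding period_lattice_def rescale_def mob_def by blast
  hence "fst p = of_int m * lin a b (snd p) + of_int n * lin c d (snd p)"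
    using assms(1) by (simp add: field_simps)
  hence "fst p = of_int (m * a + n * c) * snd p + of_int (m * b + n * d)"
    by (simp add: lin_def algebra_simps)
  thus ?thesis by (rule period_latticeI)
qed

text \<open>At the fixed point \<open>j\<close> is an eigenvalue, so \<open>j + 1 / j\<close> is the
  trace and the exponent becomes that of the Rademacher invariant with opposite sign.\<close>

lemma eta_const_eigenvalue:
  assumes "j + 1 / j = of_int (a + d)" "c > 0"
  shows "exp (- of_real pi * \<i> * ((j + 1 / j) / (12 * of_int c) - of_real (dedekind_sum d c) - 1 / 4)) = 1 / eta_const a c d"
proof -
  have e: "eta_const a c d = exp (of_real pi * \<i> / 12 * (of_int (a + d) / of_int c - 12 * of_real (dedekind_sum d c) - 3))"
    by (simp add: eta_const_def)
  have "- P * \<i> * (S / (12 * of_int c) - D - 1 / 4) = - (P * \<i> / 12 * (S / of_int c - 12 * D - 3))" for P D S :: complex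
    using assms(2) by (simp add: field_simps)
  thus ?thesis unfolding assms(1) e by (simp only: exp_minus inverse_eq_divide)
qed

context
  fixes a b c d :: int
  assumes det: "a * d - b * c = 1" and c: "c > 0"
begin

lemma mob_upper: "p \<in> UNIV \<times> upper_half_plane \<Longrightarrow> Im (mob a b c d p) > 0"
  using lin_upper(4)[OF det c, of "snd p"] by (auto simp: mob_def upper_half_plane_def)

lemma generic_pointsD:
  assumes "p \<in> generic_points"
  shows "Im (snd p) > 0" "fst p \<notin> period_lattice (snd p)" "p \<in> gam_domain c d" "p \<in> UNIV \<times> upper_half_plane"
    "rescale c d p \<notin> period_lattice (mob a b c d p)" "Im (mob a b c d p) > 0"
    "gam_num c d p = varpi (fst p) (snd p)" "gam_den c d p = varpi (rescale c d p) (mob a b c d p)"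
    "gam_num c d p \<noteq> 0" "gam_den c d p \<noteq> 0"
proof -
  show 1: "Im (snd p) > 0" "fst p \<notin> period_lattice (snd p)" using assms by (auto simp: generic_points_def)
  show 2: "p \<in> UNIV \<times> upper_half_plane" using assms generic_subset[OF det c] by blast
  thus 3: "p \<in> gam_domain c d" using upper_subset_gam_domain[OF det c] by blast
  show "rescale c d p \<notin> period_lattice (mob a b c d p)"
    using rescale_period_lattice[OF gam_domain_lin_nonzero[OF 3]] 1(2) by blast
  show "Im (mob a b c d p) > 0" by (rule mob_upper[OF 2])
  show "gam_num c d p = varpi (fst p) (snd p)" "gam_den c d p = varpi (rescale c d p) (mob a b c d p)"
    using gam_upper[OF det c 1(1), of "fst p"] by (simp_all add: rescale_def mob_def)
  show "gam_num c d p \<noteq> 0" "gam_den c d p \<noteq> 0" using gam_nonzero[OF det c _ 1(2)] 1(1) by simp_all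
qed

lemma sigma_num_generic:
  assumes "p \<in> generic_points"
  shows "sigma_num a b c d m n p = gam_den c d p * (shift_top m (rescale c d p) (mob a b c d p) / shift_bot m (rescale c d p) (mob a b c d p))"
proof -
  note g = generic_pointsD[OF assms]
  have "varpi (rescale c d p + of_int m * mob a b c d p - of_int n) (mob a b c d p) =
      varpi (rescale c d p + of_int m * mob a b c d p) (mob a b c d p)"
    using varpi_of_int[of "rescale c d p + of_int m * mob a b c d p" "- n"] by simp
  thus ?thesis unfolding sigma_num_def g(8)
    using varpi_shift_int[OF g(6), of "rescale c d p" m] shift_nonzero(2)[OF g(5), of m] by (simp add: field_simps)
qed

lemma holomorphic2_sigma_num: "sigma_num a b c d m n holomorphic2_on UNIV \<times> upper_half_plane"
  unfolding sigma_num_def[abs_def]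
  by (intro holomorphic2_varpi_compose holomorphic2_on_diff holomorphic2_on_add holomorphic2_on_mult holomorphic2_on_const
      holomorphic2_on_subset[OF holomorphic2_mob] holomorphic2_on_subset[OF holomorphic2_rescale]
      upper_subset_gam_domain[OF det c] mob_upper)

lemma holomorphic2_fad_numerator: "(\<lambda>p. varpi (of_int m * snd p + fst p) (snd p)) holomorphic2_on UNIV \<times> upper_half_plane"
  by (intro holomorphic2_varpi_compose holomorphic2_on_add holomorphic2_on_mult holomorphic2_on_const
      holomorphic2_on_fst holomorphic2_on_snd) (auto simp: upper_half_plane_def)

lemma fad_numerator_generic:
  assumes "p \<in> generic_points"
  shows "varpi (of_int m * snd p + fst p) (snd p) = gam_num c d p * (shift_top m (fst p) (snd p) / shift_bot m (fst p) (snd p))"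
proof -
  note g = generic_pointsD[OF assms]
  show ?thesis unfolding g(7)
    using varpi_shift_int[OF g(1), of "fst p" m] shift_nonzero(2)[OF g(2), of m] by (simp add: field_simps)
qed

lemma continuation2_sigma:
  assumes B: "open B" "connected B" "B \<subseteq> gam_domain c d" "p \<in> B" and \<phi>: "\<phi> holomorphic2_on B"
    and V: "B \<inter> generic_points \<noteq> {}"
      "\<And>x. x \<in> B \<inter> generic_points \<Longrightarrow> \<phi> x = sigma_num a b c d m n x / varpi (fst x) (snd x)"
  shows "continuation2 (sigma_num a b c d m n) (\<lambda>x. varpi (fst x) (snd x)) (UNIV \<times> upper_half_plane) (gam_domain c d) p = \<phi> p"
proof (rule continuation2_gam[OF det c gam_meromorphic(2)[OF det c]
    holomorphic2_shift(1)[OF holomorphic2_rescale holomorphic2_mob]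
    holomorphic2_shift(2)[OF holomorphic2_rescale holomorphic2_mob] holomorphic2_sigma_num _ _ B \<phi> V])
  show "(\<lambda>x. varpi (fst x) (snd x)) holomorphic2_on UNIV \<times> upper_half_plane"
    using holomorphic2_fad_numerator[of 0] by simp
  fix x assume x: "x \<in> generic_points"
  note g = generic_pointsD[OF x]
  show "shift_bot m (rescale c d x) (mob a b c d x) \<noteq> 0 \<and> varpi (fst x) (snd x) \<noteq> 0 \<and>
     sigma_num a b c d m n x / varpi (fst x) (snd x) = gam_den c d x / gam_num c d x *
     (shift_top m (rescale c d x) (mob a b c d x) / shift_bot m (rescale c d x) (mob a b c d x))"
    using g shift_nonzero[OF g(5), of m] unfolding sigma_num_generic[OF x] by simp
qed

lemma continuation2_faddeev:
  assumes B: "open B" "connected B" "B \<subseteq> gam_domain c d" "p \<in> B" and \<phi>: "\<phi> holomorphic2_on B"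
    and V: "B \<inter> generic_points \<noteq> {}"
      "\<And>x. x \<in> B \<inter> generic_points \<Longrightarrow> \<phi> x = varpi (of_int m * snd x + fst x) (snd x) / sigma_num a b c d 0 0 x"
  shows "continuation2 (\<lambda>x. varpi (of_int m * snd x + fst x) (snd x)) (sigma_num a b c d 0 0) (UNIV \<times> upper_half_plane) (gam_domain c d) p = \<phi> p"
proof (rule continuation2_gam[OF det c gam_meromorphic(1)[OF det c]
    holomorphic2_shift(1)[OF holomorphic2_on_fst holomorphic2_on_snd]
    holomorphic2_shift(2)[OF holomorphic2_on_fst holomorphic2_on_snd] holomorphic2_fad_numerator holomorphic2_sigma_num _ B \<phi> V])
  fix x assume x: "x \<in> generic_points"
  note g = generic_pointsD[OF x]
  have "sigma_num a b c d 0 0 x = gam_den c d x"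
    unfolding sigma_num_generic[OF x] by (simp add: shift_top_def shift_bot_def)
  thus "shift_bot m (fst x) (snd x) \<noteq> 0 \<and> sigma_num a b c d 0 0 x \<noteq> 0 \<and>
     varpi (of_int m * snd x + fst x) (snd x) / sigma_num a b c d 0 0 x = gam_num c d x / gam_den c d x *
     (shift_top m (fst x) (snd x) / shift_bot m (fst x) (snd x))"
    using g shift_nonzero[OF g(2), of m] unfolding fad_numerator_generic[OF x] by simp
qed

text \<open>Near \<open>p\<close> the continuations are \<open>g / h\<close> and
  \<open>h / g\<close>, each times its shift factors. The shift factors are unrelated at nearby
  points, but at \<open>p\<close> the fixed point equation makes them reciprocal by
  \<open>shift_inversion\<close>.\<close>

lemma faddeev_sigma_inverse:
  assumes p: "p \<in> gam_domain c d" "Im (snd p) = 0" "fst p \<notin> period_lattice (snd p)"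
    and fp: "mob a b c d p = snd p" "rescale c d p = fst p + of_int m * snd p + of_int n"
  shows "continuation2 (\<lambda>x. varpi (of_int m * snd x + fst x) (snd x)) (sigma_num a b c d 0 0) (UNIV \<times> upper_half_plane) (gam_domain c d) p =
    inverse (continuation2 (sigma_num a b c d (- m) n) (\<lambda>x. varpi (fst x) (snd x)) (UNIV \<times> upper_half_plane) (gam_domain c d) p)"
proof -
  obtain r g h where *: "r > 0" "ball p r \<subseteq> gam_domain c d" "g holomorphic2_on ball p r" "h holomorphic2_on ball p r"
      "\<forall>x\<in>ball p r. fst x \<notin> period_lattice (snd x) \<longrightarrow> g x \<noteq> 0 \<and> h x \<noteq> 0"
      "\<forall>x\<in>ball p r. Im (snd x) \<noteq> 0 \<longrightarrow> gam_num c d x * h x = g x * gam_den c d x"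
    using gam_local[OF det c p(1)] by (elim exE conjE) (rule that; assumption)
  define T1 B1 T2 B2 where "T1 = (\<lambda>x :: complex \<times> complex. shift_top m (fst x) (snd x))" and "B1 = (\<lambda>x :: complex \<times> complex. shift_bot m (fst x) (snd x))"
    and "T2 = (\<lambda>x. shift_top (- m) (rescale c d x) (mob a b c d x))" and "B2 = (\<lambda>x. shift_bot (- m) (rescale c d x) (mob a b c d x))"
  have hol: "T1 holomorphic2_on ball p r" "B1 holomorphic2_on ball p r" "T2 holomorphic2_on ball p r" "B2 holomorphic2_on ball p r"
    unfolding T1_def B1_def T2_def B2_def
    by (intro holomorphic2_shift holomorphic2_on_fst holomorphic2_on_snd
        holomorphic2_on_subset[OF holomorphic2_mob *(2)] holomorphic2_on_subset[OF holomorphic2_rescale *(2)])+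
  have eq: "T2 p = B1 p" "B2 p = T1 p"
    unfolding T1_def T2_def B1_def B2_def fp by (rule shift_inversion)+
  have nz: "T1 p \<noteq> 0" "B1 p \<noteq> 0" unfolding T1_def B1_def by (rule shift_nonzero[OF p(3)])+
  have gh: "g p \<noteq> 0" "h p \<noteq> 0" using *(1,5) p(3) by auto
  \<comment> \<open>One product collects every factor that occurs in a denominator, so that a single
    ball around \<open>p\<close> is free of all their zeros.\<close>
  define K where "K = (\<lambda>x. g x * h x * T1 x * B1 x * T2 x * B2 x)"
  have "K holomorphic2_on ball p r" unfolding K_def by (intro holomorphic2_on_mult hol *)
  moreover have "K p \<noteq> 0" using eq nz gh by (simp add: K_def)
  ultimately obtain q where q: "q > 0" "ball p q \<subseteq> ball p r" "\<forall>x\<in>ball p q. K x \<noteq> 0"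
    using holomorphic2_nonzero_nbhd[of K "ball p r" p] *(1) by auto
  have V: "ball p q \<inter> generic_points \<noteq> {}"
    using generic_points_meet_real[of "ball p q" "fst p" "snd p"] q(1) p(2) by simp
  have B: "open (ball p q)" "connected (ball p q)" "ball p q \<subseteq> gam_domain c d" "p \<in> ball p q"
    using q *(2) by auto
  have "continuation2 (\<lambda>x. varpi (of_int m * snd x + fst x) (snd x)) (sigma_num a b c d 0 0) (UNIV \<times> upper_half_plane) (gam_domain c d) p =
     (\<lambda>x. (g x * T1 x) / (h x * B1 x)) p"
  proof (rule continuation2_faddeev[OF B _ V])
    show "(\<lambda>x. (g x * T1 x) / (h x * B1 x)) holomorphic2_on ball p q"
      using q by (intro holomorphic2_on_divide holomorphic2_on_mult holomorphic2_on_subset[OF _ q(2)] hol *) (auto simp: K_def)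
    fix x assume x: "x \<in> ball p q \<inter> generic_points"
    note gp = generic_pointsD[OF IntD2[OF x]]
    have s0: "sigma_num a b c d 0 0 x = gam_den c d x"
      unfolding sigma_num_generic[OF IntD2[OF x]] by (simp add: shift_top_def shift_bot_def)
    have "gam_num c d x * h x = g x * gam_den c d x" using *(6) x q(2) gp(1) by auto
    moreover have "h x \<noteq> 0" "B1 x \<noteq> 0" using q(3) x by (auto simp: K_def)
    ultimately show "(g x * T1 x) / (h x * B1 x) = varpi (of_int m * snd x + fst x) (snd x) / sigma_num a b c d 0 0 x"
      unfolding s0 fad_numerator_generic[OF IntD2[OF x]] T1_def[symmetric, THEN fun_cong] B1_def[symmetric, THEN fun_cong]
      using gp(10) by (simp add: frac_eq_eq mult_ac)
  qed
  moreover have "continuation2 (sigma_num a b c d (- m) n) (\<lambda>x. varpi (fst x) (snd x)) (UNIV \<times> upper_half_plane) (gam_domain c d) p =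
     (\<lambda>x. (h x * T2 x) / (g x * B2 x)) p"
  proof (rule continuation2_sigma[OF B _ V])
    show "(\<lambda>x. (h x * T2 x) / (g x * B2 x)) holomorphic2_on ball p q"
      using q by (intro holomorphic2_on_divide holomorphic2_on_mult holomorphic2_on_subset[OF _ q(2)] hol *) (auto simp: K_def)
    fix x assume x: "x \<in> ball p q \<inter> generic_points"
    note gp = generic_pointsD[OF IntD2[OF x]]
    have "gam_num c d x * h x = g x * gam_den c d x" using *(6) x q(2) gp(1) by auto
    moreover have "g x \<noteq> 0" "B2 x \<noteq> 0" using q(3) x by (auto simp: K_def)
    ultimately show "(h x * T2 x) / (g x * B2 x) = sigma_num a b c d (- m) n x / varpi (fst x) (snd x)"
      unfolding gp(7)[symmetric] sigma_num_generic[OF IntD2[OF x]] T2_def[symmetric, THEN fun_cong] B2_def[symmetric, THEN fun_cong]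
      using gp(9) by (simp add: frac_eq_eq mult_ac)
  qed
  ultimately show ?thesis using eq nz gh by simp
qed

end

section \<open>Values at points of the period lattice\<close>

definition e2pi_quot :: "complex \<Rightarrow> complex" where
  "e2pi_quot w = (if w = 0 then deriv (\<lambda>w. 1 - e2pi w) 0 else (1 - e2pi w - (1 - e2pi 0)) / (w - 0))"

text \<open>The removable singularity of \<open>(1 - e2pi w) / w\<close> at 0. The terms with 0 in
  the definition give it the form of a difference quotient that \<open>pole_lemma_open\<close>
  expects.\<close>

lemma holomorphic_e2pi_quot: "e2pi_quot holomorphic_on UNIV"
  unfolding e2pi_quot_def[abs_def]
  by (rule pole_lemma_open) (auto intro!: holomorphic_intros holomorphic_e2pi)

lemma holomorphic2_e2pi_quot: "f holomorphic2_on U \<Longrightarrow> (\<lambda>p. e2pi_quot (f p)) holomorphic2_on U"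
  by (rule holomorphic2_on_compose1[OF holomorphic_e2pi_quot]) auto

lemma e2pi_quot_mult: "w * e2pi_quot w = 1 - e2pi w"
  by (simp add: e2pi_quot_def)

lemma e2pi_quot_0: "e2pi_quot 0 \<noteq> 0"
proof -
  have "((\<lambda>w. 1 - e2pi w) has_field_derivative - (2 * of_real pi * \<i>)) (at 0)"
    unfolding e2pi_def by (auto intro!: derivative_eq_intros)
  thus ?thesis by (simp add: e2pi_quot_def DERIV_imp_deriv)
qed

context
  fixes a b c d :: int
  assumes det: "a * d - b * c = 1" and c: "c > 0"
begin

context
  fixes R R' m n :: int
  assumes m: "m = R - c * R' - d * R" and n: "n = R' - a * R' - b * R"
begin

text \<open>\<open>(n, m)\<close> is \<open>I - \<gamma>\<close> applied to \<open>(R', R)\<close>,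
  the cocycle data of an integral vector. Recentring moves the associated point
  \<open>R \<tau> - R'\<close> to \<open>z = 0\<close>.\<close>

definition recentre :: "complex \<times> complex \<Rightarrow> complex \<times> complex" where
  "recentre p = (fst p - of_int R * snd p + of_int R', snd p)"

lemma holomorphic2_recentre: "(\<lambda>p. fst (recentre p)) holomorphic2_on U"
  unfolding recentre_def fst_conv
  by (intro holomorphic2_on_add holomorphic2_on_diff holomorphic2_on_mult holomorphic2_on_const holomorphic2_on_fst holomorphic2_on_snd)

lemma recentre_generic:
  assumes "p \<in> generic_points"
  shows "recentre p \<in> generic_points"
proof -
  have False if *: "fst p - of_int R * snd p + of_int R' \<in> period_lattice (snd p)"
  proof -
    obtain k l where "fst p - of_int R * snd p + of_int R' = of_int k * snd p + of_int l"
      using * unfolding period_lattice_def by blast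
    hence "fst p = of_int (k + R) * snd p + of_int (l - R')" by (simp add: algebra_simps)
    hence "fst p \<in> period_lattice (snd p)" by (rule period_latticeI)
    thus False using assms by (auto simp: generic_points_def)
  qed
  thus ?thesis using assms by (auto simp: generic_points_def recentre_def)
qed

text \<open>By the determinant
  \<open>(c R' + d R) (a \<tau> + b) - (a R' + b R) (c \<tau> + d)\<close> collapses to
  \<open>R \<tau> - R'\<close>, which is the translation made by \<open>recentre\<close>.\<close>

lemma rescale_recentre:
  assumes "lin c d (snd p) \<noteq> 0"
  shows "rescale c d p + of_int m * mob a b c d p - of_int n =
    rescale c d (recentre p) + of_int R * mob a b c d p - of_int R'"
proof -
  define z t j where "z = fst p" and "t = snd p" and "j = lin c d (snd p)"
  have "(1 - (of_int a * of_int d - of_int b * of_int c)) * (of_int R * t - of_int R') = (0 :: complex)"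
    using arg_cong[OF det, of complex_of_int] by simp
  hence "z + of_int m * lin a b t - of_int n * j =
      (z - of_int R * t + of_int R') + of_int R * lin a b t - of_int R' * j"
    unfolding j_def t_def[symmetric] lin_def m n by (simp add: algebra_simps)
  thus ?thesis using assms unfolding rescale_def mob_def recentre_def fst_conv snd_conv z_def[symmetric] t_def[symmetric]
    by (simp add: divide_simps j_def t_def)
qed

text \<open>In the recentred variable the shift is by the same \<open>R\<close> above and below,
  once with the rescaled data and once with the original ones. At the fixed point these data
  coincide.\<close>

lemma sigma_quotient_recentre:
  assumes "p \<in> generic_points"
  defines "q \<equiv> recentre p"
  shows "sigma_num a b c d m n p / varpi (fst p) (snd p) = gam_den c d q / gam_num c d q *
     (shift_top R (rescale c d q) (mob a b c d q) * shift_bot R (fst q) (snd q) /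
       (shift_bot R (rescale c d q) (mob a b c d q) * shift_top R (fst q) (snd q)))"
proof -
  note gp = generic_pointsD[OF det c assms(1)]
  have q: "q \<in> generic_points" unfolding q_def by (rule recentre_generic[OF assms(1)])
  note gq = generic_pointsD[OF det c q]
  have mob: "mob a b c d p = mob a b c d q" by (simp add: mob_def q_def recentre_def)
  have "sigma_num a b c d m n p = sigma_num a b c d R R' q"
    unfolding sigma_num_def rescale_recentre[OF gam_domain_lin_nonzero[OF gp(3)]] unfolding q_def[symmetric] mob ..
  moreover have "fst p = fst q + of_int R * snd q + of_int (- R')" "snd p = snd q" by (simp_all add: q_def recentre_def)
  hence "varpi (fst p) (snd p) = varpi (fst q + of_int R * snd q) (snd q)" by (simp only: varpi_of_int)
  moreover have "varpi (fst q + of_int R * snd q) (snd q) = gam_num c d q * (shift_top R (fst q) (snd q) / shift_bot R (fst q) (snd q))"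
    using fad_numerator_generic[OF det c q, of R] by (simp add: add.commute)
  ultimately show ?thesis unfolding sigma_num_generic[OF det c q] by (simp add: mult_ac)
qed

text \<open>\<open>A\<close> stands for a holomorphic extension of the quotient of shift factors
  through the lattice point, where top and bottom may both vanish; \<open>gam_exp\<close> is the
  extension of \<open>gam_num / gam_den\<close>.\<close>

lemma sigma_value:
  assumes y: "0 < y" "y < 2 * pi" "y < 2 * pi * Re (1 / lin c d (snd p))"
    and p: "fst (recentre p) = 0" "Im (snd p) = 0" "p \<in> gam_domain c d"
    and r: "r > 0" "ball p r \<subseteq> gam_domain c d" and A: "A holomorphic2_on ball p r"
    and eq: "\<And>x. x \<in> ball p r \<inter> generic_points \<Longrightarrow>
      A x = shift_top R (rescale c d (recentre x)) (mob a b c d (recentre x)) * shift_bot R (fst (recentre x)) (snd x) /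
       (shift_bot R (rescale c d (recentre x)) (mob a b c d (recentre x)) * shift_top R (fst (recentre x)) (snd x))"
  shows "continuation2 (sigma_num a b c d m n) (\<lambda>x. varpi (fst x) (snd x)) (UNIV \<times> upper_half_plane) (gam_domain c d) p =
    A p / gam_exp c d y (0, snd p)"
proof -
  have rp: "recentre p = (0, snd p)" using p(1) by (simp add: recentre_def)
  have "continuous_on UNIV recentre"
    unfolding recentre_def[abs_def] by (intro continuous_intros)
  from open_vimage[OF open_gam_strip[OF y(1)] this]
  have "open (recentre -` gam_strip c d y \<inter> ball p r)" by (intro open_Int) auto
  moreover have "p \<in> recentre -` gam_strip c d y \<inter> ball p r"
    using gam_strip_0[OF det c y(1,3)] r(1) by (simp add: rp)
  ultimately obtain q where q: "q > 0" "ball p q \<subseteq> recentre -` gam_strip c d y \<inter> ball p r"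
    using open_contains_ball by blast
  have V: "ball p q \<inter> generic_points \<noteq> {}"
    using generic_points_meet_real[of "ball p q" "fst p" "snd p"] q(1) p(2) by simp
  have B: "open (ball p q)" "connected (ball p q)" "ball p q \<subseteq> gam_domain c d" "p \<in> ball p q"
    using q r by auto
  have "continuation2 (sigma_num a b c d m n) (\<lambda>x. varpi (fst x) (snd x)) (UNIV \<times> upper_half_plane) (gam_domain c d) p =
     (\<lambda>x. A x / gam_exp c d y (recentre x)) p"
  proof (rule continuation2_sigma[OF det c B _ V])
    have "(\<lambda>x. gam_exp c d y (fst (recentre x), snd x)) holomorphic2_on ball p q"
      by (rule holomorphic2_on_compose[OF holomorphic2_recentre holomorphic2_on_snd holomorphic2_gam_exp[OF y(1,2)]])
         (use q(2) in \<open>auto simp: recentre_def\<close>)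
    hence "(\<lambda>x. gam_exp c d y (recentre x)) holomorphic2_on ball p q" by (simp add: recentre_def)
    thus "(\<lambda>x. A x / gam_exp c d y (recentre x)) holomorphic2_on ball p q"
      using q(2) by (intro holomorphic2_on_divide holomorphic2_on_subset[OF A] gam_exp_nonzero) auto
    fix x assume x: "x \<in> ball p q \<inter> generic_points"
    define w where "w = recentre x"
    have xg: "x \<in> generic_points" using x by blast
    have w: "w \<in> generic_points" unfolding w_def by (rule recentre_generic[OF xg])
    note gw = generic_pointsD[OF det c w]
    have "w \<in> gam_strip c d y" using x q(2) by (auto simp: w_def)
    hence "gam_exp c d y w * gam_den c d w = gam_num c d w"
      using gam_exp_quotient[OF det c y(1,2)] gw(1) by simp
    hence "1 / gam_exp c d y w = gam_den c d w / gam_num c d w"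
      using gw(9) gam_exp_nonzero[of c d y w] by (simp add: field_simps)
    moreover have "snd w = snd x" by (simp add: w_def recentre_def)
    moreover have "A x = shift_top R (rescale c d w) (mob a b c d w) * shift_bot R (fst w) (snd x) /
       (shift_bot R (rescale c d w) (mob a b c d w) * shift_top R (fst w) (snd x))"
      using eq[of x] x q(2) by (auto simp: w_def)
    ultimately have "A x * (1 / gam_exp c d y w) = sigma_num a b c d m n x / varpi (fst x) (snd x)"
      unfolding sigma_quotient_recentre[OF xg] w_def[symmetric] by (simp only: mult.commute)
    thus "A x / gam_exp c d y (recentre x) = sigma_num a b c d m n x / varpi (fst x) (snd x)"
      by (simp add: w_def)
  qed
  thus ?thesis by (simp only: rp)
qed

text \<open>Irrationality of the fixed point ensures that among the shift factors at the origin only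
  the one with \<open>k = 0\<close> vanishes.\<close>

lemma shift_factor_nonzero:
  assumes "Re t \<notin> \<rat>" "k \<noteq> 0"
  shows "e2pi (of_int k * t) \<noteq> 1"
proof
  assume "e2pi (of_int k * t) = 1"
  then obtain l where "of_int k * t = of_int l" by (auto simp: e2pi_eq_1_iff elim: Ints_cases)
  hence "Re (of_int k * t) = of_int l" by simp
  hence "Re t = of_int l / of_int k" using assms(2) by (simp add: field_simps)
  thus False using assms(1) by simp
qed

text \<open>For \<open>R \<le> 0\<close> the index 0 does not occur, and the two shift products
  coincide at \<open>p\<close>. For \<open>R > 0\<close> both contain it, in \<open>z\<close> and in
  \<open>z / j\<close>; the zeros cancel and leave the factor \<open>j\<close>.\<close>

lemma sigma_value_lattice:
  assumes y: "0 < y" "y < 2 * pi" "y < 2 * pi * Re (1 / lin c d (snd p))"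
    and p: "fst (recentre p) = 0" "Im (snd p) = 0" "p \<in> gam_domain c d" "Re (snd p) \<notin> \<rat>" "mob a b c d p = snd p"
  shows "continuation2 (sigma_num a b c d m n) (\<lambda>x. varpi (fst x) (snd x)) (UNIV \<times> upper_half_plane) (gam_domain c d) p =
    (if R > 0 then lin c d (snd p) else 1) / gam_exp c d y (0, snd p)"
proof -
  have rp: "recentre p = (0, snd p)" using p(1) by (simp add: recentre_def)
  have rp0: "rescale c d (recentre p) = 0" by (simp add: rescale_def rp)
  have mr: "mob a b c d (recentre x) = mob a b c d x" for x by (simp add: mob_def recentre_def)
  have rh: "rescale c d (recentre x) = fst (recentre x) / lin c d (snd x)" for x by (simp add: rescale_def recentre_def)
  have hm: "(\<lambda>x. rescale c d (recentre x)) holomorphic2_on gam_domain c d" "mob a b c d holomorphic2_on gam_domain c d"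
    unfolding rh
    by (intro holomorphic2_on_divide holomorphic2_recentre holomorphic2_lin gam_domain_lin_nonzero, assumption)
       (rule holomorphic2_mob)
  show ?thesis
  proof (cases "R > 0")
    case False
    define K where "K = (\<lambda>x. shift_top R (fst (recentre x)) (snd x))"
    have hK: "K holomorphic2_on U" for U unfolding K_def by (intro holomorphic2_shift holomorphic2_recentre holomorphic2_on_snd)
    have "e2pi (of_int (R + int k) * snd p) \<noteq> 1" if "k < nat (- R)" for k
      by (rule shift_factor_nonzero[OF p(4)]) (use that in auto)
    hence "K p \<noteq> 0" unfolding K_def rp shift_top_def by (fastforce simp: algebra_simps)
    then obtain r where r: "r > 0" "ball p r \<subseteq> gam_domain c d" "\<forall>x\<in>ball p r. K x \<noteq> 0"
      using holomorphic2_nonzero_nbhd[OF hK open_gam_domain p(3)] by blast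
    have "continuation2 (sigma_num a b c d m n) (\<lambda>x. varpi (fst x) (snd x)) (UNIV \<times> upper_half_plane) (gam_domain c d) p =
      (\<lambda>x. shift_top R (rescale c d (recentre x)) (mob a b c d x) / K x) p / gam_exp c d y (0, snd p)"
    proof (rule sigma_value[OF y p(1,2,3) r(1,2)])
      show "(\<lambda>x. shift_top R (rescale c d (recentre x)) (mob a b c d x) / K x) holomorphic2_on ball p r"
        using r by (intro holomorphic2_on_divide holomorphic2_shift(1) hK holomorphic2_on_subset[OF hm(1)] holomorphic2_on_subset[OF hm(2)]) auto
    qed (use False in \<open>simp add: shift_bot_def K_def mr\<close>)
    moreover have "shift_top R (rescale c d (recentre p)) (mob a b c d p) = K p"
      by (simp add: K_def rp0 p(5)) (simp add: rp)
    ultimately show ?thesis using False \<open>K p \<noteq> 0\<close> by simp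
  next
    case True
    \<comment> \<open>This is \<open>shift_bot R z t\<close> with its simple zero divided out. After
      cancellation of \<open>z\<close> against \<open>z / j\<close> the quotient of shift factors is
      \<open>j\<close> times a quotient of values of \<open>E\<close>.\<close>
    define E where "E = (\<lambda>z t. e2pi_quot z * (\<Prod>k\<in>{1..<nat R}. 1 - e2pi (z + of_nat k * t)))"
    have hE: "(\<lambda>x. E (X x) (T x)) holomorphic2_on U" if "X holomorphic2_on U" "T holomorphic2_on U" for X T U
      unfolding E_def using that
      by (auto intro!: holomorphic2_on_prod holomorphic2_on_diff holomorphic2_on_const holomorphic2_e2pi
          holomorphic2_on_add holomorphic2_on_mult holomorphic2_e2pi_quot)
    have bot: "shift_bot R z t = z * E z t" for z t
    proof -
      have "{..<nat R} = insert 0 {1..<nat R}" using True by auto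
      thus ?thesis by (simp add: shift_bot_def E_def e2pi_quot_mult[symmetric])
    qed
    define K where "K = (\<lambda>x. E (rescale c d (recentre x)) (mob a b c d x))"
    have hK: "K holomorphic2_on gam_domain c d" unfolding K_def by (intro hE hm)
    have "e2pi (of_int (int k) * snd p) \<noteq> 1" if "k \<in> {1..<nat R}" for k
      by (rule shift_factor_nonzero[OF p(4)]) (use that in auto)
    hence E0: "E 0 (snd p) \<noteq> 0" using e2pi_quot_0 by (fastforce simp: E_def)
    have Kp: "K p = E 0 (snd p)" by (simp add: K_def rp0 p(5))
    then obtain r where r: "r > 0" "ball p r \<subseteq> gam_domain c d" "\<forall>x\<in>ball p r. K x \<noteq> 0"
      using holomorphic2_nonzero_nbhd[OF hK open_gam_domain p(3)] E0 by auto
    have "continuation2 (sigma_num a b c d m n) (\<lambda>x. varpi (fst x) (snd x)) (UNIV \<times> upper_half_plane) (gam_domain c d) p =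
      (\<lambda>x. lin c d (snd x) * E (fst (recentre x)) (snd x) / K x) p / gam_exp c d y (0, snd p)"
    proof (rule sigma_value[OF y p(1,2,3) r(1,2)])
      show "(\<lambda>x. lin c d (snd x) * E (fst (recentre x)) (snd x) / K x) holomorphic2_on ball p r"
        using r by (intro holomorphic2_on_divide holomorphic2_on_mult hE holomorphic2_lin holomorphic2_recentre
            holomorphic2_on_snd holomorphic2_on_subset[OF hK]) auto
      fix x assume x: "x \<in> ball p r \<inter> generic_points"
      have "recentre x \<in> generic_points" using recentre_generic x by blast
      hence "fst (recentre x) \<noteq> 0"
        using period_latticeI[of "fst (recentre x)" 0 "snd (recentre x)" 0] by (auto simp: generic_points_def)
      moreover have "lin c d (snd x) \<noteq> 0" "K x \<noteq> 0" using r x gam_domain_lin_nonzero[of x c d] by auto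
      ultimately show "lin c d (snd x) * E (fst (recentre x)) (snd x) / K x =
        shift_top R (rescale c d (recentre x)) (mob a b c d (recentre x)) * shift_bot R (fst (recentre x)) (snd x) /
         (shift_bot R (rescale c d (recentre x)) (mob a b c d (recentre x)) * shift_top R (fst (recentre x)) (snd x))"
        using True unfolding bot mr K_def by (simp add: shift_top_def rh)
    qed
    thus ?thesis using True E0 by (simp add: Kp rp)
  qed
qed

end

text \<open>At the fixed point \<open>gam_exp\<close> equals
  \<open>sqrt \<epsilon> / eta_const a c d\<close>; dividing 1 or \<epsilon> by it gives the two
  cases.\<close>

lemma sigma_value_fixed_point:
  assumes \<epsilon>: "1 < \<epsilon>" "lin c d (of_real \<tau>) = of_real \<epsilon>" "\<epsilon> + 1 / \<epsilon> = of_int (a + d)"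
    and \<tau>: "\<tau> \<notin> \<rat>" "lin a b (of_real \<tau>) = of_real (\<epsilon> * \<tau>)"
    and m: "m = R - c * R' - d * R" and n: "n = R' - a * R' - b * R"
  shows "continuation2 (sigma_num a b c d m n) (\<lambda>x. varpi (fst x) (snd x)) (UNIV \<times> upper_half_plane) (gam_domain c d)
      (of_int R * of_real \<tau> - of_int R', of_real \<tau>) =
    eta_const a c d * of_real (if R > 0 then sqrt \<epsilon> else 1 / sqrt \<epsilon>)"
proof -
  define p where "p = (of_int R * complex_of_real \<tau> - of_int R', complex_of_real \<tau>)"
  \<comment> \<open>As \<open>\<epsilon> > 1\<close>, the height \<open>pi / \<epsilon>\<close> is
    half of \<open>2 * pi / \<epsilon>\<close>, the lower of the two bounds.\<close>
  have y: "0 < pi / \<epsilon>" "pi / \<epsilon> < 2 * pi" "pi / \<epsilon> < 2 * pi * Re (1 / lin c d (snd p))"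
  proof -
    show "0 < pi / \<epsilon>" using \<epsilon>(1) by simp
    have "pi / \<epsilon> < pi / 1" using \<epsilon>(1) by (intro divide_strict_left_mono) auto
    thus "pi / \<epsilon> < 2 * pi" using pi_gt_zero by linarith
    have "1 / complex_of_real \<epsilon> = of_real (1 / \<epsilon>)" by simp
    hence "Re (1 / lin c d (snd p)) = 1 / \<epsilon>" unfolding p_def snd_conv \<epsilon>(2) by (simp only: Re_complex_of_real)
    thus "pi / \<epsilon> < 2 * pi * Re (1 / lin c d (snd p))" using \<epsilon>(1) by (simp add: field_simps)
  qed
  have "continuation2 (sigma_num a b c d m n) (\<lambda>x. varpi (fst x) (snd x)) (UNIV \<times> upper_half_plane) (gam_domain c d) p =
    (if R > 0 then lin c d (snd p) else 1) / gam_exp c d (pi / \<epsilon>) (0, snd p)"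
    using \<epsilon> \<tau> by (intro sigma_value_lattice[OF m n y])
      (auto simp: recentre_def p_def gam_domain_def mob_def complex_nonpos_Reals_iff)
  also have "gam_exp c d (pi / \<epsilon>) (0, snd p) = csqrt (of_real \<epsilon>) * (1 / eta_const a c d)"
  proof -
    have "complex_of_real \<epsilon> + 1 / complex_of_real \<epsilon> = of_real (\<epsilon> + 1 / \<epsilon>)" by simp
    also have "\<dots> = of_int (a + d)" unfolding \<epsilon>(3) by simp
    finally have j: "lin c d (snd p) + 1 / lin c d (snd p) = of_int (a + d)"
      unfolding p_def snd_conv \<epsilon>(2) .
    show ?thesis unfolding gam_exp_def snd_conv prod_exp_fad_int_0[OF det c y] eta_const_eigenvalue[OF j c]
      by (simp add: p_def \<epsilon>(2))
  qed
  also have "csqrt (of_real \<epsilon>) = of_real (sqrt \<epsilon>)" using \<epsilon>(1) by (simp add: csqrt_of_real_nonneg)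
  finally have *: "continuation2 (sigma_num a b c d m n) (\<lambda>x. varpi (fst x) (snd x)) (UNIV \<times> upper_half_plane) (gam_domain c d) p =
    (if R > 0 then of_real \<epsilon> else 1) / (of_real (sqrt \<epsilon>) * (1 / eta_const a c d))"
    by (simp add: p_def \<epsilon>(2))
  have "complex_of_real \<epsilon> / of_real (sqrt \<epsilon>) = of_real (sqrt \<epsilon>)"
    using real_div_sqrt[of \<epsilon>] \<epsilon>(1) by (simp flip: of_real_divide)
  hence "complex_of_real \<epsilon> / (of_real (sqrt \<epsilon>) * (1 / eta_const a c d)) = of_real (sqrt \<epsilon>) * eta_const a c d"
    by (metis divide_divide_eq_left divide_divide_eq_right div_by_1 mult.commute times_divide_eq_right mult_1_right)
  thus ?thesis unfolding p_def[symmetric] * by (simp add: mult.commute)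
qed

end

section \<open>Fixed points of hyperbolic matrices\<close>

lemma matrix_inv_unique:
  fixes A :: "'a :: semiring_1^'n^'n"
  assumes "A ** B = mat 1" "B ** A = mat 1"
  shows "matrix_inv A = B"
proof -
  have "A ** matrix_inv A = mat 1 \<and> matrix_inv A ** A = mat 1"
    unfolding matrix_inv_def by (rule someI[of _ B]) (use assms in blast)
  thus ?thesis using assms(2) by (metis matrix_mul_assoc matrix_mul_lid matrix_mul_rid)
qed

lemma matrix_inv_mat2:
  fixes a b c d :: int
  assumes "a * d - b * c = 1"
  shows "matrix_inv (vector [vector [a, b], vector [c, d]] :: int^2^2) = vector [vector [d, - b], vector [- c, a]]"
proof (rule matrix_inv_unique)
  have *: "a * d + - (b * c) = 1" "d * a + - (b * c) = 1" "- (c * b) + d * a = 1" using assms by (simp_all add: mult.commute)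
  show "(vector [vector [a, b], vector [c, d]] :: int^2^2) ** vector [vector [d, - b], vector [- c, a]] = mat 1"
    using * by (simp add: vec_eq_iff forall_2 matrix_matrix_mult_def sum_2 mat_def mult.commute)
  show "(vector [vector [d, - b], vector [- c, a]] :: int^2^2) ** vector [vector [a, b], vector [c, d]] = mat 1"
    using * by (simp add: vec_eq_iff forall_2 matrix_matrix_mult_def sum_2 mat_def mult.commute)
qed

text \<open>The determinant of \<open>transpose \<gamma> - mat 1\<close> is \<open>- N\<close>, so
  solving for a preimage divides by \<open>N\<close>; the quotients of \<open>w1\<close> and
  \<open>w2\<close> by \<open>N\<close> determine its coordinates through a unimodular
  matrix.\<close>

lemma range_transpose_minus_id_iff:
  fixes a b c d :: int and u :: "int^2"
  assumes det: "a * d - b * c = 1" and N: "N = a + d - 2" "N \<noteq> 0"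
    and w: "w1 = (d - 1) * u $ 2 + b * u $ 1" "w2 = - c * u $ 2 + (1 - a) * u $ 1"
  shows "u \<in> range (\<lambda>x. (transpose (vector [vector [a, b], vector [c, d]]) - mat 1) *v x) \<longleftrightarrow> N dvd w1 \<and> N dvd w2"
proof -
  have bc: "b * c = a * d - 1" using det by simp
  have eq: "u = (transpose (vector [vector [a, b], vector [c, d]]) - mat 1) *v x \<longleftrightarrow>
     u $ 1 = (a - 1) * x $ 1 + c * x $ 2 \<and> u $ 2 = b * x $ 1 + (d - 1) * x $ 2" for x :: "int^2"
    by (simp add: vec_eq_iff forall_2 matrix_vector_mult_def sum_2 transpose_def mat_def)
  show ?thesis
  proof
    assume "u \<in> range (\<lambda>x. (transpose (vector [vector [a, b], vector [c, d]]) - mat 1) *v x)"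
    then obtain x :: "int^2" where "u = (transpose (vector [vector [a, b], vector [c, d]]) - mat 1) *v x" by blast
    hence x: "u $ 1 = (a - 1) * x $ 1 + c * x $ 2" "u $ 2 = b * x $ 1 + (d - 1) * x $ 2" unfolding eq by auto
    have "w1 = N * (b * x $ 1 + d * x $ 2) + (1 - (a * d - b * c)) * x $ 2"
      unfolding w x N by (simp add: algebra_simps)
    moreover have "w2 = - N * (a * x $ 1 + c * x $ 2) - (1 - (a * d - b * c)) * x $ 1"
      unfolding w x N by (simp add: algebra_simps)
    ultimately show "N dvd w1 \<and> N dvd w2" unfolding det by simp
  next
    assume "N dvd w1 \<and> N dvd w2"
    then obtain r1 r2 where r: "w1 = N * r1" "w2 = N * r2" by (auto elim!: dvdE)
    have "N * u $ 2 = (1 - a) * w1 - b * w2 - (1 - (a * d - b * c)) * u $ 2"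
      unfolding w N by (simp add: algebra_simps)
    hence "N * u $ 2 = N * ((1 - a) * r1 - b * r2)" unfolding r det by (simp add: algebra_simps)
    hence u2: "u $ 2 = (1 - a) * r1 - b * r2" using N by simp
    have "N * u $ 1 = c * w1 + (d - 1) * w2 - (1 - (a * d - b * c)) * u $ 1"
      unfolding w N by (simp add: algebra_simps)
    hence "N * u $ 1 = N * (c * r1 + (d - 1) * r2)" unfolding r det by (simp add: algebra_simps)
    hence u1: "u $ 1 = c * r1 + (d - 1) * r2" using N by simp
    \<comment> \<open>Solves \<open>r1 = b x1 + d x2\<close> and
      \<open>r2 = - (a x1 + c x2)\<close>, the relations found in the converse direction; their
      determinant is 1.\<close>
    define x :: "int^2" where "x = vector [- c * r1 - d * r2, a * r1 + b * r2]"
    have "(a - 1) * x $ 1 + c * x $ 2 = c * r1 + (d - (a * d - b * c)) * r2"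
      by (simp add: x_def algebra_simps)
    moreover have "b * x $ 1 + (d - 1) * x $ 2 = ((a * d - b * c) - a) * r1 - b * r2"
      by (simp add: x_def algebra_simps)
    ultimately have "u = (transpose (vector [vector [a, b], vector [c, d]]) - mat 1) *v x"
      unfolding eq det by (simp add: u1 u2)
    thus "u \<in> range (\<lambda>x. (transpose (vector [vector [a, b], vector [c, d]]) - mat 1) *v x)" by blast
  qed
qed

text \<open>All four facts rest on the characteristic equation of \<open>\<epsilon>\<close>, a root
  of \<open>X ^ 2 - (a + d) X + 1\<close>.\<close>

lemma fixed_point_equations:
  fixes a b c d N :: int and \<tau> \<epsilon> :: real
  assumes det: "a * d - b * c = 1" and c: "c > 0" and N: "N = a + d - 2" "N > 0"
    and \<tau>: "\<tau> = (of_int a - of_int d + sqrt (of_int (N * (N + 4)))) / (2 * of_int c)"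
    and \<epsilon>: "\<epsilon> = of_int c * \<tau> + of_int d"
  shows "\<epsilon> > 1" "\<epsilon> + 1 / \<epsilon> = of_int (a + d)" "of_int a * \<tau> + of_int b = \<epsilon> * \<tau>" "\<tau> \<notin> \<rat>"
proof -
  define D where "D = sqrt (of_int (N * (N + 4)))"
  have D2: "D * D = of_int (N * (N + 4))" using N(2) by (simp add: D_def)
  have D: "D \<ge> 0" using N(2) by (simp add: D_def)
  have e: "2 * \<epsilon> = of_int (a + d) + D" using c by (simp add: \<epsilon> \<tau> D_def field_simps)
  have "of_int (a + d) \<ge> (3 :: real)" using N by linarith
  thus 1: "\<epsilon> > 1" using e D by linarith
  \<comment> \<open>Multiplication by 4 avoids halves in \<open>\<epsilon>\<close>: with
    \<open>a + d = N + 2\<close> the claim is \<open>(N + 2) ^ 2 - N (N + 4) = 4\<close>.\<close>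
  have "4 * (\<epsilon> * (of_int (a + d) - \<epsilon>)) = (2 * \<epsilon>) * (2 * of_int (a + d) - 2 * \<epsilon>)" by (simp add: algebra_simps)
  also have "\<dots> = of_int (a + d) * of_int (a + d) - D * D" unfolding e by (simp add: algebra_simps)
  also have "\<dots> = 4" unfolding D2 N by (simp add: algebra_simps)
  finally have q: "\<epsilon> * (of_int (a + d) - \<epsilon>) = 1" by simp
  thus 2: "\<epsilon> + 1 / \<epsilon> = of_int (a + d)" using 1 by (simp add: field_simps)
  have "of_int c * (of_int a * \<tau> + of_int b - \<epsilon> * \<tau>) = of_int a * (\<epsilon> - of_int d) + of_int (b * c) - \<epsilon> * (\<epsilon> - of_int d)"
    unfolding \<epsilon> by (simp add: algebra_simps)
  also have "b * c = a * d - 1" using det by simp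
  also have "of_int a * (\<epsilon> - of_int d) + of_int (a * d - 1) - \<epsilon> * (\<epsilon> - of_int d) = \<epsilon> * (of_int (a + d) - \<epsilon>) - 1"
    by (simp add: algebra_simps)
  finally show "of_int a * \<tau> + of_int b = \<epsilon> * \<tau>" using q c by simp
  show "\<tau> \<notin> \<rat>"
  proof
    assume "\<tau> \<in> \<rat>"
    hence "\<epsilon> \<in> \<rat>" unfolding \<epsilon> by simp
    then obtain p q :: int where pq: "q > 0" "coprime p q" "\<epsilon> = of_int p / of_int q" by (rule Rats_cases')
    have "of_int (p * ((a + d) * q - p)) = (of_int (q * q) :: real)"
      using q pq(1) unfolding pq(3) by (simp add: field_simps)
    hence pp: "p * ((a + d) * q - p) = q * q" by (simp only: of_int_eq_iff)
    \<comment> \<open>The rational root argument: the numerator of a reduced rational root divides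
      the constant term 1, which bounds \<epsilon> by 1.\<close>
    hence "p dvd q * q" by (metis dvd_triv_left)
    hence "p dvd 1" using pq(2) by (metis coprime_dvd_mult_left_iff coprime_common_divisor dvd_refl)
    hence "p \<le> 1" by (simp add: zdvd_imp_le)
    hence "\<epsilon> \<le> 1" unfolding pq(3) using pq(1) by simp
    thus False using 1 by simp
  qed
qed

lemma irrational_linear_eq:
  fixes \<tau> :: real and k l m n :: int
  assumes "\<tau> \<notin> \<rat>" "of_int k * \<tau> + of_int l = of_int m * \<tau> + of_int n"
  shows "k = m \<and> l = n"
proof -
  have "k = m"
  proof (rule ccontr)
    assume "k \<noteq> m"
    hence "\<tau> = of_int (n - l) / of_int (k - m)" using assms(2) by (simp add: field_simps)
    hence "\<tau> \<in> \<rat>" by simp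
    thus False using assms(1) by simp
  qed
  thus ?thesis using assms(2) by simp
qed

section \<open>The definitions expressed through the entries of the matrix\<close>

context
  fixes a b c d :: int and \<gamma> :: "int^2^2"
  assumes det: "a * d - b * c = 1" and c: "c > 0" and \<gamma>: "\<gamma> = vector [vector [a, b], vector [c, d]]"
begin

lemma aut_factor_lin: "aut_factor \<gamma> = lin c d"
  by (simp add: fun_eq_iff aut_factor_def lin_def \<gamma>)

lemma moebius_lin: "moebius \<gamma> \<tau> = lin a b \<tau> / lin c d \<tau>"
  by (simp add: moebius_def aut_factor_lin) (simp add: lin_def \<gamma>)

lemma slit_domain_gam_domain: "slit_domain \<gamma> = gam_domain c d"
  by (auto simp: slit_domain_def gam_domain_def aut_factor_lin)

lemma eta_multiplier_eq: "eta_multiplier \<gamma> = eta_const a c d"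
proof -
  have *: "dedekind_eta (moebius \<gamma> z) / (dedekind_eta z * csqrt (aut_factor \<gamma> z)) = eta_const a c d" if "z \<in> upper_half_plane" for z
  proof -
    have z: "Im z > 0" using that by (simp add: upper_half_plane_def)
    have "csqrt (lin c d z) \<noteq> 0" using lin_upper(2)[OF det c z] by simp
    thus ?thesis using eta_transformation[OF det c z] dedekind_eta_nonzero[OF z]
      by (simp add: moebius_lin aut_factor_lin)
  qed
  have "\<i> \<in> upper_half_plane" by (simp add: upper_half_plane_def)
  thus ?thesis unfolding eta_multiplier_def using * by (intro the_equality) auto
qed

lemma exp_rademacher: "exp (of_real pi * \<i> / 12 * of_real (rademacher \<gamma>)) = eta_const a c d"
  by (simp add: eta_const_def rademacher_def trace_def sum_2 \<gamma>)

lemma faddeev_eq: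
  "faddeev \<gamma> m 0 = continuation2 (\<lambda>x. varpi (of_int m * snd x + fst x) (snd x)) (sigma_num a b c d 0 0)
     (UNIV \<times> upper_half_plane) (gam_domain c d)"
proof -
  have 1: "(\<lambda>(z, \<tau>). qpoch_inf (e2pi (of_int m * \<tau> + z)) (e2pi \<tau>)) = (\<lambda>x. varpi (of_int m * snd x + fst x) (snd x))"
    by (simp add: fun_eq_iff qpoch_inf_e2pi)
  have 2: "(\<lambda>(z, \<tau>). qpoch_inf (e2pi (of_int 0 * moebius \<gamma> \<tau> + z / aut_factor \<gamma> \<tau>)) (e2pi (moebius \<gamma> \<tau>))) = sigma_num a b c d 0 0"
    by (simp add: fun_eq_iff qpoch_inf_e2pi sigma_num_def rescale_def mob_def aut_factor_lin moebius_lin)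
  show ?thesis unfolding faddeev_def 1 2 slit_domain_gam_domain ..
qed

lemma sf_sigma_eq:
  "sf_sigma v \<gamma> = continuation2 (sigma_num a b c d (v $ 2) (v $ 1)) (\<lambda>x. varpi (fst x) (snd x))
     (UNIV \<times> upper_half_plane) (gam_domain c d)"
proof -
  have 1: "(\<lambda>(z, \<tau>). varpi (z / aut_factor \<gamma> \<tau> + of_int (v $ 2) * moebius \<gamma> \<tau> - of_int (v $ 1)) (moebius \<gamma> \<tau>)) = sigma_num a b c d (v $ 2) (v $ 1)"
    by (simp add: fun_eq_iff sigma_num_def rescale_def mob_def aut_factor_lin moebius_lin)
  have 2: "(\<lambda>(z, \<tau>). varpi z \<tau>) = (\<lambda>x. varpi (fst x) (snd x))" by (simp add: fun_eq_iff)
  show ?thesis unfolding sf_sigma_def 1 2 slit_domain_gam_domain ..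
qed

end

theorem proposition2p1:
  fixes \<gamma> :: "int^2^2" and a b c d N s :: int and u w :: "int^2" and r :: "rat^2"
    and \<tau> :: real
  assumes "\<gamma> = vector [vector [a, b], vector [c, d]]"
    and "det \<gamma> = 1" and "trace \<gamma> > 2" and "c > 0"
    and "N = trace \<gamma> - 2"
    and "\<tau> = (of_int a - of_int d + sqrt (of_int (N * (N + 4)))) / (2 * of_int c)"
    and "w = (mat 1 - matrix_inv \<gamma>) *v (S_mat *v u)"
    and "r = (\<chi> i. of_int (w $ i) / of_int N)"
    and "s \<in> {1, -1}"
  shows "(u \<notin> range (\<lambda>x. (transpose \<gamma> - mat 1) *v x) \<longrightarrow>
            fin_qdilog s \<gamma> u =
              exp (of_real pi * \<i> / 12 * of_real (rademacher \<gamma>))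
                * inverse (sf_cocycle r \<gamma> (of_real \<tau>))) \<and>
         (u \<in> range (\<lambda>x. (transpose \<gamma> - mat 1) *v x) \<longrightarrow>
            fin_qdilog s \<gamma> u =
              (if w $ 2 > 0
               then (exp (- (of_real pi * \<i> / 12 * of_real (rademacher \<gamma>)))
                       * sf_cocycle r \<gamma> (of_real \<tau>)) powi s
               else (exp (- (of_real pi * \<i> / 12 * of_real (rademacher \<gamma>)))
                       * sf_cocycle r \<gamma> (of_real \<tau>)) powi (- s)))"
proof -
  note \<gamma> = assms(1) and c = assms(4)
  have det: "a * d - b * c = 1" using assms(2) by (simp add: \<gamma> det_2)
  have N: "N = a + d - 2" "N > 0" using assms(3,5) by (auto simp: \<gamma> trace_def sum_2)
  have w: "w $ 1 = (d - 1) * u $ 2 + b * u $ 1" "w $ 2 = - c * u $ 2 + (1 - a) * u $ 1"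
    unfolding assms(7) \<gamma> matrix_inv_mat2[OF det] S_mat_def
    by (simp_all add: matrix_vector_mult_def sum_2 mat_def algebra_simps)
  define \<epsilon> where "\<epsilon> = of_int c * \<tau> + of_int d"
  note fp = fixed_point_equations[OF det c N assms(6) \<epsilon>_def]
  have fixed: "fixed_pt \<gamma> = \<tau>" unfolding fixed_pt_def Let_def assms(5)[symmetric] by (simp add: assms(6) \<gamma>)
  have eig: "eigenval \<gamma> = \<epsilon>" unfolding eigenval_def fixed by (simp add: \<epsilon>_def \<gamma>)
  have range: "u \<in> range (\<lambda>x. (transpose \<gamma> - mat 1) *v x) \<longleftrightarrow> N dvd w $ 1 \<and> N dvd w $ 2"
    unfolding \<gamma> by (rule range_transpose_minus_id_iff[OF det N(1) _ w]) (use N in simp)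
  have jt: "lin c d (of_real \<tau>) = of_real \<epsilon>" by (simp add: lin_def \<epsilon>_def)
  have at: "lin a b (of_real \<tau>) = of_real (\<epsilon> * \<tau>)" unfolding fp(3)[symmetric] by (simp add: lin_def)
  \<comment> \<open>This is \<open>r2 \<tau> - r1\<close>, the argument of the cocycle;
    \<open>zu\<close> identifies it with the argument of Faddeev's function, so both continuations
    are evaluated at one point.\<close>
  define z where "z = (of_int (w $ 2) * \<tau> - of_int (w $ 1)) / of_int N"
  \<comment> \<open>The form \<open>x2 \<tau> - x1\<close> is the determinant of
    \<open>(\<tau>, 1)\<close> and \<open>x\<close>. Since \<open>(\<tau>, 1)\<close> is an
    eigenvector of \<gamma> for \<epsilon>, it turns \<open>matrix_inv \<gamma>\<close> into
    multiplication by \<epsilon>.\<close>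
  have wz: "of_int (w $ 2) * \<tau> - of_int (w $ 1) = (1 - \<epsilon>) * (of_int (u $ 1) * \<tau> + of_int (u $ 2))"
  proof -
    have "of_int (w $ 2) * \<tau> - of_int (w $ 1) = of_int (u $ 1) * (\<tau> - (of_int a * \<tau> + of_int b)) + of_int (u $ 2) * (1 - \<epsilon>)"
      unfolding w \<epsilon>_def by (simp add: algebra_simps)
    thus ?thesis unfolding fp(3) by (simp add: algebra_simps)
  qed
  \<comment> \<open>The trace is \<open>\<epsilon> + 1 / \<epsilon>\<close>; the factor
    \<open>1 - \<epsilon>\<close> then cancels against the one in \<open>wz\<close>.\<close>
  have Ne: "of_int N = (1 - \<epsilon>) * (1 / \<epsilon> - 1)"
  proof -
    have "of_int N = of_int (a + d) - (2 :: real)" unfolding N(1) by simp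
    thus ?thesis unfolding fp(2)[symmetric] using fp(1) by (simp add: field_simps)
  qed
  have zu: "z = (of_int (u $ 1) * \<tau> + of_int (u $ 2)) / (1 / \<epsilon> - 1)"
    unfolding z_def wz Ne using fp(1) by simp
  \<comment> \<open>The relation that couples the two functions: rescaling by the automorphy factor
    is translation by the lattice vector of \<open>u\<close>.\<close>
  have ze: "z / \<epsilon> = z + of_int (u $ 1) * \<tau> + of_int (u $ 2)"
  proof -
    have "1 / \<epsilon> - 1 \<noteq> 0" using fp(1) by (simp add: field_simps)
    hence "z * (1 / \<epsilon> - 1) = of_int (u $ 1) * \<tau> + of_int (u $ 2)" unfolding zu by simp
    thus ?thesis by (simp add: algebra_simps)
  qed
  \<comment> \<open>The product of \<open>I - \<gamma>\<close> and
    \<open>I - matrix_inv \<gamma>\<close> is \<open>2 - trace \<gamma> = - N\<close> times the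
    identity, so \<open>(I - \<gamma>) r\<close> is \<open>- S_mat *v u\<close>, and the floors act
    on integers.\<close>
  have v: "(\<chi> i. \<lfloor>((mat 1 - map_matrix of_int \<gamma>) *v r) $ i\<rfloor>) = (vector [u $ 2, - u $ 1] :: int^2)"
  proof -
    have N0: "(of_int N :: rat) \<noteq> 0" using N by simp
    have 1: "(1 - a) * w $ 1 - b * w $ 2 = N * u $ 2"
    proof -
      have "(1 - a) * w $ 1 - b * w $ 2 = N * u $ 2 + (1 - (a * d - b * c)) * u $ 2"
        unfolding w N by (simp add: algebra_simps)
      thus ?thesis unfolding det by simp
    qed
    have 2: "- c * w $ 1 + (1 - d) * w $ 2 = N * (- u $ 1)"
    proof -
      have "- c * w $ 1 + (1 - d) * w $ 2 = N * (- u $ 1) - (1 - (a * d - b * c)) * u $ 1"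
        unfolding w N by (simp add: algebra_simps)
      thus ?thesis unfolding det by simp
    qed
    have "((mat 1 - map_matrix of_int \<gamma>) *v r) $ 1 = (of_int ((1 - a) * w $ 1 - b * w $ 2) :: rat) / of_int N"
      by (simp add: assms(8) \<gamma> matrix_vector_mult_def map_matrix_def sum_2 mat_def diff_divide_distrib)
    hence "((mat 1 - map_matrix of_int \<gamma>) *v r) $ 1 = of_int (u $ 2)" unfolding 1 using N0 by simp
    moreover have "((mat 1 - map_matrix of_int \<gamma>) *v r) $ 2 = (of_int (- c * w $ 1 + (1 - d) * w $ 2) :: rat) / of_int N"
      by (simp add: assms(8) \<gamma> matrix_vector_mult_def map_matrix_def sum_2 mat_def diff_divide_distrib add_divide_distrib)
    hence "((mat 1 - map_matrix of_int \<gamma>) *v r) $ 2 = of_int (- u $ 1)" unfolding 2 using N0 by simp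
    ultimately show ?thesis by (simp add: vec_eq_iff forall_2)
  qed
  have rz: "of_rat (r $ 2) * of_real \<tau> - of_rat (r $ 1) = complex_of_real z"
    by (simp add: assms(8) z_def of_rat_divide diff_divide_distrib)
  have sh: "sf_cocycle r \<gamma> (of_real \<tau>) = continuation2 (sigma_num a b c d (- u $ 1) (u $ 2)) (\<lambda>x. varpi (fst x) (snd x))
     (UNIV \<times> upper_half_plane) (gam_domain c d) (of_real z, of_real \<tau>)"
    unfolding sf_cocycle_def v rz sf_sigma_eq[OF det c \<gamma>] by simp
  define E where "E = eta_const a c d"
  have E: "exp (of_real pi * \<i> / 12 * of_real (rademacher \<gamma>)) = E" unfolding E_def by (rule exp_rademacher[OF det c \<gamma>])
  have E0: "E \<noteq> 0" by (simp add: E_def eta_const_def)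
  show ?thesis
  proof (intro conjI impI)
    assume u: "u \<notin> range (\<lambda>x. (transpose \<gamma> - mat 1) *v x)"
    \<comment> \<open>Because \<tau> is irrational, coefficients of \<tau> and 1 can be compared; a
      lattice point would make both entries of \<open>w\<close> divisible by \<open>N\<close>, that
      is, put \<open>u\<close> into the range.\<close>
    have "complex_of_real z \<notin> period_lattice (of_real \<tau>)"
    proof
      assume "complex_of_real z \<in> period_lattice (of_real \<tau>)"
      then obtain k l where "complex_of_real z = of_int k * of_real \<tau> + of_int l"
        unfolding period_lattice_def by blast
      hence "complex_of_real z = of_real (of_int k * \<tau> + of_int l)" by simp
      hence "z = of_int k * \<tau> + of_int l" by (simp only: of_real_eq_iff)
      hence "of_int (w $ 2) * \<tau> + of_int (- w $ 1) = of_int (N * k) * \<tau> + of_int (N * l)"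
        unfolding z_def using N(2) by (simp add: field_simps)
      from irrational_linear_eq[OF fp(4) this] have "w $ 2 = N * k" "w $ 1 = N * (- l)" by auto
      hence "N dvd w $ 1 \<and> N dvd w $ 2" by simp
      thus False using u range by blast
    qed
    moreover have "complex_of_real z / of_real \<epsilon> = of_real z + of_int (u $ 1) * of_real \<tau> + of_int (u $ 2)"
      using arg_cong[OF ze, of complex_of_real] by simp
    ultimately have "faddeev \<gamma> (u $ 1) 0 (of_real z, of_real \<tau>) = inverse (sf_cocycle r \<gamma> (of_real \<tau>))"
      unfolding faddeev_eq[OF det c \<gamma>] sh using fp(1) jt at
      by (intro faddeev_sigma_inverse[OF det c])
         (auto simp: gam_domain_def mob_def rescale_def complex_nonpos_Reals_iff)
    moreover have "fin_qdilog s \<gamma> u = E * faddeev \<gamma> (u $ 1) 0 (of_real z, of_real \<tau>)"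
      using u unfolding fin_qdilog_def Let_def fixed eig eta_multiplier_eq[OF det c \<gamma>] zu E_def
      by (simp add: inverse_eq_divide)
    ultimately show "fin_qdilog s \<gamma> u = exp (of_real pi * \<i> / 12 * of_real (rademacher \<gamma>)) * inverse (sf_cocycle r \<gamma> (of_real \<tau>))"
      unfolding E by simp
  next
    assume u: "u \<in> range (\<lambda>x. (transpose \<gamma> - mat 1) *v x)"
    then obtain R' R where R: "w $ 1 = N * R'" "w $ 2 = N * R" using range by (auto elim!: dvdE)
    have zR: "complex_of_real z = of_int R * of_real \<tau> - of_int R'"
    proof -
      have "z = of_int R * \<tau> - of_int R'" unfolding z_def R using N(2) by (simp add: field_simps)
      thus ?thesis by simp
    qed
    \<comment> \<open>Recovers \<open>u\<close> from \<open>w\<close>: with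
      \<open>w = N (R', R)\<close> the cocycle data \<open>- u $ 1\<close> and \<open>u $ 2\<close>
      are \<open>I - \<gamma>\<close> applied to \<open>(R', R)\<close>, as
      \<open>sigma_value_fixed_point\<close> requires.\<close>
    have "N * (- u $ 1) = - c * w $ 1 + (1 - d) * w $ 2 + (1 - (a * d - b * c)) * u $ 1"
      unfolding w N by (simp add: algebra_simps)
    hence "N * (- u $ 1) = N * (R - c * R' - d * R)" unfolding R det by (simp add: algebra_simps)
    hence u1: "- u $ 1 = R - c * R' - d * R" unfolding mult_left_cancel[OF less_imp_neq[OF N(2), symmetric]] .
    have "N * u $ 2 = (1 - a) * w $ 1 - b * w $ 2 - (1 - (a * d - b * c)) * u $ 2"
      unfolding w N by (simp add: algebra_simps)
    hence "N * u $ 2 = N * (R' - a * R' - b * R)" unfolding R det by (simp add: algebra_simps)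
    hence u2: "u $ 2 = R' - a * R' - b * R" using N(2) by simp
    have "sf_cocycle r \<gamma> (of_real \<tau>) = E * of_real (if R > 0 then sqrt \<epsilon> else 1 / sqrt \<epsilon>)"
      unfolding sh zR E_def by (rule sigma_value_fixed_point[OF det c fp(1) jt fp(2,4) at u1 u2])
    hence "exp (- (of_real pi * \<i> / 12 * of_real (rademacher \<gamma>))) * sf_cocycle r \<gamma> (of_real \<tau>) =
        of_real (if R > 0 then sqrt \<epsilon> else 1 / sqrt \<epsilon>)"
      unfolding exp_minus E using E0 by simp
    moreover have "R > 0 \<longleftrightarrow> w $ 2 > 0" unfolding R using N(2) by (simp add: zero_less_mult_iff)
    moreover have "fin_qdilog s \<gamma> u = of_real (sqrt \<epsilon>) powi s"
    proof -
      have "\<epsilon> powr (1 / 2) = sqrt \<epsilon>" "\<epsilon> powr (- 1 / 2) = inverse (sqrt \<epsilon>)"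
        using fp(1) by (simp_all add: powr_half_sqrt powr_minus)
      thus ?thesis using u assms(9) unfolding fin_qdilog_def eig by (auto simp: power_int_minus)
    qed
    \<comment> \<open>For \<open>R \<le> 0\<close> the cocycle gives the reciprocal root, which the
      opposite exponent in the second case compensates.\<close>
    moreover have "(1 / complex_of_real (sqrt \<epsilon>)) powi (- s) = of_real (sqrt \<epsilon>) powi s"
      using assms(9) by (auto simp: power_int_minus field_simps)
    ultimately show "fin_qdilog s \<gamma> u =
              (if w $ 2 > 0
               then (exp (- (of_real pi * \<i> / 12 * of_real (rademacher \<gamma>)))
                       * sf_cocycle r \<gamma> (of_real \<tau>)) powi s
               else (exp (- (of_real pi * \<i> / 12 * of_real (rademacher \<gamma>)))
                       * sf_cocycle r \<gamma> (of_real \<tau>)) powi (- s))"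
      by auto
  qed
qed

end
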